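(* Let $\nu>0$, $\lambda\ge0$ and $M>0$ be such that $\nu+\lambda\le1/2$ and $M\le\min\{(\nu+\lambda)^{-1/2},\nu^{-1/3}\}$. Assume $\rho^{in}\in H^1(\mathbb T\times\mathbb R)$ and $\alpha^{in},\omega^{in}\in L^2(\mathbb T\times\mathbb R)$, and let $(\rho,\alpha,\omega)$ be the solution with this initial data of $$\partial_t\rho+y\partial_x\rho+\alpha=0,\qquad \partial_t\alpha+y\partial_x\alpha+2\partial_xv^y+\tfrac1{M^2}\Delta\rho=(\nu+\lambda)\Delta\alpha,\qquad \partial_t\omega+y\partial_x\omega-\alpha=\nu\Delta\omega .$$ Set $$D_{in}=\|\alpha^{in}-\alpha^{in}_0\|_{L^2}+\frac1M\|\nabla(\rho^{in}-\rho^{in}_0)\|_{L^2}+\|\omega^{in}-\omega^{in}_0\|_{L^2}.$$ Then for all $t\ge0$ $$\|(\alpha-\alpha_0)(t)\|_{L^2}+\frac1M\|\nabla(\rho-\rho_0)(t)\|_{L^2}+\|(\omega-\omega_0)(t)\|_{L^2}\lesssim\nu^{-1/2}e^{-\frac{\nu^{1/3}}{64}t}D_{in},$$ and in addition $$\|(\boldsymbol v-\boldsymbol v_0)(t)\|_{L^2}+\frac1M\|(\rho-\rho_0)(t)\|_{L^2}\lesssim\nu^{-1/6}e^{-\frac{\nu^{1/3}}{64}t}D_{in}.$$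
   Context: Setting: $(x,y)\in\mathbb T\times\mathbb R$, $\mathbb T=\mathbb R/2\pi\mathbb Z$. The system is the linearization of the 2D isentropic compressible Navier–Stokes equations around the Couette flow $(y,0)$ with density $1$; $\rho$ is the density perturbation, $\boldsymbol v=(v^x,v^y)$ the velocity perturbation, $\alpha=\operatorname{div}\boldsymbol v$, $\omega=\nabla^\perp\cdot\boldsymbol v$, $\nabla^\perp=(-\partial_y,\partial_x)^T$, and $\boldsymbol v$ is recovered by $\boldsymbol v=\nabla\Delta^{-1}\alpha+\nabla^\perp\Delta^{-1}\omega$; in particular $v^y=\partial_y\Delta^{-1}\alpha+\partial_x\Delta^{-1}\omega$ closes the system. $x$-average: $f_0(y)=\frac1{2\pi}\int_{\mathbb T}f(x,y)\,dx$. $A\lesssim B$ means $A\le CB$ with $C$ independent of $t,\nu,\lambda$ and the data, but possibly depending on $M$ through increasing factors such as $(1+M)^\beta$ or $\exp(M^\beta)$, $\beta\ge1$. *)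

theory Defs
  imports "HOL-Analysis.Analysis"
begin

section \<open>The cylinder \<open>\<T> \<times> \<real>\<close>\<close>

text \<open>
  \<open>\<T> = \<real>/2\<pi>\<int>\<close> is represented by its fundamental domain \<open>[0, 2\<pi>)\<close> with Lebesgue measure.
  Elements of \<open>L\<^sup>2(\<T> \<times> \<real>)\<close> are (representatives of) real functions on this domain; their values
  outside of it are irrelevant.  Periodicity in \<open>x\<close> only enters through the test functions.
\<close>

definition torus :: "real measure" where
  "torus = restrict_space lborel {0..<2 * pi}"

definition cyl :: "(real \<times> real) measure" where
  "cyl = torus \<Otimes>\<^sub>M lborel"

definition L2 :: "(real \<times> real \<Rightarrow> real) \<Rightarrow> bool" where
  "L2 f \<longleftrightarrow> f \<in> borel_measurable cyl \<and> integrable cyl (\<lambda>z. (f z)\<^sup>2)"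

definition L2norm :: "(real \<times> real \<Rightarrow> real) \<Rightarrow> real" where
  "L2norm f = sqrt (\<integral>z. (f z)\<^sup>2 \<partial>cyl)"

definition L2norm2 :: "(real \<times> real \<Rightarrow> real) \<Rightarrow> (real \<times> real \<Rightarrow> real) \<Rightarrow> real" where
  "L2norm2 f g = sqrt (\<integral>z. (f z)\<^sup>2 + (g z)\<^sup>2 \<partial>cyl)"

definition pairing :: "(real \<times> real \<Rightarrow> real) \<Rightarrow> (real \<times> real \<Rightarrow> real) \<Rightarrow> real" where
  "pairing f g = (\<integral>z. f z * g z \<partial>cyl)"

definition xavg :: "(real \<times> real \<Rightarrow> real) \<Rightarrow> real \<times> real \<Rightarrow> real" where
  "xavg f = (\<lambda>(x, y). 1 / (2 * pi) * (\<integral>s. f (s, y) \<partial>torus))"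

definition fluct :: "(real \<times> real \<Rightarrow> real) \<Rightarrow> real \<times> real \<Rightarrow> real" where
  "fluct f = (\<lambda>z. f z - xavg f z)"


section \<open>Test functions\<close>

definition pdx :: "(real \<times> real \<Rightarrow> real) \<Rightarrow> real \<times> real \<Rightarrow> real" where
  "pdx f = (\<lambda>(x, y). deriv (\<lambda>s. f (s, y)) x)"

definition pdy :: "(real \<times> real \<Rightarrow> real) \<Rightarrow> real \<times> real \<Rightarrow> real" where
  "pdy f = (\<lambda>(x, y). deriv (\<lambda>s. f (x, s)) y)"

definition laplacian :: "(real \<times> real \<Rightarrow> real) \<Rightarrow> real \<times> real \<Rightarrow> real" where
  "laplacian f = (\<lambda>z. pdx (pdx f) z + pdy (pdy f) z)"

text \<open>
  \<open>C\<^sub>c\<^sup>\<infinity>(\<T> \<times> \<real>)\<close>.  Frechet differentiability of all \<open>\<partial>\<^sub>x\<^sup>i \<partial>\<^sub>y\<^sup>j \<phi>\<close> makes them continuous and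
  is equivalent to smoothness.
\<close>

definition test_function :: "(real \<times> real \<Rightarrow> real) \<Rightarrow> bool" where
  "test_function \<phi> \<longleftrightarrow>
     (\<forall>i j z. ((pdx ^^ i) ((pdy ^^ j) \<phi>)) differentiable (at z)) \<and>
     (\<forall>x y. \<phi> (x + 2 * pi, y) = \<phi> (x, y)) \<and>
     (\<exists>R. \<forall>x y. \<bar>y\<bar> \<ge> R \<longrightarrow> \<phi> (x, y) = 0)"


section \<open>Weak derivatives and the inverse Laplacian\<close>

definition is_weak_dx :: "(real \<times> real \<Rightarrow> real) \<Rightarrow> (real \<times> real \<Rightarrow> real) \<Rightarrow> bool" where
  "is_weak_dx f g \<longleftrightarrow> L2 g \<and> (\<forall>\<phi>. test_function \<phi> \<longrightarrow> pairing f (pdx \<phi>) = - pairing g \<phi>)"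

definition is_weak_dy :: "(real \<times> real \<Rightarrow> real) \<Rightarrow> (real \<times> real \<Rightarrow> real) \<Rightarrow> bool" where
  "is_weak_dy f g \<longleftrightarrow> L2 g \<and> (\<forall>\<phi>. test_function \<phi> \<longrightarrow> pairing f (pdy \<phi>) = - pairing g \<phi>)"

definition H1 :: "(real \<times> real \<Rightarrow> real) \<Rightarrow> bool" where
  "H1 f \<longleftrightarrow> L2 f \<and> (\<exists>g. is_weak_dx f g) \<and> (\<exists>g. is_weak_dy f g)"

text \<open>
  Weak derivatives are unique up to null sets; the choice operator merely picks a representative.
\<close>

definition wdx :: "(real \<times> real \<Rightarrow> real) \<Rightarrow> real \<times> real \<Rightarrow> real" where
  "wdx f = (SOME g. is_weak_dx f g)"

definition wdy :: "(real \<times> real \<Rightarrow> real) \<Rightarrow> real \<times> real \<Rightarrow> real" where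
  "wdy f = (SOME g. is_weak_dy f g)"

text \<open>
  \<open>\<Delta>\<^sup>-\<^sup>1 g\<close> is the distributional solution \<open>\<psi> \<in> L\<^sup>2\<close> of \<open>\<Delta>\<psi> = g\<close>, which is unique up to null sets
  since the only harmonic function in \<open>L\<^sup>2(\<T> \<times> \<real>)\<close> is \<open>0\<close>.  It exists, and lies in \<open>H\<^sup>2\<close>,
  whenever \<open>g \<in> L\<^sup>2\<close> has vanishing \<open>x\<close>-average.
\<close>

definition inv_laplacian :: "(real \<times> real \<Rightarrow> real) \<Rightarrow> real \<times> real \<Rightarrow> real" where
  "inv_laplacian g =
     (SOME \<psi>. L2 \<psi> \<and> (\<forall>\<phi>. test_function \<phi> \<longrightarrow> pairing \<psi> (laplacian \<phi>) = pairing g \<phi>))"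

text \<open>
  The two components of \<open>v - v\<^sub>0\<close>, where \<open>v = \<nabla>\<Delta>\<^sup>-\<^sup>1\<alpha> + \<nabla>\<^sup>\<bottom>\<Delta>\<^sup>-\<^sup>1\<omega>\<close> and \<open>\<nabla>\<^sup>\<bottom> = (-\<partial>\<^sub>y, \<partial>\<^sub>x)\<close>.  Since \<open>\<Delta>\<^sup>-\<^sup>1\<close> and
  the derivatives commute with the \<open>x\<close>-average, they are obtained from \<open>\<alpha> - \<alpha>\<^sub>0\<close> and \<open>\<omega> - \<omega>\<^sub>0\<close>.
  The average \<open>v\<^sub>0\<close> itself need not be in \<open>L\<^sup>2\<close> for \<open>\<alpha>, \<omega> \<in> L\<^sup>2\<close>, but it does not contribute to
  \<open>\<partial>\<^sub>x v\<^sup>y\<close>.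
\<close>

definition vx_fluct :: "(real \<times> real \<Rightarrow> real) \<Rightarrow> (real \<times> real \<Rightarrow> real) \<Rightarrow> real \<times> real \<Rightarrow> real" where
  "vx_fluct \<alpha> \<omega> = (\<lambda>z. wdx (inv_laplacian (fluct \<alpha>)) z - wdy (inv_laplacian (fluct \<omega>)) z)"

definition vy_fluct :: "(real \<times> real \<Rightarrow> real) \<Rightarrow> (real \<times> real \<Rightarrow> real) \<Rightarrow> real \<times> real \<Rightarrow> real" where
  "vy_fluct \<alpha> \<omega> = (\<lambda>z. wdy (inv_laplacian (fluct \<alpha>)) z + wdx (inv_laplacian (fluct \<omega>)) z)"


section \<open>Solutions of the linearized system\<close>

definition C0_L2 :: "(real \<Rightarrow> real \<times> real \<Rightarrow> real) \<Rightarrow> bool" where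
  "C0_L2 u \<longleftrightarrow> (\<forall>t\<ge>0. L2 (u t)) \<and>
     (\<forall>t\<ge>0. ((\<lambda>s. L2norm (\<lambda>z. u s z - u t z)) \<longlongrightarrow> 0) (at t within {0..}))"

definition C0_H1 :: "(real \<Rightarrow> real \<times> real \<Rightarrow> real) \<Rightarrow> bool" where
  "C0_H1 u \<longleftrightarrow> (\<forall>t\<ge>0. H1 (u t)) \<and> C0_L2 u \<and>
     C0_L2 (\<lambda>t. wdx (u t)) \<and> C0_L2 (\<lambda>t. wdy (u t))"

text \<open>
  Distributional solutions with \<open>\<rho> \<in> C([0,\<infinity>); H\<^sup>1)\<close> and \<open>\<alpha>, \<omega> \<in> C([0,\<infinity>); L\<^sup>2)\<close>.  All spatial
  derivatives (including the one in \<open>2 \<partial>\<^sub>x v\<^sup>y\<close>) are moved onto the test function.  By continuity in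
  time, it is equivalent to use test functions depending on \<open>t\<close> or not.
\<close>

definition couette_solution ::
  "real \<Rightarrow> real \<Rightarrow> real \<Rightarrow>
   (real \<times> real \<Rightarrow> real) \<Rightarrow> (real \<times> real \<Rightarrow> real) \<Rightarrow> (real \<times> real \<Rightarrow> real) \<Rightarrow>
   (real \<Rightarrow> real \<times> real \<Rightarrow> real) \<Rightarrow> (real \<Rightarrow> real \<times> real \<Rightarrow> real) \<Rightarrow>
   (real \<Rightarrow> real \<times> real \<Rightarrow> real) \<Rightarrow> bool" where
  "couette_solution \<nu> l M \<rho>in \<alpha>in \<omega>in \<rho> \<alpha> \<omega> \<longleftrightarrow>
     C0_H1 \<rho> \<and> C0_L2 \<alpha> \<and> C0_L2 \<omega> \<and>
     (AE z in cyl. \<rho> 0 z = \<rho>in z) \<and>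
     (AE z in cyl. \<alpha> 0 z = \<alpha>in z) \<and>
     (AE z in cyl. \<omega> 0 z = \<omega>in z) \<and>
     (\<forall>\<phi> t. test_function \<phi> \<longrightarrow> t \<ge> 0 \<longrightarrow>
        ((\<lambda>s. pairing (\<rho> s) \<phi>) has_real_derivative
           (pairing (\<rho> t) (\<lambda>(x, y). y * pdx \<phi> (x, y)) - pairing (\<alpha> t) \<phi>))
          (at t within {0..}) \<and>
        ((\<lambda>s. pairing (\<alpha> s) \<phi>) has_real_derivative
           (pairing (\<alpha> t) (\<lambda>(x, y). y * pdx \<phi> (x, y))
            + 2 * pairing (vy_fluct (\<alpha> t) (\<omega> t)) (pdx \<phi>)
            - 1 / M\<^sup>2 * pairing (\<rho> t) (laplacian \<phi>)
            + (\<nu> + l) * pairing (\<alpha> t) (laplacian \<phi>)))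
          (at t within {0..}) \<and>
        ((\<lambda>s. pairing (\<omega> s) \<phi>) has_real_derivative
           (pairing (\<omega> t) (\<lambda>(x, y). y * pdx \<phi> (x, y)) + pairing (\<alpha> t) \<phi>
            + \<nu> * pairing (\<omega> t) (laplacian \<phi>)))
          (at t within {0..}))"

text \<open>
  \<open>\<parallel>\<alpha> - \<alpha>\<^sub>0\<parallel> + \<parallel>\<nabla>(\<rho> - \<rho>\<^sub>0)\<parallel> / M + \<parallel>\<omega> - \<omega>\<^sub>0\<parallel>\<close>; at the initial data this is \<open>D\<^sub>i\<^sub>n\<close>.
\<close>

definition dev_norm ::
  "real \<Rightarrow> (real \<times> real \<Rightarrow> real) \<Rightarrow> (real \<times> real \<Rightarrow> real) \<Rightarrow> (real \<times> real \<Rightarrow> real) \<Rightarrow> real" where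
  "dev_norm M \<rho> \<alpha> \<omega> =
     L2norm (fluct \<alpha>) + 1 / M * L2norm2 (wdx (fluct \<rho>)) (wdy (fluct \<rho>)) + L2norm (fluct \<omega>)"

end

(*
  Only the nonzero x-frequencies k contribute.  Following the shear, the frequency q = eta - k t turns the system into an ODE for the amplitudes (R, A, W) of (rho, alpha, omega).
  With P^2 = k^2 + q^2, S = P R / M and X = W + R, the equation of X contains no A, and the energy
  (A^2 + S^2) / 2 + X^2 / 64 + (c - c2) A S grows at most like P^3 while it is damped at the rate
  min (1, nu P^2).  Since nu P^2 >= nu (t - eta / k)^2, this rate exceeds nu^(1/3) up to an
  integrable function of t, which gives the exponential factor; P^3 against the initial P costs
  (1 + t)^3, and the exponential absorbs it at the price of nu^(-1).

  The solution is only known weakly, so its amplitudes are read off by testing with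
  cutoff (e y) cos (k x + q y + theta).  The cutoff produces errors of order e in the ODE.  Summing
  over the frequencies q in a lattice of spacing pi e / 2, Bessel's inequality controls the errors and
  the data, Parseval's identity recovers the solution, and the errors vanish as e tends to 0.
*)
theory Submission
  imports Defs
begin

section \<open>The energy of a single mode\<close>

text \<open>A derivative that falls on the cutoff leaves a factor \<open>e q\<close>, which is not
  small uniformly in \<open>q\<close>. The errors are therefore written as \<open>P h1\<close> and
  \<open>P h2\<close>: the viscous damping, of size \<open>P\<^sup>2\<close>, absorbs the factor
  \<open>P\<close>, and only \<open>(h1\<^sup>2 + h2\<^sup>2) / \<nu>\<close> survives, with a
  prefactor \<open>e\<^sup>2\<close> and with sums that need no regularity beyond L2. The two
  estimates differ in how the growth \<open>P^3\<close> is paid. In general it costs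
  \<open>(1 + t)^3\<close>, hence \<nu>^(-1), and \<nu>^(-1/2) after the square root. Velocity and
  density see the energy divided by \<open>P\<^sup>2\<close>, which pays for two of the three
  powers; the remaining \<open>1 + t\<close> costs \<nu>^(-1/3), and \<nu>^(-1/6) after the square
  root. \<open>inv_laplacian\<close> is a choice among distributional solutions. It becomes usable
  through existence with weak first derivatives, by Dirichlet's principle, and uniqueness, a
  Liouville theorem in L2. There the frequency \<open>k = 0\<close> cannot be discarded: near
  \<open>q = 0\<close> the symbol \<open>k\<^sup>2 + q\<^sup>2\<close> gives no control, and the
  small number of such lattice points has to replace it.\<close>

lemma young_abs:
  fixes x y a :: real assumes "a > 0" shows "\<bar>x * y\<bar> \<le> a * x\<^sup>2 + y\<^sup>2 / (4 * a)"
proof -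
  have "0 \<le> (2 * a * \<bar>x\<bar> - \<bar>y\<bar>)\<^sup>2 / (4 * a)" using assms by simp
  also have "\<dots> = a * x\<^sup>2 + y\<^sup>2 / (4 * a) - \<bar>x * y\<bar>"
    using assms by (simp add: field_simps power2_eq_square abs_mult)
  finally show ?thesis by simp
qed

text \<open>
  The shear amplifies \<open>A\<close> at the rate \<open>2 s / b\<close> and \<open>S = P R / M\<close> at the rate \<open>s / b\<close>.  The cross term
  \<open>c A S\<close> distributes this evenly, so that the energy grows like \<open>b\<^bsup>3/2\<^esup>\<close>, and \<open>c2 A S\<close> transfers
  the dissipation of \<open>A\<close> to \<open>S\<close>, which has none of its own.
\<close>

lemma mode_energy_ineq:
  fixes A S X M \<delta> \<nu> P s h1 h2 \<theta> D1 :: real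
  assumes M: "M > 0" and nu: "0 < \<nu>" "\<nu> \<le> \<delta>" and dM: "\<delta> * M\<^sup>2 \<le> 1"
    and b: "b = 1 + s\<^sup>2" and P: "P \<ge> 1" "P\<^sup>2 \<ge> b"
    and Lam: "\<Lambda> = 1 + M\<^sup>2" and sg: "\<sigma> = max 0 s"
    and dd: "dd = \<sigma>^3 / (2 * (\<Lambda> + s\<^sup>2) * b)"
    and D1: "\<bar>D1\<bar> \<le> 7 / (2 * b)" "s \<le> 0 \<Longrightarrow> D1 = 0"
    and c: "c = M * dd / P" and c': "c' = M * (D1 / P - dd * s / (b * P))"
    and x: "x = \<delta> * M * P" and c2: "c2 = x / (4 * (1 + x\<^sup>2))"
    and c2': "c2' = x * (s / b) * (1 - x\<^sup>2) / (4 * (1 + x\<^sup>2)\<^sup>2)"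
    and W: "W = X - M * S / P"
    and A': "A' = 2 * s / b * A - 2 / b * W + P / M * S - \<delta> * P\<^sup>2 * A + P * h1"
    and S': "S' = s / b * S - P / M * A"
    and X': "X' = - \<nu> * P\<^sup>2 * X + \<nu> * M * P * S + P * h2"
    and E: "E = (A\<^sup>2 + S\<^sup>2) / 2 + X\<^sup>2 / 64 + (c - c2) * A * S"
    and E': "E' = A * A' + S * S' + X * X' / 32 + (c' - c2') * A * S + (c - c2) * (A' * S + A * S')"
    and th: "0 \<le> \<theta>" "\<theta> \<le> \<delta> * P\<^sup>2 / (1 + \<delta> * P\<^sup>2)" "\<theta> \<le> \<nu> * P\<^sup>2 / (1 + \<nu> * P\<^sup>2)"
  shows "E' - 3 * \<sigma> / (1 + \<sigma>\<^sup>2) * E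
      \<le> (128 * (1 + M)\<^sup>2 / b - \<theta> / 12) * E + (4 / \<nu> + 1) * (h1\<^sup>2 + h2\<^sup>2)"
    and "E \<ge> 3/8 * (A\<^sup>2 + S\<^sup>2) + X\<^sup>2 / 64" "E \<le> 5/8 * (A\<^sup>2 + S\<^sup>2) + X\<^sup>2 / 64"
proof -
  have d: "\<delta> > 0" using nu by simp
  have b1: "b \<ge> 1" by (simp add: b)
  have Lb: "b \<le> \<Lambda> + s\<^sup>2" by (simp add: b Lam)
  have sb: "\<bar>s\<bar> \<le> b" "s\<^sup>2 \<le> b"
    using zero_le_power2[of "\<bar>s\<bar> - 1"] abs_ge_zero[of s] unfolding b by (auto simp add: power2_diff)
  have x0: "x > 0" using d M P by (simp add: x)
  have sg0: "\<sigma> \<ge> 0" "\<sigma> \<le> \<bar>s\<bar>" by (auto simp: sg)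
  define q where "q = \<delta> * P\<^sup>2"
  have q0: "q > 0" using d P by (simp add: q_def)
  have dd0: "dd \<ge> 0" using sg0 b1 Lb by (simp add: dd)
  have dd1: "dd \<le> \<bar>s\<bar> / (2 * (\<Lambda> + s\<^sup>2))"
  proof -
    have "\<sigma>^3 \<le> \<bar>s\<bar>^3" using sg0 by (intro power_mono)
    also have "\<dots> = \<bar>s\<bar> * s\<^sup>2" by (simp add: power2_eq_square power3_eq_cube abs_mult_self_eq mult.assoc)
    also have "\<dots> \<le> \<bar>s\<bar> * b" using sb by (intro mult_left_mono) auto
    finally have "dd \<le> (\<bar>s\<bar> * b) / (2 * (\<Lambda> + s\<^sup>2) * b)"
      unfolding dd using b1 Lb by (intro divide_right_mono) auto
    then show ?thesis using b1 by simp
  qed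
  \<comment> \<open>This is why the denominator of \<open>dd\<close> contains
    \<open>\<Lambda>\<close> and not only \<open>b\<close>: by
    \<open>2 M |s| <= \<Lambda> + s\<^sup>2\<close> the coefficient \<open>c\<close> is at most 1/4
    for every \<open>M\<close>, which keeps the energy coercive.\<close>
  have Mdd: "M * dd \<le> 1/4"
  proof -
    have "0 \<le> (M - \<bar>s\<bar>)\<^sup>2" by simp
    then have "2 * (M * \<bar>s\<bar>) \<le> \<Lambda> + s\<^sup>2" by (simp add: Lam power2_diff)
    then have "M * (\<bar>s\<bar> / (2 * (\<Lambda> + s\<^sup>2))) \<le> 1/4" using Lb b1 by (simp add: field_simps)
    moreover have "M * dd \<le> M * (\<bar>s\<bar> / (2 * (\<Lambda> + s\<^sup>2)))" using dd1 M by (intro mult_left_mono) auto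
    ultimately show ?thesis by linarith
  qed
  have dd2: "dd\<^sup>2 \<le> 1 / (4 * b)"
  proof -
    have "dd\<^sup>2 \<le> (\<bar>s\<bar> / (2 * (\<Lambda> + s\<^sup>2)))\<^sup>2" using dd0 dd1 by (intro power_mono) auto
    also have "\<dots> = s\<^sup>2 / (4 * (\<Lambda> + s\<^sup>2) * (\<Lambda> + s\<^sup>2))"
      by (simp add: power_divide) (simp add: power2_eq_square algebra_simps)
    also have "\<dots> \<le> (\<Lambda> + s\<^sup>2) / (4 * (\<Lambda> + s\<^sup>2) * (\<Lambda> + s\<^sup>2))"
      by (intro divide_right_mono) (auto simp: Lam)
    also have "\<dots> = 1 / (4 * (\<Lambda> + s\<^sup>2))" using Lb b1 by simp
    also have "\<dots> \<le> 1 / (4 * b)" using Lb b1 by (intro divide_left_mono) auto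
    finally show ?thesis .
  qed
  have c0: "c \<ge> 0" using M dd0 P by (simp add: c)
  have cle: "c \<le> 1/4"
  proof -
    have "c \<le> M * dd / 1" unfolding c using P M dd0 by (intro divide_left_mono) auto
    then show ?thesis using Mdd by simp
  qed
  have cP: "c * P = M * dd" using P by (simp add: c)
  have c20: "c2 \<ge> 0" using x0 by (simp add: c2)
  have c2x: "c2 * x \<le> 1/4"
  proof -
    have "c2 * x = x\<^sup>2 / (4 * (1 + x\<^sup>2))" by (simp add: c2 power2_eq_square)
    also have "\<dots> \<le> (1 + x\<^sup>2) / (4 * (1 + x\<^sup>2))" by (intro divide_right_mono) auto
    also have "\<dots> = 1/4" using x0 by (simp add: add_nonneg_eq_0_iff)
    finally show ?thesis .
  qed
  have c2lex: "c2 \<le> x / 4"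
    unfolding c2 using x0 mult_pos_pos[OF x0, of "x\<^sup>2"] by (simp add: field_simps add_pos_nonneg)
  have c2le: "c2 \<le> 1/8"
  proof -
    have "0 \<le> (1 - x)\<^sup>2" by simp
    then have "2 * x \<le> 1 + x\<^sup>2" by (simp add: power2_diff)
    then show ?thesis using x0 zero_le_power2[of x] by (simp add: c2 field_simps add_pos_nonneg)
  qed
  have cc: "\<bar>c - c2\<bar> \<le> 1/4" using c0 c20 cle c2le by linarith
  have ASle: "\<bar>A * S\<bar> \<le> (A\<^sup>2 + S\<^sup>2) / 2"
    using young_abs[of "1/2" A S] by simp
  have "\<bar>(c - c2) * A * S\<bar> \<le> 1/4 * ((A\<^sup>2 + S\<^sup>2) / 2)"
    using cc ASle by (simp only: abs_mult mult.assoc) (intro mult_mono, auto simp: abs_mult)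
  then show Elow: "E \<ge> 3/8 * (A\<^sup>2 + S\<^sup>2) + X\<^sup>2 / 64" and Eup: "E \<le> 5/8 * (A\<^sup>2 + S\<^sup>2) + X\<^sup>2 / 64"
    unfolding E abs_le_iff by linarith+
  \<comment> \<open>The damping rate of \<open>S\<^sup>2\<close> that \<open>- c2 A S\<close>
    produces through the coupling \<open>P / M\<close>. It equals
    \<open>q / (4 (1 + x\<^sup>2))\<close>, and \<open>x\<^sup>2 = \<delta> M\<^sup>2 q <= q\<close>
    makes it at least a quarter of \<open>q / (1 + q)\<close>: this is where the restriction on the
    Mach number enters.\<close>
  define d2 where "d2 = c2 * P / M"
  have d20: "d2 \<ge> 0" using c20 P M by (simp add: d2_def)
  have d2low: "d2 \<ge> 1/4 * (q / (1 + q))"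
  proof -
    have "x\<^sup>2 = \<delta> * M\<^sup>2 * q" by (simp add: x q_def power2_eq_square)
    also have "\<dots> \<le> 1 * q" using dM q0 by (intro mult_right_mono) auto
    finally have "1 + x\<^sup>2 \<le> 1 + q" by simp
    moreover have "d2 = q / (4 * (1 + x\<^sup>2))" using M by (simp add: d2_def c2 x q_def power2_eq_square)
    moreover have "q / (4 * (1 + q)) \<le> q / (4 * (1 + x\<^sup>2))"
      using calculation(1) q0 zero_le_power2[of x] by (intro divide_left_mono mult_pos_pos mult_left_mono add_pos_nonneg) auto
    ultimately show ?thesis by simp
  qed
  have d2up: "d2 \<le> q / 4"
  proof -
    have "d2 \<le> x / 4 * P / M" unfolding d2_def using c2lex P M by (intro divide_right_mono mult_right_mono) auto
    also have "\<dots> = q / 4" using M by (simp add: x q_def power2_eq_square)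
    finally show ?thesis .
  qed
  \<comment> \<open>The coupling with \<open>W\<close> has the factor \<open>2 / b\<close>, which is
    integrable in time. It need not be small and goes into the \<open>1 / b\<close> part of the
    right-hand side.\<close>
  have t1: "- 2 / b * W * A - (c - c2) * (2 / b * W * S) \<le> 2 * (1 + M) / b * (X\<^sup>2 + 2 * A\<^sup>2 + 2 * S\<^sup>2)"
  proof -
    have "\<bar>W\<bar> \<le> \<bar>X\<bar> + \<bar>M * S / P\<bar>" unfolding W by (rule abs_triangle_ineq4)
    also have "\<bar>M * S / P\<bar> \<le> M * \<bar>S\<bar>" using M P mult_left_mono[of 1 P "M * \<bar>S\<bar>"] by (simp add: abs_mult divide_simps)
    finally have Wle: "\<bar>W\<bar> \<le> (1 + M) * (\<bar>X\<bar> + \<bar>S\<bar>)" using M mult_nonneg_nonneg[of M "\<bar>X\<bar>"] unfolding distrib_right distrib_left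
      by linarith
    have "- W * A - (c - c2) * W * S \<le> \<bar>W\<bar> * \<bar>A\<bar> + \<bar>c - c2\<bar> * \<bar>W\<bar> * \<bar>S\<bar>"
      using abs_ge_minus_self[of "W * A"] abs_ge_minus_self[of "(c - c2) * W * S"]
      unfolding abs_mult by linarith
    also have "\<dots> \<le> \<bar>W\<bar> * \<bar>A\<bar> + 1 * \<bar>W\<bar> * \<bar>S\<bar>"
      using cc by (intro add_left_mono mult_right_mono) auto
    also have "\<dots> = \<bar>W\<bar> * (\<bar>A\<bar> + \<bar>S\<bar>)" by (simp add: algebra_simps)
    also have "\<dots> \<le> (1 + M) * (\<bar>X\<bar> + \<bar>S\<bar>) * (\<bar>A\<bar> + \<bar>S\<bar>)" using Wle by (intro mult_right_mono) auto
    also have "\<dots> \<le> (1 + M) * (X\<^sup>2 + 2 * A\<^sup>2 + 2 * S\<^sup>2)"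
    proof -
      have "0 \<le> (\<bar>X\<bar> - \<bar>A\<bar>)\<^sup>2 + (\<bar>S\<bar> - \<bar>A\<bar>)\<^sup>2 + (\<bar>X\<bar> - \<bar>S\<bar>)\<^sup>2" by simp
      then have "(\<bar>X\<bar> + \<bar>S\<bar>) * (\<bar>A\<bar> + \<bar>S\<bar>) \<le> X\<^sup>2 + 2 * A\<^sup>2 + 2 * S\<^sup>2"
        using zero_le_power2[of A] unfolding power2_diff distrib_left distrib_right power2_abs
        by (simp only: power2_eq_square abs_mult_self_eq mult_ac)
      then show ?thesis using M by (simp add: mult.assoc mult_left_mono)
    qed
    finally have "2 / b * (- W * A - (c - c2) * W * S) \<le> 2 / b * ((1 + M) * (X\<^sup>2 + 2 * A\<^sup>2 + 2 * S\<^sup>2))"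
      using b1 by (intro mult_left_mono) auto
    then show ?thesis using b1 by (simp add: field_simps)
  qed
  \<comment> \<open>Budget for the damping terms. Of \<open>q A\<^sup>2\<close> the estimates
    \<open>t2\<close> to \<open>t5\<close> spend 1/4 + 1/8 + 1/4 + 1/8. Of
    \<open>d2 S\<^sup>2\<close> the estimates \<open>t2\<close>, \<open>t7\<close>,
    \<open>t8\<close>, \<open>t10\<close> spend 1/4 + 1/8 + 1/4 + 1/8. Of
    \<open>\<nu> P\<^sup>2 X\<^sup>2 / 32\<close> the estimates \<open>t10\<close>,
    \<open>t11\<close> spend three quarters. A quarter of each is left.\<close>
  have t2: "c2 * \<delta> * P\<^sup>2 * A * S \<le> q / 4 * A\<^sup>2 + d2 / 4 * S\<^sup>2"
  proof -
    have "\<bar>A * (c2 * S)\<bar> \<le> 1/4 * A\<^sup>2 + (c2 * S)\<^sup>2 / (4 * (1/4))" by (rule young_abs) simp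
    then have "A * (c2 * S) \<le> 1/4 * A\<^sup>2 + c2\<^sup>2 * S\<^sup>2" by (simp add: power_mult_distrib)
    then have "q * (A * (c2 * S)) \<le> q * (1/4 * A\<^sup>2 + c2\<^sup>2 * S\<^sup>2)" using q0 by (intro mult_left_mono) auto
    moreover have "q * c2\<^sup>2 \<le> d2 / 4"
    proof -
      have "q * c2\<^sup>2 = (c2 * x) * d2" using M by (simp add: q_def x d2_def power2_eq_square)
      also have "\<dots> \<le> 1/4 * d2" using c2x d20 by (intro mult_right_mono) auto
      finally show ?thesis by simp
    qed
    then have "q * c2\<^sup>2 * S\<^sup>2 \<le> d2 / 4 * S\<^sup>2" by (intro mult_right_mono) auto
    ultimately show ?thesis by (simp add: q_def algebra_simps)
  qed
  \<comment> \<open>Although \<open>\<delta> P\<^sup>2\<close> is unbounded,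
    \<open>c P = M dd\<close> is not: after Young's inequality the price on \<open>S\<^sup>2\<close>
    is a multiple of \<open>\<delta> M\<^sup>2 dd\<^sup>2\<close>, which is
    \<open>O(1 / b)\<close>.\<close>
  have t3: "- c * \<delta> * P\<^sup>2 * A * S \<le> q / 8 * A\<^sup>2 + 1 / (2 * b) * S\<^sup>2"
  proof -
    have "\<bar>A * (c * S)\<bar> \<le> 1/8 * A\<^sup>2 + (c * S)\<^sup>2 / (4 * (1/8))" by (rule young_abs) simp
    then have "- A * (c * S) \<le> 1/8 * A\<^sup>2 + 2 * c\<^sup>2 * S\<^sup>2" by (simp add: power_mult_distrib)
    then have "q * (- A * (c * S)) \<le> q * (1/8 * A\<^sup>2 + 2 * c\<^sup>2 * S\<^sup>2)" using q0 by (intro mult_left_mono) auto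
    moreover have "q * c\<^sup>2 \<le> 1 / (4 * b)"
    proof -
      have "q * c\<^sup>2 = \<delta> * (c * P)\<^sup>2" by (simp add: q_def power_mult_distrib)
      also have "\<dots> = (\<delta> * M\<^sup>2) * dd\<^sup>2" by (simp add: cP power_mult_distrib)
      also have "\<dots> \<le> 1 * dd\<^sup>2" using dM by (intro mult_right_mono) auto
      finally show ?thesis using dd2 by simp
    qed
    then have "q * c\<^sup>2 * S\<^sup>2 \<le> 1 / (4 * b) * S\<^sup>2" by (intro mult_right_mono) auto
    ultimately show ?thesis by (simp add: q_def algebra_simps)
  qed
  have t4: "c2 * (P / M) * A\<^sup>2 \<le> q / 4 * A\<^sup>2"
    using d2up by (intro mult_right_mono) (auto simp: d2_def)
  have t5: "P * h1 * A \<le> q / 8 * A\<^sup>2 + 2 / \<delta> * h1\<^sup>2"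
  proof -
    have "\<bar>(P * A) * h1\<bar> \<le> \<delta> / 8 * (P * A)\<^sup>2 + h1\<^sup>2 / (4 * (\<delta> / 8))" using d by (intro young_abs) simp
    then show ?thesis by (simp add: q_def power_mult_distrib abs_le_iff mult_ac)
  qed
  have t6: "c * P * h1 * S \<le> M\<^sup>2 / (4 * b) * S\<^sup>2 + h1\<^sup>2"
  proof -
    have "\<bar>(c * P * S) * h1\<bar> \<le> 1/4 * (c * P * S)\<^sup>2 + h1\<^sup>2 / (4 * (1/4))" by (rule young_abs) simp
    then have "c * P * h1 * S \<le> (M * dd)\<^sup>2 * S\<^sup>2 + h1\<^sup>2"
      using zero_le_power2[of "M * dd * S"] abs_ge_self[of "M * dd * S * h1"]
      unfolding cP power_mult_distrib[of "M * dd" S] by (simp only: mult_ac)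
    moreover have "(M * dd)\<^sup>2 * S\<^sup>2 \<le> M\<^sup>2 / (4 * b) * S\<^sup>2"
      using dd2 mult_left_mono[OF dd2, of "M\<^sup>2"] by (intro mult_right_mono) (auto simp: power_mult_distrib)
    ultimately show ?thesis by linarith
  qed
  have t7: "- c2 * P * h1 * S \<le> d2 / 8 * S\<^sup>2 + 1 / (2 * \<delta>) * h1\<^sup>2"
  proof -
    have "\<bar>S * (M * h1)\<bar> \<le> 1/8 * S\<^sup>2 + (M * h1)\<^sup>2 / (4 * (1/8))" by (rule young_abs) simp
    then have "- (S * (M * h1)) \<le> 1/8 * S\<^sup>2 + 2 * M\<^sup>2 * h1\<^sup>2" by (simp add: power_mult_distrib abs_le_iff)
    then have "d2 * (- (S * (M * h1))) \<le> d2 * (1/8 * S\<^sup>2 + 2 * M\<^sup>2 * h1\<^sup>2)" using d20 by (intro mult_left_mono)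
    moreover have "- c2 * P * h1 * S = d2 * (- (S * (M * h1)))" using M by (simp add: d2_def)
    moreover have "d2 * M\<^sup>2 \<le> 1 / (4 * \<delta>)"
    proof -
      have "d2 * M\<^sup>2 = (c2 * x) / \<delta>" using M d by (simp add: d2_def x power2_eq_square)
      also have "\<dots> \<le> (1/4) / \<delta>" using c2x d by (intro divide_right_mono) auto
      finally show ?thesis by simp
    qed
    then have "d2 * M\<^sup>2 * (2 * h1\<^sup>2) \<le> 1 / (4 * \<delta>) * (2 * h1\<^sup>2)" by (intro mult_right_mono) auto
    ultimately show ?thesis by (simp only:) (simp add: algebra_simps)
  qed
  have c2'le: "\<bar>c2'\<bar> \<le> c2 * \<bar>s\<bar> / b"
  proof -
    have "\<bar>1 - x\<^sup>2\<bar> \<le> 1 + x\<^sup>2" by (simp add: abs_le_iff)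
    then have "\<bar>1 - x\<^sup>2\<bar> / (1 + x\<^sup>2)\<^sup>2 \<le> (1 + x\<^sup>2) / (1 + x\<^sup>2)\<^sup>2" by (intro divide_right_mono) auto
    also have "\<dots> = 1 / (1 + x\<^sup>2)" using x0 by (simp add: power2_eq_square[of "1 + x\<^sup>2"])
    finally have *: "\<bar>1 - x\<^sup>2\<bar> / (1 + x\<^sup>2)\<^sup>2 \<le> 1 / (1 + x\<^sup>2)" .
    have "\<bar>c2'\<bar> = x * \<bar>s\<bar> / (4 * b) * (\<bar>1 - x\<^sup>2\<bar> / (1 + x\<^sup>2)\<^sup>2)"
      using x0 b1 by (simp add: c2' abs_mult)
    also have "\<dots> \<le> x * \<bar>s\<bar> / (4 * b) * (1 / (1 + x\<^sup>2))" using * x0 b1 by (intro mult_left_mono) auto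
    finally show ?thesis by (simp add: c2 mult_ac)
  qed
  have t8: "- c2' * A * S \<le> d2 / 4 * S\<^sup>2 + 1 / (4 * b) * A\<^sup>2"
  proof -
    have "- c2' * A * S \<le> \<bar>c2'\<bar> * \<bar>A * S\<bar>" using abs_ge_minus_self[of "c2' * (A * S)"] unfolding abs_mult by (simp add: mult.assoc)
    also have "\<dots> \<le> c2 * \<bar>s\<bar> / b * \<bar>A * S\<bar>" using c2'le by (intro mult_right_mono) auto
    also have "\<dots> = c2 * \<bar>S * (\<bar>s\<bar> / b * A)\<bar>" using b1 by (simp add: abs_mult)
    also have "\<dots> \<le> c2 * (P / (4 * M) * S\<^sup>2 + (\<bar>s\<bar> / b * A)\<^sup>2 / (4 * (P / (4 * M))))"
      using c20 P M by (intro mult_left_mono young_abs) auto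
    also have "\<dots> = d2 / 4 * S\<^sup>2 + (c2 * M / P) * (s\<^sup>2 / b\<^sup>2) * A\<^sup>2"
      using M P by (simp add: d2_def power_mult_distrib power_divide field_simps)
    also have "(c2 * M / P) * (s\<^sup>2 / b\<^sup>2) * A\<^sup>2 \<le> 1 / 4 * (1 / b) * A\<^sup>2"
    proof (intro mult_right_mono mult_mono)
      have "c2 * M / P \<le> x / 4 * M / P" using c2lex M P by (intro divide_right_mono mult_right_mono) auto
      also have "\<dots> = \<delta> * M\<^sup>2 / 4" using P by (simp add: x power2_eq_square)
      finally show "c2 * M / P \<le> 1/4" using dM by simp
      have "s\<^sup>2 / b\<^sup>2 \<le> b / b\<^sup>2" using sb by (intro divide_right_mono) auto
      then show "s\<^sup>2 / b\<^sup>2 \<le> 1 / b" using b1 by (simp add: power2_eq_square)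
    qed (auto simp: b)
    finally show ?thesis by simp
  qed
  have t9: "c' * A * S \<le> 4 * M / b * ((A\<^sup>2 + S\<^sup>2) / 2)"
  proof -
    have "\<bar>dd * s\<bar> \<le> 1/2"
    proof -
      have "dd * \<bar>s\<bar> \<le> \<bar>s\<bar> / (2 * (\<Lambda> + s\<^sup>2)) * \<bar>s\<bar>" using dd1 by (intro mult_right_mono) auto
      also have "\<dots> = s\<^sup>2 / (2 * (\<Lambda> + s\<^sup>2))" by (simp add: power2_eq_square)
      also have "\<dots> \<le> 1/2" using Lb b1 by (simp add: divide_simps Lam)
      finally show ?thesis using dd0 by (simp add: abs_mult)
    qed
    then have *: "\<bar>dd * s / b\<bar> \<le> 1 / (2 * b)" using b1 by (simp add: divide_simps)
    have "\<bar>c'\<bar> = M * (\<bar>D1 - dd * s / b\<bar> / P)" using M P by (simp add: c' abs_mult diff_divide_distrib[symmetric] flip: divide_divide_eq_left)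
    also have "\<dots> \<le> M * (\<bar>D1 - dd * s / b\<bar> / 1)" using M P by (intro mult_left_mono divide_left_mono) auto
    also have "\<bar>D1 - dd * s / b\<bar> \<le> 4 / b" using * D1(1) b1 abs_triangle_ineq4[of D1 "dd * s / b"] by (simp add: field_simps)
    then have "M * (\<bar>D1 - dd * s / b\<bar> / 1) \<le> 4 * M / b"
      using M mult_left_mono[of "\<bar>D1 - dd * s / b\<bar>" "4/b" M] by (simp add: mult.commute)
    finally have c'le: "\<bar>c'\<bar> \<le> 4 * M / b" .
    have "c' * A * S \<le> \<bar>c'\<bar> * \<bar>A * S\<bar>" using abs_ge_self[of "c' * (A * S)"] unfolding abs_mult by (simp add: mult.assoc)
    also have "\<dots> \<le> 4 * M / b * ((A\<^sup>2 + S\<^sup>2) / 2)" using c'le ASle by (intro mult_mono) auto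
    finally show ?thesis .
  qed
  \<comment> \<open>Young's inequality for the forcing of \<open>X\<close> by \<open>S\<close>
    leaves \<open>\<nu> M\<^sup>2 S\<^sup>2\<close>, which must be paid by the damping rate of
    \<open>S\<close> or by \<open>1 / b\<close>. For \<open>q >= 1\<close> the rate is of order one.
    For \<open>q < 1\<close> and \<open>b >= M\<^sup>2\<close> one has
    \<open>\<nu> M\<^sup>2 <= \<delta> b <= q\<close>. For \<open>b < M\<^sup>2\<close> the term
    \<open>M\<^sup>2 / b\<close> exceeds 1.\<close>
  have nuM: "\<nu> * M\<^sup>2 \<le> 2 * (q / (1 + q)) + M\<^sup>2 / b"
  proof -
    have n1: "\<nu> * M\<^sup>2 \<le> 1" using mult_right_mono[OF nu(2), of "M\<^sup>2"] dM by simp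
    consider "q \<ge> 1" | "q < 1" "b \<ge> M\<^sup>2" | "b < M\<^sup>2" by linarith
    then show ?thesis
    proof cases
      case 1 then have "2 * (q / (1 + q)) \<ge> 1" by (simp add: divide_simps)
      moreover have "M\<^sup>2 / b \<ge> 0" using b1 by simp
      ultimately show ?thesis using n1 by linarith
    next
      case 2
      have "\<nu> * M\<^sup>2 \<le> \<delta> * b" using nu 2 d by (intro mult_mono) auto
      also have "\<dots> \<le> q" unfolding q_def using P d by (intro mult_left_mono) auto
      also have "q \<le> 2 * (q / (1 + q))" using 2 q0 by (simp add: divide_simps mult_le_cancel_left1)
      moreover have "M\<^sup>2 / b \<ge> 0" using b1 by simp
      ultimately show ?thesis by linarith
    next
      case 3 then have "M\<^sup>2 / b \<ge> 1" using b1 by simp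
      moreover have "q / (1 + q) \<ge> 0" using q0 by simp
      ultimately show ?thesis using n1 by linarith
    qed
  qed
  have t10: "\<nu> * M * P * S * X / 32 \<le> \<nu> * P\<^sup>2 / 64 * X\<^sup>2 + d2 / 8 * S\<^sup>2 + M\<^sup>2 / (64 * b) * S\<^sup>2"
  proof -
    have "\<bar>(P * X) * (M * S)\<bar> \<le> 1/2 * (P * X)\<^sup>2 + (M * S)\<^sup>2 / (4 * (1/2))" by (rule young_abs) simp
    then have "P * X * (M * S) \<le> 1/2 * (P * X)\<^sup>2 + (M * S)\<^sup>2 / 2" by (simp add: abs_le_iff)
    then have "\<nu> / 32 * (P * X * (M * S)) \<le> \<nu> / 32 * (1/2 * (P * X)\<^sup>2 + (M * S)\<^sup>2 / 2)"
      using nu by (intro mult_left_mono) auto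
    moreover have "\<nu> * M\<^sup>2 * S\<^sup>2 \<le> (8 * d2 + M\<^sup>2 / b) * S\<^sup>2"
      using nuM d2low by (intro mult_right_mono zero_le_power2) linarith
    ultimately show ?thesis by (simp add: power_mult_distrib algebra_simps)
  qed
  have t11: "P * h2 * X / 32 \<le> \<nu> * P\<^sup>2 / 128 * X\<^sup>2 + 1 / (32 * \<nu>) * h2\<^sup>2"
  proof -
    have "\<bar>(P * X) * h2\<bar> \<le> \<nu> / 4 * (P * X)\<^sup>2 + h2\<^sup>2 / (4 * (\<nu> / 4))" using nu by (intro young_abs) auto
    then have "P * X * h2 \<le> \<nu> / 4 * (P * X)\<^sup>2 + h2\<^sup>2 / \<nu>" by (simp add: abs_le_iff)
    then show ?thesis using nu by (simp add: power_mult_distrib field_simps)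
  qed
  \<comment> \<open>The terms caused by the shear and by the time dependence of the cross
    coefficients. For \<open>s >= 0\<close> the term
    \<open>c (P / M) (S\<^sup>2 - A\<^sup>2)\<close> moves the rates \<open>2 s / b\<close> and
    \<open>s / b\<close> to their mean \<open>3 s / (2 b)\<close>, up to an error of order
    \<open>\<Lambda> / b\<close>. Subtracting \<open>3 s / b\<close> times the full \<open>E\<close>
    removes that mean and also cancels \<open>(c - c2) (3 s / b) A S\<close> exactly.\<close>
  define T0 where "T0 = 2 * s / b * A\<^sup>2 + s / b * S\<^sup>2 + (c - c2) * (3 * s / b) * A * S
     + c * (P / M) * (S\<^sup>2 - A\<^sup>2) + (c' - c2') * A * S - 3 * \<sigma> / (1 + \<sigma>\<^sup>2) * E"
  have Eeq: "E' - 3 * \<sigma> / (1 + \<sigma>\<^sup>2) * E = T0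
      + (- 2 / b * W * A - (c - c2) * (2 / b * W * S))
      + c2 * \<delta> * P\<^sup>2 * A * S - c * \<delta> * P\<^sup>2 * A * S + c2 * (P / M) * A\<^sup>2
      + P * h1 * A + c * P * h1 * S - c2 * P * h1 * S
      + \<nu> * M * P * S * X / 32 + P * h2 * X / 32
      - q * A\<^sup>2 - d2 * S\<^sup>2 - \<nu> * P\<^sup>2 / 32 * X\<^sup>2"
    unfolding E' A' S' X' T0_def q_def d2_def by (simp add: algebra_simps power2_eq_square add_divide_distrib diff_divide_distrib)
  have T0: "T0 \<le> (\<Lambda> / 2 + 2 * M + 1/4) / b * (A\<^sup>2 + S\<^sup>2) + d2 / 4 * S\<^sup>2"
  proof (cases "s \<ge> 0")
    case True
    then have sgs: "\<sigma> = s" by (simp add: sg)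
    have cPM: "c * (P / M) = dd" using cP M P by (simp add: c)
    have "3 * \<sigma> / (1 + \<sigma>\<^sup>2) * E = 3 * s / b * E" by (simp add: sgs b)
    then have "T0 = (s / b / 2 - dd) * (A\<^sup>2 - S\<^sup>2) + c' * A * S + (- c2' * A * S) - 3 * s / b * (X\<^sup>2 / 64)"
      unfolding T0_def cPM E by (simp add: algebra_simps add_divide_distrib diff_divide_distrib)
    moreover have "3 * s / b * (X\<^sup>2 / 64) \<ge> 0" using True b1 by simp
    moreover have "(s / b / 2 - dd) * (A\<^sup>2 - S\<^sup>2) \<le> \<Lambda> / 2 / b * (A\<^sup>2 + S\<^sup>2)"
    proof -
      have e: "s / b / 2 - dd = \<Lambda> / 2 / b * (s / (\<Lambda> + s\<^sup>2))"
        unfolding dd sgs using Lb b1 by (simp add: divide_simps) (simp add: algebra_simps power2_eq_square power3_eq_cube)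
      have f: "0 \<le> s / (\<Lambda> + s\<^sup>2)" "s / (\<Lambda> + s\<^sup>2) \<le> 1" using True Lb b1 sb by (auto simp: divide_simps)
      have "(s / (\<Lambda> + s\<^sup>2)) * (A\<^sup>2 - S\<^sup>2) \<le> (s / (\<Lambda> + s\<^sup>2)) * (A\<^sup>2 + S\<^sup>2)" using f by (intro mult_left_mono) auto
      also have "\<dots> \<le> 1 * (A\<^sup>2 + S\<^sup>2)" using f by (intro mult_right_mono) auto
      finally have "\<Lambda> / 2 / b * ((s / (\<Lambda> + s\<^sup>2)) * (A\<^sup>2 - S\<^sup>2)) \<le> \<Lambda> / 2 / b * (A\<^sup>2 + S\<^sup>2)"
        using b1 by (intro mult_left_mono) (auto simp: Lam)
      then show ?thesis unfolding e by (simp add: mult.assoc)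
    qed
    moreover have "(\<Lambda> / 2 + 2 * M + 1/4) / b * (A\<^sup>2 + S\<^sup>2) = \<Lambda> / 2 / b * (A\<^sup>2 + S\<^sup>2)
        + 4 * M / b * ((A\<^sup>2 + S\<^sup>2) / 2) + 1 / (4 * b) * A\<^sup>2 + 1 / (4 * b) * S\<^sup>2"
      using b1 by (simp add: field_simps)
    moreover have "1 / (4 * b) * S\<^sup>2 \<ge> 0" using b1 by simp
    ultimately show ?thesis using t8 t9 by linarith
  next
    case False
    \<comment> \<open>Before the critical time the shear damps both components. The negative terms
      \<open>2 s / b A\<^sup>2\<close> and \<open>s / b S\<^sup>2\<close> dominate the cross terms
      because \<open>c2 <= 1/8\<close>.\<close>
    then have z: "\<sigma> = 0" "dd = 0" "c = 0" "D1 = 0" "c' = 0"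
      using D1(2) by (auto simp: sg dd c c')
    have "T0 = 2 * s / b * A\<^sup>2 + s / b * S\<^sup>2 - c2 * (3 * s / b) * A * S - c2' * A * S"
      unfolding T0_def z by (simp add: algebra_simps)
    also have "\<dots> \<le> 0"
    proof -
      have "- c2 * (3 * s / b) * A * S - c2' * A * S \<le> (c2 * (3 * \<bar>s\<bar> / b) + \<bar>c2'\<bar>) * \<bar>A * S\<bar>"
      proof -
        have "- c2 * (3 * s / b) * A * S - c2' * A * S = (- c2 * (3 * s / b) - c2') * (A * S)" by (simp add: algebra_simps)
        also have "\<dots> \<le> \<bar>- c2 * (3 * s / b) - c2'\<bar> * \<bar>A * S\<bar>" by (metis abs_ge_self abs_mult)
        also have "\<dots> \<le> (c2 * (3 * \<bar>s\<bar> / b) + \<bar>c2'\<bar>) * \<bar>A * S\<bar>"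
          using c20 b1 abs_triangle_ineq4[of "- c2 * (3 * s / b)" c2'] by (intro mult_right_mono) (auto simp: abs_mult)
        finally show ?thesis .
      qed
      also have "\<dots> \<le> (\<bar>s\<bar> / b / 2) * ((A\<^sup>2 + S\<^sup>2) / 2)"
      proof (intro mult_mono)
        have "c2 * (3 * \<bar>s\<bar> / b) + \<bar>c2'\<bar> \<le> 4 * c2 * (\<bar>s\<bar> / b)" using c2'le by simp
        also have "\<dots> \<le> 1/2 * (\<bar>s\<bar> / b)" using c2le b1 by (intro mult_right_mono) auto
        finally show "c2 * (3 * \<bar>s\<bar> / b) + \<bar>c2'\<bar> \<le> \<bar>s\<bar> / b / 2" by simp
      qed (use ASle b1 in auto)
      finally have "- c2 * (3 * s / b) * A * S - c2' * A * S \<le> (\<bar>s\<bar> / b) * ((A\<^sup>2 + S\<^sup>2) / 4)" by simp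
      moreover have "\<bar>s\<bar> / b * A\<^sup>2 \<ge> 0" "\<bar>s\<bar> / b * S\<^sup>2 \<ge> 0" using b1 by auto
      moreover have "2 * s / b * A\<^sup>2 = - 2 * (\<bar>s\<bar> / b * A\<^sup>2)" "s / b * S\<^sup>2 = - (\<bar>s\<bar> / b * S\<^sup>2)"
        using False by auto
      ultimately show ?thesis unfolding add_divide_distrib distrib_left by simp
    qed
    moreover have "(\<Lambda> / 2 + 2 * M + 1/4) / b * (A\<^sup>2 + S\<^sup>2) \<ge> 0" "d2 / 4 * S\<^sup>2 \<ge> 0"
      using b1 M d20 by (auto simp: Lam intro!: mult_nonneg_nonneg divide_nonneg_nonneg)
    ultimately show ?thesis by linarith
  qed
  define Y where "Y = A\<^sup>2 + S\<^sup>2"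
  have "E' - 3 * \<sigma> / (1 + \<sigma>\<^sup>2) * E \<le> ((\<Lambda> / 2 + 2 * M + 1/4) / b * (A\<^sup>2 + S\<^sup>2) + 2 * (1 + M) / b * (X\<^sup>2 + 2 * A\<^sup>2 + 2 * S\<^sup>2)
      + 1 / (2 * b) * S\<^sup>2 + M\<^sup>2 / (4 * b) * S\<^sup>2 + M\<^sup>2 / (64 * b) * S\<^sup>2)
      + (2 / \<delta> * h1\<^sup>2 + h1\<^sup>2 + 1 / (2 * \<delta>) * h1\<^sup>2 + 1 / (32 * \<nu>) * h2\<^sup>2)
      - (q / 4 * A\<^sup>2 + d2 / 4 * S\<^sup>2 + \<nu> * P\<^sup>2 / 128 * X\<^sup>2)"
    unfolding Eeq using T0 t1 t2 t3 t4 t5 t6 t7 t10 t11 by (simp add: algebra_simps)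
  moreover have "(\<Lambda> / 2 + 2 * M + 1/4) / b * (A\<^sup>2 + S\<^sup>2) + 2 * (1 + M) / b * (X\<^sup>2 + 2 * A\<^sup>2 + 2 * S\<^sup>2)
      + 1 / (2 * b) * S\<^sup>2 + M\<^sup>2 / (4 * b) * S\<^sup>2 + M\<^sup>2 / (64 * b) * S\<^sup>2 \<le> 128 * (1 + M)\<^sup>2 / b * E"
  proof -
    have "(\<Lambda> / 2 + 2 * M + 1/4) * (A\<^sup>2 + S\<^sup>2) + 2 * (1 + M) * (X\<^sup>2 + 2 * (A\<^sup>2 + S\<^sup>2))
      + 1 / 2 * S\<^sup>2 + M\<^sup>2 / 4 * S\<^sup>2 + M\<^sup>2 / 64 * S\<^sup>2
      \<le> (\<Lambda> / 2 + 2 * M + 1/4 + 4 * (1 + M) + 1/2 + M\<^sup>2 / 4 + M\<^sup>2 / 64) * (A\<^sup>2 + S\<^sup>2) + 2 * (1 + M) * X\<^sup>2"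
      using zero_le_power2[of A] mult_nonneg_nonneg[OF zero_le_power2[of M] zero_le_power2[of A]]
      by (simp add: field_simps)
    also have "\<dots> \<le> 48 * (1 + M)\<^sup>2 * (A\<^sup>2 + S\<^sup>2) + 2 * (1 + M)\<^sup>2 * X\<^sup>2"
    proof (intro add_mono mult_right_mono)
      have "0 \<le> M * M" by simp
      then show "\<Lambda> / 2 + 2 * M + 1/4 + 4 * (1 + M) + 1/2 + M\<^sup>2 / 4 + M\<^sup>2 / 64 \<le> 48 * (1 + M)\<^sup>2"
        using M unfolding Lam power2_eq_square distrib_left distrib_right add_divide_distrib by linarith
      show "2 * (1 + M) \<le> 2 * (1 + M)\<^sup>2" using M mult_right_mono[of 1 "1 + M" "1 + M"] unfolding power2_eq_square by linarith
    qed auto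
    also have "\<dots> = 128 * (1 + M)\<^sup>2 * (3/8 * (A\<^sup>2 + S\<^sup>2) + X\<^sup>2 / 64)" by (simp add: algebra_simps)
    also have "\<dots> \<le> 128 * (1 + M)\<^sup>2 * E" using Elow by (intro mult_left_mono) auto
    finally have "((\<Lambda> / 2 + 2 * M + 1/4) * (A\<^sup>2 + S\<^sup>2) + 2 * (1 + M) * (X\<^sup>2 + 2 * (A\<^sup>2 + S\<^sup>2))
      + 1 / 2 * S\<^sup>2 + M\<^sup>2 / 4 * S\<^sup>2 + M\<^sup>2 / 64 * S\<^sup>2) / b \<le> (128 * (1 + M)\<^sup>2 * E) / b"
      using b1 by (intro divide_right_mono) auto
    then show ?thesis by (simp add: algebra_simps add_divide_distrib)
  qed
  moreover have "2 / \<delta> * h1\<^sup>2 + h1\<^sup>2 + 1 / (2 * \<delta>) * h1\<^sup>2 + 1 / (32 * \<nu>) * h2\<^sup>2 \<le> (4 / \<nu> + 1) * (h1\<^sup>2 + h2\<^sup>2)"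
  proof -
    have "1 / \<delta> * h1\<^sup>2 \<le> 1 / \<nu> * h1\<^sup>2" using nu d by (intro mult_right_mono divide_left_mono) auto
    moreover have "1 / \<nu> * h1\<^sup>2 \<ge> 0" "1 / \<nu> * h2\<^sup>2 \<ge> 0" "h2\<^sup>2 \<ge> 0" using nu by auto
    moreover have "2 / \<delta> * h1\<^sup>2 = 2 * (1 / \<delta> * h1\<^sup>2)" "1 / (2 * \<delta>) * h1\<^sup>2 = 1/2 * (1 / \<delta> * h1\<^sup>2)"
      "1 / (32 * \<nu>) * h2\<^sup>2 = 1/32 * (1 / \<nu> * h2\<^sup>2)"
      "(4 / \<nu> + 1) * (h1\<^sup>2 + h2\<^sup>2) = 4 * (1 / \<nu> * h1\<^sup>2) + 4 * (1 / \<nu> * h2\<^sup>2) + h1\<^sup>2 + h2\<^sup>2"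
      by (simp_all add: algebra_simps)
    ultimately show ?thesis by linarith
  qed
  \<comment> \<open>The rate 1/12 is dictated by \<open>S\<close>: the remaining damping is
    \<open>d2 / 4 >= q / (16 (1 + q)) >= \<theta> / 16\<close>, while \<open>E\<close> contains up
    to \<open>5/8 S\<^sup>2\<close>, and \<open>5/8 * 1/12 <= 1/16\<close>.\<close>
  moreover have "\<theta> / 12 * E \<le> q / 4 * A\<^sup>2 + d2 / 4 * S\<^sup>2 + \<nu> * P\<^sup>2 / 128 * X\<^sup>2"
  proof -
    have "\<theta> / 12 * E \<le> \<theta> / 12 * (5/8 * (A\<^sup>2 + S\<^sup>2) + X\<^sup>2 / 64)" using Eup th by (intro mult_left_mono) auto
    also have "\<dots> \<le> \<theta> / 16 * A\<^sup>2 + \<theta> / 16 * S\<^sup>2 + \<theta> / 128 * X\<^sup>2"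
      using mult_nonneg_nonneg[OF th(1) zero_le_power2[of A]] mult_nonneg_nonneg[OF th(1) zero_le_power2[of S]]
        mult_nonneg_nonneg[OF th(1) zero_le_power2[of X]] by (simp add: algebra_simps)
    also have "\<dots> \<le> q / 4 * A\<^sup>2 + d2 / 4 * S\<^sup>2 + \<nu> * P\<^sup>2 / 128 * X\<^sup>2"
    proof (intro add_mono mult_right_mono)
      have "q / (1 + q) \<le> q / 1" using q0 by (intro divide_left_mono) auto
      then show "\<theta> / 16 \<le> q / 4" using th(2) q0 by (simp add: q_def[symmetric])
      show "\<theta> / 16 \<le> d2 / 4" using th(2) d2low unfolding q_def[symmetric] by linarith
      have "\<nu> * P\<^sup>2 / (1 + \<nu> * P\<^sup>2) \<le> \<nu> * P\<^sup>2 / 1" using nu by (intro divide_left_mono) (auto intro: add_pos_nonneg)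
      then show "\<theta> / 128 \<le> \<nu> * P\<^sup>2 / 128" using th(3) by simp
    qed auto
    finally show ?thesis .
  qed
  ultimately show "E' - 3 * \<sigma> / (1 + \<sigma>\<^sup>2) * E
      \<le> (128 * (1 + M)\<^sup>2 / b - \<theta> / 12) * E + (4 / \<nu> + 1) * (h1\<^sup>2 + h2\<^sup>2)"
    unfolding left_diff_distrib by linarith
qed

section \<open>Time weights and the integrated growth bound for one mode\<close>

lemma DERIV_max_0_power:
  assumes "n \<ge> 2"
  shows "((\<lambda>x::real. max 0 x ^ n) has_real_derivative (of_nat n * max 0 x ^ (n - 1))) (at x)"
proof (cases "x = 0")
  case False
  show ?thesis
  proof (cases "x > 0")
    case True
    have "((\<lambda>x::real. x ^ n) has_real_derivative (of_nat n * max 0 x ^ (n - 1))) (at x)"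
      using True by (auto intro!: derivative_eq_intros)
    then show ?thesis
      by (rule has_field_derivative_transform_within_open[of _ _ _ "{0<..}"]) (use True in auto)
  next
    case neg: False
    have "((\<lambda>x::real. 0) has_real_derivative (of_nat n * max 0 x ^ (n - 1))) (at x)"
      using neg assms by (auto simp: power_0_left)
    then show ?thesis
      by (rule has_field_derivative_transform_within_open[of _ _ _ "{..<0}"])
        (use neg False assms in \<open>auto simp: power_0_left\<close>)
  qed
next
  case True
  have "((\<lambda>h::real. (max 0 h) ^ n / h) \<longlongrightarrow> 0) (at 0)"
  proof (rule Lim_null_comparison)
    show "eventually (\<lambda>h. norm (max 0 h ^ n / h) \<le> \<bar>h\<bar> ^ (n - 1)) (at (0::real))"
    proof (intro always_eventually allI)
      fix h :: real
      show "norm (max 0 h ^ n / h) \<le> \<bar>h\<bar> ^ (n - 1)"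
      proof (cases "h > 0")
        case True then show ?thesis using assms by (cases n) auto
      qed (use assms in \<open>auto simp: power_0_left max_def\<close>)
    qed
    have "((\<lambda>h::real. \<bar>h\<bar> ^ (n - 1)) \<longlongrightarrow> \<bar>0\<bar> ^ (n - 1)) (at 0)" by (intro tendsto_intros)
    then show "((\<lambda>h::real. \<bar>h\<bar> ^ (n - 1)) \<longlongrightarrow> 0) (at 0)" using assms by (simp add: power_0_left)
  qed
  then show ?thesis using True assms by (auto simp: DERIV_def power_0_left)
qed

text \<open>The cube of the positive part is differentiable through \<open>s = 0\<close>, so the
  cross term can be switched on at the critical time. The derivative is \<open>O(1 / b)\<close> and
  hence integrable in time; 7/2 is 14/4, from the quotient rule with every power of
  \<open>\<sigma>\<close> estimated by \<open>L\<close> or \<open>b\<close>.\<close>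

lemma cutoff_coefficient_deriv:
  fixes M :: real
  defines "f \<equiv> (\<lambda>s. (max 0 s)^3 / (2 * (1 + M\<^sup>2 + s\<^sup>2) * (1 + s\<^sup>2)))"
  obtains D where "(f has_real_derivative D) (at s)" "\<bar>D\<bar> \<le> 7 / (2 * (1 + s\<^sup>2))" "s \<le> 0 \<Longrightarrow> D = 0"
proof -
  define \<sigma> where "\<sigma> = max 0 s"
  define L where "L = 1 + M\<^sup>2 + s\<^sup>2"
  define b where "b = 1 + s\<^sup>2"
  define D where "D = (3 * \<sigma>\<^sup>2 * (2 * L * b) - \<sigma>^3 * (4 * s * b + 4 * s * L)) / (2 * L * b)\<^sup>2"
  have pos: "L > 0" "b > 0" "L \<ge> b" "b \<ge> 1" by (auto simp: L_def b_def add_pos_nonneg)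
  have "(f has_real_derivative D) (at s)"
  proof -
    have 1: "((\<lambda>s. (max 0 s)^3) has_real_derivative 3 * \<sigma>\<^sup>2) (at s)"
      using DERIV_max_0_power[of 3 s] by (simp add: \<sigma>_def)
    have 2: "((\<lambda>s. 2 * (1 + M\<^sup>2 + s\<^sup>2) * (1 + s\<^sup>2)) has_real_derivative 4 * s * b + 4 * s * L) (at s)"
      by (auto intro!: derivative_eq_intros simp: L_def b_def algebra_simps power2_eq_square)
    have 3: "2 * (1 + M\<^sup>2 + s\<^sup>2) * (1 + s\<^sup>2) \<noteq> 0" using pos by (simp add: L_def[symmetric] b_def[symmetric])
    show ?thesis
      using DERIV_divide[OF 1 2 3] unfolding f_def D_def \<sigma>_def L_def[symmetric] b_def[symmetric]
      by (simp only: power2_eq_square[of "2 * L * b"])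
  qed
  moreover have "s \<le> 0 \<Longrightarrow> D = 0" by (simp add: D_def \<sigma>_def)
  moreover have "\<bar>D\<bar> \<le> 7 / (2 * b)"
  proof -
    have s2: "\<sigma>\<^sup>2 \<le> L" "\<sigma>\<^sup>2 \<le> b" "\<sigma> \<ge> 0" "\<sigma> * s = \<sigma>\<^sup>2" by (auto simp: \<sigma>_def L_def b_def max_def power2_eq_square)
    have "\<sigma>^3 * (4 * s * b + 4 * s * L) = 4 * \<sigma>\<^sup>2 * (\<sigma> * s) * (b + L)"
      by (simp add: power2_eq_square power3_eq_cube algebra_simps)
    then have D: "D = (6 * \<sigma>\<^sup>2 * (L * b) - 4 * \<sigma>\<^sup>2 * \<sigma>\<^sup>2 * (b + L)) / (4 * L\<^sup>2 * b\<^sup>2)"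
      using s2 by (simp add: D_def power_mult_distrib mult_ac)
    have "\<bar>6 * \<sigma>\<^sup>2 * (L * b) - 4 * \<sigma>\<^sup>2 * \<sigma>\<^sup>2 * (b + L)\<bar> \<le> 6 * \<sigma>\<^sup>2 * (L * b) + 4 * \<sigma>\<^sup>2 * \<sigma>\<^sup>2 * (b + L)"
      using pos by (intro order_trans[OF abs_triangle_ineq4]) (simp add: abs_mult)
    also have "\<dots> \<le> 6 * L * (L * b) + 4 * (L * L * b + L * b * L)"
    proof -
      have "\<sigma>\<^sup>2 * \<sigma>\<^sup>2 * b \<le> L * L * b" "\<sigma>\<^sup>2 * \<sigma>\<^sup>2 * L \<le> L * b * L"
        using s2 pos by (intro mult_right_mono mult_mono; simp)+
      moreover have "\<sigma>\<^sup>2 * (L * b) \<le> L * (L * b)" using s2 pos by (intro mult_right_mono) auto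
      ultimately show ?thesis by (simp add: algebra_simps)
    qed
    also have "\<dots> = 14 * L\<^sup>2 * b" by (simp add: power2_eq_square)
    finally have "\<bar>6 * \<sigma>\<^sup>2 * (L * b) - 4 * \<sigma>\<^sup>2 * \<sigma>\<^sup>2 * (b + L)\<bar> / (4 * L\<^sup>2 * b\<^sup>2) \<le> 14 * L\<^sup>2 * b / (4 * L\<^sup>2 * b\<^sup>2)"
      by (rule divide_right_mono) simp
    then have "\<bar>D\<bar> \<le> 14 * L\<^sup>2 * b / (4 * L\<^sup>2 * b\<^sup>2)" unfolding D abs_divide by simp
    also have "\<dots> = 7 / (2 * b)" using pos by (simp add: power2_eq_square)
    finally show ?thesis .
  qed
  ultimately show ?thesis using that unfolding b_def by blast
qed

text \<open>The energy inequality in integrated form. \<open>y\<close> is the energy times weights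
  whose logarithmic derivatives cancel the growth, the \<open>1 / b\<close> terms and the damping,
  so \<open>y\<close> can increase only through \<open>h1\<close> and \<open>h2\<close>. The last
  two conclusions undo the weights in two ways; the second lets the division by
  \<open>P\<^sup>2\<close> pay for part of the growth.\<close>

lemma mode_growth:
  fixes k \<eta> M \<delta> \<nu> T :: real and R A W h1 h2 :: "real \<Rightarrow> real"
  assumes k: "\<bar>k\<bar> \<ge> 1" and M: "M > 0" and nu: "0 < \<nu>" "\<nu> \<le> \<delta>" "\<nu> \<le> 1" and dM: "\<delta> * M\<^sup>2 \<le> 1"
  defines "s \<equiv> \<lambda>t. t - \<eta> / k"
  defines "b \<equiv> \<lambda>t. 1 + (s t)\<^sup>2"
  defines "P \<equiv> \<lambda>t. \<bar>k\<bar> * sqrt (b t)"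
  assumes R': "\<And>t. t \<ge> 0 \<Longrightarrow> (R has_real_derivative - A t) (at t within {0..})"
    and A': "\<And>t. t \<ge> 0 \<Longrightarrow> (A has_real_derivative 2 * s t / b t * A t - 2 / b t * W t + (P t)\<^sup>2 / M\<^sup>2 * R t
               - \<delta> * (P t)\<^sup>2 * A t + P t * h1 t) (at t within {0..})"
    and W': "\<And>t. t \<ge> 0 \<Longrightarrow> (W has_real_derivative A t - \<nu> * (P t)\<^sup>2 * W t + P t * h2 t) (at t within {0..})"
  defines "F \<equiv> \<lambda>t. (A t)\<^sup>2 + (P t * R t / M)\<^sup>2 + (W t)\<^sup>2"
  obtains y y' where
    "\<And>t. t \<ge> 0 \<Longrightarrow> (y has_real_derivative y' t) (at t within {0..})"
    "\<And>t. t \<ge> 0 \<Longrightarrow> t \<le> T \<Longrightarrow> y' t \<le> (4 / \<nu> + 1) * exp (512 * (1 + M)\<^sup>2 + 1 + T) * ((h1 t)\<^sup>2 + (h2 t)\<^sup>2)"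
    "y 0 \<le> (1 + M\<^sup>2) * F 0"
    "\<And>t. t \<ge> 0 \<Longrightarrow> F t \<le> 128 * (1 + M\<^sup>2) * exp (512 * (1 + M)\<^sup>2 + 1) * ((1 + t)^3 * exp (- (\<nu> powr (1/3) * t / 12)) * y t)"
    "\<And>t. t \<ge> 0 \<Longrightarrow> F t / (P t)\<^sup>2 \<le> 128 * (1 + M\<^sup>2) * exp (512 * (1 + M)\<^sup>2 + 1) * ((1 + t) * exp (- (\<nu> powr (1/3) * t / 12)) * y t)"
proof -
  define S where "S t = P t * R t / M" for t
  define X where "X t = W t + R t" for t
  define \<sigma> where "\<sigma> t = max 0 (s t)" for t
  define dd where "dd t = \<sigma> t ^ 3 / (2 * (1 + M\<^sup>2 + (s t)\<^sup>2) * b t)" for t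
  define c where "c t = M * dd t / P t" for t
  define x where "x t = \<delta> * M * P t" for t
  define c2 where "c2 t = x t / (4 * (1 + (x t)\<^sup>2))" for t
  define E where "E t = ((A t)\<^sup>2 + (S t)\<^sup>2) / 2 + (X t)\<^sup>2 / 64 + (c t - c2 t) * A t * S t" for t
  define G where "G = 128 * (1 + M)\<^sup>2"
  define \<mu> where "\<mu> = \<nu> powr (1/3)"
  define J where "J t = \<mu> / (1 + (\<mu> * s t)\<^sup>2)" for t
  define v where "v t = 1 + (\<sigma> t)\<^sup>2" for t
  define w where "w t = v t powr (-3/2)" for t
  \<comment> \<open>The logarithmic derivative is \<open>- G / b - J / 12 + \<mu> / 12\<close>.
    Since the arctangents are bounded, \<open>I\<close> is \<open>exp (\<mu> t / 12)\<close> up to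
    factors that depend on \<open>M\<close> only: the damping fails near the critical time, but only
    by the integrable amount \<open>J\<close>.\<close>
  define I where "I t = exp (- G * arctan (s t) - arctan (\<mu> * s t) / 12 + \<mu> * t / 12)" for t
  define y where "y t = w t * E t * I t / (w 0 * I 0)" for t
  have k0: "k \<noteq> 0" using k by auto
  have b1: "b t \<ge> 1" for t by (simp add: b_def)
  have P2: "(P t)\<^sup>2 = k\<^sup>2 * b t" for t using b1[of t] by (simp add: P_def power_mult_distrib)
  have k2: "k\<^sup>2 \<ge> 1" using k by (metis abs_le_square_iff abs_one one_power2 power2_abs)
  have P2b: "(P t)\<^sup>2 \<ge> b t" for t using mult_right_mono[OF k2, of "b t"] b1[of t] by (simp add: P2)
  have P1: "P t \<ge> 1" for t
    using mult_mono[of 1 "\<bar>k\<bar>" 1 "sqrt (b t)"] k b1[of t] by (simp add: P_def)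
  have mu: "0 < \<mu>" "\<mu> \<le> 1" using nu by (auto simp: \<mu>_def powr_le1)
  have mu3: "\<mu>^3 = \<nu>"
  proof -
    have "\<mu>^3 = \<mu> powr 3" using mu by (simp only: powr_numeral)
    also have "\<dots> = \<nu>" using nu by (simp add: \<mu>_def powr_powr)
    finally show ?thesis .
  qed
  have v1: "v t \<ge> 1" for t by (simp add: v_def)
  have w0: "w t > 0" for t using v1[of t] by (simp add: w_def)
  have I0: "I t > 0" for t by (simp add: I_def)
  have s': "(s has_real_derivative 1) (at t within Q)" for t Q
    unfolding s_def by (auto intro!: derivative_eq_intros)
  have b': "(b has_real_derivative 2 * s t) (at t within Q)" for t Q
    unfolding b_def by (auto intro!: derivative_eq_intros s')
  have P': "(P has_real_derivative P t * s t / b t) (at t within Q)" for t Q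
  proof -
    have "(P has_real_derivative \<bar>k\<bar> * (inverse (sqrt (b t)) / 2 * (2 * s t))) (at t within Q)"
      unfolding P_def using b1[of t]
      by (intro DERIV_cmult DERIV_chain2[where f = sqrt, OF DERIV_real_sqrt b']) linarith
    moreover have "\<bar>k\<bar> * (inverse (sqrt (b t)) / 2 * (2 * s t)) = P t * s t / b t"
      using b1[of t] by (simp add: P_def field_simps)
    ultimately show ?thesis by simp
  qed
  have v': "(v has_real_derivative 2 * \<sigma> t) (at t within Q)" for t Q
  proof -
    have "((\<lambda>t. (\<sigma> t)\<^sup>2) has_real_derivative 2 * \<sigma> t * 1) (at t within Q)"
      unfolding \<sigma>_def using DERIV_max_0_power[of 2 "s t"]
      by (intro DERIV_chain2[where f = "\<lambda>x. (max 0 x)\<^sup>2", OF _ s']) simp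
    from DERIV_add[OF DERIV_const this] show ?thesis unfolding v_def[abs_def] by simp
  qed
  have w': "(w has_real_derivative - (3 * \<sigma> t / v t) * w t) (at t within Q)" for t Q
  proof -
    have "(w has_real_derivative (-3/2) * v t powr (-3/2 - 1) * (2 * \<sigma> t)) (at t within Q)"
      unfolding w_def using v1[of t]
      by (intro DERIV_chain2[where f = "\<lambda>x. x powr (-3/2)", OF has_real_derivative_powr v']) linarith
    moreover have "v t powr (-3/2 - 1) = w t / v t"
      using v1[of t] unfolding w_def by (subst powr_diff) simp
    ultimately show ?thesis by (simp only: ) (simp add: field_simps)
  qed
  have I': "(I has_real_derivative (- G / b t - J t / 12 + \<mu> / 12) * I t) (at t within Q)" for t Q
  proof -
    have 1: "((\<lambda>t. arctan (s t)) has_real_derivative 1 / b t) (at t within Q)"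
      using DERIV_chain2[OF DERIV_arctan s', of t Q] by (simp add: b_def divide_inverse)
    have 2: "((\<lambda>t. arctan (\<mu> * s t)) has_real_derivative J t) (at t within Q)"
      using DERIV_chain2[OF DERIV_arctan DERIV_cmult[OF s'], of \<mu> t Q] by (simp add: J_def divide_inverse mult.commute)
    have 3: "((\<lambda>t. \<mu> * t / 12) has_real_derivative \<mu> / 12) (at t within Q)"
      by (auto intro!: derivative_eq_intros)
    have "((\<lambda>t. - G * arctan (s t) - arctan (\<mu> * s t) / 12 + \<mu> * t / 12) has_real_derivative
        (- G * (1 / b t) - J t / 12 + \<mu> / 12)) (at t within Q)"
      by (intro DERIV_add DERIV_diff DERIV_cmult DERIV_cdivide 1 2 3)
    from DERIV_chain2[OF DERIV_exp this] show ?thesis unfolding I_def[abs_def] by (simp add: mult.commute)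
  qed
  have wmono: "w t \<le> w 0" if "t \<ge> 0" for t
  proof -
    have "\<sigma> 0 \<le> \<sigma> t" "\<sigma> 0 \<ge> 0" using that by (auto simp: \<sigma>_def s_def)
    then have "v 0 \<le> v t" by (simp add: v_def power_mono)
    then show ?thesis using v1[of 0] unfolding w_def by (intro powr_mono2') auto
  qed
  \<comment> \<open>Two arctangents differ by less than pi, rounded up to 4. This is the origin of
    \<open>512 (1 + M)\<^sup>2 = 4 G\<close>.\<close>
  have ar: "\<bar>arctan a - arctan a'\<bar> \<le> 4" for a a'
    using arctan_ubound[of a] arctan_lbound[of a] arctan_ubound[of a'] arctan_lbound[of a'] pi_less_4 by linarith
  have Ibd: "\<bar>- G * arctan (s t) - arctan (\<mu> * s t) / 12 - (- G * arctan (s 0) - arctan (\<mu> * s 0) / 12)\<bar> \<le> 4 * G + 1" for t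
  proof -
    have "\<bar>G * (arctan (s t) - arctan (s 0))\<bar> \<le> G * 4"
      unfolding abs_mult using ar by (intro mult_mono) (auto simp: G_def)
    then show ?thesis using ar[of "\<mu> * s t" "\<mu> * s 0"] by (simp add: algebra_simps)
  qed
  \<comment> \<open>The bound grows with \<open>T\<close>, but it multiplies only the error terms,
    which carry a factor \<open>e\<^sup>2\<close> and disappear for fixed \<open>T\<close>.\<close>
  have Iup: "I t / I 0 \<le> exp (4 * G + 1 + T)" if "0 \<le> t" "t \<le> T" for t
  proof -
    have "\<mu> * t \<le> 1 * T" using that mu by (intro mult_mono) auto
    moreover have "I t / I 0 = exp (- G * arctan (s t) - arctan (\<mu> * s t) / 12 + \<mu> * t / 12 - (- G * arctan (s 0) - arctan (\<mu> * s 0) / 12))"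
      by (simp add: I_def exp_diff)
    ultimately show ?thesis using Ibd[of t] that by simp
  qed
  have Ilow: "I 0 / I t \<le> exp (4 * G + 1) * exp (- (\<mu> * t / 12))" for t
  proof -
    have "I 0 / I t = exp (- G * arctan (s 0) - arctan (\<mu> * s 0) / 12 - (- G * arctan (s t) - arctan (\<mu> * s t) / 12 + \<mu> * t / 12))"
      by (simp add: I_def exp_diff)
    also have "\<dots> \<le> exp (4 * G + 1 - \<mu> * t / 12)" using Ibd[of t] by simp
    also have "\<dots> = exp (4 * G + 1) * exp (- (\<mu> * t / 12))" by (simp flip: exp_add)
    finally show ?thesis .
  qed
  have key: "\<exists>E'. (E has_real_derivative E') (at t within {0..}) \<and>
      E' - 3 * \<sigma> t / v t * E t \<le> (G / b t - (\<mu> - J t) / 12) * E t + (4 / \<nu> + 1) * ((h1 t)\<^sup>2 + (h2 t)\<^sup>2)"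
    if "t \<ge> 0" for t
  proof -
    obtain D1 where D1: "((\<lambda>s. (max 0 s)^3 / (2 * (1 + M\<^sup>2 + s\<^sup>2) * (1 + s\<^sup>2))) has_real_derivative D1) (at (s t))"
       "\<bar>D1\<bar> \<le> 7 / (2 * b t)" "s t \<le> 0 \<Longrightarrow> D1 = 0"
      using cutoff_coefficient_deriv[of M "s t"] unfolding b_def by blast
    have dd': "(dd has_real_derivative D1) (at t within {0..})"
      unfolding dd_def b_def \<sigma>_def using DERIV_chain2[OF D1(1) s'] by simp
    define A1 where "A1 = 2 * s t / b t * A t - 2 / b t * W t + P t / M * S t - \<delta> * (P t)\<^sup>2 * A t + P t * h1 t"
    define S1 where "S1 = s t / b t * S t - P t / M * A t"
    define X1 where "X1 = - \<nu> * (P t)\<^sup>2 * X t + \<nu> * M * P t * S t + P t * h2 t"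
    define c1 where "c1 = M * (D1 / P t - dd t * s t / (b t * P t))"
    define c21 where "c21 = x t * (s t / b t) * (1 - (x t)\<^sup>2) / (4 * (1 + (x t)\<^sup>2)\<^sup>2)"
    have dA: "(A has_real_derivative A1) (at t within {0..})"
      using A'[OF that] M by (simp add: A1_def S_def power2_eq_square mult.assoc)
    have dS: "(S has_real_derivative S1) (at t within {0..})"
      unfolding S_def S1_def using M by (auto intro!: derivative_eq_intros P' R' that simp: field_simps)
    have dX: "(X has_real_derivative X1) (at t within {0..})"
      unfolding X_def[abs_def] X1_def using M
      by (auto intro!: derivative_eq_intros W' R' that simp: S_def X_def field_simps power2_eq_square)
    have dc: "(c has_real_derivative c1) (at t within {0..})"
      unfolding c_def[abs_def] c1_def using P1[of t] b1[of t]
      by (auto intro!: derivative_eq_intros P' dd' simp: field_simps power2_eq_square)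
    have dx: "(x has_real_derivative x t * (s t / b t)) (at t within {0..})"
      unfolding x_def[abs_def] by (auto intro!: derivative_eq_intros P')
    have xp: "1 + (x t)\<^sup>2 > 0" by (auto intro: add_pos_nonneg)
    have dc2: "(c2 has_real_derivative c21) (at t within {0..})"
    proof -
      have 1: "((\<lambda>t. 4 * (1 + (x t)\<^sup>2)) has_real_derivative 8 * (x t * (x t * (s t / b t)))) (at t within {0..})"
        by (auto intro!: derivative_eq_intros dx)
      have 2: "x t * (s t / b t) * (4 * (1 + (x t)\<^sup>2)) - x t * (8 * (x t * (x t * (s t / b t))))
          = 4 * (x t * (s t / b t) * (1 - (x t)\<^sup>2))"
      proof -
        have "x t * r * (4 * (1 + (x t)\<^sup>2)) - x t * (8 * (x t * (x t * r))) = 4 * (x t * r * (1 - (x t)\<^sup>2))" for r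
          by (simp add: algebra_simps power2_eq_square)
        then show ?thesis .
      qed
      have 3: "4 * (1 + (x t)\<^sup>2) \<noteq> 0" using xp by simp
      have "4 * (x t * (s t / b t) * (1 - (x t)\<^sup>2)) / (4 * (1 + (x t)\<^sup>2) * (4 * (1 + (x t)\<^sup>2))) = c21"
      proof -
        have "4 * N / (4 * u * (4 * u)) = N / (4 * u\<^sup>2)" if "u \<noteq> 0" for N u :: real
          using that by (simp add: power2_eq_square)
        then show ?thesis unfolding c21_def using xp by (metis less_irrefl)
      qed
      then show ?thesis
        using DERIV_divide[OF dx 1 3] unfolding c2_def[abs_def] 2 by simp
    qed
    define E1 where "E1 = A t * A1 + S t * S1 + X t * X1 / 32 + (c1 - c21) * A t * S t + (c t - c2 t) * (A1 * S t + A t * S1)"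
    have dE: "(E has_real_derivative E1) (at t within {0..})"
      unfolding E_def[abs_def] E1_def
      by (auto intro!: derivative_eq_intros dA dS dX dc dc2 simp: field_simps)
    have "0 \<le> \<mu> - J t"
      using mu by (simp add: J_def field_simps add_pos_nonneg)
    \<comment> \<open>The choice \<open>\<theta> = \<mu> - J\<close> equals
      \<open>\<nu> s\<^sup>2 / (1 + (\<mu> s)\<^sup>2)\<close>, and the exponent 1/3 is the one for
      which \<open>\<mu>^3 = \<nu>\<close> gives this form. Because \<open>\<mu> <= 1\<close>, the
      denominator is at least \<open>1 + \<nu> s\<^sup>2\<close>. Monotonicity of
      \<open>u / (1 + u)\<close> and \<open>s\<^sup>2 <= P\<^sup>2\<close> then give the bound for
      \<open>z = \<delta>\<close> and for \<open>z = \<nu>\<close>.\<close>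
    moreover have mJ: "\<mu> - J t \<le> z * (P t)\<^sup>2 / (1 + z * (P t)\<^sup>2)" if "\<nu> \<le> z" for z
    proof -
      define a where "a = \<mu>^3 * (s t)\<^sup>2"
      have a: "0 \<le> a" using mu by (simp add: a_def)
      have az: "a \<le> z * (P t)\<^sup>2"
        unfolding a_def mu3 using that nu P2b[of t] by (intro mult_mono) (auto simp: b_def)
      have "\<mu> - J t = a / (1 + (\<mu> * s t)\<^sup>2)"
        using add_pos_nonneg[of 1 "(\<mu> * s t)\<^sup>2"]
        by (simp add: J_def a_def field_simps) (simp add: power2_eq_square power3_eq_cube)
      also have "\<dots> \<le> a / (1 + a)"
      proof (intro divide_left_mono add_left_mono)
        have "a = \<mu> * (\<mu> * s t)\<^sup>2" by (simp add: a_def power2_eq_square power3_eq_cube)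
        also have "\<dots> \<le> 1 * (\<mu> * s t)\<^sup>2" using mu by (intro mult_right_mono) auto
        finally show "a \<le> (\<mu> * s t)\<^sup>2" by simp
        show "0 < (1 + (\<mu> * s t)\<^sup>2) * (1 + a)" using a by (intro mult_pos_pos add_pos_nonneg) auto
      qed (use a in auto)
      also have "\<dots> \<le> z * (P t)\<^sup>2 / (1 + z * (P t)\<^sup>2)"
      proof -
        have "a / (1 + a) \<le> u / (1 + u)" if "a \<le> u" for u using that a by (simp add: field_simps)
        then show ?thesis using az by blast
      qed
      finally show ?thesis .
    qed
    moreover have "W t = X t - M * S t / P t" using M P1[of t] by (simp add: X_def S_def)
    ultimately have "E1 - 3 * \<sigma> t / (1 + (\<sigma> t)\<^sup>2) * E t
      \<le> (128 * (1 + M)\<^sup>2 / b t - (\<mu> - J t) / 12) * E t + (4 / \<nu> + 1) * ((h1 t)\<^sup>2 + (h2 t)\<^sup>2)"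
      using D1(2,3) nu
      by (intro mode_energy_ineq(1)[OF M nu(1,2) dM b_def[THEN meta_eq_to_obj_eq, THEN fun_cong] P1 P2b refl \<sigma>_def dd_def _ _ c_def
           c1_def x_def c2_def c21_def _ A1_def S1_def X1_def E_def E1_def]) auto
    then show ?thesis using dE unfolding v_def G_def by blast
  qed
  obtain E1 where E1: "\<And>t. t \<ge> 0 \<Longrightarrow> (E has_real_derivative E1 t) (at t within {0..})"
      "\<And>t. t \<ge> 0 \<Longrightarrow> E1 t - 3 * \<sigma> t / v t * E t \<le> (G / b t - (\<mu> - J t) / 12) * E t + (4 / \<nu> + 1) * ((h1 t)\<^sup>2 + (h2 t)\<^sup>2)"
    using key by metis
  have Ebd: "E t \<ge> 3/8 * ((A t)\<^sup>2 + (S t)\<^sup>2) + (X t)\<^sup>2 / 64" "E t \<le> 5/8 * ((A t)\<^sup>2 + (S t)\<^sup>2) + (X t)\<^sup>2 / 64" for t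
  proof -
    obtain D1 where D1: "\<bar>D1\<bar> \<le> 7 / (2 * b t)" "s t \<le> 0 \<Longrightarrow> D1 = 0"
      using cutoff_coefficient_deriv[of M "s t"] unfolding b_def by blast
    note * = M nu(1,2) dM b_def[THEN meta_eq_to_obj_eq, THEN fun_cong] P1 P2b refl \<sigma>_def dd_def D1 c_def
           refl x_def c2_def refl refl refl refl refl E_def refl order_refl
    have z: "0 \<le> \<delta> * (P t)\<^sup>2 / (1 + \<delta> * (P t)\<^sup>2)" "0 \<le> \<nu> * (P t)\<^sup>2 / (1 + \<nu> * (P t)\<^sup>2)" using nu by auto
    show "E t \<ge> 3/8 * ((A t)\<^sup>2 + (S t)\<^sup>2) + (X t)\<^sup>2 / 64" using mode_energy_ineq(2)[OF * z] .
    show "E t \<le> 5/8 * ((A t)\<^sup>2 + (S t)\<^sup>2) + (X t)\<^sup>2 / 64" using mode_energy_ineq(3)[OF * z] .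
  qed
  define y' where "y' t = (E1 t - 3 * \<sigma> t / v t * E t + (- G / b t - J t / 12 + \<mu> / 12) * E t) * (w t * I t / (w 0 * I 0))" for t
  show ?thesis
  proof (rule that[of y y'])
    fix t :: real assume t: "t \<ge> 0"
    show "(y has_real_derivative y' t) (at t within {0..})"
    proof -
      have "((\<lambda>t. w t * E t * I t / (w 0 * I 0)) has_real_derivative
          ((- (3 * \<sigma> t / v t) * w t * E t + E1 t * w t) * I t + (- G / b t - J t / 12 + \<mu> / 12) * I t * (w t * E t)) / (w 0 * I 0))
          (at t within {0..})"
        by (intro DERIV_cdivide DERIV_mult w' I' E1(1) t)
      moreover have "((- r * w t * E t + E1 t * w t) * I t + g * I t * (w t * E t)) / z = (E1 t - r * E t + g * E t) * (w t * I t / z)" for r g z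
        by (simp add: algebra_simps add_divide_distrib diff_divide_distrib)
      ultimately show ?thesis unfolding y_def[abs_def] y'_def by (rule DERIV_cong)
    qed
    have "0 \<le> 3/8 * ((A t)\<^sup>2 + (S t)\<^sup>2) + (X t)\<^sup>2 / 64" by simp
    then have y0: "0 \<le> E t" using Ebd(1)[of t] by linarith
    have S2: "(P t * R t / M)\<^sup>2 = (S t)\<^sup>2" by (simp add: S_def)
    have Fle: "F t \<le> 128 * (1 + M\<^sup>2) * E t"
    proof -
      have Wt: "W t = X t - M * S t / P t" using M P1[of t] by (simp add: X_def S_def)
      have "(W t)\<^sup>2 \<le> 2 * (X t)\<^sup>2 + 2 * (M * S t / P t)\<^sup>2"
        unfolding Wt using zero_le_power2[of "X t + M * S t / P t"] by (simp add: power2_sum power2_diff)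
      also have "(M * S t / P t)\<^sup>2 \<le> M\<^sup>2 * (S t)\<^sup>2"
      proof -
        have "(M * S t / P t)\<^sup>2 = M\<^sup>2 * (S t)\<^sup>2 / (P t)\<^sup>2" by (simp add: power_divide power_mult_distrib)
        also have "\<dots> \<le> M\<^sup>2 * (S t)\<^sup>2 / 1" using P1[of t] by (intro divide_left_mono) auto
        finally show ?thesis by simp
      qed
      finally have "(W t)\<^sup>2 \<le> 2 * (X t)\<^sup>2 + 2 * (M\<^sup>2 * (S t)\<^sup>2)" by simp
      moreover have "0 \<le> M\<^sup>2 * (A t)\<^sup>2" by simp
      ultimately have "F t \<le> (1 + 2 * M\<^sup>2) * ((A t)\<^sup>2 + (S t)\<^sup>2) + 2 * (X t)\<^sup>2"
        unfolding F_def S2 distrib_left distrib_right mult.assoc by linarith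
      also have "\<dots> \<le> 48 * (1 + M\<^sup>2) * ((A t)\<^sup>2 + (S t)\<^sup>2) + 2 * (1 + M\<^sup>2) * (X t)\<^sup>2"
        by (intro add_mono mult_right_mono) auto
      also have "\<dots> = 128 * (1 + M\<^sup>2) * (3/8 * ((A t)\<^sup>2 + (S t)\<^sup>2) + (X t)\<^sup>2 / 64)" by (simp add: algebra_simps)
      also have "\<dots> \<le> 128 * (1 + M\<^sup>2) * E t" using Ebd(1)[of t] by (intro mult_left_mono) auto
      finally show ?thesis .
    qed
    \<comment> \<open>The comparison is uniform in the frequency, although \<open>\<sigma> 0\<close>
      may be arbitrarily large: relative to its initial size the weight grows at most like
      \<open>(1 + t)\<^sup>2\<close>.\<close>
    have vv: "v t \<le> v 0 * (1 + t)\<^sup>2"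
    proof -
      have "\<sigma> t \<le> \<sigma> 0 + t" "0 \<le> \<sigma> t" "0 \<le> \<sigma> 0" using t by (auto simp: \<sigma>_def s_def)
      then have "v t \<le> 1 + (\<sigma> 0 + t)\<^sup>2" unfolding v_def by (intro add_left_mono power_mono) auto
      also have "\<dots> \<le> (1 + (\<sigma> 0)\<^sup>2) * (1 + t)\<^sup>2"
      proof -
        have "\<sigma> 0 \<le> 1 + (\<sigma> 0)\<^sup>2" using zero_le_power2[of "\<sigma> 0 - 1"] \<open>0 \<le> \<sigma> 0\<close> unfolding power2_diff by simp
        then have "2 * t * \<sigma> 0 \<le> 2 * t * (1 + (\<sigma> 0)\<^sup>2)" using t by (intro mult_left_mono) auto
        moreover have "0 \<le> (\<sigma> 0)\<^sup>2 * t\<^sup>2" by simp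
        ultimately show ?thesis unfolding power2_sum distrib_left distrib_right mult_1_left mult_1_right
          by (simp only: mult_ac one_power2)
      qed
      finally show ?thesis by (simp add: v_def)
    qed
    have sq: "(v t / v 0) powr (1/2) \<le> 1 + t"
    proof -
      have "(v t / v 0) powr (1/2) \<le> ((1 + t)\<^sup>2) powr (1/2)"
        using vv v1[of 0] v1[of t] by (intro powr_mono2) (auto simp: field_simps)
      also have "\<dots> = 1 + t" using t by (simp add: powr_half_sqrt)
      finally show ?thesis .
    qed
    have ww: "w 0 / w t = (v t / v 0) powr (3/2)"
      using v1[of 0] v1[of t] by (simp add: w_def powr_minus_divide powr_divide)
    have ww3: "w 0 / w t \<le> (1 + t)^3"
    proof -
      have "((v t / v 0) powr (1/2)) powr 3 = ((v t / v 0) powr (1/2)) ^ 3"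
        using v1[of 0] v1[of t] by (intro powr_numeral) auto
      then have "(v t / v 0) powr (3/2) = ((v t / v 0) powr (1/2)) ^ 3"
        by (simp add: powr_powr)
      also have "\<dots> \<le> (1 + t)^3" using sq by (intro power_mono) auto
      finally show ?thesis unfolding ww .
    qed
    \<comment> \<open>Of the exponent 3/2 only 1/2 is paid by time. The remaining full power is
      bounded by \<open>v t <= b t <= P\<^sup>2\<close>, which is the source of the better power of
      \<nu> for velocity and density.\<close>
    have ww1: "w 0 / w t \<le> (1 + t) * (P t)\<^sup>2"
    proof -
      have "(v t / v 0) powr (3/2) = (v t / v 0) powr (1/2 + 1)" by simp
      also have "\<dots> = (v t / v 0) powr (1/2) * (v t / v 0)"
        using v1[of 0] v1[of t] by (simp only: powr_add) simp
      also have "\<dots> \<le> (1 + t) * (P t)\<^sup>2"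
      proof (intro mult_mono sq)
        have "v t / v 0 \<le> v t / 1" using v1[of 0] v1[of t] by (intro divide_left_mono) auto
        also have "\<dots> \<le> b t" by (auto simp: v_def b_def \<sigma>_def max_def)
        finally show "v t / v 0 \<le> (P t)\<^sup>2" using P2b[of t] by simp
      qed (use t v1[of 0] v1[of t] in auto)
      finally show ?thesis unfolding ww .
    qed
    have yE: "E t = (w 0 / w t) * (I 0 / I t) * y t"
      using w0[of 0] w0[of t] I0[of 0] I0[of t] by (simp add: y_def)
    have ypos: "y t \<ge> 0" using y0 w0[of 0] w0[of t] I0[of 0] I0[of t] by (simp add: y_def)
    have Ir: "0 \<le> I 0 / I t" using I0[of 0] I0[of t] by simp
    have C0: "0 \<le> 128 * (1 + M\<^sup>2)" by simp
    have "E t \<le> (1 + t)^3 * (exp (4 * G + 1) * exp (- (\<mu> * t / 12))) * y t"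
      unfolding yE using ww3 Ilow[of t] ypos Ir t by (intro mult_right_mono mult_mono) auto
    then have "128 * (1 + M\<^sup>2) * E t \<le> 128 * (1 + M\<^sup>2) * ((1 + t)^3 * (exp (4 * G + 1) * exp (- (\<mu> * t / 12))) * y t)"
      by (rule mult_left_mono[OF _ C0])
    then show "F t \<le> 128 * (1 + M\<^sup>2) * exp (512 * (1 + M)\<^sup>2 + 1) * ((1 + t)^3 * exp (- (\<nu> powr (1/3) * t / 12)) * y t)"
      using Fle unfolding \<mu>_def G_def by (simp add: mult_ac)
    have "E t \<le> ((1 + t) * (P t)\<^sup>2) * (exp (4 * G + 1) * exp (- (\<mu> * t / 12))) * y t"
      unfolding yE using ww1 Ilow[of t] ypos Ir t by (intro mult_right_mono mult_mono) auto
    then have "128 * (1 + M\<^sup>2) * E t \<le> 128 * (1 + M\<^sup>2) * (((1 + t) * (P t)\<^sup>2) * (exp (4 * G + 1) * exp (- (\<mu> * t / 12))) * y t)"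
      by (rule mult_left_mono[OF _ C0])
    then have "F t \<le> (128 * (1 + M\<^sup>2) * exp (4 * G + 1) * ((1 + t) * exp (- (\<mu> * t / 12)) * y t)) * (P t)\<^sup>2"
      using Fle by (simp add: mult_ac)
    then have "F t / (P t)\<^sup>2 \<le> 128 * (1 + M\<^sup>2) * exp (4 * G + 1) * ((1 + t) * exp (- (\<mu> * t / 12)) * y t)"
      using P1[of t] by (simp add: pos_divide_le_eq)
    then show "F t / (P t)\<^sup>2 \<le> 128 * (1 + M\<^sup>2) * exp (512 * (1 + M)\<^sup>2 + 1) * ((1 + t) * exp (- (\<nu> powr (1/3) * t / 12)) * y t)"
      unfolding \<mu>_def G_def by (simp add: mult_ac)
  next
    fix t :: real assume t: "t \<ge> 0" "t \<le> T"
    have "E1 t - 3 * \<sigma> t / v t * E t + (- G / b t - J t / 12 + \<mu> / 12) * E t \<le> (4 / \<nu> + 1) * ((h1 t)\<^sup>2 + (h2 t)\<^sup>2)"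
      using E1(2)[OF t(1)] by (simp add: algebra_simps add_divide_distrib diff_divide_distrib)
    moreover have q0: "0 \<le> w t * I t / (w 0 * I 0)" using w0[of 0] w0[of t] I0[of 0] I0[of t] by simp
    ultimately have "y' t \<le> (4 / \<nu> + 1) * ((h1 t)\<^sup>2 + (h2 t)\<^sup>2) * (w t * I t / (w 0 * I 0))"
      unfolding y'_def by (intro mult_right_mono)
    also have "\<dots> \<le> (4 / \<nu> + 1) * ((h1 t)\<^sup>2 + (h2 t)\<^sup>2) * exp (4 * G + 1 + T)"
    proof (rule mult_left_mono)
      have "w t * I t / (w 0 * I 0) = (w t / w 0) * (I t / I 0)" by simp
      also have "\<dots> \<le> 1 * exp (4 * G + 1 + T)"
        using wmono[OF t(1)] w0[of 0] Iup[OF t] I0[of 0] I0[of t] by (intro mult_mono) (auto simp: less_imp_le)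
      finally show "w t * I t / (w 0 * I 0) \<le> exp (4 * G + 1 + T)" by simp
    qed (use nu in simp)
    finally show "y' t \<le> (4 / \<nu> + 1) * exp (512 * (1 + M)\<^sup>2 + 1 + T) * ((h1 t)\<^sup>2 + (h2 t)\<^sup>2)"
      unfolding G_def by (simp add: mult_ac)
  next
    have "y 0 = E 0" using w0[of 0] I0[of 0] by (simp add: y_def)
    also have "\<dots> \<le> 5/8 * ((A 0)\<^sup>2 + (S 0)\<^sup>2) + (X 0)\<^sup>2 / 64" by (rule Ebd)
    also have "(X 0)\<^sup>2 \<le> 2 * (W 0)\<^sup>2 + 2 * M\<^sup>2 * (S 0)\<^sup>2"
    proof -
      have "X 0 = W 0 + M * S 0 / P 0" using M P1[of 0] by (simp add: X_def S_def)
      then have "(X 0)\<^sup>2 \<le> 2 * (W 0)\<^sup>2 + 2 * (M * S 0 / P 0)\<^sup>2"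
        using zero_le_power2[of "W 0 - M * S 0 / P 0"] by (simp add: power2_sum power2_diff)
      also have "(M * S 0 / P 0)\<^sup>2 \<le> M\<^sup>2 * (S 0)\<^sup>2"
      proof -
        have "(M * S 0 / P 0)\<^sup>2 = M\<^sup>2 * (S 0)\<^sup>2 / (P 0)\<^sup>2" by (simp add: power_divide power_mult_distrib)
        also have "\<dots> \<le> M\<^sup>2 * (S 0)\<^sup>2 / 1" using P1[of 0] by (intro divide_left_mono) auto
        finally show ?thesis by simp
      qed
      finally show ?thesis by simp
    qed
    also have "5/8 * ((A 0)\<^sup>2 + (S 0)\<^sup>2) + (2 * (W 0)\<^sup>2 + 2 * M\<^sup>2 * (S 0)\<^sup>2) / 64 \<le> (1 + M\<^sup>2) * F 0"
    proof -
      have "0 \<le> M\<^sup>2 * (A 0)\<^sup>2" "0 \<le> M\<^sup>2 * (S 0)\<^sup>2" "0 \<le> M\<^sup>2 * (W 0)\<^sup>2" "0 \<le> (A 0)\<^sup>2" "0 \<le> (S 0)\<^sup>2" "0 \<le> (W 0)\<^sup>2" by simp_all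
      then show ?thesis unfolding F_def S_def[symmetric] distrib_left distrib_right add_divide_distrib by linarith
    qed
    finally show "y 0 \<le> (1 + M\<^sup>2) * F 0" by simp
  qed
qed

section \<open>The space \<open>L\<^sup>2\<close> of the cylinder\<close>

lemma square_integrable_mult:
  fixes f g :: "'a \<Rightarrow> real"
  assumes [measurable]: "f \<in> borel_measurable M" "g \<in> borel_measurable M"
    and "integrable M (\<lambda>z. (f z)\<^sup>2)" "integrable M (\<lambda>z. (g z)\<^sup>2)"
  shows "integrable M (\<lambda>z. f z * g z)"
proof (rule Bochner_Integration.integrable_bound)
  show "integrable M (\<lambda>z. (f z)\<^sup>2 + (g z)\<^sup>2)" using assms by simp
  show "AE z in M. norm (f z * g z) \<le> norm ((f z)\<^sup>2 + (g z)\<^sup>2)"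
  proof (intro AE_I2)
    fix z
    have "2 * \<bar>f z\<bar> * \<bar>g z\<bar> \<le> (f z)\<^sup>2 + (g z)\<^sup>2"
      using zero_le_power2[of "\<bar>f z\<bar> - \<bar>g z\<bar>"] unfolding power2_diff by simp
    moreover have "0 \<le> \<bar>f z\<bar> * \<bar>g z\<bar>" by simp
    ultimately show "norm (f z * g z) \<le> norm ((f z)\<^sup>2 + (g z)\<^sup>2)"
      unfolding real_norm_def abs_mult by linarith
  qed
qed simp

lemma nonneg_quadratic_imp_discriminant:
  fixes a b c :: real
  assumes "\<And>t. 0 \<le> a * t\<^sup>2 + 2 * b * t + c" "a \<ge> 0"
  shows "b\<^sup>2 \<le> a * c"
proof (cases "a = 0")
  case True
  have "b = 0"
  proof (rule ccontr)
    assume "b \<noteq> 0"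
    then show False using assms(1)[of "- (c + 1) / (2 * b)"] True by (simp add: field_simps)
  qed
  then show ?thesis using True by simp
next
  case False
  have "a * (- b / a)\<^sup>2 + 2 * b * (- b / a) + c = c - b\<^sup>2 / a"
    using False by (simp add: power2_eq_square)
  then have "b\<^sup>2 / a \<le> c" using assms(1)[of "- b / a"] by simp
  then show ?thesis using False assms(2) by (simp add: field_simps)
qed

lemma Cauchy_Schwarz_integral:
  fixes f g :: "'a \<Rightarrow> real"
  assumes "f \<in> borel_measurable M" "g \<in> borel_measurable M"
    and "integrable M (\<lambda>z. (f z)\<^sup>2)" "integrable M (\<lambda>z. (g z)\<^sup>2)"
  shows "(\<integral>z. f z * g z \<partial>M)\<^sup>2 \<le> (\<integral>z. (f z)\<^sup>2 \<partial>M) * (\<integral>z. (g z)\<^sup>2 \<partial>M)"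
proof (rule nonneg_quadratic_imp_discriminant)
  fix t :: real
  note i = square_integrable_mult[OF assms]
  have "0 \<le> (\<integral>z. (t * f z + g z)\<^sup>2 \<partial>M)" by simp
  also have "\<dots> = (\<integral>z. t\<^sup>2 * (f z)\<^sup>2 + 2 * t * (f z * g z) + (g z)\<^sup>2 \<partial>M)"
    by (intro Bochner_Integration.integral_cong) (auto simp: power2_eq_square algebra_simps)
  also have "\<dots> = (\<integral>z. (f z)\<^sup>2 \<partial>M) * t\<^sup>2 + 2 * (\<integral>z. f z * g z \<partial>M) * t + (\<integral>z. (g z)\<^sup>2 \<partial>M)"
    using assms i by simp
  finally show "0 \<le> (\<integral>z. (f z)\<^sup>2 \<partial>M) * t\<^sup>2 + 2 * (\<integral>z. f z * g z \<partial>M) * t + (\<integral>z. (g z)\<^sup>2 \<partial>M)" .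
qed simp

section \<open>The measures \<open>torus\<close> and \<open>cyl\<close> and the calculus of
  \<open>pairing\<close> and \<open>L2norm\<close>\<close>

lemma space_torus: "space torus = {0..<2 * pi}"
  by (simp add: torus_def space_restrict_space)

lemma sets_torus: "sets torus = sets (restrict_space borel {0..<2 * pi})"
  unfolding torus_def by (intro sets_restrict_space_cong) simp

lemma emeasure_torus: "emeasure torus (space torus) = ennreal (2 * pi)"
  unfolding space_torus unfolding torus_def by (subst emeasure_restrict_space) auto

interpretation torus: finite_measure torus
  by (rule finite_measureI) (simp add: emeasure_torus)

lemma measure_torus: "measure torus (space torus) = 2 * pi"
  by (simp add: measure_def emeasure_torus)

interpretation cyl: pair_sigma_finite torus lborel ..

lemma space_cyl: "space cyl = {0..<2 * pi} \<times> UNIV"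
  by (simp add: cyl_def space_pair_measure space_torus)

lemma measurable_torus_borel: "f \<in> borel_measurable borel \<Longrightarrow> f \<in> borel_measurable torus"
  using measurable_restrict_space1[of f borel borel] sets_torus by (metis measurable_cong_sets)

lemma measurable_cyl_borel:
  fixes f :: "real \<times> real \<Rightarrow> 'a::topological_space"
  assumes "f \<in> borel_measurable borel" shows "f \<in> borel_measurable cyl"
proof -
  have "(\<lambda>x. x) \<in> measurable torus borel" by (rule measurable_torus_borel) simp
  then have "(\<lambda>z. (fst z, snd z)) \<in> measurable cyl (borel \<Otimes>\<^sub>M borel)"
    unfolding cyl_def by (intro measurable_Pair measurable_compose[OF measurable_fst] measurable_snd) auto
  then have "(\<lambda>z. z) \<in> measurable cyl borel" by (simp add: borel_prod)
  from measurable_compose[OF this assms] show ?thesis by simp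
qed

lemma measurable_cyl_continuous:
  fixes f :: "real \<times> real \<Rightarrow> 'a::topological_space"
  shows "continuous_on UNIV f \<Longrightarrow> f \<in> borel_measurable cyl"
  by (intro measurable_cyl_borel borel_measurable_continuous_onI)

lemma L2D: "L2 f \<Longrightarrow> f \<in> borel_measurable cyl" "L2 f \<Longrightarrow> integrable cyl (\<lambda>z. (f z)\<^sup>2)"
  by (auto simp: L2_def)

lemma L2_bound:
  assumes "L2 g" "f \<in> borel_measurable cyl" "\<And>z. z \<in> space cyl \<Longrightarrow> \<bar>f z\<bar> \<le> \<bar>g z\<bar>"
  shows "L2 f"
  unfolding L2_def
proof
  show "integrable cyl (\<lambda>z. (f z)\<^sup>2)"
  proof (rule Bochner_Integration.integrable_bound[OF L2D(2)[OF assms(1)]])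
    show "AE z in cyl. norm ((f z)\<^sup>2) \<le> norm ((g z)\<^sup>2)"
      using assms(3) by (intro AE_I2) (simp add: abs_le_square_iff)
  qed (use assms in simp)
qed fact

lemma L2_scale: assumes "L2 f" shows "L2 (\<lambda>z. c * f z)"
  using assms unfolding L2_def by (auto simp: power_mult_distrib)

lemma L2_uminus: "L2 f \<Longrightarrow> L2 (\<lambda>z. - f z)"
  using L2_scale[of f "-1"] by simp

lemma L2_integrable_mult: "L2 f \<Longrightarrow> L2 g \<Longrightarrow> integrable cyl (\<lambda>z. f z * g z)"
  unfolding L2_def by (intro square_integrable_mult) auto

lemma L2_add: assumes "L2 f" "L2 g" shows "L2 (\<lambda>z. f z + g z)"
proof -
  have "(\<lambda>z. (f z + g z)\<^sup>2) = (\<lambda>z. (f z)\<^sup>2 + 2 * (f z * g z) + (g z)\<^sup>2)"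
    by (auto simp: power2_eq_square algebra_simps)
  then have "integrable cyl (\<lambda>z. (f z + g z)\<^sup>2)" using assms L2_integrable_mult[OF assms] unfolding L2_def by simp
  then show ?thesis using assms unfolding L2_def by auto
qed

lemma L2_diff: "L2 f \<Longrightarrow> L2 g \<Longrightarrow> L2 (\<lambda>z. f z - g z)"
  using L2_add[OF _ L2_uminus] by simp

lemma L2_sum: "finite I \<Longrightarrow> (\<And>i. i \<in> I \<Longrightarrow> L2 (f i)) \<Longrightarrow> L2 (\<lambda>z. \<Sum>i\<in>I. f i z)"
proof (induction I rule: finite_induct)
  case empty show ?case by (simp add: L2_def)
qed (simp add: L2_add)

lemma L2_mult_bounded:
  assumes "L2 f" "h \<in> borel_measurable cyl" "\<And>z. z \<in> space cyl \<Longrightarrow> \<bar>h z\<bar> \<le> C"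
  shows "L2 (\<lambda>z. f z * h z)"
proof (rule L2_bound)
  show "L2 (\<lambda>z. \<bar>C\<bar> * f z)" using assms by (intro L2_scale)
  show "(\<lambda>z. f z * h z) \<in> borel_measurable cyl" using assms L2D(1)[OF assms(1)] by measurable
  fix z assume "z \<in> space cyl"
  from assms(3)[OF this] have "\<bar>h z\<bar> \<le> \<bar>C\<bar>" by simp
  then show "\<bar>f z * h z\<bar> \<le> \<bar>\<bar>C\<bar> * f z\<bar>" by (simp add: abs_mult mult.commute[of "\<bar>f z\<bar>"] mult_right_mono)
qed

lemma L2norm_sq: "(L2norm f)\<^sup>2 = (\<integral>z. (f z)\<^sup>2 \<partial>cyl)"
  by (simp add: L2norm_def)

lemma L2norm_nonneg [simp]: "0 \<le> L2norm f" by (simp add: L2norm_def)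

lemma L2norm2_sq: "L2 f \<Longrightarrow> L2 g \<Longrightarrow> (L2norm2 f g)\<^sup>2 = (L2norm f)\<^sup>2 + (L2norm g)\<^sup>2"
  by (simp add: L2norm_sq) (simp add: L2norm2_def L2_def)

lemma L2norm2_nonneg [simp]: "0 \<le> L2norm2 f g" by (simp add: L2norm2_def)

lemma pairing_self: "pairing f f = (L2norm f)\<^sup>2"
  unfolding L2norm_sq pairing_def by (simp add: power2_eq_square)

lemma pairing_le: assumes "L2 f" "L2 g" shows "\<bar>pairing f g\<bar> \<le> L2norm f * L2norm g"
proof -
  have "(pairing f g)\<^sup>2 \<le> (L2norm f * L2norm g)\<^sup>2"
    using assms unfolding pairing_def power_mult_distrib L2norm_sq L2_def
    by (intro Cauchy_Schwarz_integral) auto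
  then show ?thesis by (metis L2norm_nonneg abs_le_square_iff abs_of_nonneg mult_nonneg_nonneg)
qed

lemma pairing_commute: "pairing f g = pairing g f"
  by (simp add: pairing_def mult.commute)

lemma pairing_add_left: "L2 f \<Longrightarrow> L2 g \<Longrightarrow> L2 h \<Longrightarrow> pairing (\<lambda>z. f z + g z) h = pairing f h + pairing g h"
  unfolding pairing_def distrib_right by (intro Bochner_Integration.integral_add L2_integrable_mult)

lemma pairing_diff_left: "L2 f \<Longrightarrow> L2 g \<Longrightarrow> L2 h \<Longrightarrow> pairing (\<lambda>z. f z - g z) h = pairing f h - pairing g h"
  unfolding pairing_def left_diff_distrib by (intro Bochner_Integration.integral_diff L2_integrable_mult)

lemma pairing_scale_left: "pairing (\<lambda>z. c * f z) h = c * pairing f h"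
  unfolding pairing_def by (simp add: mult.assoc)

lemma pairing_add_right: "L2 f \<Longrightarrow> L2 g \<Longrightarrow> L2 h \<Longrightarrow> pairing h (\<lambda>z. f z + g z) = pairing h f + pairing h g"
  using pairing_add_left by (simp add: pairing_commute)

lemma pairing_diff_right: "L2 f \<Longrightarrow> L2 g \<Longrightarrow> L2 h \<Longrightarrow> pairing h (\<lambda>z. f z - g z) = pairing h f - pairing h g"
  using pairing_diff_left by (simp add: pairing_commute)

lemma pairing_scale_right: "pairing h (\<lambda>z. c * f z) = c * pairing h f"
  using pairing_scale_left by (simp add: pairing_commute)

lemma pairing_cong_AE:
  assumes "f \<in> borel_measurable cyl" "f' \<in> borel_measurable cyl" "g \<in> borel_measurable cyl" "AE z in cyl. f z = f' z"
  shows "pairing f g = pairing f' g"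
  unfolding pairing_def using assms by (intro integral_cong_AE) auto

lemma L2norm_scale: "L2norm (\<lambda>z. c * f z) = \<bar>c\<bar> * L2norm f"
  by (simp add: L2norm_def power_mult_distrib real_sqrt_mult)

lemma L2norm_minus_commute: "L2norm (\<lambda>z. f z - g z) = L2norm (\<lambda>z. g z - f z)"
  by (simp add: L2norm_def power2_commute)

lemma L2norm_triangle: assumes "L2 f" "L2 g" shows "L2norm (\<lambda>z. f z + g z) \<le> L2norm f + L2norm g"
proof -
  have "(L2norm (\<lambda>z. f z + g z))\<^sup>2 = (\<integral>z. (f z)\<^sup>2 + 2 * (f z * g z) + (g z)\<^sup>2 \<partial>cyl)"
    unfolding L2norm_sq by (intro Bochner_Integration.integral_cong) (auto simp: power2_eq_square algebra_simps)
  also have "\<dots> = (L2norm f)\<^sup>2 + 2 * pairing f g + (L2norm g)\<^sup>2"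
    using assms L2_integrable_mult[OF assms] unfolding L2norm_sq pairing_def L2_def by simp
  also have "\<dots> \<le> (L2norm f + L2norm g)\<^sup>2"
    using pairing_le[OF assms] unfolding power2_sum by linarith
  finally show ?thesis by (rule power2_le_imp_le) simp
qed

lemma L2norm_triangle_diff: assumes "L2 f" "L2 g" shows "L2norm f \<le> L2norm g + L2norm (\<lambda>z. f z - g z)"
  using L2norm_triangle[OF assms(2) L2_diff[OF assms]] by simp

lemma L2norm_mono:
  assumes "L2 g" "f \<in> borel_measurable cyl" "\<And>z. z \<in> space cyl \<Longrightarrow> \<bar>f z\<bar> \<le> \<bar>g z\<bar>"
  shows "L2norm f \<le> L2norm g"
  unfolding L2norm_def using assms L2_bound[OF assms]
  by (intro real_sqrt_le_mono integral_mono) (auto simp: L2_def abs_le_square_iff)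

lemma nn_integral_L2: "L2 f \<Longrightarrow> (\<integral>\<^sup>+z. ennreal ((f z)\<^sup>2) \<partial>cyl) = ennreal ((L2norm f)\<^sup>2)"
  unfolding L2norm_sq L2_def by (intro nn_integral_eq_integral) auto

lemma L2_nn_integralI:
  assumes "f \<in> borel_measurable cyl" "(\<integral>\<^sup>+z. ennreal ((f z)\<^sup>2) \<partial>cyl) \<le> ennreal C" "C \<ge> 0"
  shows "L2 f" "(L2norm f)\<^sup>2 \<le> C"
proof -
  have [measurable]: "f \<in> borel_measurable cyl" by fact
  have "(\<integral>\<^sup>+z. ennreal ((f z)\<^sup>2) \<partial>cyl) < \<infinity>" using assms(2) by (rule order_le_less_trans) simp
  then show L: "L2 f" unfolding L2_def by (auto intro!: integrableI_nonneg)
  show "(L2norm f)\<^sup>2 \<le> C" using assms(2,3) unfolding nn_integral_L2[OF L] by simp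
qed

lemma L2norm_sum_le:
  fixes n :: nat
  assumes "\<And>i. i < n \<Longrightarrow> L2 (f i)"
  shows "L2norm (\<lambda>z. \<Sum>i<n. f i z) \<le> (\<Sum>i<n. L2norm (f i))"
  using assms
proof (induct n)
  case 0 then show ?case by (simp add: L2norm_def)
next
  case (Suc n)
  have "L2norm (\<lambda>z. (\<Sum>i<n. f i z) + f n z) \<le> L2norm (\<lambda>z. \<Sum>i<n. f i z) + L2norm (f n)"
    using Suc(2) by (intro L2norm_triangle L2_sum) auto
  then show ?case using Suc by fastforce
qed

lemma L2norm_abs: "L2norm (\<lambda>z. \<bar>f z\<bar>) = L2norm f" by (simp add: L2norm_def)

lemma L2_abs: "L2 f \<Longrightarrow> L2 (\<lambda>z. \<bar>f z\<bar>)" by (auto simp: L2_def)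

text \<open>The partial sums of the absolute increments have norm at most 2, the sum of the
  geometric series. By monotone convergence their supremum is finite almost everywhere, and there
  the telescoping series converges absolutely.\<close>

lemma L2_fast_Cauchy_convergent:
  assumes f: "\<And>n. L2 (f n)" and c: "\<And>n. L2norm (\<lambda>z. f (Suc n) z - f n z) \<le> (1/2)^n"
  shows "AE z in cyl. convergent (\<lambda>n. f n z)"
proof -
  note [measurable] = L2D(1)[OF f]
  define g where "g N z = (\<Sum>n<N. \<bar>f (Suc n) z - f n z\<bar>)" for N z
  have g2: "L2 (g N)" for N unfolding g_def by (intro L2_sum L2_abs L2_diff f) auto
  have gN: "L2norm (g N) \<le> 2" for N
  proof -
    have "L2norm (g N) \<le> (\<Sum>n<N. L2norm (\<lambda>z. \<bar>f (Suc n) z - f n z\<bar>))"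
      unfolding g_def by (intro L2norm_sum_le L2_abs L2_diff f)
    also have "\<dots> \<le> (\<Sum>n<N. (1/2)^n)" unfolding L2norm_abs by (intro sum_mono c)
    also have "\<dots> \<le> 2" using geometric_sum[of "1/2::real" N] by simp
    finally show ?thesis .
  qed
  have inc: "incseq (\<lambda>N z. ennreal ((g N z)\<^sup>2))"
    unfolding incseq_Suc_iff le_fun_def
    by (auto simp: g_def intro!: ennreal_leI power_mono sum_nonneg)
  have "(\<integral>\<^sup>+z. (SUP N. ennreal ((g N z)\<^sup>2)) \<partial>cyl) = (SUP N. \<integral>\<^sup>+z. ennreal ((g N z)\<^sup>2) \<partial>cyl)"
    using inc by (intro nn_integral_monotone_convergence_SUP) (auto simp: g_def)
  also have "\<dots> \<le> ennreal 4"
  proof (rule SUP_least)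
    fix N show "(\<integral>\<^sup>+z. ennreal ((g N z)\<^sup>2) \<partial>cyl) \<le> ennreal 4"
      unfolding nn_integral_L2[OF g2] using power_mono[OF gN[of N], of 2] by (intro ennreal_leI) simp
  qed
  finally have "(\<integral>\<^sup>+z. (SUP N. ennreal ((g N z)\<^sup>2)) \<partial>cyl) \<noteq> \<infinity>"
    by (metis ennreal_neq_top infinity_ennreal_def neq_top_trans)
  then have "AE z in cyl. (SUP N. ennreal ((g N z)\<^sup>2)) \<noteq> \<infinity>"
    by (intro nn_integral_PInf_AE) (auto simp: g_def)
  then show ?thesis
  proof eventually_elim
    case (elim z)
    then obtain B where B: "(SUP N. ennreal ((g N z)\<^sup>2)) = ennreal B" "B \<ge> 0"
      by (cases "(SUP N. ennreal ((g N z)\<^sup>2))") auto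
    have "g N z \<le> sqrt B" for N
    proof -
      have "ennreal ((g N z)\<^sup>2) \<le> ennreal B" unfolding B(1)[symmetric] by (rule SUP_upper) simp
      then have "(g N z)\<^sup>2 \<le> B" using B(2) by simp
      then show ?thesis by (rule real_le_rsqrt)
    qed
    then have "summable (\<lambda>n. \<bar>f (Suc n) z - f n z\<bar>)"
      unfolding g_def by (intro bounded_imp_summable[of _ "sqrt B"]) (auto simp: lessThan_Suc_atMost[symmetric] simp del: sum.lessThan_Suc)
    then have "summable (\<lambda>n. f (Suc n) z - f n z)" by (rule summable_rabs_cancel)
    then have "convergent (\<lambda>n. \<Sum>i<n. f (Suc i) z - f i z)" by (simp add: summable_iff_convergent)
    then have "convergent (\<lambda>n. f n z - f 0 z)" unfolding sum_lessThan_telescope[of "\<lambda>i. f i z"] .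
    then have "convergent (\<lambda>n. (f n z - f 0 z) + f 0 z)"
      by (intro convergent_add convergent_const)
    then show ?case by simp
  qed
qed

text \<open>The Riesz-Fischer theorem for representatives. The limit is taken pointwise along a fast
  subsequence, and Fatou's lemma compares every late member of the whole sequence with it.\<close>

lemma L2_complete:
  assumes f: "\<And>n. L2 (f n)"
    and c: "\<And>e. e > 0 \<Longrightarrow> \<exists>N. \<forall>m\<ge>N. \<forall>n\<ge>N. L2norm (\<lambda>z. f m z - f n z) \<le> e"
  obtains F where "L2 F" "(\<lambda>n. L2norm (\<lambda>z. f n z - F z)) \<longlonglongrightarrow> 0"
proof -
  note [measurable] = L2D(1)[OF f]
  have "\<forall>j. \<exists>N. \<forall>m\<ge>N. \<forall>n\<ge>N. L2norm (\<lambda>z. f m z - f n z) \<le> (1/2)^j" using c by simp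
  then obtain N where N: "\<And>j m n. m \<ge> N j \<Longrightarrow> n \<ge> N j \<Longrightarrow> L2norm (\<lambda>z. f m z - f n z) \<le> (1/2)^j" by metis
  \<comment> \<open>Cumulative sums make the subsequence monotone while keeping
    \<open>r j >= N j\<close>, so consecutive members differ by at most
    \<open>(1/2)^j\<close>.\<close>
  define r where "r j = (\<Sum>i\<le>j. N i)" for j
  have rN: "r j \<ge> N j" for j unfolding r_def by (simp add: member_le_sum)
  have rS: "r (Suc j) \<ge> r j" for j by (simp add: r_def)
  have A: "AE z in cyl. convergent (\<lambda>n. f (r n) z)"
    by (rule L2_fast_Cauchy_convergent) (use f N order_trans[OF rN rS] rN in auto)
  \<comment> \<open>Where the subsequence diverges, \<open>lim\<close> returns an arbitrary number;
    this concerns a null set only, and \<open>F\<close> stays measurable.\<close>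
  define F where "F z = lim (\<lambda>n. f (r n) z)" for z
  have Fm [measurable]: "F \<in> borel_measurable cyl" unfolding F_def by measurable
  have est: "(\<integral>\<^sup>+z. ennreal ((f m z - F z)\<^sup>2) \<partial>cyl) \<le> ennreal (((1/2)^j)\<^sup>2)"
    if m: "m \<ge> N j" for m j
  proof -
    have "(\<integral>\<^sup>+z. ennreal ((f m z - F z)\<^sup>2) \<partial>cyl) = (\<integral>\<^sup>+z. liminf (\<lambda>n. ennreal ((f m z - f (r n) z)\<^sup>2)) \<partial>cyl)"
    proof (rule nn_integral_cong_AE)
      show "AE z in cyl. ennreal ((f m z - F z)\<^sup>2) = liminf (\<lambda>n. ennreal ((f m z - f (r n) z)\<^sup>2))"
        using A
      proof eventually_elim
        case (elim z)
        then have "(\<lambda>n. f (r n) z) \<longlonglongrightarrow> F z" unfolding F_def by (simp add: convergent_LIMSEQ_iff)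
        then have "(\<lambda>n. ennreal ((f m z - f (r n) z)\<^sup>2)) \<longlonglongrightarrow> ennreal ((f m z - F z)\<^sup>2)"
          by (intro tendsto_ennrealI tendsto_intros)
        from lim_imp_Liminf[OF _ this] show ?case by simp
      qed
    qed
    also have "\<dots> \<le> liminf (\<lambda>n. \<integral>\<^sup>+z. ennreal ((f m z - f (r n) z)\<^sup>2) \<partial>cyl)"
      by (rule nn_integral_liminf) measurable
    also have "\<dots> \<le> ennreal (((1/2)^j)\<^sup>2)"
    proof (rule Liminf_le)
      show "\<forall>\<^sub>F n in sequentially. (\<integral>\<^sup>+z. ennreal ((f m z - f (r n) z)\<^sup>2) \<partial>cyl) \<le> ennreal (((1/2)^j)\<^sup>2)"
        using eventually_ge_at_top[of j]
      proof eventually_elim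
        case (elim n)
        have "N j \<le> r j" by (rule rN)
        also have "r j \<le> r n" using elim rS by (rule lift_Suc_mono_le[of r, rotated])
        finally have "L2norm (\<lambda>z. f m z - f (r n) z) \<le> (1/2)^j" using N m by blast
        then show ?case unfolding nn_integral_L2[OF L2_diff[OF f f]]
          by (intro ennreal_leI power_mono) auto
      qed
    qed simp
    finally show ?thesis .
  qed
  have d: "L2 (\<lambda>z. f m z - F z)" "L2norm (\<lambda>z. f m z - F z) \<le> (1/2)^j" if "m \<ge> N j" for m j
  proof -
    have m1: "(\<lambda>z. f m z - F z) \<in> borel_measurable cyl" by measurable
    note * = L2_nn_integralI[OF m1 est[OF that]]
    show "L2 (\<lambda>z. f m z - F z)" by (rule *) simp
    have "(L2norm (\<lambda>z. f m z - F z))\<^sup>2 \<le> ((1/2)^j)\<^sup>2" by (rule *) simp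
    then show "L2norm (\<lambda>z. f m z - F z) \<le> (1/2)^j" by (rule power2_le_imp_le) simp
  qed
  show thesis
  proof
    show "L2 F" using L2_diff[OF f d(1)[OF order_refl], of "N 0" 0] by simp
    show "(\<lambda>n. L2norm (\<lambda>z. f n z - F z)) \<longlonglongrightarrow> 0"
    proof (rule LIMSEQ_I)
      fix e :: real assume "e > 0"
      then obtain j where j: "(1/2)^j < e" using real_arch_pow_inv[of e "1/2"] by auto
      show "\<exists>no. \<forall>n\<ge>no. norm (L2norm (\<lambda>z. f n z - F z) - 0) < e"
        using d(2)[of j] j by (intro exI[of _ "N j"]) fastforce
    qed
  qed
qed

lemma pairing_tendsto:
  assumes "\<And>n. L2 (f n)" "L2 F" "L2 g" "((\<lambda>n. L2norm (\<lambda>z. f n z - F z)) \<longlongrightarrow> 0) net"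
  shows "((\<lambda>n. pairing (f n) g) \<longlongrightarrow> pairing F g) net"
proof -
  have 1: "((\<lambda>n. L2norm (\<lambda>z. f n z - F z) * L2norm g) \<longlongrightarrow> 0) net"
    using tendsto_mult_right[OF assms(4), of "L2norm g"] by simp
  have "norm (pairing (f n) g - pairing F g) \<le> L2norm (\<lambda>z. f n z - F z) * L2norm g" for n
    using pairing_le[OF L2_diff[OF assms(1,2)] assms(3)] pairing_diff_left[OF assms(1,2,3)] by simp
  then have "((\<lambda>n. pairing (f n) g - pairing F g) \<longlongrightarrow> 0) net"
    by (intro Lim_null_comparison[OF _ 1] always_eventually allI)
  then show ?thesis by (rule Lim_null[THEN iffD2])
qed

lemma L2norm_tendsto:
  assumes "\<And>n. L2 (f n)" "L2 F" "((\<lambda>n. L2norm (\<lambda>z. f n z - F z)) \<longlongrightarrow> 0) net"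
  shows "((\<lambda>n. L2norm (f n)) \<longlongrightarrow> L2norm F) net"
proof -
  have "((\<lambda>n. L2norm (f n) - L2norm F) \<longlongrightarrow> 0) net"
  proof (rule Lim_null_comparison[OF always_eventually assms(3)], intro allI)
    fix n
    show "norm (L2norm (f n) - L2norm F) \<le> L2norm (\<lambda>z. f n z - F z)"
      using L2norm_triangle_diff[OF assms(1,2), of n] L2norm_triangle_diff[OF assms(2,1), of n]
        L2norm_minus_commute[of F "f n"] by (simp add: abs_le_iff)
  qed
  then show ?thesis by (rule Lim_null[THEN iffD2])
qed

section \<open>Fubini's theorem and the average in x\<close>

lemma integral_cyl_iterated:
  fixes f :: "real \<times> real \<Rightarrow> real"
  assumes "integrable cyl f"
  shows "(\<integral>z. f z \<partial>cyl) = (\<integral>y. (\<integral>x. f (x, y) \<partial>torus) \<partial>lborel)"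
    "(\<integral>z. f z \<partial>cyl) = (\<integral>x. (\<integral>y. f (x, y) \<partial>lborel) \<partial>torus)"
  using cyl.integral_snd[of "\<lambda>x y. f (x, y)"] cyl.integral_fst'[of f] assms by (simp_all add: cyl_def split_beta')

lemma nn_integral_cyl_iterated:
  assumes "f \<in> borel_measurable cyl"
  shows "(\<integral>\<^sup>+z. f z \<partial>cyl) = (\<integral>\<^sup>+y. (\<integral>\<^sup>+x. f (x, y) \<partial>torus) \<partial>lborel)"
  using cyl.nn_integral_snd[of f] assms by (simp add: cyl_def)

lemma measurable_section:
  "f \<in> borel_measurable cyl \<Longrightarrow> (\<lambda>x. f (x, y)) \<in> borel_measurable torus"
  unfolding cyl_def by (rule measurable_compose[OF measurable_Pair2']) simp_all

lemma L2_section_integrable: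
  assumes "L2 f" shows "AE y in lborel. integrable torus (\<lambda>x. (f (x, y))\<^sup>2)"
  using cyl.AE_integrable_snd[of "\<lambda>x y. (f (x, y))\<^sup>2"] L2D(2)[OF assms] by (simp add: cyl_def split_beta')

lemma xavg_measurable:
  assumes "f \<in> borel_measurable cyl" shows "xavg f \<in> borel_measurable cyl"
proof -
  have "(\<lambda>y. \<integral>s. f (s, y) \<partial>torus) \<in> borel_measurable lborel"
    using assms unfolding cyl_def by (intro torus.borel_measurable_lebesgue_integral measurable_compose[OF measurable_pair_swap']) (auto simp: split_beta')
  then show ?thesis unfolding xavg_def cyl_def by (simp add: split_beta') measurable
qed

text \<open>Jensen's inequality on every circle, in the form of Cauchy-Schwarz against the constant
  1. Circles on which the function is not square integrable occur for a null set of \<open>y\<close>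
  only.\<close>

lemma xavg_L2:
  assumes "L2 f" shows "L2 (xavg f)" "L2norm (xavg f) \<le> L2norm f"
proof -
  note fm = L2D(1)[OF assms]
  have "(\<integral>\<^sup>+z. ennreal ((xavg f z)\<^sup>2) \<partial>cyl) = (\<integral>\<^sup>+y. (\<integral>\<^sup>+x. ennreal ((xavg f (x, y))\<^sup>2) \<partial>torus) \<partial>lborel)"
    using xavg_measurable[OF fm] by (intro nn_integral_cyl_iterated) auto
  also have "\<dots> \<le> (\<integral>\<^sup>+y. (\<integral>\<^sup>+x. ennreal ((f (x, y))\<^sup>2) \<partial>torus) \<partial>lborel)"
  proof (rule nn_integral_mono_AE, use L2_section_integrable[OF assms] in eventually_elim)
    case (elim y)
    have m: "(\<lambda>x. f (x, y)) \<in> borel_measurable torus" using fm by (rule measurable_section)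
    have "(\<integral>s. f (s, y) * 1 \<partial>torus)\<^sup>2 \<le> (\<integral>s. (f (s, y))\<^sup>2 \<partial>torus) * (\<integral>s. 1\<^sup>2 \<partial>torus)"
      using m elim by (intro Cauchy_Schwarz_integral) auto
    then have "2 * pi * (1 / (2 * pi) * (\<integral>s. f (s, y) \<partial>torus))\<^sup>2 \<le> (\<integral>s. (f (s, y))\<^sup>2 \<partial>torus)"
      by (simp add: measure_torus field_simps power2_eq_square)
    then have "ennreal (2 * pi * (1 / (2 * pi) * (\<integral>s. f (s, y) \<partial>torus))\<^sup>2) \<le> ennreal (\<integral>s. (f (s, y))\<^sup>2 \<partial>torus)"
      by (rule ennreal_leI)
    also have "ennreal (\<integral>s. (f (s, y))\<^sup>2 \<partial>torus) = (\<integral>\<^sup>+x. ennreal ((f (x, y))\<^sup>2) \<partial>torus)"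
      using elim by (intro nn_integral_eq_integral[symmetric]) auto
    also have "ennreal (2 * pi * (1 / (2 * pi) * (\<integral>s. f (s, y) \<partial>torus))\<^sup>2) = (\<integral>\<^sup>+x. ennreal ((xavg f (x, y))\<^sup>2) \<partial>torus)"
      by (simp add: xavg_def emeasure_torus ennreal_mult' mult.commute)
    finally show ?case .
  qed
  also have "\<dots> = (\<integral>\<^sup>+z. ennreal ((f z)\<^sup>2) \<partial>cyl)"
    using fm by (intro nn_integral_cyl_iterated[symmetric]) auto
  also have "\<dots> = ennreal ((L2norm f)\<^sup>2)" by (rule nn_integral_L2[OF assms])
  finally have *: "(\<integral>\<^sup>+z. ennreal ((xavg f z)\<^sup>2) \<partial>cyl) \<le> ennreal ((L2norm f)\<^sup>2)" .
  note ** = L2_nn_integralI[OF xavg_measurable[OF fm] *]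
  show "L2 (xavg f)" by (rule **) simp
  have "(L2norm (xavg f))\<^sup>2 \<le> (L2norm f)\<^sup>2" by (rule **) simp
  then show "L2norm (xavg f) \<le> L2norm f" by (rule power2_le_imp_le) simp
qed

lemma fluct_L2: assumes "L2 f" shows "L2 (fluct f)"
  unfolding fluct_def using assms xavg_L2[OF assms] by (intro L2_diff)

lemma pairing_xavg:
  assumes "L2 f" "L2 g"
  shows "pairing (xavg f) g = 1 / (2 * pi) * (\<integral>y. (\<integral>s. f (s, y) \<partial>torus) * (\<integral>x. g (x, y) \<partial>torus) \<partial>lborel)"
  unfolding pairing_def using integral_cyl_iterated(1)[OF L2_integrable_mult[OF xavg_L2(1)[OF assms(1)] assms(2)]]
  by (simp add: xavg_def)

text \<open>Self-adjointness: both sides are the integral over \<open>y\<close> of the product of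
  the two circle integrals. It is used to move averages and fluctuations onto test functions, where
  they are classical.\<close>

lemma pairing_xavg_commute:
  assumes "L2 f" "L2 g" shows "pairing (xavg f) g = pairing f (xavg g)"
  unfolding pairing_commute[of f] pairing_xavg[OF assms] pairing_xavg[OF assms(2,1)] by (simp add: mult.commute)

lemma pairing_fluct_commute:
  assumes "L2 f" "L2 g" shows "pairing (fluct f) g = pairing f (fluct g)"
  unfolding fluct_def
  using pairing_diff_left[OF assms(1) xavg_L2(1)[OF assms(1)] assms(2)]
    pairing_diff_right[OF assms(2) xavg_L2(1)[OF assms(2)] assms(1)] pairing_xavg_commute[OF assms] by simp

section \<open>Test functions\<close>

definition smooth1 :: "(real \<Rightarrow> real) \<Rightarrow> bool" where
  "smooth1 g \<longleftrightarrow> (\<forall>n y. ((deriv ^^ n) g) field_differentiable (at y))"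

lemma smooth1_deriv: "smooth1 g \<Longrightarrow> smooth1 (deriv g)"
  unfolding smooth1_def by (metis comp_apply funpow_Suc_right)

lemma smooth1_DERIV: "smooth1 g \<Longrightarrow> (g has_real_derivative deriv g y) (at y)"
  unfolding smooth1_def by (metis DERIV_deriv_iff_field_differentiable funpow_0)

lemma smooth1_continuous: "smooth1 g \<Longrightarrow> continuous_on S g"
  by (metis DERIV_isCont continuous_at_imp_continuous_on smooth1_DERIV)

lemma smooth1_coinduct:
  assumes "R g" "\<And>g. R g \<Longrightarrow> \<exists>g'. R g' \<and> (\<forall>y. (g has_real_derivative g' y) (at y))"
  shows "smooth1 g"
proof -
  have "R ((deriv ^^ n) g)" for n
  proof (induct n)
    case (Suc n)
    from assms(2)[OF this] obtain g' where g': "R g'" "\<And>y. ((deriv ^^ n) g has_real_derivative g' y) (at y)" by blast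
    then have "deriv ((deriv ^^ n) g) = g'" using DERIV_imp_deriv by blast
    then show ?case using g' by simp
  qed (use assms in simp)
  then show ?thesis unfolding smooth1_def using assms(2) field_differentiable_def by blast
qed

text \<open>The invariant class consists of the finite sums of products of smooth functions: the
  product rule turns \<open>n\<close> summands into \<open>2 n\<close> summands of the same
  kind.\<close>

lemma smooth1_mult:
  assumes "smooth1 f" "smooth1 g" shows "smooth1 (\<lambda>y. f y * g y)"
proof -
  define R where "R h \<longleftrightarrow> (\<exists>n::nat. \<exists>u v. (\<forall>i<n. smooth1 (u i) \<and> smooth1 (v i)) \<and> h = (\<lambda>y. \<Sum>i<n. u i y * v i y))" for h
  show ?thesis
  proof (rule smooth1_coinduct[of R])
    show "R (\<lambda>y. f y * g y)" unfolding R_def using assms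
      by (intro exI[of _ 1] exI[of _ "\<lambda>_. f"] exI[of _ "\<lambda>_. g"]) auto
  next
    fix h assume "R h"
    then obtain n :: nat and u v where uv: "\<And>i. i < n \<Longrightarrow> smooth1 (u i)" "\<And>i. i < n \<Longrightarrow> smooth1 (v i)"
      and h: "h = (\<lambda>y. \<Sum>i<n. u i y * v i y)" unfolding R_def by blast
    define U where "U i = (if i < n then u i else deriv (u (i - n)))" for i
    define V where "V i = (if i < n then deriv (v i) else v (i - n))" for i
    define h' where "h' = (\<lambda>y. \<Sum>i<n+n. U i y * V i y)"
    have sp: "(\<Sum>i<n+n. F i) = (\<Sum>i<n. F i) + (\<Sum>i<n. F (n + i))" for F :: "nat \<Rightarrow> real"
    proof -
      have "(\<Sum>i<n+m. F i) = (\<Sum>i<n. F i) + (\<Sum>i<m. F (n + i))" for m by (induct m) auto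
      then show ?thesis .
    qed
    have "R h'" unfolding R_def h'_def using uv
      by (intro exI[of _ "n+n"] exI[of _ U] exI[of _ V]) (auto simp: U_def V_def smooth1_deriv)
    moreover have "(h has_real_derivative h' y) (at y)" for y
    proof -
      have "(h has_real_derivative (\<Sum>i<n. deriv (u i) y * v i y + deriv (v i) y * u i y)) (at y)"
        unfolding h using uv by (intro DERIV_sum DERIV_mult smooth1_DERIV) auto
      moreover have "(\<Sum>i<n. deriv (u i) y * v i y + deriv (v i) y * u i y) = h' y"
        unfolding h'_def sp by (simp add: U_def V_def sum.distrib mult.commute)
      ultimately show ?thesis by simp
    qed
    ultimately show "\<exists>g'. R g' \<and> (\<forall>y. (h has_real_derivative g' y) (at y))" by blast
  qed
qed

lemma smooth1_affine:
  assumes "smooth1 g" shows "smooth1 (\<lambda>y. c * g (a * y + b))"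
proof (rule smooth1_coinduct[of "\<lambda>h. \<exists>c g. smooth1 g \<and> h = (\<lambda>y. c * g (a * y + b))"])
  fix h assume "\<exists>c g. smooth1 g \<and> h = (\<lambda>y. c * g (a * y + b))"
  then obtain c g where g: "smooth1 g" and h: "h = (\<lambda>y. c * g (a * y + b))" by blast
  have "(h has_real_derivative (c * a) * deriv g (a * y + b)) (at y)" for y
  proof -
    have "((\<lambda>y. a * y + b) has_real_derivative a) (at y)" by (auto intro!: derivative_eq_intros)
    from DERIV_cmult[OF DERIV_chain2[OF smooth1_DERIV[OF g] this], of c] show ?thesis by (simp add: h mult_ac)
  qed
  moreover have "smooth1 (deriv g)" using g by (rule smooth1_deriv)
  ultimately show "\<exists>g'. (\<exists>c g. smooth1 g \<and> g' = (\<lambda>y. c * g (a * y + b))) \<and> (\<forall>y. (h has_real_derivative g' y) (at y))"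
    by (intro exI[of _ "\<lambda>y. (c * a) * deriv g (a * y + b)"]) blast
qed (use assms in blast)

section \<open>A smooth cutoff function\<close>

definition exp_bump :: "real \<Rightarrow> real" where
  "exp_bump x = (if x > 0 then exp (- 1 / x) else 0)"

lemma poly_exp_tendsto_0: "((\<lambda>x. poly p (1 / x) * exp (- 1 / x)) \<longlongrightarrow> 0) (at_right (0::real))"
proof -
  have "((\<lambda>x. \<Sum>i\<le>degree p. coeff p i * (x ^ i / exp x)) \<longlongrightarrow> (\<Sum>i\<le>degree p. coeff p i * 0)) at_top"
    by (intro tendsto_intros tendsto_power_div_exp_0)
  then have 1: "((\<lambda>x. poly p x / exp x) \<longlongrightarrow> 0) at_top"
    by (simp add: poly_altdef sum_divide_distrib)
  have "((\<lambda>x. poly p (inverse x) / exp (inverse x)) \<longlongrightarrow> 0) (at_right 0)"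
    by (rule filterlim_compose[OF 1 filterlim_inverse_at_top_right])
  then show ?thesis by (simp add: exp_minus divide_inverse)
qed

text \<open>The invariant class consists of the functions \<open>p(u) exp(- u)\<close> with
  \<open>u = 1 / x\<close> and a polynomial \<open>p\<close>, extended by 0 to
  \<open>x <= 0\<close>. Since \<open>u' = - u\<^sup>2\<close>, differentiation maps
  \<open>p\<close> to \<open>u\<^sup>2 (p - p')\<close>. At 0 the difference quotient from the right
  is again of this form and tends to 0.\<close>

lemma smooth1_exp_bump: "smooth1 exp_bump"
proof -
  define H where "H p x = (if x > 0 then poly p (1 / x) * exp (- 1 / x) else 0)" for p and x :: real
  have D: "(H p has_real_derivative H ([:0, 0, 1:] * (p - pderiv p)) x) (at x)" for p x
  proof -
    consider "x > 0" | "x < 0" | "x = 0" by linarith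
    then show ?thesis
    proof cases
      case 1
      have "((\<lambda>x. poly p (1 / x) * exp (- 1 / x)) has_real_derivative
         poly (pderiv p) (1 / x) * (- 1 / x\<^sup>2) * exp (- 1 / x) + exp (- 1 / x) * (1 / x\<^sup>2) * poly p (1 / x)) (at x)"
        using 1 by (auto intro!: derivative_eq_intros DERIV_chain2[OF poly_DERIV] simp: power2_eq_square field_simps)
      also have "poly (pderiv p) (1 / x) * (- 1 / x\<^sup>2) * exp (- 1 / x) + exp (- 1 / x) * (1 / x\<^sup>2) * poly p (1 / x)
          = H ([:0, 0, 1:] * (p - pderiv p)) x"
        using 1 by (simp add: H_def power2_eq_square field_simps)
      finally show ?thesis
        by (rule has_field_derivative_transform_within_open[of _ _ _ "{0<..}"]) (use 1 in \<open>auto simp: H_def\<close>)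
    next
      case 2
      have "((\<lambda>x. 0) has_real_derivative H ([:0, 0, 1:] * (p - pderiv p)) x) (at x)" using 2 by (simp add: H_def)
      then show ?thesis
        by (rule has_field_derivative_transform_within_open[of _ _ _ "{..<0}"]) (use 2 in \<open>auto simp: H_def\<close>)
    next
      case 3
      have "((\<lambda>h. H p h / h) \<longlongrightarrow> 0) (at 0)"
        unfolding filterlim_at_split
      proof
        show "((\<lambda>h. H p h / h) \<longlongrightarrow> 0) (at_left 0)"
          by (rule tendsto_eventually) (auto simp: H_def eventually_at_filter)
        have "\<forall>\<^sub>F h in at_right 0. poly ([:0, 1:] * p) (1 / h) * exp (- 1 / h) = H p h / h"
          by (auto simp: H_def eventually_at_filter)
        from Lim_transform_eventually[OF poly_exp_tendsto_0 this] show "((\<lambda>h. H p h / h) \<longlongrightarrow> 0) (at_right 0)" .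
      qed
      then show ?thesis using 3 by (simp add: DERIV_def H_def)
    qed
  qed
  have "exp_bump = H 1" by (auto simp: H_def exp_bump_def)
  then show ?thesis
    by (intro smooth1_coinduct[of "\<lambda>h. \<exists>p. h = H p"]) (use D in blast)+
qed

text \<open>The factor \<open>exp 2\<close> normalizes the value at 0 to 1. Inside the unit interval
  the function is \<open>exp (- 2 y\<^sup>2 / (1 - y\<^sup>2))\<close>, which shows that it never
  exceeds 1.\<close>

definition cutoff :: "real \<Rightarrow> real" where
  "cutoff y = exp 2 * exp_bump (1 + y) * exp_bump (1 - y)"

lemma smooth1_cutoff: "smooth1 cutoff"
proof -
  have "smooth1 (\<lambda>y. (exp 2 * exp_bump (1 * y + 1)) * (1 * exp_bump (- 1 * y + 1)))"
    by (intro smooth1_mult smooth1_affine smooth1_exp_bump)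
  then show ?thesis unfolding cutoff_def[abs_def] by (simp add: add.commute)
qed

lemma cutoff_props: "cutoff 0 = 1" "0 \<le> cutoff y" "cutoff y \<le> 1" "\<bar>y\<bar> > 1 \<Longrightarrow> cutoff y = 0"
proof -
  show "cutoff 0 = 1" by (simp add: cutoff_def exp_bump_def flip: exp_add)
  show "0 \<le> cutoff y" by (simp add: cutoff_def exp_bump_def)
  show "\<bar>y\<bar> > 1 \<Longrightarrow> cutoff y = 0" by (auto simp: cutoff_def exp_bump_def)
  show "cutoff y \<le> 1"
  proof (cases "1 + y > 0 \<and> 1 - y > 0")
    case True
    then have "cutoff y = exp (2 - 1 / (1 + y) - 1 / (1 - y))"
      by (simp add: cutoff_def exp_bump_def flip: exp_add)
    also have "2 - 1 / (1 + y) - 1 / (1 - y) = - 2 * y\<^sup>2 / ((1 + y) * (1 - y))"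
      using True by (simp add: field_simps power2_eq_square)
    also have "exp (- 2 * y\<^sup>2 / ((1 + y) * (1 - y))) \<le> 1" using True by (simp add: divide_nonneg_pos)
    finally show ?thesis .
  qed (auto simp: cutoff_def exp_bump_def)
qed

section \<open>Compactly supported profiles and localized waves\<close>

definition csmooth :: "(real \<Rightarrow> real) \<Rightarrow> bool" where
  "csmooth g \<longleftrightarrow> smooth1 g \<and> (\<exists>R. \<forall>y. \<bar>y\<bar> > R \<longrightarrow> g y = 0)"

lemma csmooth_deriv: assumes "csmooth g" shows "csmooth (deriv g)"
proof -
  from assms obtain R where R: "\<And>y. \<bar>y\<bar> > R \<Longrightarrow> g y = 0" unfolding csmooth_def by blast
  have "deriv g y = 0" if "\<bar>y\<bar> > R" for y
  proof (rule DERIV_imp_deriv, rule has_field_derivative_transform_within_open[of "\<lambda>_. 0"])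
    show "open {y. \<bar>y\<bar> > R}" by (intro open_Collect_less continuous_intros)
  qed (use that R in auto)
  then show ?thesis using assms unfolding csmooth_def by (blast intro: smooth1_deriv)
qed

lemma csmooth_scaled_cutoff: "e > 0 \<Longrightarrow> csmooth (\<lambda>y. cutoff (e * y))"
proof -
  assume e: "e > 0"
  have "smooth1 (\<lambda>y. cutoff (e * y))" using smooth1_affine[OF smooth1_cutoff, of 1 e 0] by simp
  moreover have "cutoff (e * y) = 0" if "\<bar>y\<bar> > 1 / e" for y
    using that e by (intro cutoff_props) (simp add: abs_mult field_simps)
  ultimately show ?thesis unfolding csmooth_def by blast
qed

lemma csmooth_bounded: assumes "csmooth g" obtains B where "\<And>y. \<bar>g y\<bar> \<le> B"
proof -
  from assms obtain R where R: "\<And>y. \<bar>y\<bar> > R \<Longrightarrow> g y = 0" and g: "smooth1 g" unfolding csmooth_def by blast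
  have "compact (g ` {-R..R})" by (intro compact_continuous_image smooth1_continuous g) simp
  then have "bounded (g ` {-R..R})" by (rule compact_imp_bounded)
  then obtain B where "\<And>v. v \<in> g ` {-R..R} \<Longrightarrow> \<bar>v\<bar> \<le> B" unfolding bounded_iff real_norm_def by blast
  then have B: "\<And>y. y \<in> {-R..R} \<Longrightarrow> \<bar>g y\<bar> \<le> B" by blast
  have "\<bar>g y\<bar> \<le> \<bar>B\<bar>" for y
  proof (cases "\<bar>y\<bar> > R")
    case False
    then have "y \<in> {-R..R}" by auto
    then show ?thesis using B[of y] by simp
  qed (use R in simp)
  then show thesis by (rule that)
qed

text \<open>The phase replaces complex exponentials, since \<open>pairing\<close> and the test
  functions are real: differentiating in \<open>x\<close> shifts \<open>\<theta>\<close> by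
  \<open>pi / 2\<close> and multiplies by \<open>k\<close>, so one family of functions
  suffices.\<close>

definition mode :: "(real \<Rightarrow> real) \<Rightarrow> real \<Rightarrow> real \<Rightarrow> real \<Rightarrow> real \<times> real \<Rightarrow> real" where
  "mode g k q \<theta> = (\<lambda>(x, y). g y * cos (k * x + q * y + \<theta>))"

lemma cos_add_pi_half: "cos (a + pi / 2) = - sin (a::real)" by (simp add: cos_add)

lemma pdx_mode: "pdx (mode g k q \<theta>) = (\<lambda>z. k * mode g k q (\<theta> + pi / 2) z)"
proof (rule ext, clarify)
  fix x y
  have "((\<lambda>s. g y * cos (k * s + q * y + \<theta>)) has_real_derivative g y * (- sin (k * x + q * y + \<theta>) * k)) (at x)"
    by (auto intro!: derivative_eq_intros)
  from DERIV_imp_deriv[OF this] show "pdx (mode g k q \<theta>) (x, y) = k * mode g k q (\<theta> + pi / 2) (x, y)"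
    using cos_add_pi_half[of "k * x + q * y + \<theta>"] by (simp add: pdx_def mode_def add.assoc)
qed

lemma pdy_mode:
  assumes "smooth1 g"
  shows "pdy (mode g k q \<theta>) = (\<lambda>z. q * mode g k q (\<theta> + pi / 2) z + mode (deriv g) k q \<theta> z)"
proof (rule ext, clarify)
  fix x y
  have "((\<lambda>s. g s * cos (k * x + q * s + \<theta>)) has_real_derivative deriv g y * cos (k * x + q * y + \<theta>) + (- sin (k * x + q * y + \<theta>) * q) * g y) (at y)"
    by (intro DERIV_mult smooth1_DERIV assms) (auto intro!: derivative_eq_intros)
  from DERIV_imp_deriv[OF this] show "pdy (mode g k q \<theta>) (x, y) = q * mode g k q (\<theta> + pi / 2) (x, y) + mode (deriv g) k q \<theta> (x, y)"
    using cos_add_pi_half[of "k * x + q * y + \<theta>"] by (simp add: pdy_def mode_def add.assoc)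
qed

lemma differentiable_section_x:
  fixes f :: "real \<times> real \<Rightarrow> real"
  assumes "f differentiable (at (x, y))" shows "((\<lambda>s. f (s, y)) has_real_derivative pdx f (x, y)) (at x)"
proof -
  have "(\<lambda>s. (s, y)) differentiable (at x)" by (auto simp: differentiable_def intro!: derivative_eq_intros exI)
  then have "(\<lambda>s. f (s, y)) differentiable (at x)" using assms differentiable_chain_at[of "\<lambda>s. (s, y)" x f] by (simp add: comp_def)
  then show ?thesis unfolding pdx_def by (simp add: DERIV_deriv_iff_real_differentiable)
qed

lemma differentiable_section_y:
  fixes f :: "real \<times> real \<Rightarrow> real"
  assumes "f differentiable (at (x, y))" shows "((\<lambda>s. f (x, s)) has_real_derivative pdy f (x, y)) (at y)"
proof -
  have "(\<lambda>s. (x, s)) differentiable (at y)" by (auto simp: differentiable_def intro!: derivative_eq_intros exI)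
  then have "(\<lambda>s. f (x, s)) differentiable (at y)" using assms differentiable_chain_at[of "\<lambda>s. (x, s)" y f] by (simp add: comp_def)
  then show ?thesis unfolding pdy_def by (simp add: DERIV_deriv_iff_real_differentiable)
qed

lemma pdx_lincomb:
  assumes "\<And>z. f differentiable (at z)" "\<And>z. g differentiable (at z)"
  shows "pdx (\<lambda>z. a * f z + b * g z) = (\<lambda>z. a * pdx f z + b * pdx g z)"
proof (rule ext, clarify)
  fix x y
  have "((\<lambda>s. a * f (s, y) + b * g (s, y)) has_real_derivative a * pdx f (x, y) + b * pdx g (x, y)) (at x)"
    by (intro DERIV_add DERIV_cmult differentiable_section_x assms)
  from DERIV_imp_deriv[OF this] show "pdx (\<lambda>z. a * f z + b * g z) (x, y) = a * pdx f (x, y) + b * pdx g (x, y)"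
    by (simp add: pdx_def)
qed

lemma pdy_lincomb:
  assumes "\<And>z. f differentiable (at z)" "\<And>z. g differentiable (at z)"
  shows "pdy (\<lambda>z. a * f z + b * g z) = (\<lambda>z. a * pdy f z + b * pdy g z)"
proof (rule ext, clarify)
  fix x y
  have "((\<lambda>s. a * f (x, s) + b * g (x, s)) has_real_derivative a * pdy f (x, y) + b * pdy g (x, y)) (at y)"
    by (intro DERIV_add DERIV_cmult differentiable_section_y assms)
  from DERIV_imp_deriv[OF this] show "pdy (\<lambda>z. a * f z + b * g z) (x, y) = a * pdy f (x, y) + b * pdy g (x, y)"
    by (simp add: pdy_def)
qed

definition smooth2 :: "(real \<times> real \<Rightarrow> real) \<Rightarrow> bool" where
  "smooth2 \<phi> \<longleftrightarrow> (\<forall>i j z. ((pdx ^^ i) ((pdy ^^ j) \<phi>)) differentiable (at z))"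

lemma smooth2_coinduct:
  assumes "R f" "\<And>f. R f \<Longrightarrow> (\<forall>z. f differentiable (at z)) \<and> R (pdx f) \<and> R (pdy f)"
  shows "smooth2 f"
proof -
  have "R ((pdy ^^ j) f)" for j using assms by (induct j) auto
  then have "R ((pdx ^^ i) ((pdy ^^ j) f))" for i j using assms(2) by (induct i) auto
  then show ?thesis unfolding smooth2_def using assms(2) by blast
qed

lemma smooth2_lincomb:
  assumes "smooth2 f" "smooth2 g"
  shows "smooth2 (\<lambda>z. a * f z + b * g z)"
proof -
  have d: "((pdx ^^ i) ((pdy ^^ j) f)) differentiable (at z)" "((pdx ^^ i) ((pdy ^^ j) g)) differentiable (at z)" for i j z
    using assms unfolding smooth2_def by blast+
  have y: "(pdy ^^ j) (\<lambda>z. a * f z + b * g z) = (\<lambda>z. a * (pdy ^^ j) f z + b * (pdy ^^ j) g z)" for j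
    using d[of 0] by (induct j) (simp_all add: pdy_lincomb)
  have "(pdx ^^ i) ((pdy ^^ j) (\<lambda>z. a * f z + b * g z)) = (\<lambda>z. a * (pdx ^^ i) ((pdy ^^ j) f) z + b * (pdx ^^ i) ((pdy ^^ j) g) z)" for i j
    using d by (induct i) (simp_all add: pdx_lincomb y)
  then show ?thesis unfolding smooth2_def using d by (auto intro!: derivative_intros)
qed

text \<open>The invariant class for \<open>smooth2_coinduct\<close>. It is closed under both
  derivatives because an x-derivative shifts the phase and a y-derivative either shifts the phase or
  differentiates the profile.\<close>

inductive mode_sum :: "(real \<times> real \<Rightarrow> real) \<Rightarrow> bool" where
  base: "smooth1 g \<Longrightarrow> mode_sum (mode g k q \<theta>)"
| lin: "mode_sum f \<Longrightarrow> mode_sum g \<Longrightarrow> mode_sum (\<lambda>z. a * f z + b * g z)"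

lemma mode_differentiable: "smooth1 g \<Longrightarrow> mode g k q \<theta> differentiable (at z)"
proof -
  assume g: "smooth1 g"
  have "g differentiable (at (snd z))" using smooth1_DERIV[OF g] real_differentiable_def by blast
  then have 1: "(\<lambda>z. g (snd z)) differentiable (at z)"
    using differentiable_chain_at[of snd z g] by (simp add: comp_def bounded_linear_imp_differentiable bounded_linear_snd)
  have "cos differentiable (at (k * fst z + q * snd z + \<theta>))" using DERIV_cos real_differentiable_def by blast
  moreover have "(\<lambda>z. k * fst z + q * snd z + \<theta>) differentiable (at z)"
    by (intro derivative_intros bounded_linear_imp_differentiable bounded_linear_fst bounded_linear_snd)
  ultimately have "(\<lambda>z. cos (k * fst z + q * snd z + \<theta>)) differentiable (at z)"
    using differentiable_chain_at[of "\<lambda>z. k * fst z + q * snd z + \<theta>" z cos] by (simp add: comp_def)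
  then show ?thesis unfolding mode_def split_beta' using 1 by (intro derivative_intros)
qed

lemma smooth2_mode: assumes "smooth1 g" shows "smooth2 (mode g k q \<theta>)"
proof (rule smooth2_coinduct[of mode_sum])
  show "mode_sum (mode g k q \<theta>)" using assms by (rule mode_sum.base)
  fix f assume "mode_sum f"
  then show "(\<forall>z. f differentiable (at z)) \<and> mode_sum (pdx f) \<and> mode_sum (pdy f)"
  proof induct
    case (base g k q \<theta>)
    have "mode_sum (pdx (mode g k q \<theta>))"
      unfolding pdx_mode using mode_sum.lin[OF mode_sum.base[OF base] mode_sum.base[OF base], of k k q "\<theta> + pi/2" 0] by simp
    moreover have "mode_sum (pdy (mode g k q \<theta>))"
      unfolding pdy_mode[OF base] using mode_sum.lin[OF mode_sum.base[OF base] mode_sum.base[OF smooth1_deriv[OF base]], of q k q "\<theta> + pi/2" 1] by simp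
    ultimately show ?case using mode_differentiable[OF base] by blast
  next
    case (lin f g a b)
    then have "pdx (\<lambda>z. a * f z + b * g z) = (\<lambda>z. a * pdx f z + b * pdx g z)"
      "pdy (\<lambda>z. a * f z + b * g z) = (\<lambda>z. a * pdy f z + b * pdy g z)"
      by (intro pdx_lincomb pdy_lincomb; blast)+
    then show ?case using lin by (auto intro!: mode_sum.lin derivative_intros)
  qed
qed

text \<open>Periodicity forces \<open>k\<close> to be an integer. The frequency \<open>q\<close> may
  be any real number, which is what allows it to follow the shear continuously.\<close>

lemma test_function_mode:
  assumes "csmooth g" "k \<in> \<int>" shows "test_function (mode g k q \<theta>)"
proof -
  from assms obtain R where R: "\<And>y. \<bar>y\<bar> > R \<Longrightarrow> g y = 0" and g: "smooth1 g" unfolding csmooth_def by blast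
  from assms obtain n where n: "k = of_int n" by (auto elim: Ints_cases)
  have "cos (k * (x + 2 * pi) + q * y + \<theta>) = cos (k * x + q * y + \<theta>)" for x y
  proof -
    have "cos (k * x + q * y + \<theta> + 2 * pi * of_int n) = cos (k * x + q * y + \<theta>)"
      by (simp add: cos_add cos_int_2pin sin_int_2pin)
    then show ?thesis by (simp add: n algebra_simps)
  qed
  moreover have "\<forall>x y. \<bar>y\<bar> \<ge> R + 1 \<longrightarrow> mode g k q \<theta> (x, y) = 0" using R by (auto simp: mode_def)
  ultimately show ?thesis using smooth2_mode[OF g, of k q \<theta>] unfolding test_function_def smooth2_def
    by (auto simp: mode_def)
qed

lemma test_function_lincomb:
  assumes "test_function f" "test_function g"
  shows "test_function (\<lambda>z. a * f z + b * g z)"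
proof -
  obtain R S where "\<And>x y. \<bar>y\<bar> \<ge> R \<Longrightarrow> f (x, y) = 0" "\<And>x y. \<bar>y\<bar> \<ge> S \<Longrightarrow> g (x, y) = 0"
    using assms unfolding test_function_def by meson
  then have "\<forall>x y. \<bar>y\<bar> \<ge> max R S \<longrightarrow> a * f (x, y) + b * g (x, y) = 0" by auto
  moreover have "smooth2 (\<lambda>z. a * f z + b * g z)"
    using assms by (intro smooth2_lincomb) (auto simp: smooth2_def test_function_def)
  moreover have "\<forall>x y. a * f (x + 2 * pi, y) + b * g (x + 2 * pi, y) = a * f (x, y) + b * g (x, y)"
    using assms unfolding test_function_def by simp
  ultimately show ?thesis unfolding test_function_def smooth2_def by blast
qed

text \<open>Weaker than \<open>test_function\<close>: it still gives integrability and membership in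
  L2, but it survives multiplication by continuous unbounded factors such as the \<open>y\<close> of
  the transport term.\<close>

definition cc :: "(real \<times> real \<Rightarrow> real) \<Rightarrow> bool" where
  "cc f \<longleftrightarrow> continuous_on UNIV f \<and> (\<exists>R. \<forall>x y. \<bar>y\<bar> \<ge> R \<longrightarrow> f (x, y) = 0)"

lemma emeasure_cyl_box: "emeasure cyl ({0..<2 * pi} \<times> {a..b}) < \<infinity>"
proof -
  have "{0..<2*pi} \<in> sets torus" using sets.top[of torus] by (simp add: space_torus)
  then have "emeasure cyl ({0..<2 * pi} \<times> {a..b}) = emeasure torus {0..<2*pi} * emeasure lborel {a..b}"
    unfolding cyl_def by (intro lborel.emeasure_pair_measure_Times) auto
  also have "\<dots> < \<infinity>" using emeasure_torus by (simp add: space_torus ennreal_mult_less_top emeasure_lborel_Icc_eq)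
  finally show ?thesis .
qed

lemma cc_bounded: assumes "cc f" obtains B R where "\<And>z. z \<in> space cyl \<Longrightarrow> \<bar>f z\<bar> \<le> B * indicator ({0..<2*pi} \<times> {-R..R}) z"
proof -
  from assms obtain R where R: "\<And>x y. \<bar>y\<bar> \<ge> R \<Longrightarrow> f (x, y) = 0" and c: "continuous_on UNIV f" unfolding cc_def by blast
  have "compact (f ` ({0..2*pi} \<times> {-R..R}))"
    by (intro compact_continuous_image continuous_on_subset[OF c] compact_Times) auto
  then have "bounded (f ` ({0..2*pi} \<times> {-R..R}))" by (rule compact_imp_bounded)
  then obtain B where "\<And>v. v \<in> f ` ({0..2*pi} \<times> {-R..R}) \<Longrightarrow> \<bar>v\<bar> \<le> B" unfolding bounded_iff real_norm_def by blast
  then have B: "\<And>z. z \<in> {0..2*pi} \<times> {-R..R} \<Longrightarrow> \<bar>f z\<bar> \<le> B" by blast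
  show thesis
  proof (rule that)
    fix z assume z: "z \<in> space cyl"
    obtain x y where xy: "z = (x, y)" by (cases z)
    show "\<bar>f z\<bar> \<le> B * indicator ({0..<2*pi} \<times> {-R..R}) z"
    proof (cases "y \<in> {-R..R}")
      case True then show ?thesis using z B[of z] by (auto simp: xy space_cyl)
    next
      case False then show ?thesis using R[of y x] by (auto simp: xy)
    qed
  qed
qed

lemma cc_integrable: assumes "cc f" shows "integrable cyl f"
proof -
  obtain B R where B: "\<And>z. z \<in> space cyl \<Longrightarrow> \<bar>f z\<bar> \<le> B * indicator ({0..<2*pi} \<times> {-R..R}) z"
    using cc_bounded[OF assms] by blast
  have S: "{0..<2*pi} \<times> {-R..R} \<in> sets cyl" unfolding cyl_def using sets.top[of torus]
    by (intro pair_measureI) (auto simp: space_torus)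
  show ?thesis
  proof (rule Bochner_Integration.integrable_bound)
    show "integrable cyl (\<lambda>z. B * indicator ({0..<2*pi} \<times> {-R..R}) z)"
      using S emeasure_cyl_box[of "-R" R] by (intro integrable_mult_right integrable_real_indicator) auto
    show "f \<in> borel_measurable cyl" using assms measurable_cyl_continuous unfolding cc_def by blast
    show "AE z in cyl. norm (f z) \<le> norm (B * indicator ({0..<2*pi} \<times> {-R..R}) z)"
      using B by (intro AE_I2) force
  qed
qed

lemma cc_mult: "cc f \<Longrightarrow> continuous_on UNIV g \<Longrightarrow> cc (\<lambda>z. f z * g z)"
  unfolding cc_def by (auto intro!: continuous_intros)

lemma cc_mult': "cc f \<Longrightarrow> continuous_on UNIV g \<Longrightarrow> cc (\<lambda>z. g z * f z)"
  using cc_mult[of f g] by (simp add: mult.commute)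

lemma cc_add: "cc f \<Longrightarrow> cc g \<Longrightarrow> cc (\<lambda>z. f z + g z)"
proof -
  assume "cc f" "cc g"
  then obtain R S where "\<And>x y. \<bar>y\<bar> \<ge> R \<Longrightarrow> f (x, y) = 0" "\<And>x y. \<bar>y\<bar> \<ge> S \<Longrightarrow> g (x, y) = 0"
    unfolding cc_def by meson
  then have "\<forall>x y. \<bar>y\<bar> \<ge> max R S \<longrightarrow> f (x, y) + g (x, y) = 0" by auto
  then show ?thesis using \<open>cc f\<close> \<open>cc g\<close> unfolding cc_def by (blast intro: continuous_on_add)
qed

lemma cc_continuous: "cc f \<Longrightarrow> continuous_on S f"
  unfolding cc_def using continuous_on_subset by blast

lemma cc_L2: assumes "cc f" shows "L2 f"
  unfolding L2_def using cc_integrable[OF cc_mult[OF assms cc_continuous[OF assms]]] measurable_cyl_continuous[OF cc_continuous[OF assms]]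
  by (simp add: power2_eq_square)

lemma differentiable_imp_continuous_UNIV: "(\<And>z. f differentiable (at z)) \<Longrightarrow> continuous_on UNIV f"
  using differentiable_imp_continuous_within continuous_at_imp_continuous_on by blast

lemma test_function_smooth2: "test_function \<phi> \<Longrightarrow> smooth2 \<phi>"
  unfolding test_function_def smooth2_def by blast

lemma test_function_differentiable:
  assumes "test_function \<phi>"
  shows "\<phi> differentiable (at z)" "pdx \<phi> differentiable (at z)" "pdy \<phi> differentiable (at z)"
    "pdx (pdx \<phi>) differentiable (at z)" "pdy (pdy \<phi>) differentiable (at z)"
proof -
  have d: "((pdx ^^ i) ((pdy ^^ j) \<phi>)) differentiable (at z)" for i j
    using assms unfolding test_function_def by blast
  show "\<phi> differentiable (at z)" "pdx \<phi> differentiable (at z)" "pdy \<phi> differentiable (at z)"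
    "pdx (pdx \<phi>) differentiable (at z)" "pdy (pdy \<phi>) differentiable (at z)"
    using d[of 0 0] d[of 1 0] d[of 0 1] d[of 2 0] d[of 0 2] by (simp_all add: numeral_2_eq_2)
qed

lemma pdx_support: "(\<And>x y. \<bar>y\<bar> \<ge> R \<Longrightarrow> f (x, y) = 0) \<Longrightarrow> \<bar>y\<bar> \<ge> R \<Longrightarrow> pdx f (x, y) = 0"
  by (simp add: pdx_def)

text \<open>The radius grows by one because the vanishing of a difference quotient requires an open
  set; on \<open>|y| > R\<close> the function is locally zero in \<open>y\<close>, whereas at the
  boundary one side is unknown.\<close>

lemma pdy_support:
  assumes "\<And>x y. \<bar>y\<bar> \<ge> R \<Longrightarrow> f (x, y) = 0" "\<bar>y\<bar> \<ge> R + 1" shows "pdy f (x, y) = 0"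
proof -
  have "((\<lambda>s. f (x, s)) has_real_derivative 0) (at y)"
  proof (rule has_field_derivative_transform_within_open[of "\<lambda>_. 0"])
    show "open {y. \<bar>y\<bar> > R}" by (intro open_Collect_less continuous_intros)
  qed (use assms in auto)
  then show ?thesis by (simp add: pdy_def DERIV_imp_deriv)
qed

lemma test_function_cc:
  assumes "test_function \<phi>"
  shows "cc \<phi>" "cc (pdx \<phi>)" "cc (pdy \<phi>)" "cc (pdx (pdx \<phi>))" "cc (pdy (pdy \<phi>))"
proof -
  obtain R where R: "\<And>x y. \<bar>y\<bar> \<ge> R \<Longrightarrow> \<phi> (x, y) = 0" using assms unfolding test_function_def by blast
  note c = test_function_differentiable[OF assms, THEN differentiable_imp_continuous_UNIV]
  have x: "pdx \<phi> (x, y) = 0" if "\<bar>y\<bar> \<ge> R" for x y using pdx_support[of R \<phi>, OF R] that by blast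
  have y: "pdy \<phi> (x, y) = 0" if "\<bar>y\<bar> \<ge> R + 1" for x y using pdy_support[of R \<phi>, OF R] that by blast
  have xx: "pdx (pdx \<phi>) (x, y) = 0" if "\<bar>y\<bar> \<ge> R" for x y using pdx_support[of R "pdx \<phi>", OF x] that by blast
  have yy: "pdy (pdy \<phi>) (x, y) = 0" if "\<bar>y\<bar> \<ge> R + 1 + 1" for x y using pdy_support[of "R + 1" "pdy \<phi>", OF y] that by blast
  show "cc \<phi>" "cc (pdx \<phi>)" "cc (pdy \<phi>)" "cc (pdx (pdx \<phi>))" "cc (pdy (pdy \<phi>))"
    unfolding cc_def using R x y xx yy c by blast+
qed

lemma test_function_periodic:
  assumes "test_function \<phi>"
  shows "\<phi> (x + 2 * pi, y) = \<phi> (x, y)" "pdx \<phi> (x + 2 * pi, y) = pdx \<phi> (x, y)"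
proof -
  show *: "\<phi> (x + 2 * pi, y) = \<phi> (x, y)" for x y using assms unfolding test_function_def by blast
  have "((\<lambda>s. \<phi> (s, y)) has_real_derivative pdx \<phi> (x + 2 * pi, y)) (at (x + 2 * pi))"
    by (intro differentiable_section_x test_function_differentiable assms)
  then have "((\<lambda>s. \<phi> (s + 2 * pi, y)) has_real_derivative pdx \<phi> (x + 2 * pi, y)) (at x)"
    by (simp add: DERIV_shift)
  then show "pdx \<phi> (x + 2 * pi, y) = pdx \<phi> (x, y)" unfolding * pdx_def by (simp add: DERIV_imp_deriv)
qed

text \<open>The half-open fundamental domain differs from the closed interval by a null set. This
  gives access to the fundamental theorem of calculus and to differentiation under the
  integral.\<close>

lemma integral_torus:
  fixes f :: "real \<Rightarrow> real"
  assumes "continuous_on UNIV f"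
  shows "integrable torus f" "(\<integral>x. f x \<partial>torus) = integral {0..2 * pi} f"
    "(\<integral>x. f x \<partial>torus) = (\<integral>x. f x * indicator {0..2 * pi} x \<partial>lborel)"
proof -
  have fm: "f \<in> borel_measurable borel" using assms by (rule borel_measurable_continuous_onI)
  have i: "set_integrable lborel {0..2*pi} f"
    using borel_integrable_atLeastAtMost'[of 0 "2*pi" f] continuous_on_subset[OF assms] by blast
  have ae: "AE x in lborel. indicator {0..<2*pi} x *\<^sub>R f x = indicator {0..2*pi} x *\<^sub>R f x"
    using AE_lborel_singleton[of "2*pi"] by eventually_elim (auto simp: indicator_def)
  have "set_integrable lborel {0..<2*pi} f" using i unfolding set_integrable_def
    by (subst integrable_cong_AE[OF _ _ ae]) (use fm in auto)
  then show "integrable torus f" unfolding torus_def set_integrable_def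
    by (subst integrable_restrict_space) (auto simp: mult.commute)
  have "(\<integral>x. f x \<partial>torus) = (\<integral>x. indicator {0..<2*pi} x *\<^sub>R f x \<partial>lborel)"
    unfolding torus_def by (subst integral_restrict_space) (auto simp: mult.commute)
  also have "\<dots> = (\<integral>x. indicator {0..2*pi} x *\<^sub>R f x \<partial>lborel)"
    by (rule integral_cong_AE[OF _ _ ae]) (use fm in auto)
  finally have *: "(\<integral>x. f x \<partial>torus) = (\<integral>x. indicator {0..2*pi} x *\<^sub>R f x \<partial>lborel)" .
  then show "(\<integral>x. f x \<partial>torus) = (\<integral>x. f x * indicator {0..2 * pi} x \<partial>lborel)" by (simp add: mult.commute)
  show "(\<integral>x. f x \<partial>torus) = integral {0..2 * pi} f"
    using * set_borel_integral_eq_integral(2)[OF i] by (simp add: set_lebesgue_integral_def)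
qed

lemma continuous_section_x: "continuous_on UNIV f \<Longrightarrow> continuous_on S (\<lambda>s. f (s, y))"
  by (rule continuous_on_compose2[of UNIV f S "\<lambda>s. (s, y)"]) (auto intro!: continuous_intros)

lemma continuous_section_y: "continuous_on UNIV f \<Longrightarrow> continuous_on S (\<lambda>s. f (x, s))"
  by (rule continuous_on_compose2[of UNIV f S "\<lambda>s. (x, s)"]) (auto intro!: continuous_intros)

lemma integral_by_parts_x:
  assumes f: "\<And>z. f differentiable (at z)" "cc f" "cc (pdx f)" "\<And>x y. f (x + 2 * pi, y) = f (x, y)"
    and g: "\<And>z. g differentiable (at z)" "cc g" "cc (pdx g)" "\<And>x y. g (x + 2 * pi, y) = g (x, y)"
  shows "pairing f (pdx g) = - pairing (pdx f) g"
proof -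
  define h where "h z = f z * pdx g z + pdx f z * g z" for z
  have ch: "cc h" unfolding h_def using f g by (intro cc_add cc_mult cc_continuous)
  have "(\<integral>z. h z \<partial>cyl) = (\<integral>y. (\<integral>x. h (x, y) \<partial>torus) \<partial>lborel)"
    by (rule integral_cyl_iterated(1)[OF cc_integrable[OF ch]])
  also have "(\<lambda>y. \<integral>x. h (x, y) \<partial>torus) = (\<lambda>y. 0)"
  proof
    fix y
    have D: "((\<lambda>s. f (s, y) * g (s, y)) has_real_derivative h (x, y)) (at x)" for x
      using DERIV_mult[OF differentiable_section_x[OF f(1)] differentiable_section_x[OF g(1)]]
      by (simp add: h_def mult.commute add.commute)
    have c: "continuous_on UNIV (\<lambda>x. h (x, y))" by (intro continuous_section_x cc_continuous ch)
    have "(\<integral>x. h (x, y) \<partial>torus) = (\<integral>x. h (x, y) * indicator {0..2 * pi} x \<partial>lborel)"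
      by (rule integral_torus(3)[OF c])
    also have "\<dots> = f (2 * pi, y) * g (2 * pi, y) - f (0, y) * g (0, y)"
      using D c by (intro integral_FTC_Icc_real) (auto simp: continuous_on_eq_continuous_at)
    also have "\<dots> = 0" using f(4)[of 0 y] g(4)[of 0 y] by simp
    finally show "(\<integral>x. h (x, y) \<partial>torus) = 0" .
  qed
  finally have "(\<integral>z. h z \<partial>cyl) = 0" by simp
  moreover have "(\<integral>z. h z \<partial>cyl) = pairing f (pdx g) + pairing (pdx f) g"
    unfolding h_def pairing_def using f g by (intro Bochner_Integration.integral_add cc_integrable cc_mult cc_continuous)
  ultimately show ?thesis by simp
qed

lemma integral_by_parts_y:
  assumes f: "\<And>z. f differentiable (at z)" "cc f" "cc (pdy f)"
    and g: "\<And>z. g differentiable (at z)" "cc g" "cc (pdy g)"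
  shows "pairing f (pdy g) = - pairing (pdy f) g"
proof -
  define h where "h z = f z * pdy g z + pdy f z * g z" for z
  have ch: "cc h" unfolding h_def using f g by (intro cc_add cc_mult cc_continuous)
  obtain R1 where R1: "\<And>x y. \<bar>y\<bar> \<ge> R1 \<Longrightarrow> f (x, y) = 0" using f(2) unfolding cc_def by blast
  obtain R2 where R2: "\<And>x y. \<bar>y\<bar> \<ge> R2 \<Longrightarrow> h (x, y) = 0" using ch unfolding cc_def by blast
  define R where "R = max 0 (max R1 R2)"
  have "(\<integral>z. h z \<partial>cyl) = (\<integral>x. (\<integral>y. h (x, y) \<partial>lborel) \<partial>torus)"
    by (rule integral_cyl_iterated(2)[OF cc_integrable[OF ch]])
  also have "(\<lambda>x. \<integral>y. h (x, y) \<partial>lborel) = (\<lambda>x. 0)"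
  proof
    fix x
    have D: "((\<lambda>s. f (x, s) * g (x, s)) has_real_derivative h (x, y)) (at y)" for y
      using DERIV_mult[OF differentiable_section_y[OF f(1)] differentiable_section_y[OF g(1)]]
      by (simp add: h_def mult.commute add.commute)
    have c: "continuous_on UNIV (\<lambda>y. h (x, y))" by (intro continuous_section_y cc_continuous ch)
    have "h (x, y) = h (x, y) * indicator {-R..R} y" for y
    proof (cases "y \<in> {-R..R}")
      case False
      then have "\<bar>y\<bar> \<ge> R2" by (auto simp: R_def)
      then show ?thesis using R2 by simp
    qed simp
    then have "(\<integral>y. h (x, y) \<partial>lborel) = (\<integral>y. h (x, y) * indicator {-R..R} y \<partial>lborel)"
      by (rule Bochner_Integration.integral_cong[OF refl])
    also have "\<dots> = f (x, R) * g (x, R) - f (x, -R) * g (x, -R)"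
      using D c by (intro integral_FTC_Icc_real) (auto simp: continuous_on_eq_continuous_at R_def)
    also have "\<dots> = 0" using R1[of R x] R1[of "-R" x] by (simp add: R_def)
    finally show "(\<integral>y. h (x, y) \<partial>lborel) = 0" .
  qed
  finally have "(\<integral>z. h z \<partial>cyl) = 0" by simp
  moreover have "(\<integral>z. h z \<partial>cyl) = pairing f (pdy g) + pairing (pdy f) g"
    unfolding h_def pairing_def using f g by (intro Bochner_Integration.integral_add cc_integrable cc_mult cc_continuous)
  ultimately show ?thesis by simp
qed

section \<open>Averages of test functions and of weak derivatives\<close>

lemma pdy_xavg:
  assumes f: "\<And>z. f differentiable (at z)" and c: "continuous_on UNIV (pdy f)"
  shows "pdy (xavg f) = xavg (pdy f)" "xavg f differentiable (at z)"
proof -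
  have cf: "continuous_on UNIV f" using f by (rule differentiable_imp_continuous_UNIV)
  define a where "a y = (\<integral>s. f (s, y) \<partial>torus)" for y
  have a: "a = (\<lambda>y. integral (cbox 0 (2 * pi)) (\<lambda>s. f (s, y)))"
    unfolding a_def using integral_torus(2)[OF continuous_section_x[OF cf]] by (simp add: cbox_interval)
  have D: "(a has_real_derivative (\<integral>s. pdy f (s, y) \<partial>torus)) (at y)" for y
  proof -
    have "((\<lambda>y. integral (cbox 0 (2 * pi)) (\<lambda>s. f (s, y))) has_field_derivative integral (cbox 0 (2 * pi)) (\<lambda>s. pdy f (s, y))) (at y within UNIV)"
    proof (rule leibniz_rule_field_derivative)
      show "((\<lambda>y. f (s, y)) has_field_derivative pdy f (s, y)) (at y within UNIV)" for s y
        using differentiable_section_y[OF f] by simp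
      show "(\<lambda>s. f (s, y)) integrable_on cbox 0 (2 * pi)" for y
        by (intro integrable_continuous continuous_section_x cf)
      show "continuous_on (UNIV \<times> cbox 0 (2 * pi)) (\<lambda>(y, s). pdy f (s, y))"
        unfolding split_beta' by (rule continuous_on_compose2[OF c]) (auto intro!: continuous_intros)
    qed auto
    moreover have "(\<integral>s. pdy f (s, y) \<partial>torus) = integral (cbox 0 (2 * pi)) (\<lambda>s. pdy f (s, y))"
      using integral_torus(2)[OF continuous_section_x[OF c]] by (simp add: cbox_interval)
    ultimately show ?thesis unfolding a by simp
  qed
  have xa: "xavg f = (\<lambda>z. 1 / (2 * pi) * a (snd z))" by (auto simp: xavg_def a_def)
  have Dx: "((\<lambda>s. xavg f (x, s)) has_real_derivative xavg (pdy f) (x, y)) (at y)" for x y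
    unfolding xa using DERIV_cmult[OF D, of "1 / (2*pi)"] by (simp add: xavg_def)
  show "pdy (xavg f) = xavg (pdy f)" using DERIV_imp_deriv[OF Dx] by (auto simp: pdy_def)
  have "a differentiable (at (snd z))" using D real_differentiable_def by blast
  then have "(\<lambda>z. a (snd z)) differentiable (at z)"
    using differentiable_chain_at[of snd z a] by (simp add: comp_def bounded_linear_imp_differentiable bounded_linear_snd)
  then show "xavg f differentiable (at z)" unfolding xa by (intro derivative_intros)
qed

lemma pdx_xavg: "pdx (xavg f) = (\<lambda>z. 0)"
  by (auto simp: pdx_def xavg_def)

lemma smooth2_xavg: assumes "smooth2 f" shows "smooth2 (xavg f)"
proof -
  have d: "(pdy ^^ j) f differentiable (at z)" for j z
    using assms unfolding smooth2_def by (metis funpow_0)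
  have c: "continuous_on UNIV (pdy ((pdy ^^ j) f))" for j
    using d[of "Suc j"] by (intro differentiable_imp_continuous_UNIV) simp
  have y: "(pdy ^^ j) (xavg f) = xavg ((pdy ^^ j) f)" for j
    by (induct j) (simp_all add: pdy_xavg(1)[OF d c])
  have z: "pdx (\<lambda>z. 0) = (\<lambda>z. 0)" by (auto simp: pdx_def)
  have x: "(pdx ^^ Suc i) ((pdy ^^ j) (xavg f)) = (\<lambda>z. 0)" for i j
    by (induct i) (simp_all add: y pdx_xavg z)
  have "(pdx ^^ i) ((pdy ^^ j) (xavg f)) differentiable (at z)" for i j z
  proof (cases i)
    case 0 then show ?thesis using pdy_xavg(2)[OF d c] by (simp add: y)
  next
    case (Suc n) then show ?thesis using x[of n j] by simp
  qed
  then show ?thesis unfolding smooth2_def by blast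
qed

lemma test_function_xavg: assumes "test_function \<phi>" shows "test_function (xavg \<phi>)"
proof -
  obtain R where "\<And>x y. \<bar>y\<bar> \<ge> R \<Longrightarrow> \<phi> (x, y) = 0" using assms unfolding test_function_def by blast
  then have "\<forall>x y. \<bar>y\<bar> \<ge> R \<longrightarrow> xavg \<phi> (x, y) = 0" by (auto simp: xavg_def)
  moreover have "\<forall>x y. xavg \<phi> (x + 2 * pi, y) = xavg \<phi> (x, y)" by (simp add: xavg_def)
  ultimately show ?thesis using smooth2_xavg[OF test_function_smooth2[OF assms]]
    unfolding test_function_def smooth2_def by blast
qed

lemma test_function_fluct: assumes "test_function \<phi>" shows "test_function (fluct \<phi>)"
  using test_function_lincomb[OF assms test_function_xavg[OF assms], of 1 "-1"] by (simp add: fluct_def)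

lemma pdy_fluct: assumes "test_function \<phi>" shows "pdy (fluct \<phi>) = fluct (pdy \<phi>)"
  using pdy_lincomb[OF test_function_differentiable(1)[OF assms] test_function_differentiable(1)[OF test_function_xavg[OF assms]], of 1 "-1"]
    pdy_xavg(1)[OF test_function_differentiable(1)[OF assms] cc_continuous[OF test_function_cc(3)[OF assms]]]
  by (simp add: fluct_def[abs_def])

lemma xavg_indep: "(\<And>x x' y. f (x, y) = f (x', y)) \<Longrightarrow> xavg f = f"
proof (rule ext, clarify)
  fix x y assume *: "\<And>x x' y. f (x, y) = f (x', y)"
  have "(\<integral>s. f (s, y) \<partial>torus) = (\<integral>s. f (x, y) \<partial>torus)"
    by (intro Bochner_Integration.integral_cong refl *)
  then show "xavg f (x, y) = f (x, y)" by (simp add: xavg_def measure_torus)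
qed

lemma xavg_pdx: assumes "test_function \<phi>" shows "xavg (pdx \<phi>) = (\<lambda>z. 0)"
proof (rule ext, clarify)
  fix x y
  have c: "continuous_on UNIV (\<lambda>x. pdx \<phi> (x, y))" by (intro continuous_section_x cc_continuous test_function_cc assms)
  have "(\<integral>s. pdx \<phi> (s, y) \<partial>torus) = (\<integral>s. pdx \<phi> (s, y) * indicator {0..2*pi} s \<partial>lborel)" by (rule integral_torus(3)[OF c])
  also have "\<dots> = \<phi> (2 * pi, y) - \<phi> (0, y)"
    using c by (intro integral_FTC_Icc_real differentiable_section_x test_function_differentiable assms) (auto simp: continuous_on_eq_continuous_at)
  also have "\<dots> = 0" using test_function_periodic(1)[OF assms, of 0 y] by simp
  finally show "xavg (pdx \<phi>) (x, y) = 0" by (simp add: xavg_def)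
qed

text \<open>The same derivative serves for the fluctuation: \<open>pdx \<phi>\<close> has zero
  average on every circle, so it does not see the average of \<open>f\<close>.\<close>

lemma is_weak_dx_fluct:
  assumes "L2 f" "is_weak_dx f g" shows "is_weak_dx (fluct f) g"
  unfolding is_weak_dx_def
proof (intro conjI allI impI)
  show "L2 g" using assms unfolding is_weak_dx_def by blast
  fix \<phi> assume t: "test_function \<phi>"
  have "pairing (fluct f) (pdx \<phi>) = pairing f (fluct (pdx \<phi>))"
    by (intro pairing_fluct_commute assms cc_L2 test_function_cc t)
  also have "fluct (pdx \<phi>) = pdx \<phi>" unfolding fluct_def xavg_pdx[OF t] by simp
  also have "pairing f (pdx \<phi>) = - pairing g \<phi>" using assms t unfolding is_weak_dx_def by blast
  finally show "pairing (fluct f) (pdx \<phi>) = - pairing g \<phi>" .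
qed

lemma is_weak_dy_fluct:
  assumes "L2 f" "is_weak_dy f g" shows "is_weak_dy (fluct f) (fluct g)"
  unfolding is_weak_dy_def
proof (intro conjI allI impI)
  have g: "L2 g" using assms unfolding is_weak_dy_def by blast
  then show "L2 (fluct g)" by (rule fluct_L2)
  fix \<phi> assume t: "test_function \<phi>"
  have "pairing (fluct f) (pdy \<phi>) = pairing f (fluct (pdy \<phi>))"
    by (intro pairing_fluct_commute assms cc_L2 test_function_cc t)
  also have "\<dots> = pairing f (pdy (fluct \<phi>))" by (simp add: pdy_fluct t)
  also have "\<dots> = - pairing g (fluct \<phi>)" using assms test_function_fluct[OF t] unfolding is_weak_dy_def by blast
  also have "pairing g (fluct \<phi>) = pairing (fluct g) \<phi>"
    by (intro pairing_fluct_commute[symmetric] g cc_L2 test_function_cc t)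
  finally show "pairing (fluct f) (pdy \<phi>) = - pairing (fluct g) \<phi>" .
qed

lemma H1_fluct_weak:
  assumes "H1 f" shows "is_weak_dx (fluct f) (wdx (fluct f))" "is_weak_dy (fluct f) (wdy (fluct f))"
  using assms is_weak_dx_fluct is_weak_dy_fluct unfolding H1_def wdx_def wdy_def by (metis someI)+

section \<open>The Poisson equation\<close>

text \<open>On a circle two values differ by at most the integral \<open>V y\<close> of the absolute
  x-derivative. With zero average the values themselves are then bounded by \<open>V y\<close>.
  Cauchy-Schwarz and the length of the circle each contribute a factor \<open>2 pi\<close> to the
  squared inequality.\<close>

lemma poincare:
  assumes t: "test_function \<phi>" and z: "xavg \<phi> = (\<lambda>z. 0)"
  shows "L2norm \<phi> \<le> 2 * pi * L2norm (pdx \<phi>)"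
proof -
  define V where "V y = (\<integral>r. \<bar>pdx \<phi> (r, y)\<bar> \<partial>torus)" for y
  note c = cc_continuous[OF test_function_cc(1)[OF t], of UNIV] cc_continuous[OF test_function_cc(2)[OF t], of UNIV]
  have cx: "continuous_on UNIV (\<lambda>x. \<phi> (x, y))" "continuous_on UNIV (\<lambda>x. pdx \<phi> (x, y))"
    "continuous_on UNIV (\<lambda>x. \<bar>pdx \<phi> (x, y)\<bar>)" "continuous_on UNIV (\<lambda>x. (pdx \<phi> (x, y))\<^sup>2)"
    "continuous_on UNIV (\<lambda>x. (\<phi> (x, y))\<^sup>2)" for y
    by (intro continuous_intros continuous_section_x c)+
  have osc: "\<bar>\<phi> (x, y) - \<phi> (s, y)\<bar> \<le> V y" if "0 \<le> s" "s \<le> x" "x \<le> 2 * pi" for x s y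
  proof -
    have i: "integrable lborel (\<lambda>r. pdx \<phi> (r, y) * indicator {a..b} r)" for a b
      using borel_integrable_atLeastAtMost'[of a b "\<lambda>r. pdx \<phi> (r, y)"] continuous_on_subset[OF cx(2)]
      by (simp add: set_integrable_def mult.commute)
    have "\<phi> (x, y) - \<phi> (s, y) = (\<integral>r. pdx \<phi> (r, y) * indicator {s..x} r \<partial>lborel)"
      using that cx(2) by (intro integral_FTC_Icc_real[symmetric] differentiable_section_x test_function_differentiable t)
        (auto simp: continuous_on_eq_continuous_at)
    also have "\<bar>\<dots>\<bar> \<le> (\<integral>r. \<bar>pdx \<phi> (r, y) * indicator {s..x} r\<bar> \<partial>lborel)" by (rule integral_abs_bound)
    also have "\<dots> \<le> (\<integral>r. \<bar>pdx \<phi> (r, y) * indicator {0..2*pi} r\<bar> \<partial>lborel)"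
      using that by (intro integral_mono integrable_abs i) (auto simp: indicator_def)
    also have "\<dots> = V y" unfolding V_def integral_torus(3)[OF cx(3)]
      by (intro Bochner_Integration.integral_cong) (auto simp: abs_mult)
    finally show ?thesis .
  qed
  have pw: "(\<phi> (x, y))\<^sup>2 \<le> (V y)\<^sup>2" if x: "x \<in> space torus" for x y
  proof -
    have 1: "\<bar>\<phi> (x, y) - \<phi> (s, y)\<bar> \<le> V y" if "s \<in> space torus" for s
      using osc[of s x y] osc[of x s y] x that by (cases "s \<le> x") (auto simp: space_torus abs_minus_commute)
    have i: "integrable torus (\<lambda>s. \<phi> (x, y) - \<phi> (s, y))"
      using integral_torus(1)[OF cx(1)] by (intro Bochner_Integration.integrable_diff) auto
    have "(\<integral>s. \<phi> (x, y) - \<phi> (s, y) \<partial>torus) = 2 * pi * \<phi> (x, y) - (\<integral>s. \<phi> (s, y) \<partial>torus)"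
      using integral_torus(1)[OF cx(1)] by (subst Bochner_Integration.integral_diff) (auto simp: measure_torus)
    also have "(\<integral>s. \<phi> (s, y) \<partial>torus) = 0" using fun_cong[OF z, of "(x, y)"] by (simp add: xavg_def)
    finally have "2 * pi * \<bar>\<phi> (x, y)\<bar> = \<bar>\<integral>s. \<phi> (x, y) - \<phi> (s, y) \<partial>torus\<bar>" by (simp add: abs_mult)
    also have "\<dots> \<le> (\<integral>s. \<bar>\<phi> (x, y) - \<phi> (s, y)\<bar> \<partial>torus)" by (rule integral_abs_bound)
    also have "\<dots> \<le> (\<integral>s. V y \<partial>torus)" using 1 i by (intro integral_mono integrable_abs) auto
    also have "\<dots> = 2 * pi * V y" by (simp add: measure_torus)
    finally have "\<bar>\<phi> (x, y)\<bar> \<le> V y" by simp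
    then show ?thesis by (metis abs_ge_zero power2_abs power_mono)
  qed
  have V2: "(V y)\<^sup>2 \<le> 2 * pi * (\<integral>r. (pdx \<phi> (r, y))\<^sup>2 \<partial>torus)" for y
  proof -
    have "(\<integral>r. \<bar>pdx \<phi> (r, y)\<bar> * 1 \<partial>torus)\<^sup>2 \<le> (\<integral>r. \<bar>pdx \<phi> (r, y)\<bar>\<^sup>2 \<partial>torus) * (\<integral>r. 1\<^sup>2 \<partial>torus)"
      using integral_torus(1)[OF cx(4)] borel_measurable_integrable[OF integral_torus(1)[OF cx(3)]]
      by (intro Cauchy_Schwarz_integral) auto
    then show ?thesis by (simp add: V_def measure_torus mult.commute)
  qed
  have ci: "integrable cyl (\<lambda>z. (\<phi> z)\<^sup>2)" "integrable cyl (\<lambda>z. (pdx \<phi> z)\<^sup>2)"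
    using cc_L2[OF test_function_cc(1)[OF t]] cc_L2[OF test_function_cc(2)[OF t]] by (auto simp: L2_def)
  have "(L2norm \<phi>)\<^sup>2 = (\<integral>y. (\<integral>x. (\<phi> (x, y))\<^sup>2 \<partial>torus) \<partial>lborel)"
    unfolding L2norm_sq by (rule integral_cyl_iterated(1)[OF ci(1)])
  also have "\<dots> \<le> (\<integral>y. (2 * pi)\<^sup>2 * (\<integral>r. (pdx \<phi> (r, y))\<^sup>2 \<partial>torus) \<partial>lborel)"
  proof (rule integral_mono)
    show "integrable lborel (\<lambda>y. \<integral>x. (\<phi> (x, y))\<^sup>2 \<partial>torus)"
      using cyl.integrable_snd[of "\<lambda>x y. (\<phi> (x, y))\<^sup>2"] ci(1) by (simp add: cyl_def split_beta')
    show "integrable lborel (\<lambda>y. (2 * pi)\<^sup>2 * (\<integral>r. (pdx \<phi> (r, y))\<^sup>2 \<partial>torus))"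
      using cyl.integrable_snd[of "\<lambda>x y. (pdx \<phi> (x, y))\<^sup>2"] ci(2) by (simp add: cyl_def split_beta')
    fix y
    have "(\<integral>x. (\<phi> (x, y))\<^sup>2 \<partial>torus) \<le> (\<integral>x. (V y)\<^sup>2 \<partial>torus)"
      using integral_torus(1)[OF cx(5)] pw by (intro integral_mono) auto
    also have "\<dots> = 2 * pi * (V y)\<^sup>2" by (simp add: measure_torus)
    also have "\<dots> \<le> 2 * pi * (2 * pi * (\<integral>r. (pdx \<phi> (r, y))\<^sup>2 \<partial>torus))" using V2 by (intro mult_left_mono) auto
    finally show "(\<integral>x. (\<phi> (x, y))\<^sup>2 \<partial>torus) \<le> (2 * pi)\<^sup>2 * (\<integral>r. (pdx \<phi> (r, y))\<^sup>2 \<partial>torus)" by (simp add: power2_eq_square)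
  qed
  also have "\<dots> = (2 * pi)\<^sup>2 * (\<integral>y. (\<integral>r. (pdx \<phi> (r, y))\<^sup>2 \<partial>torus) \<partial>lborel)" by simp
  also have "(\<integral>y. (\<integral>r. (pdx \<phi> (r, y))\<^sup>2 \<partial>torus) \<partial>lborel) = (L2norm (pdx \<phi>))\<^sup>2"
    unfolding L2norm_sq by (rule integral_cyl_iterated(1)[OF ci(2), symmetric])
  finally have "(L2norm \<phi>)\<^sup>2 \<le> (2 * pi * L2norm (pdx \<phi>))\<^sup>2" by (simp add: power_mult_distrib)
  then show ?thesis by (rule power2_le_imp_le) simp
qed

lemma quadratic_min_aux: "0 \<le> 2 * (e + c + d)" if "a \<le> b + c + d" "b < a + e" for a b c d e :: real
  using that by argo

lemma midpoint_min_aux: "b \<le> 4 * e + 4 * e'" if "m \<le> (p + p') / 2 - b / 8" "p < m + e" "p' < m + e'" for b e e' p p' m :: real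
  using that by argo

text \<open>Riesz representation on a space that need not be complete: near-minimizers of
  \<open>J f = B f f / 2 - l f\<close> form a Cauchy sequence for \<open>B\<close> and represent
  \<open>l\<close> in the limit. Taking the limit is left to the application, where it is done in L2
  for the functions and their derivatives separately.\<close>

lemma Riesz_minimizing_sequence:
  fixes V :: "('a \<Rightarrow> real) \<Rightarrow> bool" and B :: "('a \<Rightarrow> real) \<Rightarrow> ('a \<Rightarrow> real) \<Rightarrow> real" and l :: "('a \<Rightarrow> real) \<Rightarrow> real"
  assumes V0: "V f0" and V: "\<And>f g a b. V f \<Longrightarrow> V g \<Longrightarrow> V (\<lambda>z. a * f z + b * g z)"
    and B: "\<And>f g h a b. V f \<Longrightarrow> V g \<Longrightarrow> V h \<Longrightarrow> B (\<lambda>z. a * f z + b * g z) h = a * B f h + b * B g h"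
    and sym: "\<And>f g. V f \<Longrightarrow> V g \<Longrightarrow> B f g = B g f" and pos: "\<And>f. V f \<Longrightarrow> B f f \<ge> 0"
    and l: "\<And>f g a b. V f \<Longrightarrow> V g \<Longrightarrow> l (\<lambda>z. a * f z + b * g z) = a * l f + b * l g"
    and C: "\<And>f. V f \<Longrightarrow> \<bar>l f\<bar> \<le> C * sqrt (B f f)" "C \<ge> 0"
  obtains \<phi> :: "nat \<Rightarrow> 'a \<Rightarrow> real" where
    "\<And>n. V (\<phi> n)" "\<And>m n. B (\<lambda>z. 1 * \<phi> m z + (-1) * \<phi> n z) (\<lambda>z. 1 * \<phi> m z + (-1) * \<phi> n z) \<le> 4 / real (Suc m) + 4 / real (Suc n)"
    "\<And>f. V f \<Longrightarrow> (\<lambda>n. B (\<phi> n) f) \<longlonglongrightarrow> l f" "\<And>n. sqrt (B (\<phi> n) (\<phi> n)) \<le> C + 2"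
proof -
  define J where "J f = B f f / 2 - l f" for f
  have B2: "B h (\<lambda>z. a * f z + b * g z) = a * B h f + b * B h g" if "V f" "V g" "V h" for f g h a b
    using B[OF that] sym V that by metis
  have Bq: "B (\<lambda>z. a * f z + b * g z) (\<lambda>z. a * f z + b * g z) = a\<^sup>2 * B f f + 2 * a * b * B f g + b\<^sup>2 * B g g"
    if "V f" "V g" for f g a b
    using that by (simp add: B B2 V sym[of g f] power2_eq_square algebra_simps)
  have Jlow: "- (C\<^sup>2 / 2) \<le> J f" if "V f" for f
  proof -
    have "0 \<le> (sqrt (B f f) - C)\<^sup>2" by simp
    then have "0 \<le> B f f - 2 * (C * sqrt (B f f)) + C\<^sup>2" using pos[OF that] by (simp add: power2_diff mult_ac)
    then show ?thesis unfolding J_def using C(1)[OF that] by linarith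
  qed
  define m where "m = Inf (J ` Collect V)"
  have bb: "bdd_below (J ` Collect V)" by (rule bdd_belowI[of _ "- (C\<^sup>2/2)"]) (use Jlow in auto)
  have m: "m \<le> J f" if "V f" for f unfolding m_def using that bb by (intro cInf_lower) auto
  have "\<exists>f. V f \<and> J f < m + 1 / real (Suc n)" for n
  proof -
    have "J ` Collect V \<noteq> {}" using V0 by auto
    from cInf_lessD[OF this, of "m + 1 / real (Suc n)"] show ?thesis unfolding m_def by auto
  qed
  then obtain \<phi> where \<phi>: "\<And>n. V (\<phi> n)" "\<And>n. J (\<phi> n) < m + 1 / real (Suc n)" by metis
  \<comment> \<open>Comparing \<open>J\<close> at \<open>\<phi> n + t f\<close> with the infimum for
    all real \<open>t\<close> yields a quadratic polynomial in \<open>t\<close> that is nonnegative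
    once the defect \<open>1 / Suc n\<close> is added; its discriminant gives the estimate.\<close>
  have est: "(B (\<phi> n) f - l f)\<^sup>2 \<le> B f f * (2 / real (Suc n))" if f: "V f" for f n
  proof -
    have "0 \<le> B f f * t\<^sup>2 + 2 * (B (\<phi> n) f - l f) * t + 2 / real (Suc n)" for t
    proof -
      have "m \<le> J (\<lambda>z. 1 * \<phi> n z + t * f z)" by (intro m V \<phi> f)
      also have "J (\<lambda>z. 1 * \<phi> n z + t * f z) = J (\<phi> n) + t * (B (\<phi> n) f - l f) + t\<^sup>2 * B f f / 2"
        unfolding J_def Bq[OF \<phi>(1) f] l[OF \<phi>(1) f] by (simp add: algebra_simps add_divide_distrib)
      finally have *: "m \<le> J (\<phi> n) + t * (B (\<phi> n) f - l f) + t\<^sup>2 * B f f / 2" .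
      from quadratic_min_aux[OF * \<phi>(2)] show ?thesis by (simp add: algebra_simps)
    qed
    then show ?thesis by (rule nonneg_quadratic_imp_discriminant) (rule pos[OF f])
  qed
  show thesis
  proof (rule that[of \<phi>])
    fix k n
    \<comment> \<open>Strict convexity: at the midpoint \<open>J\<close> lies below the mean of the
      two values by an eighth of the squared distance, yet not below the infimum.\<close>
    have "m \<le> J (\<lambda>z. (1/2) * \<phi> k z + (1/2) * \<phi> n z)" by (intro m V \<phi>)
    also have "\<dots> = (J (\<phi> k) + J (\<phi> n)) / 2 - B (\<lambda>z. 1 * \<phi> k z + (-1) * \<phi> n z) (\<lambda>z. 1 * \<phi> k z + (-1) * \<phi> n z) / 8"
      unfolding J_def Bq[OF \<phi>(1) \<phi>(1)] l[OF \<phi>(1) \<phi>(1)] by (simp add: power2_eq_square field_simps)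
    finally show "B (\<lambda>z. 1 * \<phi> k z + (-1) * \<phi> n z) (\<lambda>z. 1 * \<phi> k z + (-1) * \<phi> n z) \<le> 4 / real (Suc k) + 4 / real (Suc n)"
    proof -
      assume *: "m \<le> (J (\<phi> k) + J (\<phi> n)) / 2 - B (\<lambda>z. 1 * \<phi> k z + (-1) * \<phi> n z) (\<lambda>z. 1 * \<phi> k z + (-1) * \<phi> n z) / 8"
      from midpoint_min_aux[OF * \<phi>(2) \<phi>(2)] show ?thesis by simp
    qed
  next
    fix f assume f: "V f"
    have "(\<lambda>n. B (\<phi> n) f - l f) \<longlonglongrightarrow> 0"
    proof (rule Lim_null_comparison)
      show "\<forall>\<^sub>F n in sequentially. norm (B (\<phi> n) f - l f) \<le> sqrt (B f f * 2 * (1 / real (Suc n)))"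
        using est[OF f] by (intro always_eventually allI) (simp add: real_le_rsqrt)
      have "(\<lambda>n. sqrt (B f f * 2 * (1 / real (Suc n)))) \<longlonglongrightarrow> sqrt (B f f * 2 * 0)"
        by (intro tendsto_intros LIMSEQ_inverse_real_of_nat[unfolded inverse_eq_divide])
      then show "(\<lambda>n. sqrt (B f f * 2 * (1 / real (Suc n)))) \<longlonglongrightarrow> 0" by simp
    qed
    then show "(\<lambda>n. B (\<phi> n) f) \<longlonglongrightarrow> l f" by (rule Lim_null[THEN iffD2])
  next
    fix n
    \<comment> \<open>Testing \<open>est\<close> with \<open>f = \<phi> n\<close> itself gives
      \<open>|b\<^sup>2 - l (\<phi> n)| <= 2 b\<close>. Together with
      \<open>l (\<phi> n) <= C b\<close> this bounds \<open>b\<close> by \<open>C + 2\<close>,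
      independently of \<open>n\<close>.\<close>
    define b where "b = sqrt (B (\<phi> n) (\<phi> n))"
    have b: "b \<ge> 0" "b\<^sup>2 = B (\<phi> n) (\<phi> n)" using pos[OF \<phi>(1)] by (auto simp: b_def)
    have "(b\<^sup>2 - l (\<phi> n))\<^sup>2 \<le> b\<^sup>2 * (2 / real (Suc n))" using est[OF \<phi>(1), of n n] unfolding b(2) .
    also have "\<dots> \<le> b\<^sup>2 * 2\<^sup>2" by (intro mult_left_mono) (auto simp: field_simps)
    also have "\<dots> = (b * 2)\<^sup>2" by (rule power_mult_distrib[symmetric])
    finally have "\<bar>b\<^sup>2 - l (\<phi> n)\<bar> \<le> \<bar>b * 2\<bar>" unfolding abs_le_square_iff .
    then have "\<bar>b\<^sup>2 - l (\<phi> n)\<bar> \<le> b * 2" using b(1) by simp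
    then have "b * b \<le> (C + 2) * b" using C(1)[OF \<phi>(1), of n] unfolding b_def[symmetric] by (simp add: power2_eq_square algebra_simps)
    then show "sqrt (B (\<phi> n) (\<phi> n)) \<le> C + 2" unfolding b_def[symmetric]
      using b C(2) by (cases "b = 0") auto
  qed (rule \<phi>)
qed

lemma pairing_laplacian:
  assumes "test_function \<theta>" "L2 f"
  shows "pairing f (laplacian \<theta>) = pairing f (pdx (pdx \<theta>)) + pairing f (pdy (pdy \<theta>))"
  unfolding laplacian_def using assms by (intro pairing_add_right cc_L2[OF test_function_cc(4)] cc_L2[OF test_function_cc(5)])

text \<open>Dirichlet's principle on test functions with zero average, where the Poincare inequality
  makes the functional bounded and turns convergence of gradients into convergence of functions. The
  summand 2 in the norm bound stems from the near-minimizers; it is harmless, because the bound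
  serves only to keep the potentials bounded on compact time intervals.\<close>

lemma Poisson_solution:
  assumes g: "L2 g" and g0: "\<And>\<theta>. test_function \<theta> \<Longrightarrow> pairing g (xavg \<theta>) = 0"
  obtains \<psi> u v where "L2 \<psi>" "is_weak_dx \<psi> u" "is_weak_dy \<psi> v"
    "\<And>\<theta>. test_function \<theta> \<Longrightarrow> pairing \<psi> (laplacian \<theta>) = pairing g \<theta>"
    "\<And>\<theta>. test_function \<theta> \<Longrightarrow> pairing \<psi> (xavg \<theta>) = 0"
    "L2norm \<psi> \<le> 2 * pi * (2 * pi * L2norm g + 2)"
proof -
  define V where "V \<theta> \<longleftrightarrow> test_function \<theta> \<and> xavg \<theta> = (\<lambda>z. 0)" for \<theta>
  define B where "B f h = pairing (pdx f) (pdx h) + pairing (pdy f) (pdy h)" for f h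
  define l where "l f = - pairing g f" for f
  define C where "C = 2 * pi * L2norm g"
  have Vt: "V f \<Longrightarrow> test_function f" for f by (simp add: V_def)
  have Vlin: "V (\<lambda>z. a * f z + b * h z)" if "V f" "V h" for f h a b
  proof -
    note ct = integral_torus(1)[OF continuous_section_x[OF cc_continuous[OF test_function_cc(1)[OF Vt]]]]
    have "xavg (\<lambda>z. a * f z + b * h z) = (\<lambda>z. a * xavg f z + b * xavg h z)"
      using ct[OF that(1)] ct[OF that(2)] by (auto simp: xavg_def algebra_simps fun_eq_iff add_divide_distrib)
    then show ?thesis using that by (auto simp: V_def test_function_lincomb)
  qed
  have dl: "pdx (\<lambda>z. a * f z + b * h z) = (\<lambda>z. a * pdx f z + b * pdx h z)"
    "pdy (\<lambda>z. a * f z + b * h z) = (\<lambda>z. a * pdy f z + b * pdy h z)" if "V f" "V h" for f h a b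
    by (intro pdx_lincomb pdy_lincomb test_function_differentiable Vt that)+
  have tL: "L2 f" "L2 (pdx f)" "L2 (pdy f)" if "V f" for f
    by (intro cc_L2 test_function_cc Vt that)+
  have pl: "pairing (\<lambda>z. a * f z + b * h z) k = a * pairing f k + b * pairing h k" if "L2 f" "L2 h" "L2 k" for f h k a b
    using that by (simp add: pairing_add_left pairing_scale_left L2_scale)
  have Bself: "B f f = (L2norm (pdx f))\<^sup>2 + (L2norm (pdy f))\<^sup>2" for f by (simp add: B_def pairing_self)
  obtain \<phi> where \<phi>: "\<And>n. V (\<phi> n)"
    and Bc: "\<And>m n. B (\<lambda>z. 1 * \<phi> m z + (-1) * \<phi> n z) (\<lambda>z. 1 * \<phi> m z + (-1) * \<phi> n z) \<le> 4 / real (Suc m) + 4 / real (Suc n)"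
    and Bl: "\<And>f. V f \<Longrightarrow> (\<lambda>n. B (\<phi> n) f) \<longlonglongrightarrow> l f" and Bb: "\<And>n. sqrt (B (\<phi> n) (\<phi> n)) \<le> C + 2"
  proof (rule Riesz_minimizing_sequence[of V "\<lambda>z. 0" B l C])
    have "test_function (\<lambda>z. 0)"
      using test_function_lincomb[OF test_function_mode[OF csmooth_scaled_cutoff[of 1], of 0 0 0] test_function_mode[OF csmooth_scaled_cutoff[of 1], of 0 0 0], of 0 0] by simp
    then show "V (\<lambda>z. 0)" by (auto simp: V_def xavg_def)
    show "V (\<lambda>z. a * f z + b * h z)" if "V f" "V h" for f h a b using that by (rule Vlin)
    show "B (\<lambda>z. a * f z + b * h z) k = a * B f k + b * B h k" if "V f" "V h" "V k" for f h k a b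
      using that tL by (simp add: B_def dl pl algebra_simps)
    show "B f h = B h f" for f h by (simp add: B_def pairing_commute)
    show "0 \<le> B f f" for f by (simp add: Bself)
    show "l (\<lambda>z. a * f z + b * h z) = a * l f + b * l h" if "V f" "V h" for f h a b
      using pl[of f h g a b] tL that g by (simp add: l_def pairing_commute[of g])
    show "\<bar>l f\<bar> \<le> C * sqrt (B f f)" if "V f" for f
    proof -
      have "\<bar>l f\<bar> \<le> L2norm g * L2norm f" unfolding l_def using pairing_le[OF g tL(1)[OF that]] by simp
      also have "\<dots> \<le> L2norm g * (2 * pi * L2norm (pdx f))" using that by (intro mult_left_mono poincare) (auto simp: V_def)
      also have "L2norm (pdx f) \<le> sqrt (B f f)" unfolding Bself by (rule real_le_rsqrt) simp
      then have "L2norm g * (2 * pi * L2norm (pdx f)) \<le> C * sqrt (B f f)" unfolding C_def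
        by (simp add: mult.assoc mult.left_commute mult_left_mono)
      finally show ?thesis .
    qed
    show "0 \<le> C" by (simp add: C_def)
  qed blast
  have D: "L2norm (\<lambda>z. \<phi> m z - \<phi> n z) \<le> 2 * pi * L2norm (\<lambda>z. pdx (\<phi> m) z - pdx (\<phi> n) z)" for m n
    using poincare[of "\<lambda>z. 1 * \<phi> m z + (-1) * \<phi> n z"] Vlin[OF \<phi> \<phi>, of 1 m "-1" n] dl(1)[OF \<phi> \<phi>, of 1 m "-1" n]
    by (simp add: V_def)
  have D2: "L2norm (\<lambda>z. pdx (\<phi> m) z - pdx (\<phi> n) z) \<le> sqrt (4 / real (Suc m) + 4 / real (Suc n))"
    "L2norm (\<lambda>z. pdy (\<phi> m) z - pdy (\<phi> n) z) \<le> sqrt (4 / real (Suc m) + 4 / real (Suc n))" for m n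
    using Bc[of m n] dl[OF \<phi> \<phi>, of 1 m "-1" n] unfolding Bself
    by (auto intro!: real_le_rsqrt elim: order_trans[rotated])
  have cau: "\<exists>N. \<forall>m\<ge>N. \<forall>n\<ge>N. K * sqrt (4 / real (Suc m) + 4 / real (Suc n)) \<le> e" if "e > 0" "K > 0" for e K :: real
  proof -
    obtain N where N: "8 / (e / K)\<^sup>2 \<le> real N" using real_arch_simple by blast
    have "K * sqrt (4 / real (Suc m) + 4 / real (Suc n)) \<le> e" if mn: "m \<ge> N" "n \<ge> N" for m n
    proof -
      have "4 / real (Suc m) + 4 / real (Suc n) \<le> 4 / real (Suc N) + 4 / real (Suc N)"
        using mn by (intro add_mono divide_left_mono) auto
      also have "\<dots> \<le> (e / K)\<^sup>2"
      proof -
        have "4 / n + 4 / n \<le> r" if "8 / r \<le> n" "r > 0" "n > 0" for r n :: real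
          using that by (simp add: field_simps)
        from this[of "(e / K)\<^sup>2" "real (Suc N)"] N show ?thesis using \<open>e > 0\<close> \<open>K > 0\<close> by simp
      qed
      finally have "sqrt (4 / real (Suc m) + 4 / real (Suc n)) \<le> e / K" using \<open>e > 0\<close> \<open>K > 0\<close> by (intro real_le_lsqrt) auto
      then show ?thesis using \<open>K > 0\<close> by (simp add: field_simps)
    qed
    then show ?thesis by blast
  qed
  obtain \<psi> where \<psi>: "L2 \<psi>" "(\<lambda>n. L2norm (\<lambda>z. \<phi> n z - \<psi> z)) \<longlonglongrightarrow> 0"
  proof (rule L2_complete[of \<phi>])
    fix e :: real assume "e > 0"
    from cau[OF this, of "2 * pi"] obtain N where N: "\<And>m n. m \<ge> N \<Longrightarrow> n \<ge> N \<Longrightarrow> 2 * pi * sqrt (4 / real (Suc m) + 4 / real (Suc n)) \<le> e" by auto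
    have "L2norm (\<lambda>z. \<phi> m z - \<phi> n z) \<le> e" if "m \<ge> N" "n \<ge> N" for m n
    proof -
      have "2 * pi * L2norm (\<lambda>z. pdx (\<phi> m) z - pdx (\<phi> n) z) \<le> 2 * pi * sqrt (4 / real (Suc m) + 4 / real (Suc n))"
        by (intro mult_left_mono D2) simp
      then show ?thesis using D[of m n] N[OF that] by linarith
    qed
    then show "\<exists>N. \<forall>m\<ge>N. \<forall>n\<ge>N. L2norm (\<lambda>z. \<phi> m z - \<phi> n z) \<le> e" by blast
  qed (use tL \<phi> in blast)+
  obtain u where u: "L2 u" "(\<lambda>n. L2norm (\<lambda>z. pdx (\<phi> n) z - u z)) \<longlonglongrightarrow> 0"
  proof (rule L2_complete[of "\<lambda>n. pdx (\<phi> n)"])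
    fix e :: real assume "e > 0"
    from cau[OF this, of 1] show "\<exists>N. \<forall>m\<ge>N. \<forall>n\<ge>N. L2norm (\<lambda>z. pdx (\<phi> m) z - pdx (\<phi> n) z) \<le> e"
      using order_trans[OF D2(1)] unfolding mult_1 by (meson zero_less_one)
  qed (use tL \<phi> in blast)+
  obtain v where v: "L2 v" "(\<lambda>n. L2norm (\<lambda>z. pdy (\<phi> n) z - v z)) \<longlonglongrightarrow> 0"
  proof (rule L2_complete[of "\<lambda>n. pdy (\<phi> n)"])
    fix e :: real assume "e > 0"
    from cau[OF this, of 1] show "\<exists>N. \<forall>m\<ge>N. \<forall>n\<ge>N. L2norm (\<lambda>z. pdy (\<phi> m) z - pdy (\<phi> n) z) \<le> e"
      using order_trans[OF D2(2)] unfolding mult_1 by (meson zero_less_one)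
  qed (use tL \<phi> in blast)+
  have lim: "(\<lambda>n. pairing (\<phi> n) h) \<longlonglongrightarrow> pairing \<psi> h" "(\<lambda>n. pairing (pdx (\<phi> n)) h) \<longlonglongrightarrow> pairing u h"
    "(\<lambda>n. pairing (pdy (\<phi> n)) h) \<longlonglongrightarrow> pairing v h" if "L2 h" for h
    using pairing_tendsto[OF tL(1)[OF \<phi>] \<psi>(1) that \<psi>(2)] pairing_tendsto[OF tL(2)[OF \<phi>] u(1) that u(2)]
      pairing_tendsto[OF tL(3)[OF \<phi>] v(1) that v(2)] .
  \<comment> \<open>Stated for functions more general than test functions, since the Laplacian
    requires it for \<open>h = pdx \<theta>\<close>, where differentiability, support and
    periodicity are what is at hand.\<close>
  have wx: "pairing \<psi> (pdx h) = - pairing u h"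
    if h: "\<And>z. h differentiable (at z)" "cc h" "cc (pdx h)" "\<And>x y. h (x + 2 * pi, y) = h (x, y)" for h
  proof -
    have "pairing (\<phi> n) (pdx h) = - pairing (pdx (\<phi> n)) h" for n
      by (intro integral_by_parts_x test_function_differentiable test_function_cc test_function_periodic Vt \<phi> h)
    then show ?thesis using LIMSEQ_unique[OF lim(1)[OF cc_L2[OF h(3)]]] tendsto_minus[OF lim(2)[OF cc_L2[OF h(2)]]] by simp
  qed
  have wy: "pairing \<psi> (pdy h) = - pairing v h"
    if h: "\<And>z. h differentiable (at z)" "cc h" "cc (pdy h)" for h
  proof -
    have "pairing (\<phi> n) (pdy h) = - pairing (pdy (\<phi> n)) h" for n
      by (intro integral_by_parts_y test_function_differentiable test_function_cc Vt \<phi> h)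
    then show ?thesis using LIMSEQ_unique[OF lim(1)[OF cc_L2[OF h(3)]]] tendsto_minus[OF lim(3)[OF cc_L2[OF h(2)]]] by simp
  qed
  have avg: "pairing \<psi> (xavg \<theta>) = 0" if t: "test_function \<theta>" for \<theta>
  proof -
    have L: "L2 (xavg \<theta>)" by (intro cc_L2 test_function_cc test_function_xavg t)
    have "pairing (\<phi> n) (xavg \<theta>) = 0" for n
      using pairing_xavg_commute[OF tL(1)[OF \<phi>] cc_L2[OF test_function_cc(1)[OF t]], of n] \<phi>[of n] by (simp add: V_def pairing_def)
    then show ?thesis using LIMSEQ_unique[OF lim(1)[OF L]] by simp
  qed
  have lap: "pairing \<psi> (laplacian \<theta>) = - (pairing u (pdx \<theta>) + pairing v (pdy \<theta>))" if t: "test_function \<theta>" for \<theta>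
    unfolding pairing_laplacian[OF t \<psi>(1)]
    by (subst wx wy; (intro test_function_differentiable test_function_cc test_function_periodic t)?)+ simp
  have main: "pairing \<psi> (laplacian \<theta>) = pairing g \<theta>" if "V \<theta>" for \<theta>
  proof -
    have "(\<lambda>n. B (\<phi> n) \<theta>) \<longlonglongrightarrow> pairing u (pdx \<theta>) + pairing v (pdy \<theta>)"
      unfolding B_def by (intro tendsto_add lim tL that)
    then have "pairing u (pdx \<theta>) + pairing v (pdy \<theta>) = l \<theta>" using Bl[OF that] LIMSEQ_unique by blast
    then show ?thesis using lap[OF Vt[OF that]] by (simp add: l_def)
  qed
  show thesis
  proof (rule that[OF \<psi>(1)])
    show "is_weak_dx \<psi> u" unfolding is_weak_dx_def
      using u(1) by (auto intro!: wx test_function_differentiable test_function_cc test_function_periodic)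
    show "is_weak_dy \<psi> v" unfolding is_weak_dy_def
      using v(1) by (auto intro!: wy test_function_differentiable test_function_cc)
    show "pairing \<psi> (xavg \<theta>) = 0" if "test_function \<theta>" for \<theta> using avg[OF that] .
    show "L2norm \<psi> \<le> 2 * pi * (2 * pi * L2norm g + 2)"
    proof (rule LIMSEQ_le_const2[OF L2norm_tendsto[OF tL(1)[OF \<phi>] \<psi>]], intro exI allI impI)
      fix n
      have "L2norm (\<phi> n) \<le> 2 * pi * L2norm (pdx (\<phi> n))" using \<phi>[of n] by (intro poincare) (auto simp: V_def)
      also have "L2norm (pdx (\<phi> n)) \<le> sqrt (B (\<phi> n) (\<phi> n))" unfolding Bself by (rule real_le_rsqrt) simp
      also have "\<dots> \<le> 2 * pi * L2norm g + 2" using Bb[of n] by (simp add: C_def)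
      finally show "L2norm (\<phi> n) \<le> 2 * pi * (2 * pi * L2norm g + 2)" by simp
    qed
    \<comment> \<open>The minimization provides the equation for zero-average test functions. A
      general \<open>\<theta>\<close> is split into \<open>fluct \<theta>\<close> and
      \<open>xavg \<theta>\<close>: both sides vanish on the second part, the left one because
      \<open>\<psi>\<close> is orthogonal to functions of \<open>y\<close>, the right one by
      \<open>g0\<close>.\<close>
    fix \<theta> assume t: "test_function \<theta>"
    have tx: "test_function (xavg \<theta>)" "test_function (fluct \<theta>)" by (intro test_function_xavg test_function_fluct t)+
    have xx: "xavg (xavg f) = xavg f" for f by (rule xavg_indep) (simp add: xavg_def)
    have Vf: "V (fluct \<theta>)"
    proof -
      note ct = integral_torus(1)[OF continuous_section_x[OF cc_continuous[OF test_function_cc(1)]]]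
      have "xavg (fluct \<theta>) = (\<lambda>z. xavg \<theta> z - xavg (xavg \<theta>) z)"
      proof -
        have "xavg (\<lambda>z. f z - h z) = (\<lambda>z. xavg f z - xavg h z)"
          if "\<And>y. integrable torus (\<lambda>s. f (s, y))" "\<And>y. integrable torus (\<lambda>s. h (s, y))" for f h
          using that by (auto simp: xavg_def fun_eq_iff diff_divide_distrib)
        then show ?thesis unfolding fluct_def using ct[OF t] ct[OF tx(1)] by blast
      qed
      then show ?thesis using tx by (simp add: V_def xx)
    qed
    have "laplacian (xavg \<theta>) = xavg (pdy (pdy \<theta>))"
      unfolding laplacian_def pdx_xavg
      using pdy_xavg(1)[OF test_function_differentiable(1)[OF t] cc_continuous[OF test_function_cc(3)[OF t]]]
        pdy_xavg(1)[OF test_function_differentiable(3)[OF t] cc_continuous[OF test_function_cc(5)[OF t]]]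
      by (auto simp: pdx_def)
    moreover have "pairing \<psi> (xavg (pdy (pdy \<theta>))) = 0"
    proof -
      have L: "L2 (pdy (pdy \<theta>))" by (intro cc_L2 test_function_cc t)
      have "pairing (\<phi> n) (xavg (pdy (pdy \<theta>))) = 0" for n
        using pairing_xavg_commute[OF tL(1)[OF \<phi>] L, of n] \<phi>[of n] by (simp add: V_def pairing_def)
      then show ?thesis using LIMSEQ_unique[OF lim(1)[OF xavg_L2(1)[OF L]]] by simp
    qed
    ultimately have l0: "pairing \<psi> (laplacian (xavg \<theta>)) = 0" by simp
    have "laplacian (fluct \<theta>) = (\<lambda>z. laplacian \<theta> z - laplacian (xavg \<theta>) z)"
    proof -
      have "fluct \<theta> = (\<lambda>z. 1 * \<theta> z + (-1) * xavg \<theta> z)" by (simp add: fluct_def[abs_def])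
      moreover note lin = test_function_differentiable[OF t] test_function_differentiable[OF tx(1)]
      ultimately show ?thesis unfolding laplacian_def by (simp only: pdx_lincomb pdy_lincomb lin) (simp add: algebra_simps)
    qed
    moreover have LL: "L2 (laplacian \<theta>)" "L2 (laplacian (xavg \<theta>))"
      unfolding laplacian_def by (intro L2_add cc_L2 test_function_cc t tx)+
    ultimately have "pairing \<psi> (laplacian (fluct \<theta>)) = pairing \<psi> (laplacian \<theta>)"
      using l0 pairing_diff_right[OF LL \<psi>(1)] by simp
    moreover have "pairing g (fluct \<theta>) = pairing g \<theta>"
      unfolding fluct_def using g0[OF t] g by (subst pairing_diff_right) (auto intro!: cc_L2 test_function_cc t tx)
    ultimately show "pairing \<psi> (laplacian \<theta>) = pairing g \<theta>" using main[OF Vf] by simp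
  qed
qed

section \<open>Fourier series on a box\<close>

definition l2c :: "'a measure \<Rightarrow> ('a \<Rightarrow> complex) \<Rightarrow> bool" where
  "l2c M f \<longleftrightarrow> f \<in> borel_measurable M \<and> integrable M (\<lambda>z. (cmod (f z))\<^sup>2)"

text \<open>Working with the square of the norm avoids roots; the triangle inequality is replaced by
  \<open>|a + b|\<^sup>2 <= 2 |a|\<^sup>2 + 2 |b|\<^sup>2\<close>, which suffices for density
  arguments.\<close>

definition n2 :: "'a measure \<Rightarrow> ('a \<Rightarrow> complex) \<Rightarrow> real" where
  "n2 M f = (\<integral>z. (cmod (f z))\<^sup>2 \<partial>M)"

lemma cmod_add_sq: "(cmod (a + b))\<^sup>2 \<le> 2 * (cmod a)\<^sup>2 + 2 * (cmod b)\<^sup>2"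
proof -
  have "(cmod (a + b))\<^sup>2 \<le> (cmod a + cmod b)\<^sup>2" by (intro power_mono norm_triangle_ineq) simp
  also have "\<dots> \<le> 2 * (cmod a)\<^sup>2 + 2 * (cmod b)\<^sup>2"
    using zero_le_power2[of "cmod a - cmod b"] unfolding power2_sum power2_diff by linarith
  finally show ?thesis .
qed

lemma l2c_add: assumes "l2c M f" "l2c M g"
  shows "l2c M (\<lambda>z. f z + g z)" "n2 M (\<lambda>z. f z + g z) \<le> 2 * n2 M f + 2 * n2 M g"
proof -
  have [measurable]: "f \<in> borel_measurable M" "g \<in> borel_measurable M"
    and i: "integrable M (\<lambda>z. (cmod (f z))\<^sup>2)" "integrable M (\<lambda>z. (cmod (g z))\<^sup>2)"
    using assms by (auto simp: l2c_def)
  have i2: "integrable M (\<lambda>z. 2 * (cmod (f z))\<^sup>2 + 2 * (cmod (g z))\<^sup>2)" using i by simp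
  have i3: "integrable M (\<lambda>z. (cmod (f z + g z))\<^sup>2)"
    by (rule Bochner_Integration.integrable_bound[OF i2]) (use cmod_add_sq in auto)
  then show "l2c M (\<lambda>z. f z + g z)" by (simp add: l2c_def)
  have "n2 M (\<lambda>z. f z + g z) \<le> (\<integral>z. 2 * (cmod (f z))\<^sup>2 + 2 * (cmod (g z))\<^sup>2 \<partial>M)"
    unfolding n2_def by (intro integral_mono i2 i3 cmod_add_sq)
  also have "\<dots> = 2 * n2 M f + 2 * n2 M g" unfolding n2_def using i by simp
  finally show "n2 M (\<lambda>z. f z + g z) \<le> 2 * n2 M f + 2 * n2 M g" .
qed

lemma l2c_scale: assumes "l2c M f" shows "l2c M (\<lambda>z. c * f z)" "n2 M (\<lambda>z. c * f z) = (cmod c)\<^sup>2 * n2 M f"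
  using assms by (auto simp: l2c_def n2_def norm_mult power_mult_distrib)

lemma l2c_diff: "l2c M f \<Longrightarrow> l2c M g \<Longrightarrow> l2c M (\<lambda>z. f z - g z)"
  using l2c_add(1)[OF _ l2c_scale(1)[of M g "-1"]] by simp

text \<open>Dominated convergence. The bound \<open>2 |f|\<close> is the one that the approximation
  of a measurable function by simple functions provides.\<close>

lemma l2c_dominated:
  assumes f: "l2c M f" and g [measurable]: "\<And>n. g n \<in> borel_measurable M"
    and lim: "\<And>z. z \<in> space M \<Longrightarrow> (\<lambda>n. g n z) \<longlonglongrightarrow> f z"
    and bd: "\<And>n z. z \<in> space M \<Longrightarrow> cmod (g n z) \<le> 2 * cmod (f z)"
  shows "\<And>n. l2c M (g n)" "(\<lambda>n. n2 M (\<lambda>z. f z - g n z)) \<longlonglongrightarrow> 0"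
proof -
  have fm [measurable]: "f \<in> borel_measurable M" and fi: "integrable M (\<lambda>z. (cmod (f z))\<^sup>2)"
    using f by (auto simp: l2c_def)
  show "l2c M (g n)" for n unfolding l2c_def
  proof
    show "integrable M (\<lambda>z. (cmod (g n z))\<^sup>2)"
    proof (rule Bochner_Integration.integrable_bound)
      show "integrable M (\<lambda>z. 4 * (cmod (f z))\<^sup>2)" using fi by simp
      show "AE z in M. norm ((cmod (g n z))\<^sup>2) \<le> norm (4 * (cmod (f z))\<^sup>2)"
        by (intro AE_I2) (use power_mono[OF bd[of _ n], of _ 2] in \<open>simp add: power_mult_distrib\<close>)
    qed measurable
  qed fact
  have "(\<lambda>n. \<integral>z. (cmod (f z - g n z))\<^sup>2 \<partial>M) \<longlonglongrightarrow> (\<integral>z. 0 \<partial>M)"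
  proof (rule integral_dominated_convergence[where w = "\<lambda>z. 9 * (cmod (f z))\<^sup>2"])
    show "AE z in M. (\<lambda>n. (cmod (f z - g n z))\<^sup>2) \<longlonglongrightarrow> 0"
    proof (rule AE_I2)
      fix z assume "z \<in> space M"
      then have "(\<lambda>n. (cmod (f z - g n z))\<^sup>2) \<longlonglongrightarrow> (cmod (f z - f z))\<^sup>2" by (intro tendsto_intros lim)
      then show "(\<lambda>n. (cmod (f z - g n z))\<^sup>2) \<longlonglongrightarrow> 0" by simp
    qed
    show "AE z in M. norm ((cmod (f z - g n z))\<^sup>2) \<le> 9 * (cmod (f z))\<^sup>2" for n
    proof (rule AE_I2)
      fix z assume z: "z \<in> space M"
      have "cmod (f z - g n z) \<le> 3 * cmod (f z)" using norm_triangle_ineq4[of "f z" "g n z"] bd[OF z, of n] by linarith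
      from power_mono[OF this, of 2] show "norm ((cmod (f z - g n z))\<^sup>2) \<le> 9 * (cmod (f z))\<^sup>2" by (simp add: power_mult_distrib)
    qed
  qed (use fi in \<open>simp_all\<close>)
  then show "(\<lambda>n. n2 M (\<lambda>z. f z - g n z)) \<longlonglongrightarrow> 0" by (simp add: n2_def)
qed

text \<open>The sets whose indicator belongs to the class form a Dynkin system: complements by
  subtraction from the indicator of the whole space, disjoint unions by L2 convergence. Being
  generated by an intersection-stable family, all measurable sets are reached, and simple functions
  approximate the rest.\<close>

lemma (in finite_measure) l2c_dense_class:
  fixes C :: "('a \<Rightarrow> complex) \<Rightarrow> bool"
  assumes Cl: "\<And>f. C f \<Longrightarrow> l2c M f" and add: "\<And>f g. C f \<Longrightarrow> C g \<Longrightarrow> C (\<lambda>z. f z + g z)"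
    and sc: "\<And>f c. C f \<Longrightarrow> C (\<lambda>z. c * f z)"
    and cl: "\<And>f. l2c M f \<Longrightarrow> (\<And>e. e > 0 \<Longrightarrow> \<exists>g. C g \<and> n2 M (\<lambda>z. f z - g z) < e) \<Longrightarrow> C f"
    and G: "Int_stable G" "G \<subseteq> Pow (space M)" "sets M = sigma_sets (space M) G"
    and bas: "\<And>A. A \<in> G \<Longrightarrow> C (indicator A)" and sp: "C (indicator (space M))"
    and f: "l2c M f"
  shows "C f"
proof -
  have cl2: "C f" if "l2c M f" "(\<lambda>n. n2 M (\<lambda>z. f z - g n z)) \<longlonglongrightarrow> 0" "\<And>n. C (g n)" for f and g :: "nat \<Rightarrow> 'a \<Rightarrow> complex"
  proof (rule cl[OF that(1)])
    fix e :: real assume "e > 0"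
    from LIMSEQ_D[OF that(2) this] obtain n where "norm (n2 M (\<lambda>z. f z - g n z) - 0) < e" by blast
    then show "\<exists>g. C g \<and> n2 M (\<lambda>z. f z - g z) < e" using that(3) by (auto intro!: exI[of _ "g n"])
  qed
  have cong: "C f" if "C g" "f \<in> borel_measurable M" "\<And>z. z \<in> space M \<Longrightarrow> f z = g z" for f g
  proof (rule cl)
    have "integrable M (\<lambda>z. (cmod (f z))\<^sup>2) = integrable M (\<lambda>z. (cmod (g z))\<^sup>2)"
      by (rule Bochner_Integration.integrable_cong) (use that in auto)
    then show "l2c M f" using Cl[OF that(1)] that(2) by (simp add: l2c_def)
    have "n2 M (\<lambda>z. f z - g z) = (\<integral>z. 0 \<partial>M)" unfolding n2_def
      by (rule Bochner_Integration.integral_cong) (use that in auto)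
    then show "\<exists>g. C g \<and> n2 M (\<lambda>z. f z - g z) < e" if "e > 0" for e using \<open>C g\<close> that by auto
  qed
  have zero: "C (\<lambda>z. 0)" using sc[OF sp, of 0] by simp
  have sum: "finite I \<Longrightarrow> (\<And>i. i \<in> I \<Longrightarrow> C (F i)) \<Longrightarrow> C (\<lambda>z. \<Sum>i\<in>I. F i z)" for I and F :: "'i \<Rightarrow> 'a \<Rightarrow> complex"
    by (induct I rule: finite_induct) (auto intro: zero add)
  have ind: "l2c M (indicator A)" if "A \<in> sets M" for A
    using that unfolding l2c_def by (auto simp: indicator_def if_distrib[of cmod] if_distrib[of "\<lambda>x. x\<^sup>2"] cong: if_cong
       intro!: integrable_const_bound[of _ 1])
  have "C (indicator A)" if "A \<in> sets M" for A
  proof (rule sigma_sets_induct_disjoint[OF G(1,2) that[unfolded G(3)]])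
    show "C (indicator {})" using zero by (simp add: indicator_def[abs_def])
    show "C (indicator A)" if "A \<in> G" for A using bas that .
    show "C (indicator (space M - A))" if "A \<in> sigma_sets (space M) G" "C (indicator A)" for A
    proof -
      have A: "A \<in> sets M" using that G(3) by simp
      have "C (\<lambda>z. indicator (space M) z + (-1) * indicator A z)" by (intro add sc sp that)
      then show ?thesis by (rule cong) (use A in \<open>auto simp: indicator_def\<close>)
    qed
    fix A :: "nat \<Rightarrow> 'a set" assume A: "disjoint_family A" "range A \<subseteq> sigma_sets (space M) G" "\<And>i. C (indicator (A i))"
    then have As [measurable]: "A i \<in> sets M" for i using G(3) by auto
    have eq: "(\<Sum>i<n. indicator (A i) z) = (indicator (\<Union>i<n. A i) z :: complex)" for n z
      using disjoint_family_on_mono[OF subset_UNIV A(1)] by (subst indicator_UN_disjoint[symmetric]) auto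
    show "C (indicator (\<Union>i. A i))"
    proof (rule cl2)
      show l: "l2c M (indicator (\<Union>i. A i))" by (intro ind) measurable
      show "(\<lambda>n. n2 M (\<lambda>z. indicator (\<Union>i. A i) z - (\<Sum>i<n. indicator (A i) z))) \<longlonglongrightarrow> 0"
        unfolding eq
      proof (rule l2c_dominated(2)[OF l])
        show "(\<lambda>n. indicator (\<Union>i<n. A i) z) \<longlonglongrightarrow> (indicator (\<Union>i. A i) z :: complex)" for z
          by (rule LIMSEQ_indicator_UN)
      qed (auto simp: indicator_def)
      show "C (\<lambda>z. \<Sum>i<n. indicator (A i) z)" for n by (intro sum A) auto
    qed
  qed
  note Cind = this
  from f have fm: "f \<in> borel_measurable M" by (simp add: l2c_def)
  obtain s where s: "\<And>i. simple_function M (s i)" "\<And>z. z \<in> space M \<Longrightarrow> (\<lambda>i. s i z) \<longlonglongrightarrow> f z"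
    "\<And>i z. z \<in> space M \<Longrightarrow> cmod (s i z) \<le> 2 * cmod (f z)"
    using borel_measurable_implies_sequence_metric[OF fm, of 0] unfolding norm_conv_dist by metis
  show "C f"
  proof (rule cl2[OF f l2c_dominated(2)[OF f _ s(2,3)]])
    show sm: "s i \<in> borel_measurable M" for i by (rule borel_measurable_simple_function[OF s(1)])
    show "C (s i)" for i
    proof (rule cong)
      show "C (\<lambda>z. \<Sum>v\<in>s i ` space M. v * indicator (s i -` {v} \<inter> space M) z)"
        using s(1)[of i] unfolding simple_function_def by (intro sum sc Cind) auto
      show "s i z = (\<Sum>v\<in>s i ` space M. v * indicator (s i -` {v} \<inter> space M) z)" if "z \<in> space M" for z
      proof -
        have fin: "finite (s i ` space M)" using s(1)[of i] by (simp add: simple_function_def)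
        have "(\<Sum>v\<in>s i ` space M. v * indicator (s i -` {v} \<inter> space M) z) = (\<Sum>v\<in>s i ` space M. if s i z = v then v else 0)"
          using that by (intro sum.cong) (auto simp: indicator_def)
        also have "\<dots> = s i z" using fin that by (simp add: sum.delta)
        finally show ?thesis by simp
      qed
    qed (rule sm)
  qed
qed

inductive lspan :: "('a \<Rightarrow> complex) set \<Rightarrow> ('a \<Rightarrow> complex) \<Rightarrow> bool" for S where
  base: "f \<in> S \<Longrightarrow> lspan S (\<lambda>z. c * f z)"
| add: "lspan S f \<Longrightarrow> lspan S g \<Longrightarrow> lspan S (\<lambda>z. f z + g z)"

lemma lspan_scale: "lspan S f \<Longrightarrow> lspan S (\<lambda>z. c * f z)"
proof (induct rule: lspan.induct)
  case (base f a)
  then show ?case using lspan.base[of f S "c * a"] by (simp add: mult.assoc)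
next
  case (add f g)
  then show ?case using lspan.add by (simp add: distrib_left)
qed

definition l2cl :: "'a measure \<Rightarrow> ('a \<Rightarrow> complex) set \<Rightarrow> ('a \<Rightarrow> complex) \<Rightarrow> bool" where
  "l2cl M S f \<longleftrightarrow> l2c M f \<and> (\<forall>e>0. \<exists>T. lspan S T \<and> n2 M (\<lambda>z. f z - T z) < e)"

lemma l2c_lspan: "(\<And>f. f \<in> S \<Longrightarrow> l2c M f) \<Longrightarrow> lspan S T \<Longrightarrow> l2c M T"
proof -
  assume S: "\<And>f. f \<in> S \<Longrightarrow> l2c M f"
  assume "lspan S T" then show ?thesis by induct (auto intro: l2c_add(1) l2c_scale(1) S)
qed

lemma lspan_l2cl: assumes "\<And>f. f \<in> S \<Longrightarrow> l2c M f" "lspan S T" shows "l2cl M S T"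
  unfolding l2cl_def using assms l2c_lspan[OF assms] by (auto intro!: exI[of _ T] simp: n2_def)

lemma l2cl_add:
  assumes S: "\<And>f. f \<in> S \<Longrightarrow> l2c M f" and "l2cl M S f" "l2cl M S g"
  shows "l2cl M S (\<lambda>z. f z + g z)"
  unfolding l2cl_def
proof (intro conjI allI impI)
  have l: "l2c M f" "l2c M g" using assms by (auto simp: l2cl_def)
  then show "l2c M (\<lambda>z. f z + g z)" by (rule l2c_add)
  fix e :: real assume "e > 0"
  then obtain T U where TU: "lspan S T" "n2 M (\<lambda>z. f z - T z) < e / 4" "lspan S U" "n2 M (\<lambda>z. g z - U z) < e / 4"
    using assms(2,3) unfolding l2cl_def by (meson divide_pos_pos zero_less_numeral)
  have "n2 M (\<lambda>z. (f z + g z) - (T z + U z)) = n2 M (\<lambda>z. (f z - T z) + (g z - U z))" by (simp add: algebra_simps)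
  also have "\<dots> \<le> 2 * n2 M (\<lambda>z. f z - T z) + 2 * n2 M (\<lambda>z. g z - U z)"
    by (intro l2c_add l2c_diff l l2c_lspan[OF S TU(1)] l2c_lspan[OF S TU(3)])
  finally show "\<exists>T. lspan S T \<and> n2 M (\<lambda>z. f z + g z - T z) < e"
    using TU by (intro exI[of _ "\<lambda>z. T z + U z"]) (auto intro: lspan.add)
qed

lemma l2cl_scale:
  assumes "l2cl M S f" shows "l2cl M S (\<lambda>z. c * f z)"
  unfolding l2cl_def
proof (intro conjI allI impI)
  have l: "l2c M f" using assms by (auto simp: l2cl_def)
  then show "l2c M (\<lambda>z. c * f z)" by (rule l2c_scale)
  fix e :: real assume "e > 0"
  then have "e / ((cmod c)\<^sup>2 + 1) > 0" by (simp add: add_nonneg_pos)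
  then obtain T where T: "lspan S T" "n2 M (\<lambda>z. f z - T z) < e / ((cmod c)\<^sup>2 + 1)"
    using assms unfolding l2cl_def by blast
  have n0: "n2 M (\<lambda>z. f z - T z) \<ge> 0" by (simp add: n2_def)
  have "n2 M (\<lambda>z. c * f z - c * T z) = (cmod c)\<^sup>2 * n2 M (\<lambda>z. f z - T z)"
    by (simp add: n2_def right_diff_distrib[symmetric] norm_mult power_mult_distrib)
  also have "\<dots> \<le> ((cmod c)\<^sup>2 + 1) * n2 M (\<lambda>z. f z - T z)" using n0 by (intro mult_right_mono) auto
  also have "\<dots> < e" using T(2) add_nonneg_pos[of "(cmod c)\<^sup>2" 1] by (simp add: pos_less_divide_eq mult.commute)
  finally show "\<exists>T. lspan S T \<and> n2 M (\<lambda>z. c * f z - T z) < e"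
    using T by (intro exI[of _ "\<lambda>z. c * T z"]) (auto intro: lspan_scale)
qed

lemma l2cl_closed:
  assumes S: "\<And>f. f \<in> S \<Longrightarrow> l2c M f" and f: "l2c M f"
    and a: "\<And>e. e > 0 \<Longrightarrow> \<exists>g. l2cl M S g \<and> n2 M (\<lambda>z. f z - g z) < e"
  shows "l2cl M S f"
  unfolding l2cl_def
proof (intro conjI allI impI f)
  fix e :: real assume "e > 0"
  then obtain g where g: "l2cl M S g" "n2 M (\<lambda>z. f z - g z) < e / 4" using a[of "e / 4"] by auto
  then obtain T where T: "lspan S T" "n2 M (\<lambda>z. g z - T z) < e / 4" using \<open>e > 0\<close> unfolding l2cl_def by (meson divide_pos_pos zero_less_numeral)
  have "n2 M (\<lambda>z. f z - T z) = n2 M (\<lambda>z. (f z - g z) + (g z - T z))" by simp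
  also have "\<dots> \<le> 2 * n2 M (\<lambda>z. f z - g z) + 2 * n2 M (\<lambda>z. g z - T z)"
    using g(1) by (intro l2c_add l2c_diff f l2c_lspan[OF S T(1)]) (auto simp: l2cl_def)
  finally show "\<exists>T. lspan S T \<and> n2 M (\<lambda>z. f z - T z) < e" using T g by auto
qed

lemma (in finite_measure) l2cl_dense:
  assumes S: "\<And>f. f \<in> S \<Longrightarrow> l2c M f"
    and G: "Int_stable G" "G \<subseteq> Pow (space M)" "sets M = sigma_sets (space M) G"
    and bas: "\<And>A. A \<in> G \<Longrightarrow> l2cl M S (indicator A)" and sp: "l2cl M S (indicator (space M))"
    and f: "l2c M f"
  shows "l2cl M S f"
  by (rule l2c_dense_class[where C = "l2cl M S", OF _ l2cl_add[OF S] l2cl_scale l2cl_closed[OF S] G bas sp f])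
    (auto simp: l2cl_def)

section \<open>Trigonometric polynomials are dense on an interval\<close>

definition ivl :: "real \<Rightarrow> real \<Rightarrow> real measure" where
  "ivl c P = restrict_space lborel {c..<c + P}"

text \<open>The interval is half-open so that the circle is an instance; one theory of density and
  orthogonality then serves both factors of the box.\<close>

lemma torus_ivl: "torus = ivl 0 (2 * pi)" by (simp add: torus_def ivl_def)

lemma space_ivl: "space (ivl c P) = {c..<c + P}" by (simp add: ivl_def space_restrict_space)

lemma emeasure_ivl: "P \<ge> 0 \<Longrightarrow> emeasure (ivl c P) (space (ivl c P)) = ennreal P"
  unfolding space_ivl unfolding ivl_def by (subst emeasure_restrict_space) auto

lemma finite_measure_ivl: "P \<ge> 0 \<Longrightarrow> finite_measure (ivl c P)"
  by (rule finite_measureI) (simp add: emeasure_ivl)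

lemma measure_ivl: "P \<ge> 0 \<Longrightarrow> measure (ivl c P) (space (ivl c P)) = P"
  by (simp add: measure_def emeasure_ivl)

lemma measurable_ivl_borel:
  assumes "f \<in> borel_measurable borel" shows "f \<in> borel_measurable (ivl c P)"
proof -
  have "f \<in> borel_measurable lborel" using assms by simp
  then show ?thesis unfolding ivl_def by (rule measurable_restrict_space1)
qed

definition trig :: "real \<Rightarrow> int \<Rightarrow> real \<Rightarrow> complex" where
  "trig P m y = cis (2 * pi * of_int m * y / P)"

lemma trig_mult: "trig P m y * trig P n y = trig P (m + n) y"
  by (simp add: trig_def cis_mult add_divide_distrib algebra_simps)

lemma lspan_trig_mult:
  assumes "lspan (range (trig P)) f" "lspan (range (trig P)) g"
  shows "lspan (range (trig P)) (\<lambda>y. f y * g y)"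
  using assms(1)
proof (induct rule: lspan.induct)
  case (base f a)
  then obtain m where f: "f = trig P m" by blast
  from assms(2) show ?case
  proof (induct rule: lspan.induct)
    case (base g b)
    then obtain n where g: "g = trig P n" by blast
    have "(\<lambda>y. a * f y * (b * g y)) = (\<lambda>y. a * b * trig P (m + n) y)" by (simp add: f g trig_mult[symmetric] mult_ac)
    then show ?case using lspan.base[of "trig P (m + n)" "range (trig P)" "a * b"] by simp
  next
    case (add g h)
    then show ?case using lspan.add by (simp add: distrib_left)
  qed
next
  case (add f h)
  then show ?case using lspan.add by (simp add: distrib_right)
qed

lemma lspan_trig_const: "lspan (range (trig P)) (\<lambda>y. a)"
  using lspan.base[of "trig P 0" "range (trig P)" a] by (simp add: trig_def)

text \<open>A real linear form on the complex plane is \<open>a w + cnj a cnj w\<close>, and on the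
  unit circle the conjugate of \<open>trig P 1\<close> is \<open>trig P (-1)\<close>. Hence
  polynomials in the real and imaginary part become trigonometric polynomials, whose span is closed
  under products.\<close>

lemma lspan_trig_polynomial:
  assumes "real_polynomial_function p"
  shows "lspan (range (trig P)) (\<lambda>y. complex_of_real (p (trig P 1 y)))"
  using assms
proof (induct rule: real_polynomial_function.induct)
  case (linear h)
  interpret bounded_linear h by fact
  define a where "a = (complex_of_real (h 1) - \<i> * of_real (h \<i>)) / 2"
  have "complex_of_real (h w) = a * w + cnj a * cnj w" for w
  proof -
    have "h w = Re w * h 1 + Im w * h \<i>"
    proof -
      have "w = Re w *\<^sub>R 1 + Im w *\<^sub>R \<i>" by (simp add: complex_eq_iff)
      then have "h w = h (Re w *\<^sub>R 1 + Im w *\<^sub>R \<i>)" by simp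
      then show ?thesis by (simp add: add scaleR)
    qed
    then show ?thesis by (simp add: a_def complex_eq_iff field_simps)
  qed
  moreover have "cnj (trig P 1 y) = trig P (-1) y" for y by (simp add: trig_def cis_cnj)
  ultimately have "(\<lambda>y. complex_of_real (h (trig P 1 y))) = (\<lambda>y. a * trig P 1 y + cnj a * trig P (-1) y)" by simp
  then show ?case using lspan.add[OF lspan.base lspan.base, of "trig P 1" "range (trig P)" "trig P (-1)" a "cnj a"] by simp
next
  case (const c) then show ?case by (rule lspan_trig_const)
next
  case (add f g) then show ?case using lspan.add by fastforce
next
  case (mult f g) then show ?case using lspan_trig_mult by fastforce
qed

lemma l2c_bounded_ivl:
  assumes "P \<ge> 0" "f \<in> borel_measurable borel" "\<And>y. cmod (f y) \<le> B"
  shows "l2c (ivl c P) f" "n2 (ivl c P) f \<le> B\<^sup>2 * P"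
proof -
  interpret finite_measure "ivl c P" using assms(1) by (rule finite_measure_ivl)
  have m [measurable]: "f \<in> borel_measurable (ivl c P)" using assms(2) by (rule measurable_ivl_borel)
  have b: "(cmod (f y))\<^sup>2 \<le> B\<^sup>2" for y using assms(3) by (intro power_mono) auto
  have i: "integrable (ivl c P) (\<lambda>y. (cmod (f y))\<^sup>2)"
    by (rule integrable_const_bound[of _ "B\<^sup>2"]) (use b in auto)
  then show "l2c (ivl c P) f" by (simp add: l2c_def)
  have "n2 (ivl c P) f \<le> (\<integral>y. B\<^sup>2 \<partial>ivl c P)" unfolding n2_def by (intro integral_mono i b) auto
  also have "\<dots> = B\<^sup>2 * P" using assms(1) by (simp add: measure_ivl)
  finally show "n2 (ivl c P) f \<le> B\<^sup>2 * P" .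
qed

lemma trig_measurable: "trig P m \<in> borel_measurable borel"
  unfolding trig_def[abs_def] divide_inverse by (intro borel_measurable_continuous_onI continuous_intros)

lemma trig_norm: "cmod (trig P m y) = 1" by (simp add: trig_def)

lemma trig_inj:
  assumes "trig P 1 y = trig P 1 y'" "\<bar>y - y'\<bar> < P" shows "y = y'"
proof -
  have P: "P > 0" using assms(2) by linarith
  have "cis (2 * pi * (y - y') / P) = trig P 1 y * cnj (trig P 1 y')"
    by (simp add: trig_def cis_cnj cis_mult diff_divide_distrib algebra_simps)
  also have "\<dots> = 1" unfolding assms(1) by (simp add: trig_def cis_cnj cis_mult)
  finally obtain n :: int where n: "2 * pi * (y - y') / P = of_int n * 2 * pi"
    unfolding complex_eq_iff using cos_one_2pi_int by auto
  then have "pi * (y - y') = pi * (of_int n * P)" using P by (simp add: field_simps)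
  then have "y - y' = of_int n * P" by (subst (asm) mult_left_cancel) auto
  then have "\<bar>of_int n * P\<bar> < 1 * P" using assms(2) by simp
  then have "\<bar>of_int n :: real\<bar> < 1" using P by (simp add: abs_mult)
  then have "n = 0" by linarith
  then show ?thesis using \<open>y - y' = of_int n * P\<close> by simp
qed

lemma l2cl_cong:
  assumes S: "\<And>f. f \<in> S \<Longrightarrow> l2c M f" and g: "l2cl M S g" and f: "f \<in> borel_measurable M"
    and eq: "\<And>z. z \<in> space M \<Longrightarrow> f z = g z"
  shows "l2cl M S f"
proof (rule l2cl_closed[OF S])
  have "integrable M (\<lambda>z. (cmod (f z))\<^sup>2) = integrable M (\<lambda>z. (cmod (g z))\<^sup>2)"
    by (rule Bochner_Integration.integrable_cong) (use eq in auto)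
  then show "l2c M f" using g f by (simp add: l2cl_def l2c_def)
  have "n2 M (\<lambda>z. f z - g z) = (\<integral>z. 0 \<partial>M)" unfolding n2_def
    by (rule Bochner_Integration.integral_cong) (use eq in auto)
  then show "\<exists>g. l2cl M S g \<and> n2 M (\<lambda>z. f z - g z) < e" if "e > 0" for e using g that by auto
qed

lemma sets_ivl: "sets (ivl c P) = sigma_sets {c..<c + P} ((\<inter>) {c..<c + P} ` range greaterThan)"
proof -
  have b: "sets (borel :: real measure) = sigma_sets UNIV (range greaterThan)" by (subst borel_Ioi) simp
  have "sets (ivl c P) = (\<inter>) {c..<c + P} ` sets borel" by (simp add: ivl_def sets_restrict_space)
  also have "\<dots> = (\<inter>) {c..<c + P} ` sigma_sets UNIV (range greaterThan)" unfolding b ..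
  also have "\<dots> = sigma_sets {c..<c + P} ((\<inter>) {c..<c + P} ` range greaterThan)"
    by (rule sigma_sets_Int) (use b[symmetric] in auto)
  finally show ?thesis .
qed

text \<open>Stone-Weierstrass on the unit circle. A uniform error \<open>d\<close> becomes a squared
  L2 error of at most \<open>d\<^sup>2 P\<close>.\<close>

lemma trig_dense_continuous:
  assumes P: "P > 0" and H: "continuous_on UNIV H"
  shows "l2cl (ivl c P) (range (trig P)) (\<lambda>y. complex_of_real (H (trig P 1 y)))"
proof (rule l2cl_closed)
  have S: "l2c (ivl c P) f" if "f \<in> range (trig P)" for f
    using that P trig_measurable[of P] trig_norm[of P] by (auto intro!: l2c_bounded_ivl(1)[of _ _ 1])
  then show "f \<in> range (trig P) \<Longrightarrow> l2c (ivl c P) f" for f .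
  have m: "(\<lambda>y. complex_of_real (h (trig P 1 y))) \<in> borel_measurable borel" if "continuous_on UNIV h" for h
    by (intro borel_measurable_continuous_onI continuous_intros continuous_on_compose2[OF that])
      (auto simp: trig_def[abs_def] divide_inverse intro!: continuous_intros)
  have bdd: "\<exists>B. \<forall>y. cmod (complex_of_real (H (trig P 1 y))) \<le> B"
  proof -
    have "compact (H ` sphere 0 1)" by (intro compact_continuous_image continuous_on_subset[OF H]) auto
    from compact_imp_bounded[OF this] obtain B where "\<And>v. v \<in> H ` sphere 0 1 \<Longrightarrow> \<bar>v\<bar> \<le> B"
      unfolding bounded_iff real_norm_def by blast
    then show ?thesis by (intro exI[of _ B]) (auto simp: trig_norm)
  qed
  show "l2c (ivl c P) (\<lambda>y. complex_of_real (H (trig P 1 y)))"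
    using bdd P by (auto intro!: l2c_bounded_ivl(1) m H)
  fix e :: real assume e: "e > 0"
  define d where "d = sqrt (e / (2 * P))"
  have d: "d > 0" "d\<^sup>2 * P < e" using e P by (auto simp: d_def)
  obtain p where p: "real_polynomial_function p" "\<And>w. w \<in> sphere 0 1 \<Longrightarrow> \<bar>H w - p w\<bar> < d"
    using Stone_Weierstrass_real_polynomial_function[of "sphere 0 1" H d] continuous_on_subset[OF H] d by (metis compact_sphere subset_UNIV)
  have cp: "continuous_on UNIV p" using p(1) continuous_on_polymonial_function real_polynomial_function_eq by blast
  show "\<exists>g. l2cl (ivl c P) (range (trig P)) g \<and> n2 (ivl c P) (\<lambda>z. complex_of_real (H (trig P 1 z)) - g z) < e"
  proof (intro exI conjI)
    show "l2cl (ivl c P) (range (trig P)) (\<lambda>y. complex_of_real (p (trig P 1 y)))"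
      by (intro lspan_l2cl S lspan_trig_polynomial p)
    have "n2 (ivl c P) (\<lambda>z. complex_of_real (H (trig P 1 z)) - complex_of_real (p (trig P 1 z))) \<le> d\<^sup>2 * P"
    proof (rule l2c_bounded_ivl(2))
      show "(\<lambda>z. complex_of_real (H (trig P 1 z)) - complex_of_real (p (trig P 1 z))) \<in> borel_measurable borel"
        by (intro borel_measurable_diff m H cp)
      show "cmod (complex_of_real (H (trig P 1 y)) - complex_of_real (p (trig P 1 y))) \<le> d" for y
        using p(2)[of "trig P 1 y"] by (simp add: trig_norm flip: of_real_diff)
    qed (use P in simp)
    then show "n2 (ivl c P) (\<lambda>z. complex_of_real (H (trig P 1 z)) - complex_of_real (p (trig P 1 z))) < e" using d by simp
  qed
qed

text \<open>The upper parts \<open>y > a\<close> of the interval form an intersection-stable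
  generator. Their indicators are L2 limits of continuous functions on the circle, although they
  jump both at \<open>a\<close> and at the point where the ends of the interval are glued.\<close>

lemma trig_dense_ivl:
  assumes P: "P > 0" and f: "l2c (ivl c P) f"
  shows "l2cl (ivl c P) (range (trig P)) f"
proof -
  interpret finite_measure "ivl c P" using P by (intro finite_measure_ivl) simp
  have S: "l2c (ivl c P) f" if "f \<in> range (trig P)" for f
    using that P trig_measurable[of P] trig_norm[of P] by (auto intro!: l2c_bounded_ivl(1)[of _ _ 1])
  have one: "l2cl (ivl c P) (range (trig P)) (indicator (space (ivl c P)))"
    by (rule l2cl_cong[OF S lspan_l2cl[OF S lspan_trig_const[of P 1]]]) auto
  show ?thesis
  proof (rule l2cl_dense[OF S, where G = "(\<inter>) {c..<c + P} ` range greaterThan"])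
    show "Int_stable ((\<inter>) {c..<c + P} ` range greaterThan)"
      by (rule Int_stableI) (auto simp: image_iff greaterThan_def set_eq_iff, metis max_less_iff_conj)
    show "(\<inter>) {c..<c + P} ` range greaterThan \<subseteq> Pow (space (ivl c P))" by (auto simp: space_ivl)
    show "sets (ivl c P) = sigma_sets (space (ivl c P)) ((\<inter>) {c..<c + P} ` range greaterThan)"
      by (simp add: space_ivl sets_ivl)
    fix A assume "A \<in> (\<inter>) {c..<c + P} ` range greaterThan"
    then obtain a where A: "A = {c..<c + P} \<inter> {a<..}" by auto
    have As: "A \<in> sets (ivl c P)" unfolding A ivl_def by (intro sets_restrict_space_iff[THEN iffD2]) auto
    show "l2cl (ivl c P) (range (trig P)) (indicator A)"
    proof (cases "a < c")
      case True
      then have "A = space (ivl c P)" by (auto simp: A space_ivl)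
      then show ?thesis using one by simp
    next
      case False
      \<comment> \<open>\<open>K\<close> is the arc to be removed. Each \<open>H n\<close> is
        continuous and vanishes on \<open>K\<close>, and it tends to 1 away from \<open>K\<close>
        since a compact set has positive distance from points outside. Injectivity of
        \<open>trig P 1\<close> on the half-open interval ensures that \<open>y > a\<close> really
        lies off the arc.\<close>
      define K where "K = trig P 1 ` {c..a}"
      have K: "compact K" "K \<noteq> {}" using False unfolding K_def trig_def[abs_def] divide_inverse
        by (auto intro!: compact_continuous_image continuous_intros)
      define H where "H n w = min 1 (real n * infdist w K)" for n w
      have ind: "l2c (ivl c P) (indicator A)"
        using As by (auto simp: l2c_def indicator_def if_distrib[of cmod] if_distrib[of "\<lambda>x. x\<^sup>2"] cong: if_cong
            intro!: integrable_const_bound[of _ 1])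
      have H0: "H n (trig P 1 y) = 0" if "y \<in> space (ivl c P)" "y \<notin> A" for n y
      proof -
        have "trig P 1 y \<in> K" using that by (auto simp: K_def A space_ivl)
        then show ?thesis by (simp add: H_def)
      qed
      have cH: "continuous_on UNIV (H n)" for n unfolding H_def[abs_def] by (intro continuous_intros)
      have l: "l2cl (ivl c P) (range (trig P)) (\<lambda>y. complex_of_real (H n (trig P 1 y)))" for n
        by (rule trig_dense_continuous[OF P cH])
      have lim: "(\<lambda>n. complex_of_real (H n (trig P 1 y))) \<longlonglongrightarrow> indicator A y" if y: "y \<in> space (ivl c P)" for y
      proof (cases "y \<in> A")
        case True
        have "trig P 1 y \<notin> K"
        proof
          assume "trig P 1 y \<in> K"
          then obtain y' where y': "y' \<in> {c..a}" "trig P 1 y = trig P 1 y'" by (auto simp: K_def)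
          then have "y = y'" using True by (intro trig_inj[of P]) (auto simp: A)
          then show False using y' True by (auto simp: A)
        qed
        then have pos: "infdist (trig P 1 y) K > 0" using K infdist_pos_not_in_closed[of K] compact_imp_closed by blast
        obtain N where N: "1 / infdist (trig P 1 y) K \<le> real N" using real_arch_simple by blast
        have "\<forall>\<^sub>F n in sequentially. complex_of_real (H n (trig P 1 y)) = indicator A y"
          using eventually_ge_at_top[of N]
        proof eventually_elim
          case (elim n)
          then have "1 / infdist (trig P 1 y) K \<le> real n" using N by linarith
          then have "1 \<le> real n * infdist (trig P 1 y) K" using pos by (simp add: field_simps)
          then show ?case using True by (simp add: H_def)
        qed
        then show ?thesis by (rule tendsto_eventually)
      qed (use H0[OF y] in simp)
      have "(\<lambda>n. n2 (ivl c P) (\<lambda>z. indicator A z - complex_of_real (H n (trig P 1 z)))) \<longlonglongrightarrow> 0"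
      proof (rule l2c_dominated(2)[OF ind _ lim])
        show "(\<lambda>y. complex_of_real (H n (trig P 1 y))) \<in> borel_measurable (ivl c P)" for n using l[of n] by (simp add: l2cl_def l2c_def)
        show "cmod (complex_of_real (H n (trig P 1 z))) \<le> 2 * cmod (indicator A z)" if "z \<in> space (ivl c P)" for n z
          using H0[OF that, of n] infdist_nonneg[of "trig P 1 z" K] by (cases "z \<in> A") (auto simp: H_def)
      qed
      note cv = this
      show ?thesis
      proof (rule l2cl_closed[OF S ind])
        fix e :: real assume "e > 0"
        from LIMSEQ_D[OF cv this] obtain n where "norm (n2 (ivl c P) (\<lambda>z. indicator A z - complex_of_real (H n (trig P 1 z))) - 0) < e" by blast
        then show "\<exists>g. l2cl (ivl c P) (range (trig P)) g \<and> n2 (ivl c P) (\<lambda>z. indicator A z - g z) < e"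
          using l[of n] by (intro exI[of _ "\<lambda>y. complex_of_real (H n (trig P 1 y))"]) auto
      qed
    qed
  qed (use one f in auto)
qed

section \<open>A shifted exponential basis on a box, with Bessel's inequality and Parseval's
  identity\<close>

definition cylbox :: "real \<Rightarrow> (real \<times> real) measure" where
  "cylbox L = torus \<Otimes>\<^sub>M ivl (- L) (2 * L)"

text \<open>For each \<open>k\<close> the lattice of y-frequencies may be shifted by its own
  \<open>\<tau> k\<close>. Orthogonality survives: for equal \<open>k\<close> the shifts cancel, and
  different \<open>k\<close> are already orthogonal in \<open>x\<close>.\<close>

definition E2 :: "real \<Rightarrow> (int \<Rightarrow> real) \<Rightarrow> int \<times> int \<Rightarrow> real \<times> real \<Rightarrow> complex" where
  "E2 L \<tau> = (\<lambda>(k, m) (x, y). cis (of_int k * x + (pi * of_int m / L + \<tau> k) * y))"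

lemma E2_eq: "E2 L \<tau> (k, m) (x, y) = trig (2 * pi) k x * (cis (\<tau> k * y) * trig (2 * L) m y)"
  by (simp add: E2_def trig_def cis_mult algebra_simps add_divide_distrib)

lemma finite_measure_cylbox: "L \<ge> 0 \<Longrightarrow> finite_measure (cylbox L)"
  unfolding cylbox_def by (intro finite_measure_pair_measure finite_measure_ivl torus.finite_measure_axioms) simp

lemma l2c_product:
  assumes L: "L \<ge> 0" and u: "l2c torus u" and h: "l2c (ivl (- L) (2 * L)) h"
  shows "l2c (cylbox L) (\<lambda>(x, y). u x * h y)" "n2 (cylbox L) (\<lambda>(x, y). u x * h y) = n2 torus u * n2 (ivl (- L) (2 * L)) h"
proof -
  interpret Y: finite_measure "ivl (- L) (2 * L)" using L by (intro finite_measure_ivl) simp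
  have [measurable]: "u \<in> borel_measurable torus" "h \<in> borel_measurable (ivl (- L) (2 * L))"
    and i: "integrable torus (\<lambda>x. (cmod (u x))\<^sup>2)" "integrable (ivl (- L) (2 * L)) (\<lambda>x. (cmod (h x))\<^sup>2)"
    using u h by (auto simp: l2c_def)
  have m: "(\<lambda>(x, y). u x * h y) \<in> borel_measurable (cylbox L)" unfolding cylbox_def by measurable
  have n: "n2 torus u \<ge> 0" "n2 (ivl (- L) (2 * L)) h \<ge> 0" by (auto simp: n2_def)
  have "(\<integral>\<^sup>+z. ennreal ((cmod (case z of (x, y) \<Rightarrow> u x * h y))\<^sup>2) \<partial>cylbox L)
      = (\<integral>\<^sup>+x. (\<integral>\<^sup>+y. ennreal ((cmod (u x))\<^sup>2) * ennreal ((cmod (h y))\<^sup>2) \<partial>ivl (- L) (2 * L)) \<partial>torus)"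
    unfolding cylbox_def by (subst Y.nn_integral_fst[symmetric])
      (auto simp: norm_mult power_mult_distrib ennreal_mult)
  also have "\<dots> = (\<integral>\<^sup>+x. ennreal ((cmod (u x))\<^sup>2) \<partial>torus) * (\<integral>\<^sup>+y. ennreal ((cmod (h y))\<^sup>2) \<partial>ivl (- L) (2 * L))"
    by (simp add: nn_integral_cmult nn_integral_multc)
  also have "\<dots> = ennreal (n2 torus u * n2 (ivl (- L) (2 * L)) h)"
    using i n unfolding n2_def by (simp add: nn_integral_eq_integral ennreal_mult)
  finally have e: "(\<integral>\<^sup>+z. ennreal ((cmod (case z of (x, y) \<Rightarrow> u x * h y))\<^sup>2) \<partial>cylbox L) = ennreal (n2 torus u * n2 (ivl (- L) (2 * L)) h)" .
  show "l2c (cylbox L) (\<lambda>(x, y). u x * h y)"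
    unfolding l2c_def using m e by (auto intro!: integrableI_nonneg)
  have m2: "(\<lambda>z. (cmod (case z of (x, y) \<Rightarrow> u x * h y))\<^sup>2) \<in> borel_measurable (cylbox L)" using m by measurable
  show "n2 (cylbox L) (\<lambda>(x, y). u x * h y) = n2 torus u * n2 (ivl (- L) (2 * L)) h"
    unfolding n2_def[of "cylbox L"] by (rule integral_eq_nn_integral[THEN trans]) (use m2 e n in auto)
qed

lemma measurable_cnj: "f \<in> borel_measurable M \<Longrightarrow> (\<lambda>z. cnj (f z)) \<in> borel_measurable M"
  by (rule measurable_compose[of f M borel cnj]) (auto intro!: borel_measurable_continuous_onI continuous_intros)

lemma E2_measurable: "E2 L \<tau> j \<in> borel_measurable borel"
proof -
  obtain k m where "j = (k, m)" by (cases j)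
  then show ?thesis unfolding E2_def split_beta'
    by (auto intro!: borel_measurable_continuous_onI continuous_intros)
qed

lemma E2_norm: "cmod (E2 L \<tau> j z) = 1" by (simp add: E2_def split_beta')

lemma measurable_box_borel:
  fixes f :: "real \<times> real \<Rightarrow> complex"
  assumes "f \<in> borel_measurable borel" shows "f \<in> borel_measurable (cylbox L)"
proof -
  have "(\<lambda>x. x) \<in> measurable torus borel" "(\<lambda>x. x) \<in> measurable (ivl (- L) (2 * L)) borel"
    by (auto intro: measurable_ivl_borel measurable_torus_borel)
  then have "(\<lambda>z. (fst z, snd z)) \<in> measurable (cylbox L) (borel \<Otimes>\<^sub>M borel)"
    unfolding cylbox_def by (intro measurable_Pair measurable_compose[OF measurable_fst] measurable_compose[OF measurable_snd])
  then have "(\<lambda>z. z) \<in> measurable (cylbox L) borel" by (simp add: borel_prod)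
  from measurable_compose[OF this assms] show ?thesis by simp
qed

lemma l2c_E2: assumes "L \<ge> 0" shows "l2c (cylbox L) (E2 L \<tau> j)"
proof -
  interpret finite_measure "cylbox L" using assms by (rule finite_measure_cylbox)
  have "E2 L \<tau> j \<in> borel_measurable (cylbox L)" by (intro measurable_box_borel E2_measurable)
  then show ?thesis unfolding l2c_def by (auto simp: E2_norm)
qed

lemma l2c_mult_unimodular:
  assumes "l2c M f" "g \<in> borel_measurable M" "\<And>z. cmod (g z) = 1"
  shows "l2c M (\<lambda>z. f z * g z)" "n2 M (\<lambda>z. f z * g z) = n2 M f"
  using assms by (auto simp: l2c_def n2_def norm_mult)

text \<open>Multiplication by the unimodular function \<open>cis (- \<tau> k y)\<close> preserves
  \<open>n2\<close> and reduces the shifted lattice to the unshifted one.\<close>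

lemma E2_dense_xmode:
  assumes L: "L > 0" and h: "l2c (ivl (- L) (2 * L)) h"
  shows "l2cl (cylbox L) (range (E2 L \<tau>)) (\<lambda>(x, y). trig (2 * pi) k x * h y)"
proof (rule l2cl_closed)
  show S: "f \<in> range (E2 L \<tau>) \<Longrightarrow> l2c (cylbox L) f" for f using l2c_E2 L by auto
  have tk: "l2c torus (trig (2 * pi) k)" "n2 torus (trig (2 * pi) k) \<le> 2 * pi"
    using l2c_bounded_ivl[of "2 * pi" "trig (2 * pi) k" 1 0] trig_measurable trig_norm by (auto simp: torus_ivl)
  show "l2c (cylbox L) (\<lambda>(x, y). trig (2 * pi) k x * h y)" using L tk h by (intro l2c_product) auto
  fix e :: real assume e: "e > 0"
  have cm: "(\<lambda>y. cis (- \<tau> k * y)) \<in> borel_measurable (ivl (- L) (2 * L))"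
    by (intro measurable_ivl_borel borel_measurable_continuous_onI continuous_intros)
  have "l2c (ivl (- L) (2 * L)) (\<lambda>y. h y * cis (- \<tau> k * y))"
    by (rule l2c_mult_unimodular(1)[OF h cm]) simp
  then have "l2cl (ivl (- L) (2 * L)) (range (trig (2 * L))) (\<lambda>y. h y * cis (- \<tau> k * y))"
    using L by (intro trig_dense_ivl) auto
  then obtain T where T: "lspan (range (trig (2 * L))) T" "n2 (ivl (- L) (2 * L)) (\<lambda>y. h y * cis (- \<tau> k * y) - T y) < e / (2 * pi)"
  proof -
    have "e / (2 * pi) > 0" using e by simp
    then show ?thesis using that \<open>l2cl _ _ _\<close> unfolding l2cl_def by blast
  qed
  have sp: "lspan (range (E2 L \<tau>)) (\<lambda>(x, y). trig (2 * pi) k x * (cis (\<tau> k * y) * T y))"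
    using T(1)
  proof induct
    case (base f c)
    then obtain m where "f = trig (2 * L) m" by blast
    then have "(\<lambda>(x, y). trig (2 * pi) k x * (cis (\<tau> k * y) * (c * f y))) = (\<lambda>z. c * E2 L \<tau> (k, m) z)"
      by (auto simp: E2_eq)
    then show ?case using lspan.base[of "E2 L \<tau> (k, m)"] by simp
  next
    case (add f g)
    from lspan.add[OF add(2,4)] show ?case by (simp add: split_beta' algebra_simps)
  qed
  have lT: "l2c (ivl (- L) (2 * L)) T"
    by (rule l2c_lspan[OF _ T(1)]) (use L trig_measurable trig_norm in \<open>auto intro!: l2c_bounded_ivl(1)[of _ _ 1]\<close>)
  have cm2: "(\<lambda>y. cis (\<tau> k * y)) \<in> borel_measurable (ivl (- L) (2 * L))"
    by (intro measurable_ivl_borel borel_measurable_continuous_onI continuous_intros)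
  have lcT: "l2c (ivl (- L) (2 * L)) (\<lambda>y. cis (\<tau> k * y) * T y)"
    using l2c_mult_unimodular(1)[OF lT cm2] by (simp add: mult.commute)
  show "\<exists>g. l2cl (cylbox L) (range (E2 L \<tau>)) g \<and> n2 (cylbox L) (\<lambda>z. (case z of (x, y) \<Rightarrow> trig (2 * pi) k x * h y) - g z) < e"
  proof (intro exI conjI)
    show "l2cl (cylbox L) (range (E2 L \<tau>)) (\<lambda>(x, y). trig (2 * pi) k x * (cis (\<tau> k * y) * T y))"
      by (rule lspan_l2cl[OF S sp])
    have eq: "(\<lambda>z. (case z of (x, y) \<Rightarrow> trig (2 * pi) k x * h y) - (case z of (x, y) \<Rightarrow> trig (2 * pi) k x * (cis (\<tau> k * y) * T y)))
       = (\<lambda>(x, y). trig (2 * pi) k x * (h y - cis (\<tau> k * y) * T y))" by (auto simp: algebra_simps)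
    have "n2 (cylbox L) (\<lambda>(x, y). trig (2 * pi) k x * (h y - cis (\<tau> k * y) * T y))
        = n2 torus (trig (2 * pi) k) * n2 (ivl (- L) (2 * L)) (\<lambda>y. h y - cis (\<tau> k * y) * T y)"
      using L tk by (intro l2c_product(2) l2c_diff h lcT) auto
    also have "n2 (ivl (- L) (2 * L)) (\<lambda>y. h y - cis (\<tau> k * y) * T y)
        = n2 (ivl (- L) (2 * L)) (\<lambda>y. (h y - cis (\<tau> k * y) * T y) * cis (- \<tau> k * y))"
      by (rule l2c_mult_unimodular(2)[OF l2c_diff[OF h lcT] cm, symmetric]) simp
    also have "(\<lambda>y. (h y - cis (\<tau> k * y) * T y) * cis (- \<tau> k * y)) = (\<lambda>y. h y * cis (- \<tau> k * y) - T y)"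
    proof
      fix y
      have "cis (\<tau> k * y) * cis (- \<tau> k * y) = 1" by (simp add: cis_mult)
      then show "(h y - cis (\<tau> k * y) * T y) * cis (- \<tau> k * y) = h y * cis (- \<tau> k * y) - T y"
        by (simp add: left_diff_distrib mult.assoc mult.commute[of "T y"] flip: mult.assoc[of "cis (\<tau> k * y)"])
    qed
    also have "n2 torus (trig (2 * pi) k) * n2 (ivl (- L) (2 * L)) (\<lambda>y. h y * cis (- \<tau> k * y) - T y)
       \<le> 2 * pi * n2 (ivl (- L) (2 * L)) (\<lambda>y. h y * cis (- \<tau> k * y) - T y)"
      using tk by (intro mult_right_mono) (auto simp: n2_def)
    also have "\<dots> < e" using T(2) by (simp add: field_simps)
    finally show "n2 (cylbox L) (\<lambda>z. (case z of (x, y) \<Rightarrow> trig (2 * pi) k x * h y) - (case z of (x, y) \<Rightarrow> trig (2 * pi) k x * (cis (\<tau> k * y) * T y))) < e"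
      unfolding eq .
  qed
qed

lemma l2c_indicator:
  assumes "finite_measure M" "A \<in> sets M" shows "l2c M (indicator A)" "n2 M (indicator A) \<le> measure M (space M)"
proof -
  interpret finite_measure M by fact
  have i: "integrable M (\<lambda>z. (cmod (indicator A z))\<^sup>2)"
    using assms(2) by (intro integrable_const_bound[of _ 1]) (auto simp: indicator_def)
  then show "l2c M (indicator A)" using assms(2) by (simp add: l2c_def)
  have "n2 M (indicator A) \<le> (\<integral>z. 1 \<partial>M)" unfolding n2_def by (intro integral_mono i) (auto simp: indicator_def)
  then show "n2 M (indicator A) \<le> measure M (space M)" by simp
qed

text \<open>For a rectangle only the indicator in \<open>x\<close> has to be expanded; the factor in
  \<open>y\<close> is then handled for one \<open>k\<close> at a time by
  \<open>E2_dense_xmode\<close>. Rectangles generate the product sigma-algebra.\<close>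

lemma E2_dense:
  assumes L: "L > 0" and f: "l2c (cylbox L) f"
  shows "l2cl (cylbox L) (range (E2 L \<tau>)) f"
proof -
  interpret B: finite_measure "cylbox L" using L by (intro finite_measure_cylbox) simp
  interpret Y: finite_measure "ivl (- L) (2 * L)" using L by (intro finite_measure_ivl) simp
  have S: "f \<in> range (E2 L \<tau>) \<Longrightarrow> l2c (cylbox L) f" for f using l2c_E2 L by auto
  have rect: "l2cl (cylbox L) (range (E2 L \<tau>)) (indicator (A \<times> B))"
    if A: "A \<in> sets torus" and B: "B \<in> sets (ivl (- L) (2 * L))" for A B
  proof (rule l2cl_closed[OF S])
    have AB: "indicator (A \<times> B) = (\<lambda>(x, y). indicator A x * (indicator B y :: complex))" by (auto simp: indicator_def)
    have iA: "l2c torus (indicator A)" and iB: "l2c (ivl (- L) (2 * L)) (indicator B)"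
      by (auto intro!: l2c_indicator A B torus.finite_measure_axioms Y.finite_measure_axioms)
    have nB: "n2 (ivl (- L) (2 * L)) (indicator B) \<le> 2 * L"
      using l2c_indicator(2)[OF Y.finite_measure_axioms B] L by (simp add: measure_ivl)
    show "l2c (cylbox L) (indicator (A \<times> B))" unfolding AB using L by (intro l2c_product iA iB) simp
    fix e :: real assume e: "e > 0"
    have "l2cl torus (range (trig (2 * pi))) (indicator A)" unfolding torus_ivl
      by (rule trig_dense_ivl) (use iA in \<open>auto simp: torus_ivl\<close>)
    moreover have "e / (2 * L) > 0" using e L by simp
    ultimately obtain U where U: "lspan (range (trig (2 * pi))) U" "n2 torus (\<lambda>x. indicator A x - U x) < e / (2 * L)"
      unfolding l2cl_def by blast
    have lU: "l2c torus U" unfolding torus_ivl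
      by (rule l2c_lspan[OF _ U(1)]) (use trig_measurable trig_norm in \<open>auto intro!: l2c_bounded_ivl(1)[of _ _ 1]\<close>)
    have cU: "l2cl (cylbox L) (range (E2 L \<tau>)) (\<lambda>(x, y). U x * indicator B y)" using U(1)
    proof induct
      case (base f c)
      then obtain k where "f = trig (2 * pi) k" by blast
      then show ?case using l2cl_scale[OF E2_dense_xmode[OF L iB], of \<tau> c k] by (simp add: split_beta' mult.assoc)
    next
      case (add f g)
      from l2cl_add[OF S add(2,4)] show ?case by (simp add: split_beta' algebra_simps)
    qed
    have eq: "(\<lambda>z. indicator (A \<times> B) z - (case z of (x, y) \<Rightarrow> U x * indicator B y)) = (\<lambda>(x, y). (indicator A x - U x) * indicator B y)"
      unfolding AB by (auto simp: algebra_simps)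
    have "n2 (cylbox L) (\<lambda>(x, y). (indicator A x - U x) * indicator B y) = n2 torus (\<lambda>x. indicator A x - U x) * n2 (ivl (- L) (2 * L)) (indicator B)"
      using L by (intro l2c_product(2) l2c_diff iA iB lU) simp
    also have "\<dots> \<le> n2 torus (\<lambda>x. indicator A x - U x) * (2 * L)" using nB by (intro mult_left_mono) (auto simp: n2_def)
    also have "\<dots> < e" using U(2) L by (simp add: field_simps)
    finally show "\<exists>g. l2cl (cylbox L) (range (E2 L \<tau>)) g \<and> n2 (cylbox L) (\<lambda>z. indicator (A \<times> B) z - g z) < e"
      using cU eq by (intro exI[of _ "\<lambda>(x, y). U x * indicator B y"]) simp
  qed
  show ?thesis
  proof (rule B.l2cl_dense[OF S, where G = "{a \<times> b | a b. a \<in> sets torus \<and> b \<in> sets (ivl (- L) (2 * L))}"])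
    show "Int_stable {a \<times> b | a b. a \<in> sets torus \<and> b \<in> sets (ivl (- L) (2 * L))}" by (rule Int_stable_pair_measure_generator)
    show "{a \<times> b | a b. a \<in> sets torus \<and> b \<in> sets (ivl (- L) (2 * L))} \<subseteq> Pow (space (cylbox L))"
      unfolding cylbox_def space_pair_measure by (rule pair_measure_closed)
    show "sets (cylbox L) = sigma_sets (space (cylbox L)) {a \<times> b | a b. a \<in> sets torus \<and> b \<in> sets (ivl (- L) (2 * L))}"
      unfolding cylbox_def space_pair_measure by (rule sets_pair_measure)
    show "l2cl (cylbox L) (range (E2 L \<tau>)) (indicator (space (cylbox L)))"
      unfolding cylbox_def space_pair_measure unfolding cylbox_def[symmetric] by (intro rect sets.top)
  qed (use rect f in auto)
qed

lemma integral_trig: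
  assumes P: "P > 0" shows "(\<integral>y. trig P m y \<partial>ivl c P) = (if m = 0 then of_real P else 0)"
proof (cases "m = 0")
  case True then show ?thesis using P by (simp add: trig_def measure_ivl scaleR_conv_of_real)
next
  case False
  define w where "w = 2 * pi * of_int m / P"
  have w: "w \<noteq> 0" using False P by (simp add: w_def)
  have tw: "trig P m y = cis (w * y)" for y by (simp add: trig_def w_def)
  have ae: "AE y in lborel. indicator {c..<c+P} y *\<^sub>R trig P m y = indicator {c..c+P} y *\<^sub>R trig P m y"
    using AE_lborel_singleton[of "c+P"] by eventually_elim (auto simp: indicator_def)
  have tm: "trig P m \<in> borel_measurable borel" by (rule trig_measurable)
  have "(\<integral>y. trig P m y \<partial>ivl c P) = (\<integral>y. indicator {c..<c+P} y *\<^sub>R trig P m y \<partial>lborel)"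
    unfolding ivl_def by (subst integral_restrict_space) auto
  also have "\<dots> = (\<integral>y. indicator {c..c+P} y *\<^sub>R trig P m y \<partial>lborel)"
    by (rule integral_cong_AE[OF _ _ ae]) (use tm in auto)
  also have "\<dots> = cis (w * (c + P)) / (\<i> * w) - cis (w * c) / (\<i> * w)"
  proof (rule integral_FTC_Icc)
    show "((\<lambda>y. cis (w * y) / (\<i> * w)) has_vector_derivative trig P m y) (at y within {c..c+P})" for y
      unfolding tw cis_conv_exp using w
      by (auto intro!: derivative_eq_intros has_vector_derivative_real_field simp: field_simps)
    show "continuous_on {c..c+P} (trig P m)" unfolding trig_def[abs_def] divide_inverse by (intro continuous_intros)
  qed (use P in simp)
  also have "cis (w * (c + P)) = cis (w * c) * cis (2 * pi * of_int m)"
    using P by (simp add: w_def cis_mult algebra_simps add_divide_distrib)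
  also have "cis (2 * pi * of_int m) = 1" by (rule cis_multiple_2pi) simp
  finally show ?thesis using False by simp
qed

lemma integral_E2:
  assumes L: "L > 0"
  shows "(\<integral>z. E2 L \<tau> j z * cnj (E2 L \<tau> l z) \<partial>cylbox L) = (if j = l then of_real (4 * pi * L) else 0)"
proof -
  interpret B: finite_measure "cylbox L" using L by (intro finite_measure_cylbox) simp
  interpret Y: finite_measure "ivl (- L) (2 * L)" using L by (intro finite_measure_ivl) simp
  interpret XY: pair_sigma_finite torus "ivl (- L) (2 * L)" ..
  obtain k m k' m' where j: "j = (k, m)" "l = (k', m')" by (cases j, cases l)
  define h where "h y = cis (\<tau> k * y) * trig (2 * L) m y * cnj (cis (\<tau> k' * y) * trig (2 * L) m' y)" for y
  have ct: "cnj (trig P n y) = trig P (- n) y" for P n y by (simp add: trig_def cis_cnj)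
  have e: "E2 L \<tau> j z * cnj (E2 L \<tau> l z) = trig (2 * pi) (k - k') (fst z) * h (snd z)" for z
  proof -
    have "trig (2 * pi) (k - k') x = trig (2 * pi) k x * cnj (trig (2 * pi) k' x)" for x by (simp add: ct trig_mult)
    then show ?thesis by (cases z) (simp add: j E2_eq h_def mult_ac)
  qed
  have i: "integrable (cylbox L) (\<lambda>z. E2 L \<tau> j z * cnj (E2 L \<tau> l z))"
    by (rule B.integrable_const_bound[of _ 1]) (auto simp: norm_mult E2_norm intro!: borel_measurable_times measurable_cnj measurable_box_borel E2_measurable)
  have "(\<integral>z. E2 L \<tau> j z * cnj (E2 L \<tau> l z) \<partial>cylbox L) = (\<integral>y. (\<integral>x. trig (2 * pi) (k - k') x * h y \<partial>torus) \<partial>ivl (- L) (2 * L))"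
    using XY.integral_snd[of "\<lambda>x y. E2 L \<tau> j (x, y) * cnj (E2 L \<tau> l (x, y))"] i
    by (simp add: cylbox_def split_beta' e)
  also have "\<dots> = (if k = k' then of_real (2 * pi) else 0) * (\<integral>y. h y \<partial>ivl (- L) (2 * L))"
    using integral_trig[where P = "2 * pi" and m = "k - k'" and c = 0] by (simp add: torus_ivl)
  also have "\<dots> = (if j = l then of_real (4 * pi * L) else 0)"
  proof (cases "k = k'")
    case True
    have "h y = trig (2 * L) (m - m') y" for y
    proof -
      have 1: "cis (\<tau> k * y) * cnj (cis (\<tau> k * y)) = 1" by (simp add: cis_cnj cis_mult)
      have "(u * a) * (cnj u * d) = (u * cnj u) * (a * d)" for u a d :: complex by (simp add: mult_ac)
      then have "h y = 1 * (trig (2 * L) m y * cnj (trig (2 * L) m' y))" unfolding h_def True[symmetric] complex_cnj_mult 1[symmetric] .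
      then show ?thesis by (simp add: ct trig_mult)
    qed
    then show ?thesis using True integral_trig[where P = "2 * L" and m = "m - m'" and c = "- L"] L by (auto simp: j)
  qed (simp add: j)
  finally show ?thesis .
qed

lemma lspan_range_finite:
  assumes "lspan (range E) T"
  shows "\<exists>F a. finite F \<and> T = (\<lambda>z. \<Sum>j\<in>F. a j * E j z)"
  using assms
proof induct
  case (base f c)
  then obtain j where "f = E j" by blast
  then show ?case by (intro exI[of _ "{j}"] exI[of _ "\<lambda>_. c"]) auto
next
  case (add f g)
  then obtain F a G b where *: "finite F" "f = (\<lambda>z. \<Sum>j\<in>F. a j * E j z)" "finite G" "g = (\<lambda>z. \<Sum>j\<in>G. b j * E j z)" by blast
  define c where "c j = (if j \<in> F then a j else 0) + (if j \<in> G then b j else 0)" for j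
  have "(\<Sum>j\<in>F \<union> G. c j * E j z) = f z + g z" for z
  proof -
    have "(\<Sum>j\<in>F \<union> G. c j * E j z) = (\<Sum>j\<in>F \<union> G. (if j \<in> F then a j * E j z else 0)) + (\<Sum>j\<in>F \<union> G. (if j \<in> G then b j * E j z else 0))"
      unfolding sum.distrib[symmetric] by (intro sum.cong) (auto simp: c_def algebra_simps)
    also have "\<dots> = f z + g z" using * by (simp add: sum.inter_restrict[symmetric] Int_absorb1 Int_commute)
    finally show ?thesis .
  qed
  then show ?case using * by (intro exI[of _ "F \<union> G"] exI[of _ c]) auto
qed

text \<open>Expanding the square and completing it in every coefficient. The last sum vanishes for
  \<open>a j = c j / V\<close>, which yields Bessel's inequality; being nonnegative, it may be
  dropped for the coefficients of an approximating polynomial, which yields Parseval's identity up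
  to \<open>e\<close>.\<close>

lemma n2_best_approximation:
  fixes \<tau> :: "int \<Rightarrow> real"
  assumes L: "L > 0" and f: "l2c (cylbox L) f" and F: "finite F"
  defines "V \<equiv> 4 * pi * L" and "c \<equiv> \<lambda>j. \<integral>z. f z * cnj (E2 L \<tau> j z) \<partial>cylbox L"
  shows "n2 (cylbox L) (\<lambda>z. f z - (\<Sum>j\<in>F. a j * E2 L \<tau> j z))
    = n2 (cylbox L) f - (\<Sum>j\<in>F. (cmod (c j))\<^sup>2) / V + V * (\<Sum>j\<in>F. (cmod (a j - c j / V))\<^sup>2)"
proof -
  interpret B: finite_measure "cylbox L" using L by (intro finite_measure_cylbox) simp
  have V: "V > 0" using L by (simp add: V_def)
  define T where "T z = (\<Sum>j\<in>F. a j * E2 L \<tau> j z)" for z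
  have fm: "f \<in> borel_measurable (cylbox L)" and fi: "integrable (cylbox L) (\<lambda>z. (cmod (f z))\<^sup>2)" using f by (auto simp: l2c_def)
  have Em: "E2 L \<tau> j \<in> borel_measurable (cylbox L)" for j by (intro measurable_box_borel E2_measurable)
  have fE: "integrable (cylbox L) (\<lambda>z. f z * cnj (E2 L \<tau> j z))" for j
  proof (rule Bochner_Integration.integrable_bound)
    show "integrable (cylbox L) (\<lambda>z. 1 + (cmod (f z))\<^sup>2)" using fi by simp
    show "AE z in cylbox L. norm (f z * cnj (E2 L \<tau> j z)) \<le> norm (1 + (cmod (f z))\<^sup>2)"
    proof (intro AE_I2)
      fix z
      have "cmod (f z) \<le> 1 + (cmod (f z))\<^sup>2" using zero_le_power2[of "cmod (f z) - 1"] unfolding power2_diff by simp (smt (verit) norm_ge_zero)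
      then show "norm (f z * cnj (E2 L \<tau> j z)) \<le> norm (1 + (cmod (f z))\<^sup>2)" by (simp add: norm_mult E2_norm)
    qed
    show "(\<lambda>z. f z * cnj (E2 L \<tau> j z)) \<in> borel_measurable (cylbox L)" by (intro borel_measurable_times measurable_cnj fm Em)
  qed
  have EE: "integrable (cylbox L) (\<lambda>z. E2 L \<tau> j z * cnj (E2 L \<tau> l z))" for j l
    by (rule B.integrable_const_bound[of _ 1]) (auto simp: norm_mult E2_norm intro!: borel_measurable_times measurable_cnj Em)
  have fT: "(\<lambda>z. f z * cnj (T z)) = (\<lambda>z. \<Sum>j\<in>F. cnj (a j) * (f z * cnj (E2 L \<tau> j z)))"
    by (simp add: T_def sum_distrib_left mult_ac)
  have ifT: "integrable (cylbox L) (\<lambda>z. f z * cnj (T z))" unfolding fT by (intro Bochner_Integration.integrable_sum integrable_mult_right fE)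
  have IfT: "(\<integral>z. f z * cnj (T z) \<partial>cylbox L) = (\<Sum>j\<in>F. cnj (a j) * c j)"
    unfolding fT c_def by (subst Bochner_Integration.integral_sum) (auto intro!: integrable_mult_right fE)
  have TT: "(\<lambda>z. T z * cnj (T z)) = (\<lambda>z. \<Sum>j\<in>F. \<Sum>l\<in>F. (a j * cnj (a l)) * (E2 L \<tau> j z * cnj (E2 L \<tau> l z)))"
    by (simp add: T_def sum_product mult_ac)
  have iTT: "integrable (cylbox L) (\<lambda>z. T z * cnj (T z))" unfolding TT by (intro Bochner_Integration.integrable_sum integrable_mult_right EE)
  have ITT: "(\<integral>z. T z * cnj (T z) \<partial>cylbox L) = (\<Sum>j\<in>F. of_real (V * (cmod (a j))\<^sup>2))"
  proof -
    have "(\<integral>z. T z * cnj (T z) \<partial>cylbox L) = (\<Sum>j\<in>F. \<Sum>l\<in>F. (a j * cnj (a l)) * (\<integral>z. E2 L \<tau> j z * cnj (E2 L \<tau> l z) \<partial>cylbox L))"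
      unfolding TT by (subst Bochner_Integration.integral_sum, (intro Bochner_Integration.integrable_sum integrable_mult_right EE),
        intro sum.cong refl, subst Bochner_Integration.integral_sum) (auto intro!: integrable_mult_right EE)
    also have "\<dots> = (\<Sum>j\<in>F. \<Sum>l\<in>F. if l = j then a j * cnj (a j) * of_real V else 0)"
      unfolding integral_E2[OF L] by (intro sum.cong refl) (auto simp: V_def)
    also have "\<dots> = (\<Sum>j\<in>F. a j * cnj (a j) * of_real V)" using F by (intro sum.cong refl) simp
    also have "\<dots> = (\<Sum>j\<in>F. of_real (V * (cmod (a j))\<^sup>2))" by (intro sum.cong refl) (simp only: complex_norm_square of_real_mult mult.commute)
    finally show ?thesis .
  qed
  have pw: "(cmod (u - v))\<^sup>2 = (cmod u)\<^sup>2 - 2 * Re (u * cnj v) + Re (v * cnj v)" for u v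
    unfolding cmod_power2 by (simp add: power2_eq_square algebra_simps)
  have "n2 (cylbox L) (\<lambda>z. f z - T z) = (\<integral>z. (cmod (f z))\<^sup>2 - 2 * Re (f z * cnj (T z)) + Re (T z * cnj (T z)) \<partial>cylbox L)"
    unfolding n2_def pw ..
  also have "\<dots> = n2 (cylbox L) f - 2 * Re (\<integral>z. f z * cnj (T z) \<partial>cylbox L) + Re (\<integral>z. T z * cnj (T z) \<partial>cylbox L)"
    unfolding n2_def using fi ifT iTT
    by (subst Bochner_Integration.integral_add; (subst Bochner_Integration.integral_diff)?)
       (auto intro!: Bochner_Integration.integrable_diff integrable_mult_right integrable_Re simp: integral_Re simp del: times_complex.sel)
  also have "\<dots> = n2 (cylbox L) f + (\<Sum>j\<in>F. V * (cmod (a j))\<^sup>2 - 2 * Re (cnj (a j) * c j))"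
    unfolding IfT ITT by (simp add: sum_subtractf sum_distrib_left)
  also have "(\<Sum>j\<in>F. V * (cmod (a j))\<^sup>2 - 2 * Re (cnj (a j) * c j)) = (\<Sum>j\<in>F. V * (cmod (a j - c j / V))\<^sup>2 - (cmod (c j))\<^sup>2 / V)"
  proof (intro sum.cong refl)
    fix j
    have 1: "(c j / of_real V) * cnj (c j / of_real V) = of_real ((cmod (c j))\<^sup>2 / V\<^sup>2)"
      unfolding complex_norm_square[symmetric] by (simp add: norm_divide power_divide)
    have 2: "Re (a j * cnj (c j / of_real V)) = Re (cnj (a j) * c j) / V" by (simp add: Re_divide_of_real)
    have "V * (cmod (a j - c j / V))\<^sup>2 = V * (cmod (a j))\<^sup>2 - 2 * (V * (Re (cnj (a j) * c j) / V)) + V * ((cmod (c j))\<^sup>2 / V\<^sup>2)"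
      unfolding pw 1 2 by (simp add: right_diff_distrib distrib_left)
    also have "\<dots> = V * (cmod (a j))\<^sup>2 - 2 * Re (cnj (a j) * c j) + (cmod (c j))\<^sup>2 / V"
      using V by (simp add: power2_eq_square)
    finally show "V * (cmod (a j))\<^sup>2 - 2 * Re (cnj (a j) * c j) = V * (cmod (a j - c j / V))\<^sup>2 - (cmod (c j))\<^sup>2 / V" by simp
  qed
  finally show ?thesis unfolding T_def by (simp add: sum_subtractf sum_divide_distrib sum_distrib_left)
qed

lemma Bessel_box:
  assumes L: "L > 0" and f: "l2c (cylbox L) f" and F: "finite F"
  shows "(\<Sum>j\<in>F. (cmod (\<integral>z. f z * cnj (E2 L \<tau> j z) \<partial>cylbox L))\<^sup>2) \<le> 4 * pi * L * n2 (cylbox L) f"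
proof -
  have "0 \<le> n2 (cylbox L) (\<lambda>z. f z - (\<Sum>j\<in>F. ((\<integral>z. f z * cnj (E2 L \<tau> j z) \<partial>cylbox L) / (4 * pi * L)) * E2 L \<tau> j z))" by (simp add: n2_def)
  then show ?thesis unfolding n2_best_approximation[OF L f F] using L by (simp add: field_simps)
qed

lemma Parseval_box:
  assumes L: "L > 0" and f: "l2c (cylbox L) f" and e: "e > 0"
  obtains F where "finite F" "4 * pi * L * n2 (cylbox L) f \<le> (\<Sum>j\<in>F. (cmod (\<integral>z. f z * cnj (E2 L \<tau> j z) \<partial>cylbox L))\<^sup>2) + e"
proof -
  define V where "V = 4 * pi * L"
  have V: "V > 0" using L by (simp add: V_def)
  obtain T where T: "lspan (range (E2 L \<tau>)) T" "n2 (cylbox L) (\<lambda>z. f z - T z) < e / V"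
    using E2_dense[OF L f, of \<tau>] e V unfolding l2cl_def by (meson divide_pos_pos)
  obtain F a where F: "finite F" "T = (\<lambda>z. \<Sum>j\<in>F. a j * E2 L \<tau> j z)" using lspan_range_finite[OF T(1)] by blast
  define c where "c j = (\<integral>z. f z * cnj (E2 L \<tau> j z) \<partial>cylbox L)" for j
  have "n2 (cylbox L) f - (\<Sum>j\<in>F. (cmod (c j))\<^sup>2) / V \<le> n2 (cylbox L) (\<lambda>z. f z - T z)"
    unfolding F(2) n2_best_approximation[OF L f F(1)] c_def V_def[symmetric] using V by (simp add: sum_nonneg)
  then have "V * (n2 (cylbox L) f - (\<Sum>j\<in>F. (cmod (c j))\<^sup>2) / V) \<le> V * (e / V)" using T(2) V by (intro mult_left_mono) auto
  then have "V * n2 (cylbox L) f \<le> (\<Sum>j\<in>F. (cmod (c j))\<^sup>2) + e" using V by (simp add: right_diff_distrib)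
  then show thesis using that F(1) unfolding V_def c_def by blast
qed

section \<open>Localized Fourier coefficients\<close>

lemma measurable_cylbox_cyl: "f \<in> borel_measurable cyl \<Longrightarrow> f \<in> borel_measurable (cylbox L)"
proof -
  assume f: "f \<in> borel_measurable cyl"
  have "(\<lambda>y. y) \<in> measurable (ivl (- L) (2 * L)) lborel" unfolding ivl_def by (rule measurable_restrict_space1) simp
  then have "(\<lambda>z. (fst z, snd z)) \<in> measurable (cylbox L) cyl"
    unfolding cylbox_def cyl_def by (intro measurable_Pair measurable_fst measurable_compose[OF measurable_snd])
  from measurable_compose[OF this f] show ?thesis by simp
qed

lemma nn_integral_cylbox:
  assumes L: "L > 0" and f: "f \<in> borel_measurable cyl" and z: "\<And>x y. \<bar>y\<bar> \<ge> L \<Longrightarrow> f (x, y) = 0"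
  shows "(\<integral>\<^sup>+z. f z \<partial>cylbox L) = (\<integral>\<^sup>+z. f z \<partial>cyl)"
proof -
  interpret Y: finite_measure "ivl (- L) (2 * L)" using L by (intro finite_measure_ivl) simp
  interpret XY: pair_sigma_finite torus "ivl (- L) (2 * L)" ..
  have "(\<integral>\<^sup>+z. f z \<partial>cylbox L) = (\<integral>\<^sup>+y. (\<integral>\<^sup>+x. f (x, y) \<partial>torus) \<partial>ivl (- L) (2 * L))"
    using XY.nn_integral_snd[of f] measurable_cylbox_cyl[OF f, of L] by (simp add: cylbox_def)
  also have "\<dots> = (\<integral>\<^sup>+y. (\<integral>\<^sup>+x. f (x, y) \<partial>torus) * indicator {-L..<-L + 2 * L} y \<partial>lborel)"
    unfolding ivl_def by (subst nn_integral_restrict_space) auto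
  also have "\<dots> = (\<integral>\<^sup>+y. (\<integral>\<^sup>+x. f (x, y) \<partial>torus) \<partial>lborel)"
  proof (intro nn_integral_cong)
    fix y show "(\<integral>\<^sup>+x. f (x, y) \<partial>torus) * indicator {-L..<-L + 2 * L} y = (\<integral>\<^sup>+x. f (x, y) \<partial>torus)"
    proof (cases "y \<in> {-L..<-L + 2 * L}")
      case False then have "\<bar>y\<bar> \<ge> L" by auto
      then show ?thesis using z by simp
    qed simp
  qed
  also have "\<dots> = (\<integral>\<^sup>+z. f z \<partial>cyl)" by (rule nn_integral_cyl_iterated[OF f, symmetric])
  finally show ?thesis .
qed

lemma integral_cylbox:
  fixes f :: "real \<times> real \<Rightarrow> real"
  assumes L: "L > 0" and f: "integrable cyl f" and z: "\<And>x y. \<bar>y\<bar> \<ge> L \<Longrightarrow> f (x, y) = 0"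
  shows "integrable (cylbox L) f" "(\<integral>z. f z \<partial>cylbox L) = (\<integral>z. f z \<partial>cyl)"
proof -
  have fm: "f \<in> borel_measurable cyl" using f by auto
  have m: "f \<in> borel_measurable (cylbox L)" by (rule measurable_cylbox_cyl[OF fm])
  have e: "(\<integral>\<^sup>+z. ennreal (f z) \<partial>cylbox L) = (\<integral>\<^sup>+z. ennreal (f z) \<partial>cyl)"
    "(\<integral>\<^sup>+z. ennreal (- f z) \<partial>cylbox L) = (\<integral>\<^sup>+z. ennreal (- f z) \<partial>cyl)"
    using nn_integral_cylbox[OF L, of "\<lambda>z. ennreal (f z)"] nn_integral_cylbox[OF L, of "\<lambda>z. ennreal (- f z)"] fm z by simp_all
  show i: "integrable (cylbox L) f" using f m unfolding real_integrable_def e by blast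
  show "(\<integral>z. f z \<partial>cylbox L) = (\<integral>z. f z \<partial>cyl)"
    unfolding real_lebesgue_integral_def[OF i] real_lebesgue_integral_def[OF f] e ..
qed

abbreviation wave :: "real \<Rightarrow> real \<Rightarrow> real \<Rightarrow> real \<times> real \<Rightarrow> real" where
  "wave \<equiv> mode (\<lambda>_. 1)"

lemma continuous_mode:
  assumes "continuous_on UNIV g" shows "continuous_on UNIV (mode g k q \<theta>)"
proof -
  have "continuous_on UNIV (\<lambda>z::real\<times>real. g (snd z))"
    by (rule continuous_on_compose2[OF assms]) (auto intro: continuous_intros)
  then show ?thesis unfolding mode_def split_beta' by (intro continuous_intros)
qed

text \<open>A wave without cutoff is not in L2, so its product with \<open>u\<close> is not covered
  by Cauchy-Schwarz. A continuous function with bounded support in \<open>y\<close>, at least 1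
  wherever \<open>u\<close> is nonzero, makes up for this.\<close>

lemma integrable_L2_compact:
  assumes u: "L2 u" and z: "\<And>x y. \<bar>y\<bar> \<ge> L \<Longrightarrow> u (x, y) = 0"
    and f: "f \<in> borel_measurable cyl" "\<And>z. \<bar>f z\<bar> \<le> \<bar>u z\<bar>"
  shows "integrable cyl f"
proof (rule Bochner_Integration.integrable_bound)
  define b where "b = mode (\<lambda>y. max 0 (L + 1 - \<bar>y\<bar>)) 0 0 0"
  have "cc b" unfolding b_def cc_def
    by (intro conjI continuous_mode continuous_intros exI[of _ "L+1"]) (auto simp: mode_def)
  then show "integrable cyl (\<lambda>z. u z * b z)" by (intro L2_integrable_mult u cc_L2)
  show "AE z in cyl. norm (f z) \<le> norm (u z * b z)"
  proof (intro AE_I2)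
    fix z :: "real \<times> real"
    obtain x y where xy: "z = (x, y)" by (cases z)
    show "norm (f z) \<le> norm (u z * b z)"
    proof (cases "\<bar>y\<bar> \<ge> L")
      case True then show ?thesis using z[of y x] f(2)[of z] by (simp add: xy)
    next
      case False
      then have "1 \<le> \<bar>b z\<bar>" by (simp add: b_def mode_def xy)
      then have "\<bar>u z\<bar> * 1 \<le> \<bar>u z\<bar> * \<bar>b z\<bar>" by (intro mult_left_mono) auto
      then show ?thesis using f(2)[of z] by (simp add: abs_mult)
    qed
  qed
qed fact

lemma wave_le_1: "\<bar>wave k q \<theta> z\<bar> \<le> 1" by (cases z) (simp add: mode_def)

lemma wave_measurable: "wave k q \<theta> \<in> borel_measurable cyl"
  by (intro measurable_cyl_continuous continuous_mode continuous_intros)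

text \<open>The conjugate exponential is cosine minus i times sine, and a phase of
  \<open>pi / 2\<close> turns cosine into minus sine. The two real pairings are therefore the real
  and imaginary part of the complex coefficient.\<close>

lemma wave_coefficient:
  assumes L: "L > 0" and u: "L2 u" and z0: "\<forall>x y. \<bar>y\<bar> \<ge> L \<longrightarrow> u (x, y) = 0"
  shows "l2c (cylbox L) (\<lambda>z. complex_of_real (u z))" "n2 (cylbox L) (\<lambda>z. complex_of_real (u z)) = (L2norm u)\<^sup>2"
    "(cmod (\<integral>z. complex_of_real (u z) * cnj (E2 L \<tau> (k, m) z) \<partial>cylbox L))\<^sup>2
       = (pairing u (wave (of_int k) (pi * of_int m / L + \<tau> k) 0))\<^sup>2 + (pairing u (wave (of_int k) (pi * of_int m / L + \<tau> k) (pi / 2)))\<^sup>2"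
proof -
  have z: "\<And>x y. \<bar>y\<bar> \<ge> L \<Longrightarrow> u (x, y) = 0" using z0 by blast
  note i2 = integral_cylbox[OF L L2D(2)[OF u]]
  have "complex_of_real \<in> borel_measurable borel" by (intro borel_measurable_continuous_onI continuous_intros)
  from measurable_compose[OF measurable_cylbox_cyl[OF L2D(1)[OF u], of L] this]
  show l: "l2c (cylbox L) (\<lambda>z. complex_of_real (u z))" unfolding l2c_def
    using i2(1) z by simp
  show "n2 (cylbox L) (\<lambda>z. complex_of_real (u z)) = (L2norm u)\<^sup>2" unfolding n2_def L2norm_sq using i2(2) z by simp
  define q where "q = pi * of_int m / L + \<tau> k"
  have m: "(\<lambda>z. u z * wave k q \<theta> z) \<in> borel_measurable cyl" for \<theta>
    by (intro borel_measurable_times L2D(1) u wave_measurable)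
  have uB: "integrable cyl (\<lambda>z. u z * wave k q \<theta> z)" for \<theta> :: real
  proof (rule integrable_L2_compact[OF u z m])
    show "\<bar>u z * wave k q \<theta> z\<bar> \<le> \<bar>u z\<bar>" for z
      using mult_left_mono[OF wave_le_1, of "\<bar>u z\<bar>" k q \<theta> z] by (simp add: abs_mult)
  qed
  have zw: "\<bar>y\<bar> \<ge> L \<Longrightarrow> u (x, y) * wave k q \<theta> (x, y) = 0" for x y \<theta> using z by simp
  have pw: "pairing u (wave k q \<theta>) = (\<integral>z. u z * wave k q \<theta> z \<partial>cylbox L)" for \<theta>
    unfolding pairing_def using integral_cylbox(2)[OF L uB zw] by simp
  have ii: "integrable (cylbox L) (\<lambda>z. u z * wave k q \<theta> z)" for \<theta> using integral_cylbox(1)[OF L uB zw] .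
  have e: "complex_of_real (u z) * cnj (E2 L \<tau> (k, m) z)
      = complex_of_real (u z * wave k q 0 z) + \<i> * complex_of_real (u z * wave k q (pi / 2) z)" for z
    by (cases z) (simp add: complex_eq_iff E2_def mode_def q_def cos_add_pi_half)
  have "(\<integral>z. complex_of_real (u z) * cnj (E2 L \<tau> (k, m) z) \<partial>cylbox L)
      = (\<integral>z. complex_of_real (u z * wave k q 0 z) \<partial>cylbox L) + (\<integral>z. \<i> * complex_of_real (u z * wave k q (pi / 2) z) \<partial>cylbox L)"
    unfolding e by (intro Bochner_Integration.integral_add integrable_mult_right integrable_of_real ii)
  also have "\<dots> = complex_of_real (pairing u (wave k q 0)) + \<i> * complex_of_real (pairing u (wave k q (pi / 2)))"
    unfolding pw integral_mult_right_zero integral_complex_of_real ..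
  finally show "(cmod (\<integral>z. complex_of_real (u z) * cnj (E2 L \<tau> (k, m) z) \<partial>cylbox L))\<^sup>2
       = (pairing u (wave (of_int k) (pi * of_int m / L + \<tau> k) 0))\<^sup>2 + (pairing u (wave (of_int k) (pi * of_int m / L + \<tau> k) (pi / 2)))\<^sup>2"
    by (simp add: cmod_power2 q_def)
qed

text \<open>The derivatives are taken before the rescaling, so that every further y-derivative
  produces an explicit factor \<open>e\<close>.\<close>

definition chi :: "nat \<Rightarrow> real \<Rightarrow> real \<Rightarrow> real" where
  "chi j e y = (deriv ^^ j) cutoff (e * y)"

lemma smooth1_funpow_deriv: "smooth1 g \<Longrightarrow> smooth1 ((deriv ^^ j) g)"
  by (induct j) (auto intro: smooth1_deriv)

lemma csmooth_funpow_deriv: "csmooth g \<Longrightarrow> csmooth ((deriv ^^ j) g)"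
  by (induct j) (auto intro: csmooth_deriv)

lemma csmooth_cutoff: "csmooth cutoff"
  using csmooth_scaled_cutoff[of 1] by simp

lemma smooth1_chi: "smooth1 (chi j e)"
  using smooth1_affine[OF smooth1_funpow_deriv[OF smooth1_cutoff], of 1 j e 0] by (simp add: chi_def[abs_def])

lemma deriv_chi: "deriv (chi j e) = (\<lambda>y. e * chi (Suc j) e y)"
proof
  fix y
  have "((\<lambda>y. e * y) has_real_derivative e) (at y)" by (auto intro!: derivative_eq_intros)
  from DERIV_chain2[OF smooth1_DERIV[OF smooth1_funpow_deriv[OF smooth1_cutoff, of j]] this]
  show "deriv (chi j e) y = e * chi (Suc j) e y" unfolding chi_def[abs_def] by (intro DERIV_imp_deriv) (simp add: mult.commute)
qed

lemma funpow_deriv_cutoff_support: "\<bar>y\<bar> > 1 \<Longrightarrow> (deriv ^^ j) cutoff y = 0"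
proof (induct j arbitrary: y)
  case 0 then show ?case by (simp add: cutoff_props)
next
  case (Suc j)
  have "((deriv ^^ j) cutoff has_real_derivative 0) (at y)"
  proof (rule has_field_derivative_transform_within_open[of "\<lambda>_. 0"])
    show "open {y :: real. \<bar>y\<bar> > 1}" by (intro open_Collect_less continuous_intros)
  qed (use Suc in auto)
  then show ?case by (simp add: DERIV_imp_deriv)
qed

text \<open>The support is contained in \<open>|y| <= 1 / e\<close>; the radius \<open>2 / e\<close>
  leaves a margin and is the half-width of the box on which the Fourier series is taken.\<close>

lemma chi_support: assumes "e > 0" "\<bar>y\<bar> \<ge> 2 / e" shows "chi j e y = 0"
proof -
  have "\<bar>e * y\<bar> \<ge> 2" using assms by (simp add: abs_mult field_simps)
  then show ?thesis unfolding chi_def by (intro funpow_deriv_cutoff_support) simp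
qed

lemma csmooth_chi: assumes "e > 0" shows "csmooth (chi j e)"
  unfolding csmooth_def using smooth1_chi chi_support[OF assms] by (intro conjI exI[of _ "2 / e"]) auto

lemma chi_bounded: obtains B where "B \<ge> 1" "\<And>e y. \<bar>chi 0 e y\<bar> \<le> 1" "\<And>j e y. j \<le> 2 \<Longrightarrow> \<bar>chi j e y\<bar> \<le> B"
proof -
  obtain B1 where B1: "\<And>y. \<bar>(deriv ^^ 1) cutoff y\<bar> \<le> B1" using csmooth_bounded[OF csmooth_funpow_deriv[OF csmooth_cutoff]] by blast
  obtain B2 where B2: "\<And>y. \<bar>(deriv ^^ 2) cutoff y\<bar> \<le> B2" using csmooth_bounded[OF csmooth_funpow_deriv[OF csmooth_cutoff]] by blast
  have 0: "\<bar>chi 0 e y\<bar> \<le> 1" for e y using cutoff_props(2,3)[of "e * y"] by (simp add: chi_def)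
  define B where "B = max 1 (max B1 B2)"
  have "\<bar>chi j e y\<bar> \<le> B" if "j \<le> 2" for j e y
  proof -
    from that consider "j = 0" | "j = 1" | "j = 2" by linarith
    then show ?thesis
    proof cases
      case 1 then show ?thesis using 0[of e y] by (simp add: B_def)
    next
      case 2 then show ?thesis using B1[of "e * y"] unfolding B_def chi_def by (metis max.coboundedI1 max.coboundedI2)
    next
      case 3 then show ?thesis using B2[of "e * y"] unfolding B_def chi_def by (metis max.coboundedI2)
    qed
  qed
  then show thesis using 0 by (intro that[of B]) (auto simp: B_def)
qed

text \<open>
  The phases \<open>\<theta> = 0\<close> and \<open>\<theta> = \<pi> / 2\<close> give the real and imaginary part of a Fourier coefficient;
  \<open>j\<close> counts the derivatives that have fallen on the cutoff.
\<close>

definition hat :: "nat \<Rightarrow> real \<Rightarrow> real \<Rightarrow> real \<Rightarrow> real \<Rightarrow> (real \<times> real \<Rightarrow> real) \<Rightarrow> real" where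
  "hat j e k q \<theta> u = pairing u (mode (chi j e) k q \<theta>)"

definition hat2 :: "nat \<Rightarrow> real \<Rightarrow> real \<Rightarrow> real \<Rightarrow> (real \<times> real \<Rightarrow> real) \<Rightarrow> real" where
  "hat2 j e k q u = (hat j e k q 0 u)\<^sup>2 + (hat j e k q (pi / 2) u)\<^sup>2"

text \<open>The y-frequency \<open>pi m / L + \<tau> k\<close> of \<open>E2 L \<tau>\<close> for the
  box of half-width \<open>L = 2 / e\<close>.\<close>

definition freq :: "real \<Rightarrow> (int \<Rightarrow> real) \<Rightarrow> int \<times> int \<Rightarrow> real" where
  "freq e \<tau> km = pi * of_int (snd km) * e / 2 + \<tau> (fst km)"

lemma hat_wave: "hat j e k q \<theta> u = pairing (\<lambda>z. u z * chi j e (snd z)) (wave k q \<theta>)"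
  unfolding hat_def pairing_def mode_def by (intro Bochner_Integration.integral_cong) (auto simp: split_beta')

lemma L2_chi: assumes "L2 u" "e > 0" shows "L2 (\<lambda>z. u z * chi j e (snd z))"
proof -
  obtain B where B: "\<And>y. \<bar>chi j e y\<bar> \<le> B" using csmooth_bounded[OF csmooth_chi[OF assms(2)]] by blast
  have "continuous_on UNIV (\<lambda>z::real\<times>real. chi j e (snd z))"
    by (rule continuous_on_compose2[OF smooth1_continuous[OF smooth1_chi]]) (auto intro: continuous_intros)
  then show ?thesis using B by (intro L2_mult_bounded[OF assms(1)] measurable_cyl_continuous) auto
qed

lemma L2norm_chi:
  assumes "L2 u" "e > 0" "\<And>y. \<bar>chi j e y\<bar> \<le> B" shows "L2norm (\<lambda>z. u z * chi j e (snd z)) \<le> B * L2norm u"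
proof -
  have B: "B \<ge> 0" using assms(3)[of 0] by linarith
  have "L2norm (\<lambda>z. u z * chi j e (snd z)) \<le> L2norm (\<lambda>z. B * u z)"
    using assms(3) L2D(1)[OF L2_chi[OF assms(1,2)]] B
    by (intro L2norm_mono L2_scale assms) (auto simp: abs_mult mult.commute[of "\<bar>u _\<bar>"] intro!: mult_right_mono)
  then show ?thesis using B by (simp add: L2norm_scale)
qed

text \<open>\<open>8 pi / e\<close> is the area of the box. Multiplied by its inverse, the sum
  resembles a Riemann sum of a Fourier integral and stays bounded as \<open>e\<close> tends to 0.
  The bound does not depend on the shift \<open>\<tau>\<close>.\<close>

lemma Bessel_hat:
  assumes u: "L2 u" and e: "e > 0" and F: "finite F" and B: "\<And>y. \<bar>chi j e y\<bar> \<le> B"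
  shows "(\<Sum>km\<in>F. hat2 j e (of_int (fst km)) (freq e \<tau> km) u) \<le> 8 * pi / e * (B\<^sup>2 * (L2norm u)\<^sup>2)"
proof -
  define v where "v z = u z * chi j e (snd z)" for z
  have v: "L2 v" unfolding v_def by (rule L2_chi[OF u e])
  have L: "2 / e > 0" using e by simp
  have vz: "\<forall>x y. \<bar>y\<bar> \<ge> 2 / e \<longrightarrow> v (x, y) = 0" by (simp add: v_def chi_support[OF e])
  have "(\<Sum>km\<in>F. hat2 j e (of_int (fst km)) (freq e \<tau> km) u)
     = (\<Sum>km\<in>F. (cmod (\<integral>z. complex_of_real (v z) * cnj (E2 (2 / e) \<tau> km z) \<partial>cylbox (2 / e)))\<^sup>2)"
  proof (intro sum.cong refl)
    fix km :: "int \<times> int"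
    obtain k m where km: "km = (k, m)" by (cases km)
    have vv: "(\<lambda>z. u z * chi j e (snd z)) = v" by (simp add: v_def[abs_def])
    show "hat2 j e (of_int (fst km)) (freq e \<tau> km) u = (cmod (\<integral>z. complex_of_real (v z) * cnj (E2 (2 / e) \<tau> km z) \<partial>cylbox (2 / e)))\<^sup>2"
      unfolding km wave_coefficient(3)[OF L v vz] by (simp add: hat2_def hat_wave vv freq_def)
  qed
  also have "\<dots> \<le> 4 * pi * (2 / e) * n2 (cylbox (2 / e)) (\<lambda>z. complex_of_real (v z))"
    by (rule Bessel_box[OF L wave_coefficient(1)[OF L v vz] F])
  also have "\<dots> = 8 * pi / e * (L2norm v)\<^sup>2" unfolding wave_coefficient(2)[OF L v vz] by simp
  also have "\<dots> \<le> 8 * pi / e * (B * L2norm u)\<^sup>2"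
    using L2norm_chi[OF u e B] e unfolding v_def[symmetric] by (intro mult_left_mono power_mono) auto
  finally show ?thesis by (simp add: power_mult_distrib)
qed

lemma Parseval_hat:
  assumes u: "L2 u" and e: "e > 0" and d: "d > 0"
  obtains F where "finite F"
    "(L2norm (\<lambda>z. u z * chi 0 e (snd z)))\<^sup>2 \<le> e / (8 * pi) * (\<Sum>km\<in>F. hat2 0 e (of_int (fst km)) (freq e \<tau> km) u) + d"
proof -
  define v where "v z = u z * chi 0 e (snd z)" for z
  have v: "L2 v" unfolding v_def by (rule L2_chi[OF u e])
  have L: "2 / e > 0" using e by simp
  have vz: "\<forall>x y. \<bar>y\<bar> \<ge> 2 / e \<longrightarrow> v (x, y) = 0" by (simp add: v_def chi_support[OF e])
  have h: "hat2 0 e (of_int (fst km)) (freq e \<tau> km) u = (cmod (\<integral>z. complex_of_real (v z) * cnj (E2 (2 / e) \<tau> km z) \<partial>cylbox (2 / e)))\<^sup>2" for km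
  proof -
    obtain k m where km: "km = (k, m)" by (cases km)
    have vv: "(\<lambda>z. u z * chi 0 e (snd z)) = v" by (simp add: v_def[abs_def])
    show ?thesis unfolding km wave_coefficient(3)[OF L v vz] by (simp add: hat2_def hat_wave vv freq_def)
  qed
  have d': "8 * pi / e * d > 0" using e d by simp
  obtain F where F: "finite F" "4 * pi * (2 / e) * n2 (cylbox (2 / e)) (\<lambda>z. complex_of_real (v z))
      \<le> (\<Sum>km\<in>F. (cmod (\<integral>z. complex_of_real (v z) * cnj (E2 (2 / e) \<tau> km z) \<partial>cylbox (2 / e)))\<^sup>2) + 8 * pi / e * d"
    by (rule Parseval_box[OF L wave_coefficient(1)[OF L v vz] d', of \<tau>])
  define Q where "Q = (\<Sum>km\<in>F. hat2 0 e (of_int (fst km)) (freq e \<tau> km) u)"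
  have "4 * pi * (2 / e) * (L2norm v)\<^sup>2 \<le> Q + 8 * pi / e * d"
    using F(2) unfolding h[symmetric] wave_coefficient(2)[OF L v vz] Q_def[symmetric] .
  then have "(L2norm v)\<^sup>2 \<le> e / (8 * pi) * Q + d"
    using e by (simp add: field_simps)
  then have "(L2norm v)\<^sup>2 \<le> e / (8 * pi) * (\<Sum>km\<in>F. hat2 0 e (of_int (fst km)) (freq e \<tau> km) u) + d" unfolding Q_def .
  then show thesis using that F(1) unfolding v_def by blast
qed

lemma chi_tendsto:
  assumes u: "L2 u" and e: "e \<longlonglongrightarrow> 0" shows "(\<lambda>n. L2norm (\<lambda>z. u z - u z * chi 0 (e n) (snd z))) \<longlonglongrightarrow> 0"
proof -
  have um: "u \<in> borel_measurable cyl" by (rule L2D(1)[OF u])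
  have cm: "(\<lambda>z. chi 0 e (snd z)) \<in> borel_measurable cyl" for e
    by (intro measurable_cyl_continuous continuous_on_compose2[OF smooth1_continuous[OF smooth1_chi]]) (auto intro: continuous_intros)
  have c0: "isCont cutoff 0" using smooth1_DERIV[OF smooth1_cutoff] DERIV_isCont by blast
  have "(\<lambda>n. \<integral>z. (u z - u z * chi 0 (e n) (snd z))\<^sup>2 \<partial>cyl) \<longlonglongrightarrow> (\<integral>z. 0 \<partial>cyl)"
  proof (rule integral_dominated_convergence[where w = "\<lambda>z. (u z)\<^sup>2"])
    show "(\<lambda>z. (u z - u z * chi 0 (e n) (snd z))\<^sup>2) \<in> borel_measurable cyl" for n
      by (intro borel_measurable_power borel_measurable_diff borel_measurable_times um cm)
    show "integrable cyl (\<lambda>z. (u z)\<^sup>2)" by (rule L2D(2)[OF u])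
    show "AE z in cyl. (\<lambda>n. (u z - u z * chi 0 (e n) (snd z))\<^sup>2) \<longlonglongrightarrow> 0"
    proof (intro AE_I2)
      fix z :: "real \<times> real"
      have "(\<lambda>n. e n * snd z) \<longlonglongrightarrow> 0 * snd z" by (intro tendsto_intros e)
      then have "(\<lambda>n. cutoff (e n * snd z)) \<longlonglongrightarrow> cutoff 0" using isCont_tendsto_compose[OF c0] by simp
      then have "(\<lambda>n. (u z - u z * cutoff (e n * snd z))\<^sup>2) \<longlonglongrightarrow> (u z - u z * cutoff 0)\<^sup>2" by (intro tendsto_intros)
      then show "(\<lambda>n. (u z - u z * chi 0 (e n) (snd z))\<^sup>2) \<longlonglongrightarrow> 0" by (simp add: chi_def cutoff_props)
    qed
    show "AE z in cyl. norm ((u z - u z * chi 0 (e n) (snd z))\<^sup>2) \<le> (u z)\<^sup>2" for n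
    proof (intro AE_I2)
      fix z :: "real \<times> real"
      have "\<bar>1 - chi 0 (e n) (snd z)\<bar> \<le> 1" using cutoff_props(2,3)[of "e n * snd z"] by (simp add: chi_def)
      then have "(1 - chi 0 (e n) (snd z))\<^sup>2 \<le> 1" by (simp add: abs_square_le_1)
      then have "(u z)\<^sup>2 * (1 - chi 0 (e n) (snd z))\<^sup>2 \<le> (u z)\<^sup>2 * 1" by (intro mult_left_mono) auto
      moreover have "u z - u z * chi 0 (e n) (snd z) = u z * (1 - chi 0 (e n) (snd z))" by (simp add: algebra_simps)
      ultimately show "norm ((u z - u z * chi 0 (e n) (snd z))\<^sup>2) \<le> (u z)\<^sup>2" by (simp add: power_mult_distrib)
    qed
  qed auto
  from tendsto_real_sqrt[OF this] show ?thesis unfolding L2norm_def by simp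
qed

text \<open>
  The shift \<open>\<tau>\<close> allows for the lattice \<open>\<eta> - k T\<close>, the image at time \<open>T\<close> of the lattice of initial
  frequencies.
\<close>

lemma L2norm_le_synthesis:
  assumes u: "L2 u" and B: "B \<ge> 0" and C: "C \<ge> 0"
    and z: "\<And>e q \<theta>. e > 0 \<Longrightarrow> hat 0 e 0 q \<theta> u = 0"
    and h: "\<And>e F. 0 < e \<Longrightarrow> e \<le> 1 \<Longrightarrow> finite F \<Longrightarrow> (\<And>km. km \<in> F \<Longrightarrow> fst km \<noteq> 0) \<Longrightarrow>
      e / (8 * pi) * (\<Sum>km\<in>F. hat2 0 e (of_int (fst km)) (freq e \<tau> km) u) \<le> B + C * e"
  shows "(L2norm u)\<^sup>2 \<le> B"
proof -
  define e where "e n = 1 / real (Suc n)" for n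
  have e0: "e \<longlonglongrightarrow> 0" unfolding e_def using LIMSEQ_inverse_real_of_nat by (simp add: inverse_eq_divide)
  have e: "0 < e n" "e n \<le> 1" for n by (auto simp: e_def)
  define v where "v n z = u z * chi 0 (e n) (snd z)" for n z
  have v: "L2 (v n)" for n unfolding v_def by (rule L2_chi[OF u e(1)])
  have "(L2norm (v n))\<^sup>2 \<le> B + (C + 1) * e n" for n
  proof -
    \<comment> \<open>The tolerance in Parseval's identity is \<open>e n\<close> itself, so that it
      merges with the error \<open>C e\<close> and disappears in the same limit.\<close>
    obtain F where F: "finite F" "(L2norm (v n))\<^sup>2 \<le> e n / (8 * pi) * (\<Sum>km\<in>F. hat2 0 (e n) (of_int (fst km)) (freq (e n) \<tau> km) u) + e n"
      using Parseval_hat[OF u e(1) e(1), of n \<tau> n] unfolding v_def by blast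
    have "(\<Sum>km\<in>F. hat2 0 (e n) (of_int (fst km)) (freq (e n) \<tau> km) u) = (\<Sum>km\<in>{km\<in>F. fst km \<noteq> 0}. hat2 0 (e n) (of_int (fst km)) (freq (e n) \<tau> km) u)"
      using F(1) z[OF e(1)] by (intro sum.mono_neutral_right) (auto simp: hat2_def)
    moreover have "e n / (8 * pi) * (\<Sum>km\<in>{km\<in>F. fst km \<noteq> 0}. hat2 0 (e n) (of_int (fst km)) (freq (e n) \<tau> km) u) \<le> B + C * e n"
      using F(1) by (intro h e) auto
    ultimately show ?thesis using F(2) by (simp add: algebra_simps)
  qed
  moreover have "(\<lambda>n. B + (C + 1) * e n) \<longlonglongrightarrow> B + (C + 1) * 0" by (intro tendsto_intros e0)
  moreover have "(\<lambda>n. (L2norm (v n))\<^sup>2) \<longlonglongrightarrow> (L2norm u)\<^sup>2"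
    using chi_tendsto[OF u e0] by (intro tendsto_power L2norm_tendsto v u) (simp add: v_def L2norm_minus_commute[of _ u])
  ultimately show ?thesis using LIMSEQ_le[of "\<lambda>n. (L2norm (v n))\<^sup>2" _ "\<lambda>n. B + (C + 1) * e n"] by simp
qed

section \<open>Derivatives, averages and the Laplacian on localized coefficients\<close>

lemma mode_shift_pi: "mode g k q (\<theta> + pi) = (\<lambda>z. - mode g k q \<theta> z)"
  by (auto simp: mode_def add.assoc[symmetric])

lemma mode_shift_halves: "mode g k q (\<theta> + pi / 2 + pi / 2) = (\<lambda>z. - mode g k q \<theta> z)"
  using mode_shift_pi[of g k q \<theta>] by (simp add: add.assoc)

lemma mode_shift_pi': "mode g k q (pi + \<theta>) = (\<lambda>z. - mode g k q \<theta> z)"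
  using mode_shift_pi[of g k q \<theta>] by (simp add: add.commute)

lemma mode_scale_profile: "mode (\<lambda>y. c * g y) k q \<theta> = (\<lambda>z. c * mode g k q \<theta> z)"
  by (auto simp: mode_def)

lemma pdy_mode_chi: "pdy (mode (chi j e) k q \<theta>) = (\<lambda>z. q * mode (chi j e) k q (\<theta> + pi / 2) z + e * mode (chi (Suc j) e) k q \<theta> z)"
  unfolding pdy_mode[OF smooth1_chi] deriv_chi mode_scale_profile ..

lemma test_function_mode_chi: "e > 0 \<Longrightarrow> k \<in> \<int> \<Longrightarrow> test_function (mode (chi j e) k q \<theta>)"
  by (intro test_function_mode csmooth_chi)

lemma L2_mode_chi: assumes "e > 0" shows "L2 (mode (chi j e) k q \<theta>)"
proof (rule cc_L2)
  show "cc (mode (chi j e) k q \<theta>)" unfolding cc_def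
    using chi_support[OF assms] by (intro conjI continuous_mode smooth1_continuous[OF smooth1_chi] exI[of _ "2 / e"]) (auto simp: mode_def)
qed

lemma pdy_lincomb_mode_chi:
  "pdy (pdy (mode (chi 0 e) k q \<theta>)) = (\<lambda>z. - q\<^sup>2 * mode (chi 0 e) k q \<theta> z + 2 * q * e * mode (chi 1 e) k q (\<theta> + pi / 2) z
     + e\<^sup>2 * mode (chi 2 e) k q \<theta> z)"
proof -
  have d: "\<And>z. mode (chi j e) k q \<theta> differentiable (at z)" for j \<theta> by (intro mode_differentiable smooth1_chi)
  show ?thesis unfolding pdy_mode_chi[of 0]
    by (subst pdy_lincomb[OF d d]) (simp add: pdy_mode_chi mode_shift_pi' algebra_simps power2_eq_square numeral_2_eq_2)
qed

lemma laplacian_mode_chi: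
  "laplacian (mode (chi 0 e) k q \<theta>) = (\<lambda>z. - (k\<^sup>2 + q\<^sup>2) * mode (chi 0 e) k q \<theta> z
     + (2 * q * e * mode (chi 1 e) k q (\<theta> + pi / 2) z + e\<^sup>2 * mode (chi 2 e) k q \<theta> z))"
proof -
  have d: "\<And>z. mode (chi j e) k q \<theta> differentiable (at z)" for j \<theta> by (intro mode_differentiable smooth1_chi)
  have "pdx (pdx (mode (chi 0 e) k q \<theta>)) = (\<lambda>z. - k\<^sup>2 * mode (chi 0 e) k q \<theta> z)"
    unfolding pdx_mode using pdx_lincomb[OF d d, of k 0 "\<theta> + pi / 2" 0 0 \<theta>]
    by (simp add: pdx_mode mode_shift_pi' mode_shift_pi power2_eq_square mult.assoc)
  then show ?thesis unfolding laplacian_def pdy_lincomb_mode_chi by (simp add: algebra_simps)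
qed

lemma hat_add: "L2 u \<Longrightarrow> L2 v \<Longrightarrow> e > 0 \<Longrightarrow> hat j e k q \<theta> (\<lambda>z. u z + v z) = hat j e k q \<theta> u + hat j e k q \<theta> v"
  unfolding hat_def by (intro pairing_add_left L2_mode_chi)

lemma hat_diff: "L2 u \<Longrightarrow> L2 v \<Longrightarrow> e > 0 \<Longrightarrow> hat j e k q \<theta> (\<lambda>z. u z - v z) = hat j e k q \<theta> u - hat j e k q \<theta> v"
  unfolding hat_def by (intro pairing_diff_left L2_mode_chi)

lemma hat_shift: "hat j e k q (\<theta> + pi / 2 + pi / 2) u = - hat j e k q \<theta> u"
  unfolding hat_def mode_shift_halves using pairing_scale_right[of u "-1"] by simp

lemma hat_shift_pi: "hat j e k q pi u = - hat j e k q 0 u"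
  using hat_shift[of j e k q 0 u] by simp

text \<open>For \<open>k\<close> different from 0 a mode is, up to the factor \<open>k\<close>, the
  x-derivative of another periodic mode. Its average vanishes, so it does not see the average of
  \<open>u\<close>.\<close>

lemma hat_fluct:
  assumes "L2 u" "e > 0" "k \<in> \<int>" "k \<noteq> 0" shows "hat j e k q \<theta> (fluct u) = hat j e k q \<theta> u"
proof -
  have t: "test_function (mode (chi j e) k q (\<theta> - pi / 2))" by (intro test_function_mode_chi assms)
  have "pdx (mode (chi j e) k q (\<theta> - pi / 2)) = (\<lambda>z. k * mode (chi j e) k q \<theta> z)" by (simp add: pdx_mode)
  then have "xavg (\<lambda>z. k * mode (chi j e) k q \<theta> z) = (\<lambda>z. 0)" using xavg_pdx[OF t] by simp
  then have "xavg (mode (chi j e) k q \<theta>) = (\<lambda>z. 0)" using assms(4) by (auto simp: xavg_def fun_eq_iff)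
  then have "fluct (mode (chi j e) k q \<theta>) = mode (chi j e) k q \<theta>" by (simp add: fluct_def)
  then show ?thesis unfolding hat_def using pairing_fluct_commute[OF assms(1) L2_mode_chi[OF assms(2)], of j k q \<theta>] by simp
qed

lemma hat_fluct_0: assumes "L2 u" "e > 0" shows "hat j e 0 q \<theta> (fluct u) = 0"
proof -
  have "xavg (mode (chi j e) 0 q \<theta>) = mode (chi j e) 0 q \<theta>" by (rule xavg_indep) (simp add: mode_def)
  then have "fluct (mode (chi j e) 0 q \<theta>) = (\<lambda>z. 0)" by (simp add: fluct_def)
  then show ?thesis unfolding hat_def using pairing_fluct_commute[OF assms(1) L2_mode_chi[OF assms(2)], of j 0 q \<theta>] by (simp add: pairing_def)
qed

lemma hat_weak_dx:
  assumes "is_weak_dx u g" "e > 0" "k \<in> \<int>" shows "hat j e k q \<theta> g = - k * hat j e k q (\<theta> + pi / 2) u"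
proof -
  have "pairing u (pdx (mode (chi j e) k q \<theta>)) = - pairing g (mode (chi j e) k q \<theta>)"
    using assms test_function_mode_chi unfolding is_weak_dx_def by blast
  then show ?thesis unfolding hat_def pdx_mode pairing_scale_right by simp
qed

lemma hat_weak_dy:
  assumes "L2 u" "is_weak_dy u g" "e > 0" "k \<in> \<int>"
  shows "hat j e k q \<theta> g = - (q * hat j e k q (\<theta> + pi / 2) u + e * hat (Suc j) e k q \<theta> u)"
proof -
  have "pairing u (pdy (mode (chi j e) k q \<theta>)) = - pairing g (mode (chi j e) k q \<theta>)"
    using assms test_function_mode_chi unfolding is_weak_dy_def by blast
  moreover have "pairing u (pdy (mode (chi j e) k q \<theta>)) = q * hat j e k q (\<theta> + pi / 2) u + e * hat (Suc j) e k q \<theta> u"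
    unfolding hat_def pdy_mode_chi
    by (subst pairing_add_right) (auto intro!: L2_scale L2_mode_chi assms simp: pairing_scale_right)
  ultimately show ?thesis unfolding hat_def by simp
qed

lemma pairing_laplacian_mode:
  assumes "L2 u" "e > 0"
  shows "pairing u (laplacian (mode (chi 0 e) k q \<theta>)) = - (k\<^sup>2 + q\<^sup>2) * hat 0 e k q \<theta> u
     + (2 * q * e * hat 1 e k q (\<theta> + pi / 2) u + e\<^sup>2 * hat 2 e k q \<theta> u)"
  unfolding laplacian_mode_chi hat_def
  using pairing_add_right[OF L2_scale[OF L2_mode_chi] L2_add[OF L2_scale[OF L2_mode_chi] L2_scale[OF L2_mode_chi]] assms(1), OF assms(2) assms(2) assms(2)]
    pairing_add_right[OF L2_scale[OF L2_mode_chi] L2_scale[OF L2_mode_chi] assms(1), OF assms(2) assms(2)]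
  by (simp add: pairing_scale_right)

section \<open>Uniqueness for the Poisson equation in L2\<close>

lemma hat_L1_bound:
  assumes u: "L2 u" and d: "d > 0"
  obtains C where "C \<ge> 0" "\<And>e k q \<theta>. e > 0 \<Longrightarrow> \<bar>hat 0 e k q \<theta> (\<lambda>z. u z * chi 0 d (snd z))\<bar> \<le> C"
proof -
  define v where "v z = u z * chi 0 d (snd z)" for z
  have v: "L2 v" unfolding v_def by (rule L2_chi[OF u d])
  have vz: "\<bar>y\<bar> \<ge> 2 / d \<Longrightarrow> v (x, y) = 0" for x y using chi_support[OF d] by (simp add: v_def)
  have i: "integrable cyl (\<lambda>z. \<bar>v z\<bar>)"
    by (rule integrable_L2_compact[OF v vz]) (use L2D(1)[OF v] in auto)
  have "\<bar>hat 0 e k q \<theta> v\<bar> \<le> (\<integral>z. \<bar>v z\<bar> \<partial>cyl)" if "e > 0" for e k q \<theta>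
  proof -
    have m1: "\<bar>mode (chi 0 e) k q \<theta> z\<bar> \<le> 1" for z
    proof -
      have "\<bar>chi 0 e (snd z)\<bar> * \<bar>cos (k * fst z + q * snd z + \<theta>)\<bar> \<le> 1 * 1"
        using cutoff_props(2,3)[of "e * snd z"] by (intro mult_mono) (auto simp: chi_def)
      then show ?thesis by (simp add: mode_def split_beta' abs_mult)
    qed
    have "\<bar>hat 0 e k q \<theta> v\<bar> \<le> (\<integral>z. \<bar>v z * mode (chi 0 e) k q \<theta> z\<bar> \<partial>cyl)"
      unfolding hat_def pairing_def by (rule integral_abs_bound)
    also have "\<dots> \<le> (\<integral>z. \<bar>v z\<bar> \<partial>cyl)"
      using mult_left_mono[OF m1] by (intro integral_mono i integrable_abs L2_integrable_mult v L2_mode_chi that) (simp add: abs_mult)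
    finally show ?thesis .
  qed
  then show thesis unfolding v_def by (intro that[of "\<integral>z. \<bar>v z\<bar> \<partial>cyl"]) (auto simp: v_def)
qed

lemma sq_sum_le: "(a + b)\<^sup>2 \<le> 2 * a\<^sup>2 + 2 * (b::real)\<^sup>2"
  using zero_le_power2[of "a - b"] unfolding power2_sum power2_diff by linarith

text \<open>Lattice points of spacing about \<open>e\<close> in a window of width about
  \<open>sqrt e\<close>. Against the weight \<open>e\<close> of a single coefficient their total
  contribution is of order \<open>sqrt e\<close>.\<close>

lemma card_low_frequency:
  assumes e: "0 < e" "e \<le> 1"
  shows "finite {m::int. (pi * of_int m * e / 2)\<^sup>2 < e}" "real (card {m::int. (pi * of_int m * e / 2)\<^sup>2 < e}) \<le> 3 / sqrt e"
proof -
  define N where "N = \<lfloor>1 / sqrt e\<rfloor>"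
  have s: "sqrt e > 0" "sqrt e \<le> 1" "e = sqrt e * sqrt e" using e by auto
  have "{m::int. (pi * of_int m * e / 2)\<^sup>2 < e} \<subseteq> {-N..N}"
  proof
    fix m :: int assume "m \<in> {m. (pi * of_int m * e / 2)\<^sup>2 < e}"
    then have "sqrt ((pi * of_int m * e / 2)\<^sup>2) < sqrt e" by (intro real_sqrt_less_mono) blast
    then have "pi / 2 * e * \<bar>of_int m\<bar> < sqrt e" using e by (simp add: abs_mult mult_ac)
    moreover have "1 * e * \<bar>of_int m\<bar> \<le> pi / 2 * e * \<bar>of_int m\<bar>" using pi_ge_two e by (intro mult_right_mono) auto
    ultimately have "e * \<bar>of_int m\<bar> < sqrt e" by simp
    then have "sqrt e * (sqrt e * \<bar>of_int m\<bar>) < sqrt e * 1" using s(3) by (metis mult.assoc mult_1_right)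
    then have "sqrt e * \<bar>of_int m\<bar> < 1" using s(1) by (simp only: mult_less_cancel_left_pos)
    then have "\<bar>of_int m\<bar> \<le> 1 / sqrt e" using s(1) by (simp add: field_simps)
    then have "of_int \<bar>m\<bar> \<le> 1 / sqrt e" by simp
    then have "\<bar>m\<bar> \<le> N" unfolding N_def by (simp add: le_floor_iff)
    then show "m \<in> {-N..N}" by auto
  qed
  moreover have "N \<ge> 0" unfolding N_def using s by simp
  ultimately show "finite {m::int. (pi * of_int m * e / 2)\<^sup>2 < e}" by (auto intro: finite_subset)
  have "card {m::int. (pi * of_int m * e / 2)\<^sup>2 < e} \<le> card {-N..N}" by (intro card_mono \<open>_ \<subseteq> _\<close>) simp
  also have "\<dots> = nat (2 * N + 1)" by simp
  finally have "real (card {m::int. (pi * of_int m * e / 2)\<^sup>2 < e}) \<le> real (nat (2 * N + 1))" by simp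
  also have "\<dots> = 2 * of_int N + 1" using \<open>N \<ge> 0\<close> by simp
  also have "\<dots> \<le> 2 * (1 / sqrt e) + 1 / sqrt e"
    using s unfolding N_def by (intro add_mono mult_left_mono of_int_floor_le) auto
  finally show "real (card {m::int. (pi * of_int m * e / 2)\<^sup>2 < e}) \<le> 3 / sqrt e" by simp
qed

text \<open>High frequencies of a harmonic \<open>D\<close> vanish in the limit because the equation
  leaves only commutators. For the low ones \<open>D\<close> is split into a truncation
  \<open>v m\<close>, whose coefficients are uniformly bounded, and a remainder \<open>w\<close>
  that is small in L2. Letting \<open>e\<close> tend to 0 for fixed \<open>m\<close> gives
  \<open>N <= 2 |w|\<^sup>2\<close>; afterwards \<open>m\<close> tends to infinity.\<close>

lemma L2_harmonic_zero:
  assumes D: "L2 D" and h: "\<And>\<phi>. test_function \<phi> \<Longrightarrow> pairing D (laplacian \<phi>) = 0"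
  shows "L2norm D = 0"
proof -
  obtain B where B: "B \<ge> 1" "\<And>e y. \<bar>chi 0 e y\<bar> \<le> 1" "\<And>j e y. j \<le> 2 \<Longrightarrow> \<bar>chi j e y\<bar> \<le> B" using chi_bounded by blast
  define e where "e n = 1 / real (Suc n)" for n
  have e0: "e \<longlonglongrightarrow> 0" unfolding e_def using LIMSEQ_inverse_real_of_nat by (simp add: inverse_eq_divide)
  have e: "0 < e n" "e n \<le> 1" for n by (auto simp: e_def)
  define N where "N = (L2norm D)\<^sup>2"
  define v where "v n z = D z * chi 0 (e n) (snd z)" for n z
  have v: "L2 (v n)" for n unfolding v_def by (rule L2_chi[OF D e(1)])
  have vlim: "(\<lambda>n. (L2norm (v n))\<^sup>2) \<longlonglongrightarrow> N" unfolding N_def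
    using chi_tendsto[OF D e0] by (intro tendsto_power L2norm_tendsto v D) (simp add: v_def L2norm_minus_commute[of _ D])
  have main: "N \<le> 2 * (L2norm (\<lambda>z. D z - v m z))\<^sup>2" for m
  proof -
    define w where "w z = D z - v m z" for z
    have w: "L2 w" unfolding w_def by (intro L2_diff D v)
    obtain C where C: "C \<ge> 0" "\<And>e k q \<theta>. e > 0 \<Longrightarrow> \<bar>hat 0 e k q \<theta> (v m)\<bar> \<le> C"
      using hat_L1_bound[OF D e(1), of m] unfolding v_def by blast
    define t where "t n = (16 * B\<^sup>2 * N) * e n + (3 * C\<^sup>2 / pi) * sqrt (e n) + e n" for n
    have bound: "(L2norm (v n))\<^sup>2 \<le> 2 * (L2norm w)\<^sup>2 + t n" for n
    proof -
      define d where "d = e n"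
      have d: "0 < d" "d \<le> 1" using e by (auto simp: d_def)
      define H where "H j u km = hat2 j d (of_int (fst km)) (freq d (\<lambda>_. 0) km) u" for j u and km :: "int \<times> int"
      obtain F where F: "finite F" "(L2norm (v n))\<^sup>2 \<le> d / (8 * pi) * (\<Sum>km\<in>F. H 0 D km) + d"
        using Parseval_hat[OF D d(1) d(1), of "\<lambda>_. 0"] unfolding H_def v_def d_def by blast
      define S where "S = {0::int} \<times> {m::int. (pi * of_int m * d / 2)\<^sup>2 < d}"
      have S: "finite S" "real (card S) \<le> 3 / sqrt d"
        using card_low_frequency[OF d] unfolding S_def by (auto simp: card_cartesian_product)
      have Hpos: "0 \<le> H j u km" for j u km by (simp add: H_def hat2_def)
      \<comment> \<open>Harmonicity gives \<open>p hat0 = 2 q d hat1 + d\<^sup>2 hat2\<close> up to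
        the phase. Outside \<open>S\<close> one has \<open>p >= d\<close>, so
        \<open>d q\<^sup>2 <= p\<^sup>2\<close> and division by \<open>p\<^sup>2\<close> still
        leaves a positive power of \<open>d\<close>.\<close>
      have high: "H 0 D km \<le> 8 * d * H 1 D km + 2 * d\<^sup>2 * H 2 D km" if km: "km \<notin> S" for km :: "int \<times> int"
      proof -
        define k where "k = real_of_int (fst km)"
        define q where "q = freq d (\<lambda>_. 0) km"
        define p where "p = k\<^sup>2 + q\<^sup>2"
        have p: "p \<ge> d"
        proof (cases "fst km = 0")
          case True
          then have "\<not> (pi * of_int (snd km) * d / 2)\<^sup>2 < d" using km by (cases km) (auto simp: S_def)
          then have "q\<^sup>2 \<ge> d" by (simp add: q_def freq_def)
          then show ?thesis using zero_le_power2[of k] unfolding p_def by linarith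
        next
          case False
          then have "1 \<le> \<bar>fst km\<bar>" by simp
          then have "1 \<le> \<bar>k\<bar>" unfolding k_def by linarith
          then have "1 \<le> k\<^sup>2" using abs_le_square_iff[of 1 k] by simp
          then show ?thesis using d zero_le_power2[of q] unfolding p_def by linarith
        qed
        have kZ: "k \<in> \<int>" by (simp add: k_def)
        have est: "(hat 0 d k q \<theta> D)\<^sup>2 \<le> 8 * d * (hat 1 d k q (\<theta> + pi / 2) D)\<^sup>2 + 2 * d\<^sup>2 * (hat 2 d k q \<theta> D)\<^sup>2" for \<theta>
        proof -
          have "p * hat 0 d k q \<theta> D = 2 * q * d * hat 1 d k q (\<theta> + pi / 2) D + d\<^sup>2 * hat 2 d k q \<theta> D"
            using h[OF test_function_mode_chi[OF d(1) kZ]] pairing_laplacian_mode[OF D d(1), of k q \<theta>]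
            unfolding p_def[symmetric] by (metis add.commute add_eq_0_iff minus_minus mult_minus_left)
          then have "(p * hat 0 d k q \<theta> D)\<^sup>2 \<le> 2 * (2 * q * d * hat 1 d k q (\<theta> + pi / 2) D)\<^sup>2 + 2 * (d\<^sup>2 * hat 2 d k q \<theta> D)\<^sup>2"
            using sq_sum_le by simp
          also have "\<dots> = 8 * d\<^sup>2 * q\<^sup>2 * (hat 1 d k q (\<theta> + pi / 2) D)\<^sup>2 + 2 * d\<^sup>2 * d\<^sup>2 * (hat 2 d k q \<theta> D)\<^sup>2"
            by (simp add: power_mult_distrib power2_eq_square)
          also have "\<dots> \<le> 8 * d * p\<^sup>2 * (hat 1 d k q (\<theta> + pi / 2) D)\<^sup>2 + 2 * d\<^sup>2 * p\<^sup>2 * (hat 2 d k q \<theta> D)\<^sup>2"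
          proof (intro add_mono mult_right_mono)
            have "d * q\<^sup>2 \<le> p * p" using p d by (intro mult_mono) (auto simp: p_def)
            then show "8 * d\<^sup>2 * q\<^sup>2 \<le> 8 * d * p\<^sup>2" using d by (simp add: power2_eq_square)
            show "2 * d\<^sup>2 * d\<^sup>2 \<le> 2 * d\<^sup>2 * p\<^sup>2" using p d by (intro mult_left_mono power_mono) auto
          qed auto
          also have "\<dots> = p\<^sup>2 * (8 * d * (hat 1 d k q (\<theta> + pi / 2) D)\<^sup>2 + 2 * d\<^sup>2 * (hat 2 d k q \<theta> D)\<^sup>2)" by (simp add: algebra_simps)
          finally show ?thesis using p d unfolding power_mult_distrib by (simp only: mult_le_cancel_left_pos zero_less_power)
        qed
        show ?thesis using est[of 0] est[of "pi / 2"] unfolding H_def hat2_def k_def[symmetric] q_def[symmetric]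
          by (simp add: hat_shift_pi algebra_simps)
      qed
      \<comment> \<open>Bounded support in \<open>y\<close> makes \<open>v m\<close> integrable, and
        its coefficients are at most its L1 norm \<open>C\<close>, whatever \<open>d\<close> and the
        frequency. This is only affordable on the few frequencies of \<open>S\<close>.\<close>
      have low: "H 0 D km \<le> 4 * C\<^sup>2 + 2 * H 0 w km" for km
      proof -
        have dec: "hat 0 d k q \<theta> D = hat 0 d k q \<theta> (v m) + hat 0 d k q \<theta> w" for k q \<theta>
          using hat_add[OF v w d(1), of 0 k q \<theta> m] by (simp add: w_def)
        have "(hat 0 d k q \<theta> (v m))\<^sup>2 \<le> C\<^sup>2" for k q \<theta>
          using power_mono[OF C(2)[OF d(1)], of k q \<theta> 2] by simp
        have "(hat 0 d k q \<theta> D)\<^sup>2 \<le> 2 * C\<^sup>2 + 2 * (hat 0 d k q \<theta> w)\<^sup>2" for k q \<theta>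
        proof -
          have "(hat 0 d k q \<theta> D)\<^sup>2 \<le> 2 * (hat 0 d k q \<theta> (v m))\<^sup>2 + 2 * (hat 0 d k q \<theta> w)\<^sup>2"
            using dec[of k q \<theta>] sq_sum_le[of "hat 0 d k q \<theta> (v m)" "hat 0 d k q \<theta> w"] by simp
          moreover have "(hat 0 d k q \<theta> (v m))\<^sup>2 \<le> C\<^sup>2" using power_mono[OF C(2)[OF d(1)], of k q \<theta> 2] by simp
          ultimately show ?thesis by linarith
        qed
        from this[of "of_int (fst km)" "freq d (\<lambda>_. 0) km" 0] this[of "of_int (fst km)" "freq d (\<lambda>_. 0) km" "pi / 2"]
        show ?thesis unfolding H_def hat2_def by simp
      qed
      have "(\<Sum>km\<in>F. H 0 D km) \<le> (\<Sum>km\<in>F. (8 * d * H 1 D km + 2 * d\<^sup>2 * H 2 D km + 2 * H 0 w km) + (if km \<in> S then 4 * C\<^sup>2 else 0))"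
      proof (intro sum_mono)
        fix km
        show "H 0 D km \<le> (8 * d * H 1 D km + 2 * d\<^sup>2 * H 2 D km + 2 * H 0 w km) + (if km \<in> S then 4 * C\<^sup>2 else 0)"
        proof -
          have "0 \<le> 8 * d * H 1 D km" "0 \<le> 2 * d\<^sup>2 * H 2 D km" using Hpos d by (intro mult_nonneg_nonneg; simp)+
          moreover have "0 \<le> 4 * C\<^sup>2" by simp
          moreover have "H 0 D km \<le> x + y + 2 * H 0 w km + (if km \<in> S then 4 * C\<^sup>2 else 0)"
            if "0 \<le> x" "0 \<le> y" "km \<notin> S \<Longrightarrow> H 0 D km \<le> x + y" for x y
            using that low[of km] Hpos[of 0 w km] by (cases "km \<in> S") auto
          ultimately show ?thesis using high[of km] by blast
        qed
      qed
      also have "\<dots> = 8 * d * (\<Sum>km\<in>F. H 1 D km) + 2 * d\<^sup>2 * (\<Sum>km\<in>F. H 2 D km) + 2 * (\<Sum>km\<in>F. H 0 w km) + (\<Sum>km\<in>F. if km \<in> S then 4 * C\<^sup>2 else 0)"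
        by (simp add: sum.distrib sum_distrib_left)
      also have "\<dots> \<le> 8 * d * (8 * pi / d * (B\<^sup>2 * N)) + 2 * d\<^sup>2 * (8 * pi / d * (B\<^sup>2 * N)) + 2 * (8 * pi / d * (1\<^sup>2 * (L2norm w)\<^sup>2)) + 3 / sqrt d * (4 * C\<^sup>2)"
      proof (intro add_mono mult_left_mono)
        show "(\<Sum>km\<in>F. H 1 D km) \<le> 8 * pi / d * (B\<^sup>2 * N)" "(\<Sum>km\<in>F. H 2 D km) \<le> 8 * pi / d * (B\<^sup>2 * N)"
          "(\<Sum>km\<in>F. H 0 w km) \<le> 8 * pi / d * (1\<^sup>2 * (L2norm w)\<^sup>2)"
          unfolding H_def N_def by (intro Bessel_hat D w d F B(2,3); simp)+
        have "(\<Sum>km\<in>F. if km \<in> S then 4 * C\<^sup>2 else 0) = (\<Sum>km\<in>F \<inter> S. 4 * C\<^sup>2)" by (rule sum.inter_restrict[OF F(1), symmetric])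
        also have "\<dots> = real (card (F \<inter> S)) * (4 * C\<^sup>2)" by simp
        also have "\<dots> \<le> 3 / sqrt d * (4 * C\<^sup>2)"
        proof (intro mult_right_mono)
          have "real (card (F \<inter> S)) \<le> real (card S)" using S(1) by (intro of_nat_mono card_mono) auto
          then show "real (card (F \<inter> S)) \<le> 3 / sqrt d" using S(2) by linarith
        qed simp
        finally show "(\<Sum>km\<in>F. if km \<in> S then 4 * C\<^sup>2 else 0) \<le> 3 / sqrt d * (4 * C\<^sup>2)" .
      qed (use d in auto)
      finally have *: "d / (8 * pi) * (\<Sum>km\<in>F. H 0 D km) \<le> d / (8 * pi) * (8 * d * (8 * pi / d * (B\<^sup>2 * N)) + 2 * d\<^sup>2 * (8 * pi / d * (B\<^sup>2 * N)) + 2 * (8 * pi / d * (1\<^sup>2 * (L2norm w)\<^sup>2)) + 3 / sqrt d * (4 * C\<^sup>2))"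
        using d by (intro mult_left_mono) auto
      also have "\<dots> = 8 * d * (B\<^sup>2 * N) + 2 * d * d * (B\<^sup>2 * N) + 2 * (L2norm w)\<^sup>2 + 12 / (8 * pi) * C\<^sup>2 * (d / sqrt d)"
        using d by (simp add: field_simps power2_eq_square)
      also have "d / sqrt d = sqrt d" using d by (simp add: real_div_sqrt)
      also have "2 * d * d * (B\<^sup>2 * N) \<le> 8 * d * (B\<^sup>2 * N)"
        using d mult_right_mono[of d 4 "2 * d"] by (intro mult_right_mono) (auto simp: N_def)
      finally have "d / (8 * pi) * (\<Sum>km\<in>F. H 0 D km) \<le> 16 * d * (B\<^sup>2 * N) + 2 * (L2norm w)\<^sup>2 + 12 / (8 * pi) * C\<^sup>2 * sqrt d" by (simp add: mult_ac)
      moreover have "12 / (8 * pi) * C\<^sup>2 * sqrt d \<le> (3 * C\<^sup>2 / pi) * sqrt d" using d by (intro mult_right_mono) (auto simp: field_simps)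
      ultimately show ?thesis using F(2) unfolding t_def d_def[symmetric] by (simp add: mult_ac)
    qed
    have "t \<longlonglongrightarrow> (16 * B\<^sup>2 * N) * 0 + (3 * C\<^sup>2 / pi) * sqrt 0 + 0" unfolding t_def by (intro tendsto_intros e0)
    then have "(\<lambda>n. 2 * (L2norm w)\<^sup>2 + t n) \<longlonglongrightarrow> 2 * (L2norm w)\<^sup>2 + 0" by (intro tendsto_intros) simp
    then have "N \<le> 2 * (L2norm w)\<^sup>2 + 0" using LIMSEQ_le[OF vlim] bound by blast
    then show ?thesis by (simp add: w_def[abs_def])
  qed
  have "(\<lambda>m. 2 * (L2norm (\<lambda>z. D z - v m z))\<^sup>2) \<longlonglongrightarrow> 2 * 0\<^sup>2"
    unfolding v_def by (intro tendsto_intros chi_tendsto D e0)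
  then have "N \<le> 2 * 0\<^sup>2" by (rule LIMSEQ_le_const) (use main in blast)
  then show ?thesis by (simp add: N_def)
qed

lemma L2norm_zero_pairing: assumes "L2 f" "L2 g" "L2norm (\<lambda>z. f z - g z) = 0" "L2 h" shows "pairing f h = pairing g h"
  using pairing_le[OF L2_diff[OF assms(1,2)] assms(4)] pairing_diff_left[OF assms(1,2,4)] assms(3) by simp

text \<open>The choice operator returns some solution. By the Liouville property its difference from
  the constructed solution has norm 0, so weak derivatives, orthogonality to functions of
  \<open>y\<close> and the norm bound carry over.\<close>

lemma inv_laplacian_fluct:
  assumes g: "L2 g"
  defines "\<psi> \<equiv> inv_laplacian (fluct g)"
  shows "L2 \<psi>" "\<And>\<phi>. test_function \<phi> \<Longrightarrow> pairing \<psi> (laplacian \<phi>) = pairing (fluct g) \<phi>"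
    "is_weak_dx \<psi> (wdx \<psi>)" "is_weak_dy \<psi> (wdy \<psi>)" "\<And>\<phi>. test_function \<phi> \<Longrightarrow> pairing \<psi> (xavg \<phi>) = 0"
    "L2norm \<psi> \<le> 2 * pi * (2 * pi * L2norm (fluct g) + 2)"
proof -
  have fg: "L2 (fluct g)" by (rule fluct_L2[OF g])
  have g0: "pairing (fluct g) (xavg \<theta>) = 0" if t: "test_function \<theta>" for \<theta>
  proof -
    have "L2 (xavg \<theta>)" by (intro cc_L2 test_function_cc test_function_xavg t)
    then have "pairing (fluct g) (xavg \<theta>) = pairing g (fluct (xavg \<theta>))" by (rule pairing_fluct_commute[OF g])
    also have "fluct (xavg \<theta>) = (\<lambda>z. 0)" using xavg_indep[of "xavg \<theta>"] by (simp add: fluct_def xavg_def)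
    finally show ?thesis by (simp add: pairing_def)
  qed
  obtain \<psi>0 u v where P: "L2 \<psi>0" "is_weak_dx \<psi>0 u" "is_weak_dy \<psi>0 v"
    "\<And>\<theta>. test_function \<theta> \<Longrightarrow> pairing \<psi>0 (laplacian \<theta>) = pairing (fluct g) \<theta>"
    "\<And>\<theta>. test_function \<theta> \<Longrightarrow> pairing \<psi>0 (xavg \<theta>) = 0"
    "L2norm \<psi>0 \<le> 2 * pi * (2 * pi * L2norm (fluct g) + 2)"
    using Poisson_solution[OF fg g0] by blast
  have "L2 \<psi> \<and> (\<forall>\<phi>. test_function \<phi> \<longrightarrow> pairing \<psi> (laplacian \<phi>) = pairing (fluct g) \<phi>)"
    unfolding \<psi>_def inv_laplacian_def by (rule someI[of _ \<psi>0]) (use P in blast)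
  then show L: "L2 \<psi>" and lap: "\<And>\<phi>. test_function \<phi> \<Longrightarrow> pairing \<psi> (laplacian \<phi>) = pairing (fluct g) \<phi>" by auto
  have tL: "L2 (laplacian \<phi>)" if "test_function \<phi>" for \<phi>
    unfolding laplacian_def by (intro L2_add cc_L2 test_function_cc that)
  have z: "L2norm (\<lambda>z. \<psi> z - \<psi>0 z) = 0"
    by (rule L2_harmonic_zero[OF L2_diff[OF L P(1)]]) (simp add: pairing_diff_left[OF L P(1) tL] lap P(4))
  have eq: "pairing \<psi> h = pairing \<psi>0 h" if "L2 h" for h by (rule L2norm_zero_pairing[OF L P(1) z that])
  have "is_weak_dx \<psi> u" using P(2) unfolding is_weak_dx_def by (simp add: eq cc_L2 test_function_cc)
  then show "is_weak_dx \<psi> (wdx \<psi>)" unfolding wdx_def by (rule someI[of "is_weak_dx \<psi>"])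
  have "is_weak_dy \<psi> v" using P(3) unfolding is_weak_dy_def by (simp add: eq cc_L2 test_function_cc)
  then show "is_weak_dy \<psi> (wdy \<psi>)" unfolding wdy_def by (rule someI[of "is_weak_dy \<psi>"])
  show "pairing \<psi> (xavg \<phi>) = 0" if "test_function \<phi>" for \<phi>
    using P(5)[OF that] eq[of "xavg \<phi>"] by (simp add: cc_L2 test_function_cc test_function_xavg that)
  show "L2norm \<psi> \<le> 2 * pi * (2 * pi * L2norm (fluct g) + 2)"
    using L2norm_triangle_diff[OF L P(1)] z P(6) by simp
qed

section \<open>The equations for the Fourier coefficients\<close>

lemma cos_second_order: "\<bar>cos (a + h) - cos a + h * sin a\<bar> \<le> h\<^sup>2" for a h :: real
proof -
  have "norm ((cos (a + h) + h * sin a) - (cos (a + 0) + 0 * sin a)) \<le> \<bar>h\<bar> * norm (h - 0)"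
  proof (rule field_differentiable_bound[of "closed_segment 0 h" _ "\<lambda>x. - sin (a + x) + sin a"])
    fix x assume x: "x \<in> closed_segment 0 h"
    show "((\<lambda>x. cos (a + x) + x * sin a) has_field_derivative - sin (a + x) + sin a) (at x within closed_segment 0 h)"
      by (auto intro!: derivative_eq_intros)
    have "\<bar>x\<bar> \<le> \<bar>h\<bar>" using x by (auto simp: closed_segment_eq_real_ivl split: if_splits)
    have "\<bar>sin a - sin (a + x)\<bar> = 2 * \<bar>sin ((a - (a + x)) / 2)\<bar> * \<bar>cos ((a + (a + x)) / 2)\<bar>"
      by (subst sin_diff_sin) (simp add: abs_mult)
    also have "\<dots> \<le> 2 * \<bar>(a - (a + x)) / 2\<bar> * 1"
      by (intro mult_mono abs_sin_x_le_abs_x) (auto simp: abs_sin_x_le_abs_x)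
    finally show "norm (- sin (a + x) + sin a) \<le> \<bar>h\<bar>" using \<open>\<bar>x\<bar> \<le> \<bar>h\<bar>\<close> by simp
  qed auto
  then show ?thesis by (simp add: power2_eq_square algebra_simps flip: abs_mult)
qed

text \<open>The frequency moves with the shear so that the time derivative of the mode is
  \<open>- y\<close> times its x-derivative, which cancels the transport term in \<open>D\<close>;
  only the rest \<open>G\<close> remains. As \<open>u\<close> is merely continuous in L2, the
  product rule is proved by hand with a quadratic Taylor remainder.\<close>

lemma hat_time_deriv:
  assumes u: "C0_L2 u" and e: "e > 0" and k: "k \<in> \<int>" and t: "t \<ge> 0"
    and D: "((\<lambda>s. pairing (u s) (mode (chi 0 e) k (\<eta> - k * t) \<theta>)) has_real_derivative
        (pairing (u t) (\<lambda>(x, y). y * pdx (mode (chi 0 e) k (\<eta> - k * t) \<theta>) (x, y)) + G)) (at t within {0..})"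
  shows "((\<lambda>s. hat 0 e k (\<eta> - k * s) \<theta> (u s)) has_real_derivative G) (at t within {0..})"
proof -
  define m where "m s = mode (chi 0 e) k (\<eta> - k * s) \<theta>" for s
  \<comment> \<open>The time derivative of the moving mode at time \<open>t\<close>. The function
    \<open>K\<close> below dominates the Taylor remainder; the cutoff makes its factor
    \<open>y\<^sup>2\<close> square integrable.\<close>
  define N where "N z = - (snd z * pdx (m t) z)" for z
  define K where "K = mode (\<lambda>y. k\<^sup>2 * y\<^sup>2 * chi 0 e y) 0 0 0"
  have uL: "L2 (u s)" if "s \<ge> 0" for s using u that by (simp add: C0_L2_def)
  have mL: "L2 (m s)" for s unfolding m_def by (rule L2_mode_chi[OF e])
  have "test_function (m t)" unfolding m_def by (rule test_function_mode_chi[OF e k])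
  then have NL0: "L2 (\<lambda>z. snd z * pdx (m t) z)" by (intro cc_L2 cc_mult' test_function_cc continuous_intros)
  then have NL: "L2 N" unfolding N_def by (rule L2_uminus)
  have KL: "L2 K"
  proof (rule cc_L2)
    show "cc K" unfolding cc_def K_def
      using chi_support[OF e] by (intro conjI continuous_mode continuous_intros smooth1_continuous[OF smooth1_chi] exI[of _ "2 / e"]) (auto simp: mode_def)
  qed
  have pw: "\<bar>m s z - m t z - (s - t) * N z\<bar> \<le> \<bar>(s - t)\<^sup>2 * K z\<bar>" for s z
  proof -
    obtain x y where z: "z = (x, y)" by (cases z)
    define a where "a = k * x + (\<eta> - k * t) * y + \<theta>"
    define h where "h = - k * (s - t) * y"
    have "m s z = chi 0 e y * cos (a + h)" by (simp add: m_def mode_def z a_def h_def algebra_simps)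
    moreover have "m t z = chi 0 e y * cos a" by (simp add: m_def mode_def z a_def)
    moreover have "(s - t) * N z = - (chi 0 e y * (h * sin a))"
    proof -
      have "N z = - (y * (k * mode (chi 0 e) k (\<eta> - k * t) (\<theta> + pi / 2) (x, y)))"
        unfolding N_def m_def pdx_mode z by simp
      also have "mode (chi 0 e) k (\<eta> - k * t) (\<theta> + pi / 2) (x, y) = chi 0 e y * (- sin a)"
        using cos_add_pi_half[of a] by (simp add: mode_def a_def add.assoc)
      finally show ?thesis by (simp add: h_def algebra_simps)
    qed
    ultimately have "m s z - m t z - (s - t) * N z = chi 0 e y * (cos (a + h) - cos a + h * sin a)" by (simp add: algebra_simps)
    then have "\<bar>m s z - m t z - (s - t) * N z\<bar> \<le> \<bar>chi 0 e y\<bar> * h\<^sup>2"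
      using cos_second_order[of a h] by (simp add: abs_mult mult_left_mono)
    also have "\<dots> = \<bar>(s - t)\<^sup>2 * K z\<bar>" by (simp add: K_def mode_def z h_def power_mult_distrib abs_mult mult_ac)
    finally show ?thesis .
  qed
  have est: "\<bar>pairing (u s) (\<lambda>z. m s z - m t z) / (s - t) - pairing (u t) N\<bar>
      \<le> (L2norm (u t) + L2norm (\<lambda>z. u s z - u t z)) * (\<bar>s - t\<bar> * L2norm K) + L2norm (\<lambda>z. u s z - u t z) * L2norm N"
    if s: "s \<ge> 0" "s \<noteq> t" for s
  proof -
    define r where "r z = m s z - m t z - (s - t) * N z" for z
    have rL: "L2 r" unfolding r_def by (intro L2_diff mL L2_scale NL)
    have rn: "L2norm r \<le> (s - t)\<^sup>2 * L2norm K"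
      using L2norm_mono[OF L2_scale[OF KL] L2D(1)[OF rL], of "(s - t)\<^sup>2"] pw by (simp add: r_def L2norm_scale)
    have "pairing (u s) (\<lambda>z. m s z - m t z) = pairing (u s) (\<lambda>z. (s - t) * N z + r z)" by (simp add: r_def)
    also have "\<dots> = (s - t) * pairing (u s) N + pairing (u s) r"
      using pairing_add_right[OF L2_scale[OF NL] rL uL[OF s(1)]] by (simp add: pairing_scale_right)
    finally have "pairing (u s) (\<lambda>z. m s z - m t z) / (s - t) - pairing (u t) N = pairing (u s) r / (s - t) + pairing (\<lambda>z. u s z - u t z) N"
      using s pairing_diff_left[OF uL[OF s(1)] uL[OF t] NL] by (simp add: add_divide_distrib)
    also have "\<bar>\<dots>\<bar> \<le> \<bar>pairing (u s) r / (s - t)\<bar> + \<bar>pairing (\<lambda>z. u s z - u t z) N\<bar>" by (rule abs_triangle_ineq)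
    also have "\<dots> \<le> (L2norm (u t) + L2norm (\<lambda>z. u s z - u t z)) * (\<bar>s - t\<bar> * L2norm K) + L2norm (\<lambda>z. u s z - u t z) * L2norm N"
    proof (intro add_mono pairing_le L2_diff uL s t NL)
      have "\<bar>pairing (u s) r\<bar> \<le> L2norm (u s) * L2norm r" by (intro pairing_le uL s rL)
      also have "\<dots> \<le> (L2norm (u t) + L2norm (\<lambda>z. u s z - u t z)) * ((s - t)\<^sup>2 * L2norm K)"
        by (intro mult_mono rn L2norm_triangle_diff uL s t) auto
      finally have "\<bar>pairing (u s) r\<bar> / \<bar>s - t\<bar> \<le> (L2norm (u t) + L2norm (\<lambda>z. u s z - u t z)) * ((s - t)\<^sup>2 * L2norm K) / \<bar>s - t\<bar>"
        by (intro divide_right_mono) auto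
      also have "\<dots> = (L2norm (u t) + L2norm (\<lambda>z. u s z - u t z)) * (\<bar>s - t\<bar> * L2norm K)"
      proof -
        have "U * (a\<^sup>2 * V) / \<bar>a\<bar> = U * (\<bar>a\<bar> * V)" if "a \<noteq> 0" for a U V :: real
          using that by (simp add: power2_eq_square abs_if)
        then show ?thesis using s by simp
      qed
      finally show "\<bar>pairing (u s) r / (s - t)\<bar> \<le> (L2norm (u t) + L2norm (\<lambda>z. u s z - u t z)) * (\<bar>s - t\<bar> * L2norm K)"
        by (simp only: abs_divide)
    qed
    finally show ?thesis .
  qed
  have ulim: "((\<lambda>s. L2norm (\<lambda>z. u s z - u t z)) \<longlongrightarrow> 0) (at t within {0..})" using u t by (simp add: C0_L2_def)
  have g: "((\<lambda>s. pairing (u s) (\<lambda>z. m s z - m t z)) has_real_derivative pairing (u t) N) (at t within {0..})"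
    unfolding has_field_derivative_iff
  proof -
    have z0: "pairing (u t) (\<lambda>z. m t z - m t z) = 0" by (simp add: pairing_def)
    have "((\<lambda>s. pairing (u s) (\<lambda>z. m s z - m t z) / (s - t) - pairing (u t) N) \<longlongrightarrow> 0) (at t within {0..})"
    proof (rule Lim_null_comparison)
      show "\<forall>\<^sub>F s in at t within {0..}. norm (pairing (u s) (\<lambda>z. m s z - m t z) / (s - t) - pairing (u t) N)
          \<le> (L2norm (u t) + L2norm (\<lambda>z. u s z - u t z)) * (\<bar>s - t\<bar> * L2norm K) + L2norm (\<lambda>z. u s z - u t z) * L2norm N"
        using est by (auto simp: eventually_at_filter)
      have "((\<lambda>s. (L2norm (u t) + L2norm (\<lambda>z. u s z - u t z)) * (\<bar>s - t\<bar> * L2norm K) + L2norm (\<lambda>z. u s z - u t z) * L2norm N)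
          \<longlongrightarrow> (L2norm (u t) + 0) * (\<bar>t - t\<bar> * L2norm K) + 0 * L2norm N) (at t within {0..})"
        by (intro tendsto_intros ulim)
      then show "((\<lambda>s. (L2norm (u t) + L2norm (\<lambda>z. u s z - u t z)) * (\<bar>s - t\<bar> * L2norm K) + L2norm (\<lambda>z. u s z - u t z) * L2norm N) \<longlongrightarrow> 0) (at t within {0..})"
        by simp
    qed
    then have "((\<lambda>s. pairing (u s) (\<lambda>z. m s z - m t z) / (s - t)) \<longlongrightarrow> pairing (u t) N) (at t within {0..})" by (rule Lim_null[THEN iffD2])
    then show "((\<lambda>s. (pairing (u s) (\<lambda>z. m s z - m t z) - pairing (u t) (\<lambda>z. m t z - m t z)) / (s - t)) \<longlongrightarrow> pairing (u t) N) (at t within {0..})"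
      unfolding z0 by simp
  qed
  have "pairing (u t) N = - pairing (u t) (\<lambda>(x, y). y * pdx (m t) (x, y))"
    unfolding N_def using pairing_scale_right[of "u t" "-1" "\<lambda>z. snd z * pdx (m t) z"] by (simp add: split_beta')
  then have "((\<lambda>s. pairing (u s) (m t) + pairing (u s) (\<lambda>z. m s z - m t z)) has_real_derivative G) (at t within {0..})"
    using DERIV_add[OF D[folded m_def] g] by simp
  then show ?thesis
  proof (rule has_field_derivative_transform_within[where d = 1])
    fix s :: real assume "s \<in> {0..}"
    then show "pairing (u s) (m t) + pairing (u s) (\<lambda>z. m s z - m t z) = hat 0 e k (\<eta> - k * s) \<theta> (u s)"
      using pairing_diff_right[OF mL mL uL, of s s t] by (simp add: hat_def m_def)
  qed (use t in auto)
qed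

lemma solve_linear: "- p * x + c = a \<Longrightarrow> p > 0 \<Longrightarrow> x = (c - a) / (p :: real)"
  by (simp add: field_simps)

text \<open>The Mach number restriction is kept in the form in which the single-mode estimate uses
  it, with \<open>\<nu> + l\<close> in the role of \<open>\<delta>\<close>.\<close>

locale couette =
  fixes \<nu> l M :: real and \<rho>in \<alpha>in \<omega>in :: "real \<times> real \<Rightarrow> real" and \<rho> \<alpha> \<omega> :: "real \<Rightarrow> real \<times> real \<Rightarrow> real"
  assumes nu: "\<nu> > 0" and l: "l \<ge> 0" and M: "M > 0" and nul: "\<nu> + l \<le> 1 / 2"
    and Mle: "(\<nu> + l) * M\<^sup>2 \<le> 1"
    and in_reg: "H1 \<rho>in" "L2 \<alpha>in" "L2 \<omega>in" and sol: "couette_solution \<nu> l M \<rho>in \<alpha>in \<omega>in \<rho> \<alpha> \<omega>"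
begin

definition "\<psi>\<alpha> t = inv_laplacian (fluct (\<alpha> t))"
definition "\<psi>\<omega> t = inv_laplacian (fluct (\<omega> t))"

lemma C0: "C0_L2 \<rho>" "C0_L2 \<alpha>" "C0_L2 \<omega>" "t \<ge> 0 \<Longrightarrow> H1 (\<rho> t)"
  using sol unfolding couette_solution_def C0_H1_def by auto

lemma L2_sol: assumes "t \<ge> 0" shows "L2 (\<rho> t)" "L2 (\<alpha> t)" "L2 (\<omega> t)"
  using C0(1-3) assms unfolding C0_L2_def by auto

text \<open>Each right-hand side is regrouped as transport term plus remainder, the shape that
  \<open>hat_time_deriv\<close> expects.\<close>

lemma weak_eq:
  assumes "test_function \<phi>" "t \<ge> 0"
  shows "((\<lambda>s. pairing (\<rho> s) \<phi>) has_real_derivative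
           (pairing (\<rho> t) (\<lambda>(x, y). y * pdx \<phi> (x, y)) + - pairing (\<alpha> t) \<phi>)) (at t within {0..})"
    "((\<lambda>s. pairing (\<alpha> s) \<phi>) has_real_derivative
           (pairing (\<alpha> t) (\<lambda>(x, y). y * pdx \<phi> (x, y))
            + (2 * pairing (vy_fluct (\<alpha> t) (\<omega> t)) (pdx \<phi>)
            - 1 / M\<^sup>2 * pairing (\<rho> t) (laplacian \<phi>)
            + (\<nu> + l) * pairing (\<alpha> t) (laplacian \<phi>)))) (at t within {0..})"
    "((\<lambda>s. pairing (\<omega> s) \<phi>) has_real_derivative
           (pairing (\<omega> t) (\<lambda>(x, y). y * pdx \<phi> (x, y)) + (pairing (\<alpha> t) \<phi>
            + \<nu> * pairing (\<omega> t) (laplacian \<phi>)))) (at t within {0..})"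
proof -
  have "\<forall>\<phi> t. test_function \<phi> \<longrightarrow> t \<ge> 0 \<longrightarrow>
        ((\<lambda>s. pairing (\<rho> s) \<phi>) has_real_derivative
           (pairing (\<rho> t) (\<lambda>(x, y). y * pdx \<phi> (x, y)) - pairing (\<alpha> t) \<phi>))
          (at t within {0..}) \<and>
        ((\<lambda>s. pairing (\<alpha> s) \<phi>) has_real_derivative
           (pairing (\<alpha> t) (\<lambda>(x, y). y * pdx \<phi> (x, y))
            + 2 * pairing (vy_fluct (\<alpha> t) (\<omega> t)) (pdx \<phi>)
            - 1 / M\<^sup>2 * pairing (\<rho> t) (laplacian \<phi>)
            + (\<nu> + l) * pairing (\<alpha> t) (laplacian \<phi>)))
          (at t within {0..}) \<and>
        ((\<lambda>s. pairing (\<omega> s) \<phi>) has_real_derivative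
           (pairing (\<omega> t) (\<lambda>(x, y). y * pdx \<phi> (x, y)) + pairing (\<alpha> t) \<phi>
            + \<nu> * pairing (\<omega> t) (laplacian \<phi>)))
          (at t within {0..})"
    using sol unfolding couette_solution_def by (elim conjE)
  from this[rule_format, OF assms] show
    "((\<lambda>s. pairing (\<rho> s) \<phi>) has_real_derivative
           (pairing (\<rho> t) (\<lambda>(x, y). y * pdx \<phi> (x, y)) + - pairing (\<alpha> t) \<phi>)) (at t within {0..})"
    "((\<lambda>s. pairing (\<alpha> s) \<phi>) has_real_derivative
           (pairing (\<alpha> t) (\<lambda>(x, y). y * pdx \<phi> (x, y))
            + (2 * pairing (vy_fluct (\<alpha> t) (\<omega> t)) (pdx \<phi>)
            - 1 / M\<^sup>2 * pairing (\<rho> t) (laplacian \<phi>)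
            + (\<nu> + l) * pairing (\<alpha> t) (laplacian \<phi>)))) (at t within {0..})"
    "((\<lambda>s. pairing (\<omega> s) \<phi>) has_real_derivative
           (pairing (\<omega> t) (\<lambda>(x, y). y * pdx \<phi> (x, y)) + (pairing (\<alpha> t) \<phi>
            + \<nu> * pairing (\<omega> t) (laplacian \<phi>)))) (at t within {0..})"
    by (elim conjE DERIV_cong; simp)+
qed

lemma psi:
  assumes "t \<ge> 0"
  shows "L2 (\<psi>\<alpha> t)" "L2 (\<psi>\<omega> t)" "is_weak_dx (\<psi>\<alpha> t) (wdx (\<psi>\<alpha> t))" "is_weak_dy (\<psi>\<alpha> t) (wdy (\<psi>\<alpha> t))"
    "is_weak_dx (\<psi>\<omega> t) (wdx (\<psi>\<omega> t))" "is_weak_dy (\<psi>\<omega> t) (wdy (\<psi>\<omega> t))"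
    "L2 (wdx (\<psi>\<alpha> t))" "L2 (wdy (\<psi>\<alpha> t))" "L2 (wdx (\<psi>\<omega> t))" "L2 (wdy (\<psi>\<omega> t))"
  using inv_laplacian_fluct[OF L2_sol(2)[OF assms]] inv_laplacian_fluct[OF L2_sol(3)[OF assms]]
  unfolding \<psi>\<alpha>_def \<psi>\<omega>_def is_weak_dx_def is_weak_dy_def by blast+

text \<open>The contribution to the Laplacian of the derivatives that fall on the cutoff.\<close>

definition comm :: "real \<Rightarrow> real \<Rightarrow> real \<Rightarrow> real \<Rightarrow> (real \<times> real \<Rightarrow> real) \<Rightarrow> real" where
  "comm e k q \<theta> u = 2 * q * e * hat 1 e k q (\<theta> + pi / 2) u + e\<^sup>2 * hat 2 e k q \<theta> u"

text \<open>The Poisson equation at one frequency reads \<open>- (k\<^sup>2 + q\<^sup>2)\<close>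
  times the potential plus the commutator equals the source. For nonzero \<open>k\<close> the source
  and its fluctuation have the same coefficient.\<close>

lemma hat_psi:
  assumes "t \<ge> 0" "e > 0" "k \<in> \<int>" "k \<noteq> 0"
  shows "hat 0 e k q \<theta> (\<psi>\<alpha> t) = (comm e k q \<theta> (\<psi>\<alpha> t) - hat 0 e k q \<theta> (\<alpha> t)) / (k\<^sup>2 + q\<^sup>2)"
    "hat 0 e k q \<theta> (\<psi>\<omega> t) = (comm e k q \<theta> (\<psi>\<omega> t) - hat 0 e k q \<theta> (\<omega> t)) / (k\<^sup>2 + q\<^sup>2)"
proof -
  have p: "k\<^sup>2 + q\<^sup>2 > 0" using assms(4) by (intro add_pos_nonneg) auto
  note tf = test_function_mode_chi[OF assms(2,3), of 0 q \<theta>]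
  have "pairing (\<psi>\<alpha> t) (laplacian (mode (chi 0 e) k q \<theta>)) = hat 0 e k q \<theta> (fluct (\<alpha> t))"
    unfolding \<psi>\<alpha>_def using inv_laplacian_fluct(2)[OF L2_sol(2)[OF assms(1)] tf] by (simp add: hat_def)
  then show "hat 0 e k q \<theta> (\<psi>\<alpha> t) = (comm e k q \<theta> (\<psi>\<alpha> t) - hat 0 e k q \<theta> (\<alpha> t)) / (k\<^sup>2 + q\<^sup>2)"
    unfolding pairing_laplacian_mode[OF psi(1)[OF assms(1)] assms(2)] hat_fluct[OF L2_sol(2)[OF assms(1)] assms(2-4)]
      comm_def[symmetric] by (rule solve_linear) (rule p)
  have "pairing (\<psi>\<omega> t) (laplacian (mode (chi 0 e) k q \<theta>)) = hat 0 e k q \<theta> (fluct (\<omega> t))"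
    unfolding \<psi>\<omega>_def using inv_laplacian_fluct(2)[OF L2_sol(3)[OF assms(1)] tf] by (simp add: hat_def)
  then show "hat 0 e k q \<theta> (\<psi>\<omega> t) = (comm e k q \<theta> (\<psi>\<omega> t) - hat 0 e k q \<theta> (\<omega> t)) / (k\<^sup>2 + q\<^sup>2)"
    unfolding pairing_laplacian_mode[OF psi(2)[OF assms(1)] assms(2)] hat_fluct[OF L2_sol(3)[OF assms(1)] assms(2-4)]
      comm_def[symmetric] by (rule solve_linear) (rule p)
qed

lemma hat_vy:
  assumes "t \<ge> 0" "e > 0" "k \<in> \<int>"
  shows "hat 0 e k q \<theta> (vy_fluct (\<alpha> t) (\<omega> t))
    = - (q * hat 0 e k q (\<theta> + pi / 2) (\<psi>\<alpha> t) + e * hat 1 e k q \<theta> (\<psi>\<alpha> t)) - k * hat 0 e k q (\<theta> + pi / 2) (\<psi>\<omega> t)"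
proof -
  have "hat 0 e k q \<theta> (vy_fluct (\<alpha> t) (\<omega> t)) = hat 0 e k q \<theta> (wdy (\<psi>\<alpha> t)) + hat 0 e k q \<theta> (wdx (\<psi>\<omega> t))"
    unfolding vy_fluct_def \<psi>\<alpha>_def[symmetric] \<psi>\<omega>_def[symmetric] by (intro hat_add psi assms)
  then show ?thesis using hat_weak_dy[OF psi(1) psi(4) assms(2,3)] hat_weak_dx[OF psi(5) assms(2,3)] assms(1) by simp
qed

lemma hat_vx:
  assumes "t \<ge> 0" "e > 0" "k \<in> \<int>"
  shows "hat 0 e k q \<theta> (vx_fluct (\<alpha> t) (\<omega> t))
    = - k * hat 0 e k q (\<theta> + pi / 2) (\<psi>\<alpha> t) + (q * hat 0 e k q (\<theta> + pi / 2) (\<psi>\<omega> t) + e * hat 1 e k q \<theta> (\<psi>\<omega> t))"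
proof -
  have "hat 0 e k q \<theta> (vx_fluct (\<alpha> t) (\<omega> t)) = hat 0 e k q \<theta> (wdx (\<psi>\<alpha> t)) - hat 0 e k q \<theta> (wdy (\<psi>\<omega> t))"
    unfolding vx_fluct_def \<psi>\<alpha>_def[symmetric] \<psi>\<omega>_def[symmetric] by (intro hat_diff psi assms)
  then show ?thesis using hat_weak_dy[OF psi(2) psi(6) assms(2,3)] hat_weak_dx[OF psi(3) assms(2,3)] assms(1) by simp
qed

text \<open>All contributions to the equation of \<open>\<alpha>\<close> in which a derivative has
  fallen on the cutoff. The second one comes from the y-derivative inside the vertical velocity, the
  others from Laplacians.\<close>

definition err\<alpha> where
  "err\<alpha> e k q \<theta> t = 2 * k * q / (k\<^sup>2 + q\<^sup>2) * comm e k q \<theta> (\<psi>\<alpha> t) - 2 * k * e * hat 1 e k q (\<theta> + pi / 2) (\<psi>\<alpha> t)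
     + 2 * k\<^sup>2 / (k\<^sup>2 + q\<^sup>2) * comm e k q \<theta> (\<psi>\<omega> t) - comm e k q \<theta> (\<rho> t) / M\<^sup>2 + (\<nu> + l) * comm e k q \<theta> (\<alpha> t)"

lemma mode_ode:
  fixes k \<eta> \<theta> e :: real
  assumes t: "t \<ge> 0" and e: "e > 0" and k: "k \<in> \<int>" "k \<noteq> 0"
  defines "q \<equiv> \<eta> - k * t" and "h \<equiv> \<lambda>f t. hat 0 e k (\<eta> - k * t) \<theta> (f t)"
  shows "(h \<rho> has_real_derivative - h \<alpha> t) (at t within {0..})"
    "(h \<alpha> has_real_derivative - 2 * k * q / (k\<^sup>2 + q\<^sup>2) * h \<alpha> t - 2 * k\<^sup>2 / (k\<^sup>2 + q\<^sup>2) * h \<omega> t + (k\<^sup>2 + q\<^sup>2) / M\<^sup>2 * h \<rho> t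
        - (\<nu> + l) * (k\<^sup>2 + q\<^sup>2) * h \<alpha> t + err\<alpha> e k q \<theta> t) (at t within {0..})"
    "(h \<omega> has_real_derivative h \<alpha> t - \<nu> * (k\<^sup>2 + q\<^sup>2) * h \<omega> t + \<nu> * comm e k q \<theta> (\<omega> t)) (at t within {0..})"
proof -
  have p: "k\<^sup>2 + q\<^sup>2 > 0" using k by (intro add_pos_nonneg) auto
  note tf = test_function_mode_chi[OF e k(1), of 0 q \<theta>]
  have lap: "pairing u (laplacian (mode (chi 0 e) k q \<theta>)) = - (k\<^sup>2 + q\<^sup>2) * hat 0 e k q \<theta> u + comm e k q \<theta> u" if "L2 u" for u
    using pairing_laplacian_mode[OF that e, of k q \<theta>] by (simp add: comm_def)
  have hh: "h f t = hat 0 e k q \<theta> (f t)" for f by (simp add: h_def q_def)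
  have pm: "pairing u (mode (chi 0 e) k q \<theta>) = hat 0 e k q \<theta> u" for u by (simp add: hat_def)
  show "(h \<rho> has_real_derivative - h \<alpha> t) (at t within {0..})"
    unfolding hh unfolding h_def by (rule hat_time_deriv[OF C0(1) e k(1) t]) (use weak_eq(1)[OF tf t] in \<open>simp add: q_def hat_def\<close>)
  have "(h \<omega> has_real_derivative hat 0 e k q \<theta> (\<alpha> t) + \<nu> * (- (k\<^sup>2 + q\<^sup>2) * hat 0 e k q \<theta> (\<omega> t) + comm e k q \<theta> (\<omega> t))) (at t within {0..})"
    unfolding h_def by (rule hat_time_deriv[OF C0(3) e k(1) t])
      (use weak_eq(3)[OF tf t] in \<open>simp only: lap[OF L2_sol(3)[OF t]] pm q_def[symmetric]\<close>)
  then show "(h \<omega> has_real_derivative h \<alpha> t - \<nu> * (k\<^sup>2 + q\<^sup>2) * h \<omega> t + \<nu> * comm e k q \<theta> (\<omega> t)) (at t within {0..})"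
    unfolding hh by (rule DERIV_cong) (simp add: algebra_simps)
  have v: "pairing (vy_fluct (\<alpha> t) (\<omega> t)) (pdx (mode (chi 0 e) k q \<theta>))
     = k * (q * hat 0 e k q \<theta> (\<psi>\<alpha> t) - e * hat 1 e k q (\<theta> + pi / 2) (\<psi>\<alpha> t) + k * hat 0 e k q \<theta> (\<psi>\<omega> t))"
  proof -
    have "pairing (vy_fluct (\<alpha> t) (\<omega> t)) (pdx (mode (chi 0 e) k q \<theta>)) = k * hat 0 e k q (\<theta> + pi / 2) (vy_fluct (\<alpha> t) (\<omega> t))"
      unfolding pdx_mode pairing_scale_right hat_def ..
    then show ?thesis unfolding hat_vy[OF t e k(1)] hat_shift by simp
  qed
  have "(h \<alpha> has_real_derivative 2 * (k * (q * hat 0 e k q \<theta> (\<psi>\<alpha> t) - e * hat 1 e k q (\<theta> + pi / 2) (\<psi>\<alpha> t) + k * hat 0 e k q \<theta> (\<psi>\<omega> t)))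
     - 1 / M\<^sup>2 * (- (k\<^sup>2 + q\<^sup>2) * hat 0 e k q \<theta> (\<rho> t) + comm e k q \<theta> (\<rho> t))
     + (\<nu> + l) * (- (k\<^sup>2 + q\<^sup>2) * hat 0 e k q \<theta> (\<alpha> t) + comm e k q \<theta> (\<alpha> t))) (at t within {0..})"
    unfolding h_def by (rule hat_time_deriv[OF C0(2) e k(1) t])
      (use weak_eq(2)[OF tf t] in \<open>simp only: lap[OF L2_sol(1)[OF t]] lap[OF L2_sol(2)[OF t]] v pm q_def[symmetric]\<close>)
  then show "(h \<alpha> has_real_derivative - 2 * k * q / (k\<^sup>2 + q\<^sup>2) * h \<alpha> t - 2 * k\<^sup>2 / (k\<^sup>2 + q\<^sup>2) * h \<omega> t + (k\<^sup>2 + q\<^sup>2) / M\<^sup>2 * h \<rho> t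
        - (\<nu> + l) * (k\<^sup>2 + q\<^sup>2) * h \<alpha> t + err\<alpha> e k q \<theta> t) (at t within {0..})"
  proof (rule DERIV_cong)
    define pp where "pp = k\<^sup>2 + q\<^sup>2"
    show "2 * (k * (q * hat 0 e k q \<theta> (\<psi>\<alpha> t) - e * hat 1 e k q (\<theta> + pi / 2) (\<psi>\<alpha> t) + k * hat 0 e k q \<theta> (\<psi>\<omega> t)))
     - 1 / M\<^sup>2 * (- (k\<^sup>2 + q\<^sup>2) * hat 0 e k q \<theta> (\<rho> t) + comm e k q \<theta> (\<rho> t))
     + (\<nu> + l) * (- (k\<^sup>2 + q\<^sup>2) * hat 0 e k q \<theta> (\<alpha> t) + comm e k q \<theta> (\<alpha> t))
     = - 2 * k * q / (k\<^sup>2 + q\<^sup>2) * h \<alpha> t - 2 * k\<^sup>2 / (k\<^sup>2 + q\<^sup>2) * h \<omega> t + (k\<^sup>2 + q\<^sup>2) / M\<^sup>2 * h \<rho> t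
        - (\<nu> + l) * (k\<^sup>2 + q\<^sup>2) * h \<alpha> t + err\<alpha> e k q \<theta> t"
      unfolding hh hat_psi[OF t e k] err\<alpha>_def pp_def[symmetric]
      by (simp add: diff_divide_distrib add_divide_distrib algebra_simps power2_eq_square[of k])
  qed
qed

section \<open>The energy and the commutator errors of one mode\<close>

definition F2 :: "real \<Rightarrow> real \<Rightarrow> real \<Rightarrow> real \<Rightarrow> real" where
  "F2 e k q t = hat2 0 e k q (\<alpha> t) + (k\<^sup>2 + q\<^sup>2) / M\<^sup>2 * hat2 0 e k q (\<rho> t) + hat2 0 e k q (\<omega> t)"

definition commutators :: "real \<Rightarrow> real \<Rightarrow> real \<Rightarrow> real \<Rightarrow> real \<Rightarrow> real" where
  "commutators e k q \<theta> t = (\<Sum>u\<leftarrow>[\<psi>\<alpha> t, \<psi>\<omega> t, \<rho> t, \<alpha> t, \<omega> t]. (hat 1 e k q (\<theta> + pi / 2) u)\<^sup>2 + (hat 2 e k q \<theta> u)\<^sup>2)"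

definition commutators2 :: "real \<Rightarrow> real \<Rightarrow> real \<Rightarrow> real \<Rightarrow> real" where
  "commutators2 e k q t = (\<Sum>u\<leftarrow>[\<psi>\<alpha> t, \<psi>\<omega> t, \<rho> t, \<alpha> t, \<omega> t]. hat2 1 e k q u + hat2 2 e k q u)"

lemma commutators2: "commutators2 e k q t = commutators e k q 0 t + commutators e k q (pi / 2) t"
  unfolding commutators_def commutators2_def hat2_def by (simp add: hat_shift_pi)

lemma hat2_nonneg: "hat2 j e k q u \<ge> 0" unfolding hat2_def by simp

lemma commutators2_nonneg: "commutators2 e k q t \<ge> 0"
  unfolding commutators2_def by (simp add: hat2_nonneg)

text \<open>The commutator contains the unbounded factor \<open>q\<close>, but no more than one:
  \<open>q\<^sup>2 <= k\<^sup>2 + q\<^sup>2\<close>, and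
  \<open>e\<^sup>2 <= 1 <= k\<^sup>2 + q\<^sup>2\<close> handles the term of second order. So its
  size is \<open>e P\<close> times coefficients with differentiated cutoffs.\<close>

lemma comm_sq:
  assumes "0 < e" "e \<le> 1" "k \<in> \<int>" "k \<noteq> 0"
  shows "(comm e k q \<theta> u)\<^sup>2 \<le> 8 * e\<^sup>2 * (k\<^sup>2 + q\<^sup>2) * ((hat 1 e k q (\<theta> + pi / 2) u)\<^sup>2 + (hat 2 e k q \<theta> u)\<^sup>2)"
proof -
  define a b where "a = hat 1 e k q (\<theta> + pi / 2) u" and "b = hat 2 e k q \<theta> u"
  have "k\<^sup>2 \<ge> 1" using Ints_nonzero_abs_ge1[OF assms(3,4)] by (metis abs_le_square_iff abs_one one_power2 power2_abs)
  then have p: "1 \<le> k\<^sup>2 + q\<^sup>2" "q\<^sup>2 \<le> k\<^sup>2 + q\<^sup>2" by (auto intro: order_trans)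
  have "e\<^sup>2 \<le> 1" using assms by (simp add: power_le_one)
  then have ep: "e\<^sup>2 \<le> k\<^sup>2 + q\<^sup>2" using p by linarith
  have "(comm e k q \<theta> u)\<^sup>2 \<le> 2 * (2 * q * e * a)\<^sup>2 + 2 * (e\<^sup>2 * b)\<^sup>2" unfolding comm_def a_def b_def by (rule sq_sum_le)
  also have "\<dots> = 8 * e\<^sup>2 * (q\<^sup>2 * a\<^sup>2) + 2 * e\<^sup>2 * (e\<^sup>2 * b\<^sup>2)" by (simp add: power_mult_distrib power2_eq_square[of "e\<^sup>2"])
  also have "\<dots> \<le> 8 * e\<^sup>2 * ((k\<^sup>2 + q\<^sup>2) * a\<^sup>2) + 8 * e\<^sup>2 * ((k\<^sup>2 + q\<^sup>2) * b\<^sup>2)"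
    using p ep by (intro add_mono mult_mono) auto
  also have "\<dots> = 8 * e\<^sup>2 * (k\<^sup>2 + q\<^sup>2) * (a\<^sup>2 + b\<^sup>2)" by algebra
  finally show ?thesis by (simp only: a_def b_def)
qed

lemma sum5_sq_le: "(a1 + a2 + a3 + a4 + (a5::real))\<^sup>2 \<le> 5 * (a1\<^sup>2 + a2\<^sup>2 + a3\<^sup>2 + a4\<^sup>2 + a5\<^sup>2)"
proof -
  have "5 * (a1\<^sup>2 + a2\<^sup>2 + a3\<^sup>2 + a4\<^sup>2 + a5\<^sup>2) - (a1 + a2 + a3 + a4 + a5)\<^sup>2
    = (a1 - a2)\<^sup>2 + (a1 - a3)\<^sup>2 + (a1 - a4)\<^sup>2 + (a1 - a5)\<^sup>2 + (a2 - a3)\<^sup>2 + (a2 - a4)\<^sup>2 + (a2 - a5)\<^sup>2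
      + (a3 - a4)\<^sup>2 + (a3 - a5)\<^sup>2 + (a4 - a5)\<^sup>2" by algebra
  moreover have "\<dots> \<ge> 0" by simp
  ultimately show ?thesis by linarith
qed

text \<open>Both errors have the form \<open>P h\<close> with \<open>h\<close> of order
  \<open>e\<close>, as the single-mode estimate requires. The constant 160 is 5 for the five
  summands, 4 for the largest squared factor \<open>2 k\<^sup>2 / p\<close>, and 8 from
  \<open>comm_sq\<close>; \<open>1 / M^4\<close> belongs to the pressure term.\<close>

lemma err_bound:
  assumes e: "0 < e" "e \<le> 1" and k: "k \<in> \<int>" "k \<noteq> 0"
  shows "(err\<alpha> e k q \<theta> t)\<^sup>2 + (\<nu> * comm e k q \<theta> (\<omega> t))\<^sup>2 \<le> 160 * (1 + 1 / M^4) * e\<^sup>2 * (k\<^sup>2 + q\<^sup>2) * commutators e k q \<theta> t"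
proof -
  define p where "p = k\<^sup>2 + q\<^sup>2"
  have "k\<^sup>2 > 0" using k by simp
  then have p0: "p > 0" unfolding p_def by (simp add: add_pos_nonneg)
  define S where "S u = (hat 1 e k q (\<theta> + pi / 2) u)\<^sup>2 + (hat 2 e k q \<theta> u)\<^sup>2" for u
  have S0: "S u \<ge> 0" for u by (simp add: S_def)
  have c: "(comm e k q \<theta> u)\<^sup>2 \<le> 8 * (e\<^sup>2 * p * S u)" for u using comm_sq[OF e k, of q \<theta> u] by (simp add: p_def S_def mult.assoc)
  have X0: "0 \<le> e\<^sup>2 * p * S u" for u using p0 S0[of u] by simp
  have r1: "(2 * k * q / p)\<^sup>2 \<le> 1"
  proof -
    have "\<bar>2 * k * q\<bar> \<le> p" unfolding p_def using zero_le_power2[of "k - q"] zero_le_power2[of "k + q"]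
      unfolding power2_diff power2_sum by linarith
    then have "\<bar>2 * k * q / p\<bar> \<le> 1" using p0 by simp
    then show ?thesis by (metis abs_square_le_1)
  qed
  have r2: "(2 * k\<^sup>2 / p)\<^sup>2 \<le> 4"
  proof -
    have "k\<^sup>2 \<le> p" by (simp add: p_def)
    then have "\<bar>2 * k\<^sup>2 / p\<bar> \<le> \<bar>2\<bar>" using p0 by (simp add: field_simps)
    then show ?thesis unfolding abs_le_square_iff by simp
  qed
  have r3: "(\<nu> + l)\<^sup>2 \<le> 1" using nu l nul by (intro power_le_one) auto
  have r4: "\<nu>\<^sup>2 \<le> 1" using nu l nul by (intro power_le_one) auto
  have m: "(a * comm e k q \<theta> u)\<^sup>2 \<le> A * (8 * (e\<^sup>2 * p * S u))" if "a\<^sup>2 \<le> A" for a A u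
    unfolding power_mult_distrib using that by (intro mult_mono c) (auto intro: order_trans[OF zero_le_power2])
  have t2: "(- (2 * k * e * hat 1 e k q (\<theta> + pi / 2) (\<psi>\<alpha> t)))\<^sup>2 \<le> 4 * (e\<^sup>2 * p * S (\<psi>\<alpha> t))"
  proof -
    have "(- (2 * k * e * hat 1 e k q (\<theta> + pi / 2) (\<psi>\<alpha> t)))\<^sup>2 = 4 * (e\<^sup>2 * k\<^sup>2 * (hat 1 e k q (\<theta> + pi / 2) (\<psi>\<alpha> t))\<^sup>2)"
      by (simp add: power_mult_distrib)
    also have "\<dots> \<le> 4 * (e\<^sup>2 * p * S (\<psi>\<alpha> t))"
      using p0 by (intro mult_left_mono mult_mono) (auto simp: p_def S_def)
    finally show ?thesis .
  qed
  have m4: "(- (1 / M\<^sup>2))\<^sup>2 \<le> 1 / M^4" by (simp add: power_divide power_mult[symmetric])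
  have "(err\<alpha> e k q \<theta> t)\<^sup>2 = ((2 * k * q / p) * comm e k q \<theta> (\<psi>\<alpha> t) + - (2 * k * e * hat 1 e k q (\<theta> + pi / 2) (\<psi>\<alpha> t))
     + (2 * k\<^sup>2 / p) * comm e k q \<theta> (\<psi>\<omega> t) + (- (1 / M\<^sup>2)) * comm e k q \<theta> (\<rho> t) + (\<nu> + l) * comm e k q \<theta> (\<alpha> t))\<^sup>2"
    by (simp add: err\<alpha>_def p_def)
  also have "\<dots> \<le> 5 * (1 * (8 * (e\<^sup>2 * p * S (\<psi>\<alpha> t))) + 4 * (e\<^sup>2 * p * S (\<psi>\<alpha> t)) + 4 * (8 * (e\<^sup>2 * p * S (\<psi>\<omega> t)))
      + 1 / M^4 * (8 * (e\<^sup>2 * p * S (\<rho> t))) + 1 * (8 * (e\<^sup>2 * p * S (\<alpha> t))))"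
    by (rule order_trans[OF sum5_sq_le]) (intro mult_left_mono add_mono m r1 r2 r3 t2 m4; simp)
  also have "\<dots> \<le> 160 * (1 + 1 / M^4) * (e\<^sup>2 * p * S (\<psi>\<alpha> t) + e\<^sup>2 * p * S (\<psi>\<omega> t) + e\<^sup>2 * p * S (\<rho> t) + e\<^sup>2 * p * S (\<alpha> t))"
  proof -
    have "5 * (1 * (8 * x1) + 4 * x1 + 4 * (8 * x2) + w * (8 * x3) + 1 * (8 * x4)) \<le> 160 * (1 + w) * (x1 + x2 + x3 + x4)"
      if "x1 \<ge> 0" "x2 \<ge> 0" "x3 \<ge> 0" "x4 \<ge> 0" "w \<ge> 0" for x1 x2 x3 x4 w :: real
    proof -
      have "0 \<le> w * x1" "0 \<le> w * x2" "0 \<le> w * x3" "0 \<le> w * x4" using that by auto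
      then show ?thesis using that unfolding distrib_left distrib_right mult_1 mult.assoc by linarith
    qed
    from this[OF X0 X0 X0 X0, of "1 / M^4"] show ?thesis by simp
  qed
  finally have 1: "(err\<alpha> e k q \<theta> t)\<^sup>2 \<le> 160 * (1 + 1 / M^4) * (e\<^sup>2 * p * S (\<psi>\<alpha> t) + e\<^sup>2 * p * S (\<psi>\<omega> t) + e\<^sup>2 * p * S (\<rho> t) + e\<^sup>2 * p * S (\<alpha> t))" .
  have "(\<nu> * comm e k q \<theta> (\<omega> t))\<^sup>2 \<le> 1 * (8 * (e\<^sup>2 * p * S (\<omega> t)))" by (rule m[OF r4])
  also have "\<dots> \<le> 160 * (1 + 1 / M^4) * (e\<^sup>2 * p * S (\<omega> t))"
  proof -
    have "1 * (8 * x) \<le> 160 * (1 + w) * x" if "x \<ge> 0" "w \<ge> 0" for x w :: real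
    proof -
      have "0 \<le> w * x" using that by auto
      then show ?thesis using that unfolding distrib_left distrib_right mult_1 mult.assoc by linarith
    qed
    from this[OF X0, of "1 / M^4"] show ?thesis by simp
  qed
  finally have 2: "(\<nu> * comm e k q \<theta> (\<omega> t))\<^sup>2 \<le> 160 * (1 + 1 / M^4) * (e\<^sup>2 * p * S (\<omega> t))" .
  have "160 * (1 + 1 / M^4) * e\<^sup>2 * p * commutators e k q \<theta> t
     = 160 * (1 + 1 / M^4) * (e\<^sup>2 * p * S (\<psi>\<alpha> t) + e\<^sup>2 * p * S (\<psi>\<omega> t) + e\<^sup>2 * p * S (\<rho> t) + e\<^sup>2 * p * S (\<alpha> t))
       + 160 * (1 + 1 / M^4) * (e\<^sup>2 * p * S (\<omega> t))"
    unfolding commutators_def S_def[symmetric] by (simp add: distrib_left mult.assoc)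
  then show ?thesis using 1 2 unfolding p_def[symmetric] by linarith
qed

definition "growth_const = 128 * (1 + M\<^sup>2) * exp (512 * (1 + M)\<^sup>2 + 1)"
definition "growth_err T = (4 / \<nu> + 1) * exp (512 * (1 + M)\<^sup>2 + 1 + T) * (160 * (1 + 1 / M^4))"
definition "decay T = exp (- (\<nu> powr (1/3) * T / 12))"

lemma mode_phase:
  fixes e k \<eta> \<theta> T :: real
  assumes e: "0 < e" "e \<le> 1" and k: "k \<in> \<int>" "k \<noteq> 0" and T: "T \<ge> 0"
  defines "G \<equiv> \<lambda>t. (hat 0 e k (\<eta> - k * t) \<theta> (\<alpha> t))\<^sup>2 + (k\<^sup>2 + (\<eta> - k * t)\<^sup>2) / M\<^sup>2 * (hat 0 e k (\<eta> - k * t) \<theta> (\<rho> t))\<^sup>2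
     + (hat 0 e k (\<eta> - k * t) \<theta> (\<omega> t))\<^sup>2"
  obtains y y' where
    "\<And>t. t \<ge> 0 \<Longrightarrow> (y has_real_derivative y' t) (at t within {0..})"
    "\<And>t. t \<ge> 0 \<Longrightarrow> t \<le> T \<Longrightarrow> y' t \<le> growth_err T * e\<^sup>2 * commutators e k (\<eta> - k * t) \<theta> t"
    "y 0 \<le> (1 + M\<^sup>2) * G 0"
    "G T \<le> growth_const * ((1 + T)^3 * decay T * y T)"
    "G T / (k\<^sup>2 + (\<eta> - k * T)\<^sup>2) \<le> growth_const * ((1 + T) * decay T * y T)"
proof -
  define s where "s t = t - \<eta> / k" for t
  define P where "P t = \<bar>k\<bar> * sqrt (1 + (s t)\<^sup>2)" for t
  define h where "h f t = hat 0 e k (\<eta> - k * t) \<theta> (f t)" for f :: "real \<Rightarrow> real \<times> real \<Rightarrow> real" and t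
  have q: "\<eta> - k * t = - (k * s t)" for t using k by (simp add: s_def field_simps)
  have b0: "1 + (s t)\<^sup>2 > 0" for t by (simp add: add_pos_nonneg)
  have pk: "k\<^sup>2 + (\<eta> - k * t)\<^sup>2 = k\<^sup>2 * (1 + (s t)\<^sup>2)" for t unfolding q by (simp add: power_mult_distrib algebra_simps)
  have P2: "(P t)\<^sup>2 = k\<^sup>2 + (\<eta> - k * t)\<^sup>2" for t unfolding pk using b0[of t] by (simp add: P_def power_mult_distrib)
  have P0: "P t > 0" for t using k b0[of t] by (simp add: P_def)
  \<comment> \<open>With \<open>\<eta> - k t = - k s\<close> the coefficients of the localized
    equations become functions of the time \<open>s\<close> elapsed since the critical time
    \<open>\<eta> / k\<close>, as in \<open>mode_growth\<close>.\<close>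
  have c1: "2 * s t / (1 + (s t)\<^sup>2) = - 2 * k * (\<eta> - k * t) / (k\<^sup>2 + (\<eta> - k * t)\<^sup>2)"
    "2 / (1 + (s t)\<^sup>2) = 2 * k\<^sup>2 / (k\<^sup>2 + (\<eta> - k * t)\<^sup>2)" for t
    unfolding pk unfolding q using k b0[of t] by (simp_all add: power2_eq_square)
  define h1 where "h1 t = err\<alpha> e k (\<eta> - k * t) \<theta> t / P t" for t
  define h2 where "h2 t = \<nu> * comm e k (\<eta> - k * t) \<theta> (\<omega> t) / P t" for t
  have hh: "P t * h1 t = err\<alpha> e k (\<eta> - k * t) \<theta> t" "P t * h2 t = \<nu> * comm e k (\<eta> - k * t) \<theta> (\<omega> t)" for t
    using P0[of t] by (simp_all add: h1_def h2_def)
  have FG: "(h \<alpha> t)\<^sup>2 + (P t * h \<rho> t / M)\<^sup>2 + (h \<omega> t)\<^sup>2 = G t" for t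
    unfolding G_def power_divide power_mult_distrib P2 by (simp add: h_def)
  note ode = mode_ode[OF _ e(1) k, of _ \<eta> \<theta>, folded h_def[abs_def]]
  have k1: "\<bar>k\<bar> \<ge> 1" by (rule Ints_nonzero_abs_ge1[OF k])
  have nd: "\<nu> \<le> \<nu> + l" "\<nu> \<le> 1" using l nu nul by auto
  have A': "(h \<alpha> has_real_derivative 2 * s t / (1 + (s t)\<^sup>2) * h \<alpha> t - 2 / (1 + (s t)\<^sup>2) * h \<omega> t + (P t)\<^sup>2 / M\<^sup>2 * h \<rho> t
               - (\<nu> + l) * (P t)\<^sup>2 * h \<alpha> t + P t * h1 t) (at t within {0..})" if "t \<ge> 0" for t
    unfolding c1 P2 hh using ode(2)[OF that] by (simp add: h_def[abs_def])
  have W': "(h \<omega> has_real_derivative h \<alpha> t - \<nu> * (P t)\<^sup>2 * h \<omega> t + P t * h2 t) (at t within {0..})" if "t \<ge> 0" for t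
    unfolding P2 hh using ode(3)[OF that] by (simp add: h_def[abs_def])
  have R': "(h \<rho> has_real_derivative - h \<alpha> t) (at t within {0..})" if "t \<ge> 0" for t
    using ode(1)[OF that] by (simp add: h_def[abs_def])
  obtain y y' where y: "\<And>t. t \<ge> 0 \<Longrightarrow> (y has_real_derivative y' t) (at t within {0..})"
    "\<And>t. t \<ge> 0 \<Longrightarrow> t \<le> T \<Longrightarrow> y' t \<le> (4 / \<nu> + 1) * exp (512 * (1 + M)\<^sup>2 + 1 + T) * ((h1 t)\<^sup>2 + (h2 t)\<^sup>2)"
    "y 0 \<le> (1 + M\<^sup>2) * ((h \<alpha> 0)\<^sup>2 + (P 0 * h \<rho> 0 / M)\<^sup>2 + (h \<omega> 0)\<^sup>2)"
    "\<And>t. t \<ge> 0 \<Longrightarrow> (h \<alpha> t)\<^sup>2 + (P t * h \<rho> t / M)\<^sup>2 + (h \<omega> t)\<^sup>2 \<le> 128 * (1 + M\<^sup>2) * exp (512 * (1 + M)\<^sup>2 + 1) * ((1 + t)^3 * exp (- (\<nu> powr (1/3) * t / 12)) * y t)"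
    "\<And>t. t \<ge> 0 \<Longrightarrow> ((h \<alpha> t)\<^sup>2 + (P t * h \<rho> t / M)\<^sup>2 + (h \<omega> t)\<^sup>2) / (P t)\<^sup>2 \<le> 128 * (1 + M\<^sup>2) * exp (512 * (1 + M)\<^sup>2 + 1) * ((1 + t) * exp (- (\<nu> powr (1/3) * t / 12)) * y t)"
    using mode_growth[OF k1 M nu nd Mle, where R = "h \<rho>" and A = "h \<alpha>" and W = "h \<omega>" and ?h1.0 = h1 and ?h2.0 = h2 and \<eta> = \<eta> and T = T,
        folded s_def, folded P_def, OF R' A' W'] by blast
  have "y' t \<le> growth_err T * e\<^sup>2 * commutators e k (\<eta> - k * t) \<theta> t" if t: "t \<ge> 0" "t \<le> T" for t
  proof -
    define c where "c = (4 / \<nu> + 1) * exp (512 * (1 + M)\<^sup>2 + 1 + T)"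
    have c0: "c \<ge> 0" using nu by (simp add: c_def)
    have "(h1 t)\<^sup>2 + (h2 t)\<^sup>2 = ((err\<alpha> e k (\<eta> - k * t) \<theta> t)\<^sup>2 + (\<nu> * comm e k (\<eta> - k * t) \<theta> (\<omega> t))\<^sup>2) / (P t)\<^sup>2"
      by (simp add: h1_def h2_def power_divide add_divide_distrib)
    also have "\<dots> \<le> (160 * (1 + 1 / M^4) * e\<^sup>2 * (P t)\<^sup>2 * commutators e k (\<eta> - k * t) \<theta> t) / (P t)\<^sup>2"
      using err_bound[OF e k] unfolding P2 by (intro divide_right_mono) auto
    also have "\<dots> = 160 * (1 + 1 / M^4) * e\<^sup>2 * commutators e k (\<eta> - k * t) \<theta> t" using P0[of t] by simp
    finally have "c * ((h1 t)\<^sup>2 + (h2 t)\<^sup>2) \<le> c * (160 * (1 + 1 / M^4) * e\<^sup>2 * commutators e k (\<eta> - k * t) \<theta> t)"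
      by (rule mult_left_mono) (rule c0)
    with y(2)[OF t] have "y' t \<le> c * (160 * (1 + 1 / M^4) * e\<^sup>2 * commutators e k (\<eta> - k * t) \<theta> t)"
      unfolding c_def by linarith
    then show ?thesis unfolding growth_err_def c_def by (simp only: mult.assoc)
  qed
  from that[OF y(1) this y(3)[unfolded FG] y(4)[OF T, unfolded FG, folded growth_const_def decay_def]
      y(5)[OF T, unfolded FG P2, folded growth_const_def decay_def]] show thesis .
qed

text \<open>The equations are real and linear and their coefficients do not depend on the phase, so
  the bounds of both phases may be added. The existential form permits choosing \<open>Y\<close> for
  every frequency of a finite set at once.\<close>

lemma mode_pair:
  fixes e k \<eta> T :: real
  assumes e: "0 < e" "e \<le> 1" and k: "k \<in> \<int>" "k \<noteq> 0" and T: "T \<ge> 0"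
  shows "\<exists>Y Y'. (\<forall>t\<ge>0. (Y has_real_derivative Y' t) (at t within {0..})) \<and>
    (\<forall>t. 0 \<le> t \<and> t \<le> T \<longrightarrow> Y' t \<le> growth_err T * e\<^sup>2 * commutators2 e k (\<eta> - k * t) t) \<and>
    Y 0 \<le> (1 + M\<^sup>2) * F2 e k \<eta> 0 \<and>
    F2 e k (\<eta> - k * T) T \<le> growth_const * ((1 + T)^3 * decay T * Y T) \<and>
    F2 e k (\<eta> - k * T) T / (k\<^sup>2 + (\<eta> - k * T)\<^sup>2) \<le> growth_const * ((1 + T) * decay T * Y T)"
proof -
  define G where "G \<theta> t = (hat 0 e k (\<eta> - k * t) \<theta> (\<alpha> t))\<^sup>2 + (k\<^sup>2 + (\<eta> - k * t)\<^sup>2) / M\<^sup>2 * (hat 0 e k (\<eta> - k * t) \<theta> (\<rho> t))\<^sup>2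
     + (hat 0 e k (\<eta> - k * t) \<theta> (\<omega> t))\<^sup>2" for \<theta> t
  have F: "F2 e k (\<eta> - k * t) t = G 0 t + G (pi / 2) t" for t unfolding F2_def G_def hat2_def by (simp add: distrib_left)
  obtain y y' where y:
    "\<And>t. t \<ge> 0 \<Longrightarrow> (y has_real_derivative y' t) (at t within {0..})"
    "\<And>t. t \<ge> 0 \<Longrightarrow> t \<le> T \<Longrightarrow> y' t \<le> growth_err T * e\<^sup>2 * commutators e k (\<eta> - k * t) 0 t"
    "y 0 \<le> (1 + M\<^sup>2) * G 0 0"
    "G 0 T \<le> growth_const * ((1 + T)^3 * decay T * y T)"
    "G 0 T / (k\<^sup>2 + (\<eta> - k * T)\<^sup>2) \<le> growth_const * ((1 + T) * decay T * y T)"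
    using mode_phase[OF e k T, of \<eta> 0, folded G_def] by blast
  obtain x x' where x:
    "\<And>t. t \<ge> 0 \<Longrightarrow> (x has_real_derivative x' t) (at t within {0..})"
    "\<And>t. t \<ge> 0 \<Longrightarrow> t \<le> T \<Longrightarrow> x' t \<le> growth_err T * e\<^sup>2 * commutators e k (\<eta> - k * t) (pi / 2) t"
    "x 0 \<le> (1 + M\<^sup>2) * G (pi / 2) 0"
    "G (pi / 2) T \<le> growth_const * ((1 + T)^3 * decay T * x T)"
    "G (pi / 2) T / (k\<^sup>2 + (\<eta> - k * T)\<^sup>2) \<le> growth_const * ((1 + T) * decay T * x T)"
    using mode_phase[OF e k T, of \<eta> "pi / 2", folded G_def] by blast
  show ?thesis
  proof (rule exI[of _ "\<lambda>t. y t + x t"], rule exI[of _ "\<lambda>t. y' t + x' t"], intro conjI allI impI)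
    show "((\<lambda>t. y t + x t) has_real_derivative y' t + x' t) (at t within {0..})" if "0 \<le> t" for t
      by (intro DERIV_add y x that)
    show "y' t + x' t \<le> growth_err T * e\<^sup>2 * commutators2 e k (\<eta> - k * t) t" if "0 \<le> t \<and> t \<le> T" for t
      using y(2)[of t] x(2)[of t] that by (simp add: commutators2 distrib_left)
    show "y 0 + x 0 \<le> (1 + M\<^sup>2) * F2 e k \<eta> 0" using y(3) x(3) F[of 0] by (simp add: distrib_left)
    show "F2 e k (\<eta> - k * T) T \<le> growth_const * ((1 + T) ^ 3 * decay T * (y T + x T))"
      unfolding F using y(4) x(4) by (simp add: distrib_left)
    show "F2 e k (\<eta> - k * T) T / (k\<^sup>2 + (\<eta> - k * T)\<^sup>2) \<le> growth_const * ((1 + T) * decay T * (y T + x T))"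
      unfolding F add_divide_distrib using y(5) x(5) by (simp only: distrib_left)
  qed
qed

end

section \<open>Summation over the frequency lattice\<close>

lemma hat2_weak_dx:
  assumes "is_weak_dx u g" "e > 0" "k \<in> \<int>" shows "hat2 j e k q g = k\<^sup>2 * hat2 j e k q u"
  unfolding hat2_def hat_weak_dx[OF assms] by (simp add: hat_shift_pi power_mult_distrib distrib_left)

text \<open>Both directions are needed: the second bounds the initial energy by the derivative of
  the initial density, the first recovers the derivative of the density at a later time from the
  energy.\<close>

lemma hat2_weak_dy:
  assumes "L2 u" "is_weak_dy u g" "e > 0" "k \<in> \<int>"
  shows "hat2 0 e k q g \<le> 2 * q\<^sup>2 * hat2 0 e k q u + 2 * e\<^sup>2 * hat2 1 e k q u"
    "q\<^sup>2 * hat2 0 e k q u \<le> 2 * hat2 0 e k q g + 2 * e\<^sup>2 * hat2 1 e k q u"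
proof -
  have h: "hat 0 e k q 0 g = - (q * hat 0 e k q (pi / 2) u + e * hat 1 e k q 0 u)"
    "hat 0 e k q (pi / 2) g = q * hat 0 e k q 0 u - e * hat 1 e k q (pi / 2) u"
    using hat_weak_dy[OF assms, of 0 q 0] hat_weak_dy[OF assms, of 0 q "pi / 2"] by (simp_all add: hat_shift_pi)
  have i: "(- (q * a + e * b))\<^sup>2 + (q * a' - e * b')\<^sup>2 \<le> 2 * q\<^sup>2 * (a'\<^sup>2 + a\<^sup>2) + 2 * e\<^sup>2 * (b\<^sup>2 + b'\<^sup>2)" for a b a' b'
    using sq_sum_le[of "q * a" "e * b"] sq_sum_le[of "q * a'" "- (e * b')"]
    unfolding power2_minus by (simp add: power_mult_distrib distrib_left)
  show "hat2 0 e k q g \<le> 2 * q\<^sup>2 * hat2 0 e k q u + 2 * e\<^sup>2 * hat2 1 e k q u"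
    unfolding hat2_def h by (rule i)
  have "(q * a)\<^sup>2 \<le> 2 * (- (q * a + e * b))\<^sup>2 + 2 * (e * b)\<^sup>2" "(q * a)\<^sup>2 \<le> 2 * (q * a - e * b)\<^sup>2 + 2 * (e * b)\<^sup>2" for a b
    using sq_sum_le[of "q * a + e * b" "- (e * b)"] sq_sum_le[of "q * a - e * b" "e * b"] unfolding power2_minus by simp_all
  note j = this(1)[of "hat 0 e k q (pi / 2) u" "hat 1 e k q 0 u"] this(2)[of "hat 0 e k q 0 u" "hat 1 e k q (pi / 2) u"]
  show "q\<^sup>2 * hat2 0 e k q u \<le> 2 * hat2 0 e k q g + 2 * e\<^sup>2 * hat2 1 e k q u"
    unfolding hat2_def h using j by (simp add: power_mult_distrib distrib_left)
qed

lemma hat2_fluct: "L2 u \<Longrightarrow> e > 0 \<Longrightarrow> k \<in> \<int> \<Longrightarrow> k \<noteq> 0 \<Longrightarrow> hat2 j e k q (fluct u) = hat2 j e k q u"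
  unfolding hat2_def by (simp add: hat_fluct)

lemma C0_L2_norm_bounded:
  assumes "C0_L2 u" shows "\<exists>B. \<forall>t. 0 \<le> t \<and> t \<le> T \<longrightarrow> L2norm (u t) \<le> B"
proof -
  have L: "L2 (u t)" if "t \<ge> 0" for t using assms that by (simp add: C0_L2_def)
  have "continuous_on {0..T} (\<lambda>t. L2norm (u t))"
  proof (rule continuous_on_subset)
    show "continuous_on {0..} (\<lambda>t. L2norm (u t))" unfolding continuous_on_def
    proof
      fix t :: real assume t: "t \<in> {0..}"
      have l: "((\<lambda>s. L2norm (\<lambda>z. u s z - u t z)) \<longlongrightarrow> 0) (at t within {0..})"
        using assms t by (simp add: C0_L2_def)
      have "((\<lambda>s. L2norm (u s) - L2norm (u t)) \<longlongrightarrow> 0) (at t within {0..})"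
      proof (rule Lim_null_comparison[OF _ l])
        show "\<forall>\<^sub>F s in at t within {0..}. norm (L2norm (u s) - L2norm (u t)) \<le> L2norm (\<lambda>z. u s z - u t z)"
        proof (unfold eventually_at_filter, intro always_eventually allI impI)
          fix s :: real assume "s \<in> {0..}"
          then show "norm (L2norm (u s) - L2norm (u t)) \<le> L2norm (\<lambda>z. u s z - u t z)"
            using L2norm_triangle_diff[OF L[of s] L[of t]] L2norm_triangle_diff[OF L[of t] L[of s]] t L2norm_minus_commute[of "u s" "u t"]
            by auto
        qed
      qed
      then show "((\<lambda>s. L2norm (u s)) \<longlongrightarrow> L2norm (u t)) (at t within {0..})" by (rule Lim_null[THEN iffD2])
    qed
  qed auto
  then have "bounded ((\<lambda>t. L2norm (u t)) ` {0..T})" by (intro compact_imp_bounded compact_continuous_image) auto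
  then obtain B where "\<forall>t\<in>{0..T}. L2norm (u t) \<le> B" unfolding bounded_iff by auto
  then show ?thesis by (intro exI[of _ B]) auto
qed

lemma L2norm_fluct_le: assumes "L2 u" shows "L2norm (fluct u) \<le> 2 * L2norm u"
proof -
  have "L2norm (\<lambda>z. u z + (-1) * xavg u z) \<le> L2norm u + L2norm (\<lambda>z. (-1) * xavg u z)"
    by (intro L2norm_triangle assms L2_scale xavg_L2)
  also have "L2norm (\<lambda>z. (-1) * xavg u z) = L2norm (xavg u)" unfolding L2norm_scale by simp
  also have "\<dots> \<le> L2norm u" by (rule xavg_L2[OF assms])
  finally show ?thesis by (simp add: fluct_def[abs_def])
qed

context couette
begin

text \<open>Bessel's inequality is indifferent to the shift, so one bound covers the moving lattices
  of all times up to \<open>T\<close>. It also needs the potentials to be bounded in time, which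
  their norm bound in terms of \<alpha> and \<omega> provides.\<close>

lemma commutators2_sum_bounded:
  shows "\<exists>Q\<ge>0. \<forall>e F t \<tau>. 0 < e \<and> finite F \<and> 0 \<le> t \<and> t \<le> T \<longrightarrow>
     e / (8 * pi) * (\<Sum>km\<in>F. commutators2 e (of_int (fst km)) (freq e \<tau> km) t) \<le> Q"
proof -
  obtain B where B: "B \<ge> 1" "\<And>e y. \<bar>chi 0 e y\<bar> \<le> 1" "\<And>j e y. j \<le> 2 \<Longrightarrow> \<bar>chi j e y\<bar> \<le> B" using chi_bounded by blast
  obtain b1 where b1: "\<And>t. 0 \<le> t \<and> t \<le> T \<Longrightarrow> L2norm (\<rho> t) \<le> b1" using C0_L2_norm_bounded[OF C0(1)] by blast
  obtain b2 where b2: "\<And>t. 0 \<le> t \<and> t \<le> T \<Longrightarrow> L2norm (\<alpha> t) \<le> b2" using C0_L2_norm_bounded[OF C0(2)] by blast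
  obtain b3 where b3: "\<And>t. 0 \<le> t \<and> t \<le> T \<Longrightarrow> L2norm (\<omega> t) \<le> b3" using C0_L2_norm_bounded[OF C0(3)] by blast
  have psi_le: "L2norm (inv_laplacian (fluct u)) \<le> 2 * pi * (2 * pi * (2 * b) + 2)" if "L2 u" "L2norm u \<le> b" for u b
  proof -
    have "L2norm (fluct u) \<le> 2 * b" using L2norm_fluct_le[OF that(1)] that(2) by linarith
    then have "2 * pi * (2 * pi * L2norm (fluct u) + 2) \<le> 2 * pi * (2 * pi * (2 * b) + 2)"
      by (intro mult_left_mono add_right_mono) auto
    with inv_laplacian_fluct(6)[OF that(1)] show ?thesis by linarith
  qed
  define N where "N = \<bar>b1\<bar> + \<bar>b2\<bar> + \<bar>b3\<bar> + \<bar>2 * pi * (2 * pi * (2 * b2) + 2)\<bar> + \<bar>2 * pi * (2 * pi * (2 * b3) + 2)\<bar>"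
  show ?thesis
  proof (intro exI[of _ "10 * (B\<^sup>2 * N\<^sup>2)"] conjI allI impI)
    fix e t :: real and F :: "(int \<times> int) set" and \<tau> assume h: "0 < e \<and> finite F \<and> 0 \<le> t \<and> t \<le> T"
    then have t: "t \<ge> 0" "0 \<le> t \<and> t \<le> T" and e: "e > 0" and F: "finite F" by auto
    have one: "e / (8 * pi) * (\<Sum>km\<in>F. hat2 1 e (of_int (fst km)) (freq e \<tau> km) u + hat2 2 e (of_int (fst km)) (freq e \<tau> km) u) \<le> 2 * (B\<^sup>2 * N\<^sup>2)"
      if u: "L2 u" "L2norm u \<le> N" for u
    proof -
      have "(\<Sum>km\<in>F. hat2 j e (of_int (fst km)) (freq e \<tau> km) u) \<le> 8 * pi / e * (B\<^sup>2 * N\<^sup>2)" if "j \<le> 2" for j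
      proof -
        have "(\<Sum>km\<in>F. hat2 j e (of_int (fst km)) (freq e \<tau> km) u) \<le> 8 * pi / e * (B\<^sup>2 * (L2norm u)\<^sup>2)"
          by (rule Bessel_hat[OF u(1) e F B(3)[OF that]])
        also have "\<dots> \<le> 8 * pi / e * (B\<^sup>2 * N\<^sup>2)" using u e by (intro mult_left_mono power_mono) auto
        finally show ?thesis .
      qed
      from this[of 1] this[of 2] have "(\<Sum>km\<in>F. hat2 1 e (of_int (fst km)) (freq e \<tau> km) u + hat2 2 e (of_int (fst km)) (freq e \<tau> km) u)
        \<le> 8 * pi / e * (2 * (B\<^sup>2 * N\<^sup>2))" unfolding sum.distrib by (simp add: distrib_left)
      then have "e / (8 * pi) * (\<Sum>km\<in>F. hat2 1 e (of_int (fst km)) (freq e \<tau> km) u + hat2 2 e (of_int (fst km)) (freq e \<tau> km) u)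
        \<le> e / (8 * pi) * (8 * pi / e * (2 * (B\<^sup>2 * N\<^sup>2)))" using e by (intro mult_left_mono) auto
      also have "\<dots> = 2 * (B\<^sup>2 * N\<^sup>2)" using e by simp
      finally show ?thesis .
    qed
    note L = L2_sol[OF t(1)]
    have n: "L2norm (\<psi>\<alpha> t) \<le> N" "L2norm (\<psi>\<omega> t) \<le> N" "L2norm (\<rho> t) \<le> N" "L2norm (\<alpha> t) \<le> N" "L2norm (\<omega> t) \<le> N"
      using psi_le[OF L(2) b2[OF t(2)]] psi_le[OF L(3) b3[OF t(2)]] b1[OF t(2)] b2[OF t(2)] b3[OF t(2)]
      unfolding N_def \<psi>\<alpha>_def \<psi>\<omega>_def by linarith+
    show "e / (8 * pi) * (\<Sum>km\<in>F. commutators2 e (of_int (fst km)) (freq e \<tau> km) t) \<le> 10 * (B\<^sup>2 * N\<^sup>2)"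
      using one[OF psi(1)[OF t(1)] n(1)] one[OF psi(2)[OF t(1)] n(2)] one[OF L(1) n(3)] one[OF L(2) n(4)] one[OF L(3) n(5)]
      unfolding commutators2_def by (simp add: sum.distrib distrib_left)
  qed simp
qed

definition "D2 = (L2norm (fluct \<alpha>in))\<^sup>2 + ((L2norm (wdx (fluct \<rho>in)))\<^sup>2 + (L2norm (wdy (fluct \<rho>in)))\<^sup>2) / M\<^sup>2 + (L2norm (fluct \<omega>in))\<^sup>2"

lemma hat_initial:
  assumes "e > 0"
  shows "hat j e k q \<theta> (\<rho> 0) = hat j e k q \<theta> \<rho>in" "hat j e k q \<theta> (\<alpha> 0) = hat j e k q \<theta> \<alpha>in" "hat j e k q \<theta> (\<omega> 0) = hat j e k q \<theta> \<omega>in"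
proof -
  have ae: "AE z in cyl. \<rho> 0 z = \<rho>in z" "AE z in cyl. \<alpha> 0 z = \<alpha>in z" "AE z in cyl. \<omega> 0 z = \<omega>in z"
    using sol unfolding couette_solution_def by auto
  have L: "L2 \<rho>in" using in_reg(1) by (simp add: H1_def)
  note m = L2D(1)[OF L2_mode_chi[OF assms]] and s = L2_sol[OF order_refl, THEN L2D(1)]
  show "hat j e k q \<theta> (\<rho> 0) = hat j e k q \<theta> \<rho>in" unfolding hat_def by (rule pairing_cong_AE[OF s(1) L2D(1)[OF L] m ae(1)])
  show "hat j e k q \<theta> (\<alpha> 0) = hat j e k q \<theta> \<alpha>in" unfolding hat_def by (rule pairing_cong_AE[OF s(2) L2D(1)[OF in_reg(2)] m ae(2)])
  show "hat j e k q \<theta> (\<omega> 0) = hat j e k q \<theta> \<omega>in" unfolding hat_def by (rule pairing_cong_AE[OF s(3) L2D(1)[OF in_reg(3)] m ae(3)])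
qed

text \<open>The factor 2 comes from replacing \<open>q\<close> times the coefficient of the density
  by the coefficient of its weak y-derivative; the difference is a commutator and yields
  \<open>C e\<close>.\<close>

lemma initial_sum:
  "\<exists>C\<ge>0. \<forall>e F \<tau>. 0 < e \<and> e \<le> 1 \<and> finite F \<and> (\<forall>km\<in>F. fst km \<noteq> 0) \<longrightarrow>
     e / (8 * pi) * (\<Sum>km\<in>F. F2 e (of_int (fst km)) (freq e \<tau> km) 0) \<le> 2 * D2 + C * e"
proof -
  obtain B where B: "B \<ge> 1" "\<And>e y. \<bar>chi 0 e y\<bar> \<le> 1" "\<And>j e y. j \<le> 2 \<Longrightarrow> \<bar>chi j e y\<bar> \<le> B" using chi_bounded by blast
  have L: "L2 \<rho>in" using in_reg(1) by (simp add: H1_def)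
  note wx = H1_fluct_weak(1)[OF in_reg(1)] and wy = H1_fluct_weak(2)[OF in_reg(1)]
  have wL: "L2 (wdx (fluct \<rho>in))" "L2 (wdy (fluct \<rho>in))" using wx wy by (auto simp: is_weak_dx_def is_weak_dy_def)
  define C where "C = 2 * (B\<^sup>2 * (L2norm (fluct \<rho>in))\<^sup>2) / M\<^sup>2"
  show ?thesis
  proof (intro exI[of _ C] conjI allI impI)
    show "C \<ge> 0" by (simp add: C_def)
    fix e :: real and F :: "(int \<times> int) set" and \<tau> assume h: "0 < e \<and> e \<le> 1 \<and> finite F \<and> (\<forall>km\<in>F. fst km \<noteq> (0::int))"
    then have e: "e > 0" "e \<le> 1" and F: "finite F" by auto
    define b where "b j u km = hat2 j e (of_int (fst km)) (freq e \<tau> km) u" for j u km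
    have pw: "F2 e (of_int (fst km)) (freq e \<tau> km) 0 \<le> b 0 (fluct \<alpha>in) km + (b 0 (wdx (fluct \<rho>in)) km
        + 2 * b 0 (wdy (fluct \<rho>in)) km + 2 * e\<^sup>2 * b 1 (fluct \<rho>in) km) / M\<^sup>2 + b 0 (fluct \<omega>in) km" if "km \<in> F" for km
    proof -
      define k :: real where "k = of_int (fst km)"
      define q where "q = freq e \<tau> km"
      have k: "k \<in> \<int>" "k \<noteq> 0" using h that by (auto simp: k_def)
      have "F2 e k q 0 = hat2 0 e k q (fluct \<alpha>in) + (k\<^sup>2 + q\<^sup>2) / M\<^sup>2 * hat2 0 e k q (fluct \<rho>in) + hat2 0 e k q (fluct \<omega>in)"
        unfolding F2_def hat2_fluct[OF L e(1) k] hat2_fluct[OF in_reg(2) e(1) k] hat2_fluct[OF in_reg(3) e(1) k]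
        by (simp add: hat2_def hat_initial[OF e(1)])
      also have "(k\<^sup>2 + q\<^sup>2) / M\<^sup>2 * hat2 0 e k q (fluct \<rho>in) = (hat2 0 e k q (wdx (fluct \<rho>in)) + q\<^sup>2 * hat2 0 e k q (fluct \<rho>in)) / M\<^sup>2"
        unfolding hat2_weak_dx[OF wx e(1) k(1)] by (simp add: distrib_right)
      also have "\<dots> \<le> (hat2 0 e k q (wdx (fluct \<rho>in)) + (2 * hat2 0 e k q (wdy (fluct \<rho>in)) + 2 * e\<^sup>2 * hat2 1 e k q (fluct \<rho>in))) / M\<^sup>2"
        by (intro divide_right_mono add_left_mono hat2_weak_dy fluct_L2 L wy e k) simp
      finally show ?thesis unfolding b_def k_def[symmetric] q_def[symmetric] by (simp add: add.assoc)
    qed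
    have bs: "e / (8 * pi) * (\<Sum>km\<in>F. b j u km) \<le> B'\<^sup>2 * (L2norm u)\<^sup>2" if "L2 u" "\<And>y. \<bar>chi j e y\<bar> \<le> B'" for j u B'
    proof -
      have "e / (8 * pi) * (\<Sum>km\<in>F. b j u km) \<le> e / (8 * pi) * (8 * pi / e * (B'\<^sup>2 * (L2norm u)\<^sup>2))"
        unfolding b_def using e by (intro mult_left_mono Bessel_hat F that) auto
      then show ?thesis using e by simp
    qed
    have "e / (8 * pi) * (\<Sum>km\<in>F. F2 e (of_int (fst km)) (freq e \<tau> km) 0) \<le> e / (8 * pi) * (\<Sum>km\<in>F. b 0 (fluct \<alpha>in) km + (b 0 (wdx (fluct \<rho>in)) km
        + 2 * b 0 (wdy (fluct \<rho>in)) km + 2 * e\<^sup>2 * b 1 (fluct \<rho>in) km) / M\<^sup>2 + b 0 (fluct \<omega>in) km)"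
      using e by (intro mult_left_mono sum_mono pw) auto
    also have "\<dots> = e / (8 * pi) * (\<Sum>km\<in>F. b 0 (fluct \<alpha>in) km) + (e / (8 * pi) * (\<Sum>km\<in>F. b 0 (wdx (fluct \<rho>in)) km)
        + 2 * (e / (8 * pi) * (\<Sum>km\<in>F. b 0 (wdy (fluct \<rho>in)) km)) + 2 * e\<^sup>2 * (e / (8 * pi) * (\<Sum>km\<in>F. b 1 (fluct \<rho>in) km))) / M\<^sup>2
        + e / (8 * pi) * (\<Sum>km\<in>F. b 0 (fluct \<omega>in) km)"
      unfolding sum.distrib sum_divide_distrib[symmetric] sum_distrib_left[symmetric] distrib_left add_divide_distrib by (simp add: mult_ac)
    also have "\<dots> \<le> 1\<^sup>2 * (L2norm (fluct \<alpha>in))\<^sup>2 + (1\<^sup>2 * (L2norm (wdx (fluct \<rho>in)))\<^sup>2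
        + 2 * (1\<^sup>2 * (L2norm (wdy (fluct \<rho>in)))\<^sup>2) + 2 * e\<^sup>2 * (B\<^sup>2 * (L2norm (fluct \<rho>in))\<^sup>2)) / M\<^sup>2 + 1\<^sup>2 * (L2norm (fluct \<omega>in))\<^sup>2"
      by (intro add_mono divide_right_mono mult_left_mono bs fluct_L2 in_reg L wL B) auto
    also have "\<dots> \<le> 2 * D2 + C * e\<^sup>2"
    proof -
      have "C * e\<^sup>2 = 2 * e\<^sup>2 * (B\<^sup>2 * (L2norm (fluct \<rho>in))\<^sup>2) / M\<^sup>2" by (simp add: C_def)
      moreover have "0 \<le> (L2norm (wdx (fluct \<rho>in)))\<^sup>2 / M\<^sup>2" "0 \<le> (L2norm (fluct \<alpha>in))\<^sup>2" "0 \<le> (L2norm (fluct \<omega>in))\<^sup>2" by auto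
      moreover have "1\<^sup>2 * a + (1\<^sup>2 * x + 2 * (1\<^sup>2 * y) + z) / m + 1\<^sup>2 * w \<le> 2 * (a + (x + y) / m + w) + z / m"
        if "0 \<le> x / m" "0 \<le> a" "0 \<le> w" for a x y z m w :: real
        using that unfolding add_divide_distrib distrib_left times_divide_eq_right[symmetric] one_power2 mult_1 by linarith
      ultimately show ?thesis unfolding D2_def by metis
    qed
    also have "C * e\<^sup>2 \<le> C * e" using e \<open>C \<ge> 0\<close> by (intro mult_left_mono) (auto simp: power2_eq_square mult_left_le)
    finally show "e / (8 * pi) * (\<Sum>km\<in>F. F2 e (of_int (fst km)) (freq e \<tau> km) 0) \<le> 2 * D2 + C * e" by simp
  qed
qed

lemma growth_const_pos: "growth_const > 0" unfolding growth_const_def by (simp add: add_pos_nonneg)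

lemma decay_pos: "decay T > 0" by (simp add: decay_def)

text \<open>The sum of the functions \<open>y\<close> over the finite set is propagated as a whole.
  Its derivative is controlled by the commutator sum with a factor \<open>e\<^sup>2\<close>, so over
  \<open>[0, T]\<close> it changes by \<open>O(e)\<close> with a constant that may depend on
  \<open>T\<close>, \<open>M\<close>, \<nu> and the solution, but not on the set.\<close>

lemma propagated_sum:
  assumes T: "T \<ge> 0"
  shows "\<exists>C\<ge>0. \<forall>e F. 0 < e \<and> e \<le> 1 \<and> finite F \<and> (\<forall>km\<in>F. fst km \<noteq> 0) \<longrightarrow>
     e / (8 * pi) * (\<Sum>km\<in>F. F2 e (of_int (fst km)) (freq e (\<lambda>k. - of_int k * T) km) T)
       \<le> growth_const * ((1 + T)^3 * decay T) * (2 * (1 + M\<^sup>2) * D2) + C * e \<and>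
     e / (8 * pi) * (\<Sum>km\<in>F. F2 e (of_int (fst km)) (freq e (\<lambda>k. - of_int k * T) km) T
          / ((of_int (fst km))\<^sup>2 + (freq e (\<lambda>k. - of_int k * T) km)\<^sup>2))
       \<le> growth_const * ((1 + T) * decay T) * (2 * (1 + M\<^sup>2) * D2) + C * e"
proof -
  obtain Q where Q: "Q \<ge> 0" "\<And>e F t \<tau>. 0 < e \<and> finite F \<and> 0 \<le> t \<and> t \<le> T \<Longrightarrow>
     e / (8 * pi) * (\<Sum>km\<in>F. commutators2 e (of_int (fst km)) (freq e \<tau> km) t) \<le> Q"
    using commutators2_sum_bounded[of T] by blast
  obtain C0 where C0: "C0 \<ge> 0" "\<And>e F \<tau>. 0 < e \<and> e \<le> 1 \<and> finite F \<and> (\<forall>km\<in>F. fst km \<noteq> 0) \<Longrightarrow>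
     e / (8 * pi) * (\<Sum>km\<in>F. F2 e (of_int (fst km)) (freq e \<tau> km) 0) \<le> 2 * D2 + C0 * e"
    using initial_sum by blast
  have g0: "growth_err T \<ge> 0" unfolding growth_err_def using nu by (intro mult_nonneg_nonneg add_nonneg_nonneg) auto
  define C1 where "C1 = (1 + M\<^sup>2) * C0 + T * (growth_err T * Q)"
  have C1: "C1 \<ge> 0" unfolding C1_def using C0 g0 Q T by (intro add_nonneg_nonneg mult_nonneg_nonneg) auto
  have d3: "growth_const * ((1 + T)^3 * decay T) \<ge> 0" "growth_const * ((1 + T) * decay T) \<ge> 0"
    using growth_const_pos decay_pos[of T] T by auto
  define C where "C = growth_const * ((1 + T)^3 * decay T) * C1 + growth_const * ((1 + T) * decay T) * C1"
  have CC: "C \<ge> 0" "growth_const * ((1 + T)^3 * decay T) * C1 \<le> C" "growth_const * ((1 + T) * decay T) * C1 \<le> C"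
    using mult_nonneg_nonneg[OF d3(1) C1] mult_nonneg_nonneg[OF d3(2) C1] unfolding C_def by linarith+
  show ?thesis
  proof (intro exI[of _ C] conjI allI impI)
    fix e :: real and F :: "(int \<times> int) set"
    assume h: "0 < e \<and> e \<le> 1 \<and> finite F \<and> (\<forall>km\<in>F. fst km \<noteq> 0)"
    then have e: "0 < e" "e \<le> 1" and F: "finite F" by auto
    define kk :: "int \<times> int \<Rightarrow> real" where "kk km = of_int (fst km)" for km
    define fr where "fr t km = freq e (\<lambda>k. - of_int k * t) km" for t km
    \<comment> \<open>The initial lattice is unshifted; following each frequency for a time
      \<open>t\<close> gives the lattice with the shift \<open>- k t\<close> and the same index
      \<open>m\<close>.\<close>
    have fr: "fr 0 km - kk km * t = fr t km" for t km by (simp add: fr_def kk_def freq_def)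
    define X where "X km YY \<longleftrightarrow> (\<forall>t\<ge>0. (fst YY has_real_derivative snd YY t) (at t within {0..})) \<and>
        (\<forall>t. 0 \<le> t \<and> t \<le> T \<longrightarrow> snd YY t \<le> growth_err T * e\<^sup>2 * commutators2 e (kk km) (fr t km) t) \<and>
        fst YY 0 \<le> (1 + M\<^sup>2) * F2 e (kk km) (fr 0 km) 0 \<and>
        F2 e (kk km) (fr T km) T \<le> growth_const * ((1 + T)^3 * decay T * fst YY T) \<and>
        F2 e (kk km) (fr T km) T / ((kk km)\<^sup>2 + (fr T km)\<^sup>2) \<le> growth_const * ((1 + T) * decay T * fst YY T)" for km YY
    have "\<exists>YY. X km YY" if "km \<in> F" for km
    proof -
      have "kk km \<in> \<int>" "kk km \<noteq> 0" using h that by (auto simp: kk_def)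
      from mode_pair[OF e this T, of "fr 0 km", unfolded fr] obtain y y' where "X km (y, y')" unfolding X_def fst_conv snd_conv by blast
      then show ?thesis by blast
    qed
    then obtain Z where Z: "\<And>km. km \<in> F \<Longrightarrow> X km (Z km)" by metis
    define Y where "Y t = (\<Sum>km\<in>F. fst (Z km) t)" for t
    define Y' where "Y' t = (\<Sum>km\<in>F. snd (Z km) t)" for t
    have dY: "(Y has_real_derivative Y' t) (at t within {0..})" if "t \<ge> 0" for t
      unfolding Y_def Y'_def using Z that by (intro DERIV_sum) (auto simp: X_def)
    have e8: "e / (8 * pi) > 0" using e by simp
    have Y'le: "e / (8 * pi) * Y' t \<le> growth_err T * e\<^sup>2 * Q" if t: "0 \<le> t \<and> t \<le> T" for t
    proof -
      have "Y' t \<le> (\<Sum>km\<in>F. growth_err T * e\<^sup>2 * commutators2 e (kk km) (fr t km) t)"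
        unfolding Y'_def using Z t by (intro sum_mono) (auto simp: X_def)
      then have "e / (8 * pi) * Y' t \<le> e / (8 * pi) * (growth_err T * e\<^sup>2 * (\<Sum>km\<in>F. commutators2 e (kk km) (fr t km) t))"
        using e8 unfolding sum_distrib_left[symmetric] by (intro mult_left_mono) auto
      also have "\<dots> = growth_err T * e\<^sup>2 * (e / (8 * pi) * (\<Sum>km\<in>F. commutators2 e (kk km) (fr t km) t))" by simp
      also have "\<dots> \<le> growth_err T * e\<^sup>2 * Q" unfolding kk_def fr_def using g0 e F t by (intro mult_left_mono Q(2)) auto
      finally show ?thesis .
    qed
    have "e / (8 * pi) * Y T \<le> e / (8 * pi) * Y 0 + T * (growth_err T * e\<^sup>2 * Q)"
    proof -
      \<comment> \<open>Subtracting the linear function turns the bound on the derivative into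
        monotonicity; one application of the mean value theorem is then enough.\<close>
      define U where "U t = e / (8 * pi) * Y t - t * (growth_err T * e\<^sup>2 * Q)" for t
      define U' where "U' t = e / (8 * pi) * Y' t - growth_err T * e\<^sup>2 * Q" for t
      have "(U has_derivative (\<lambda>h. U' t * h)) (at t within {0..T})" if t: "0 \<le> t" "t \<le> T" for t
      proof -
        have "(U has_real_derivative e / (8 * pi) * Y' t - 1 * (growth_err T * e\<^sup>2 * Q)) (at t within {0..})"
          unfolding U_def[abs_def] by (intro DERIV_diff DERIV_cmult DERIV_cmult_right dY t DERIV_ident)
        then have "(U has_real_derivative U' t) (at t within {0..T})"
          unfolding U'_def mult_1 by (rule DERIV_subset) auto
        then show ?thesis by (rule has_field_derivative_imp_has_derivative)
      qed
      from mvt_very_simple[OF T this] obtain x where x: "x \<in> {0..T}" "U T - U 0 = U' x * (T - 0)" by blast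
      have "U' x \<le> 0" using Y'le[of x] x(1) by (simp add: U'_def)
      then have "U' x * (T - 0) \<le> 0" using T by (intro mult_nonpos_nonneg) auto
      then show ?thesis using x(2) by (simp add: U_def)
    qed
    also have "e / (8 * pi) * Y 0 \<le> (1 + M\<^sup>2) * (2 * D2 + C0 * e)"
    proof -
      have "Y 0 \<le> (\<Sum>km\<in>F. (1 + M\<^sup>2) * F2 e (kk km) (fr 0 km) 0)"
        unfolding Y_def using Z by (intro sum_mono) (auto simp: X_def)
      then have "e / (8 * pi) * Y 0 \<le> e / (8 * pi) * ((1 + M\<^sup>2) * (\<Sum>km\<in>F. F2 e (kk km) (fr 0 km) 0))"
        using e8 unfolding sum_distrib_left[symmetric] by (intro mult_left_mono) auto
      also have "\<dots> = (1 + M\<^sup>2) * (e / (8 * pi) * (\<Sum>km\<in>F. F2 e (kk km) (fr 0 km) 0))" by simp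
      also have "\<dots> \<le> (1 + M\<^sup>2) * (2 * D2 + C0 * e)" unfolding kk_def fr_def using h by (intro mult_left_mono C0(2)) auto
      finally show ?thesis .
    qed
    also have "T * (growth_err T * e\<^sup>2 * Q) \<le> T * (growth_err T * Q) * e"
    proof -
      have "e\<^sup>2 \<le> e" using e by (simp add: power2_eq_square mult_left_le)
      then have "T * (growth_err T * Q) * e\<^sup>2 \<le> T * (growth_err T * Q) * e" using T g0 Q(1) by (intro mult_left_mono) auto
      then show ?thesis by (simp add: mult_ac)
    qed
    also have "(1 + M\<^sup>2) * (2 * D2 + C0 * e) + T * (growth_err T * Q) * e = 2 * (1 + M\<^sup>2) * D2 + C1 * e"
      unfolding C1_def by (simp add: algebra_simps)
    finally have YT: "e / (8 * pi) * Y T \<le> 2 * (1 + M\<^sup>2) * D2 + C1 * e" by simp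
    have fin: "e / (8 * pi) * (\<Sum>km\<in>F. f km) \<le> c * (2 * (1 + M\<^sup>2) * D2) + C * e"
      if "\<And>km. km \<in> F \<Longrightarrow> f km \<le> c * fst (Z km) T" "c \<ge> 0" "c * C1 \<le> C" for f c
    proof -
      have "(\<Sum>km\<in>F. f km) \<le> c * Y T" unfolding Y_def sum_distrib_left using that by (intro sum_mono)
      then have "e / (8 * pi) * (\<Sum>km\<in>F. f km) \<le> e / (8 * pi) * (c * Y T)" using e8 by (intro mult_left_mono) auto
      also have "\<dots> = c * (e / (8 * pi) * Y T)" by simp
      also have "\<dots> \<le> c * (2 * (1 + M\<^sup>2) * D2 + C1 * e)" using that YT by (intro mult_left_mono)
      also have "\<dots> = c * (2 * (1 + M\<^sup>2) * D2) + (c * C1) * e" by (simp only: distrib_left mult.assoc)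
      also have "\<dots> \<le> c * (2 * (1 + M\<^sup>2) * D2) + C * e" using that e by (intro add_left_mono mult_right_mono) auto
      finally show ?thesis .
    qed
    show "e / (8 * pi) * (\<Sum>km\<in>F. F2 e (of_int (fst km)) (freq e (\<lambda>k. - of_int k * T) km) T)
       \<le> growth_const * ((1 + T)^3 * decay T) * (2 * (1 + M\<^sup>2) * D2) + C * e"
      unfolding kk_def[symmetric] fr_def[symmetric]
      by (rule fin[OF _ d3(1) CC(2)]) (use Z in \<open>simp only: X_def mult.assoc\<close>)
    show "e / (8 * pi) * (\<Sum>km\<in>F. F2 e (of_int (fst km)) (freq e (\<lambda>k. - of_int k * T) km) T
          / ((of_int (fst km))\<^sup>2 + (freq e (\<lambda>k. - of_int k * T) km)\<^sup>2))
       \<le> growth_const * ((1 + T) * decay T) * (2 * (1 + M\<^sup>2) * D2) + C * e"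
      unfolding kk_def[symmetric] fr_def[symmetric]
      by (rule fin[OF _ d3(2) CC(3)]) (use Z in \<open>simp only: X_def mult.assoc\<close>)
  qed (rule CC(1))
qed

lemma output_bounds:
  assumes T: "T \<ge> 0" and u: "L2 u" and c: "c \<ge> 0" "c' \<ge> 0"
    and z: "\<And>e q \<theta>. e > 0 \<Longrightarrow> hat 0 e 0 q \<theta> u = 0"
  shows "(\<forall>e k q. 0 < e \<longrightarrow> e \<le> 1 \<longrightarrow> k \<in> \<int> \<longrightarrow> k \<noteq> 0 \<longrightarrow> hat2 0 e k q u \<le> c * F2 e k q T + c' * e * commutators2 e k q T)
     \<Longrightarrow> (L2norm u)\<^sup>2 \<le> c * (growth_const * ((1 + T)^3 * decay T) * (2 * (1 + M\<^sup>2) * D2))"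
    "(\<forall>e k q. 0 < e \<longrightarrow> e \<le> 1 \<longrightarrow> k \<in> \<int> \<longrightarrow> k \<noteq> 0 \<longrightarrow> hat2 0 e k q u \<le> c * (F2 e k q T / (k\<^sup>2 + q\<^sup>2)) + c' * e * commutators2 e k q T)
     \<Longrightarrow> (L2norm u)\<^sup>2 \<le> c * (growth_const * ((1 + T) * decay T) * (2 * (1 + M\<^sup>2) * D2))"
proof -
  obtain Q where Q: "Q \<ge> 0" "\<And>e F t \<tau>. 0 < e \<and> finite F \<and> 0 \<le> t \<and> t \<le> T \<Longrightarrow>
     e / (8 * pi) * (\<Sum>km\<in>F. commutators2 e (of_int (fst km)) (freq e \<tau> km) t) \<le> Q"
    using commutators2_sum_bounded[of T] by blast
  obtain C where C: "C \<ge> 0" "\<And>e F. 0 < e \<and> e \<le> 1 \<and> finite F \<and> (\<forall>km\<in>F. fst km \<noteq> 0) \<Longrightarrow>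
     e / (8 * pi) * (\<Sum>km\<in>F. F2 e (of_int (fst km)) (freq e (\<lambda>k. - of_int k * T) km) T)
       \<le> growth_const * ((1 + T)^3 * decay T) * (2 * (1 + M\<^sup>2) * D2) + C * e \<and>
     e / (8 * pi) * (\<Sum>km\<in>F. F2 e (of_int (fst km)) (freq e (\<lambda>k. - of_int k * T) km) T
          / ((of_int (fst km))\<^sup>2 + (freq e (\<lambda>k. - of_int k * T) km)\<^sup>2))
       \<le> growth_const * ((1 + T) * decay T) * (2 * (1 + M\<^sup>2) * D2) + C * e"
    using propagated_sum[OF T] by blast
  have D20: "D2 \<ge> 0" by (simp add: D2_def)
  have gen: "(L2norm u)\<^sup>2 \<le> c * B" if B: "B \<ge> 0"
    and f: "\<And>e k q. 0 < e \<Longrightarrow> e \<le> 1 \<Longrightarrow> k \<in> \<int> \<Longrightarrow> k \<noteq> 0 \<Longrightarrow> hat2 0 e k q u \<le> c * f e k q + c' * e * commutators2 e k q T"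
    and fs: "\<And>e F. 0 < e \<and> e \<le> 1 \<and> finite F \<and> (\<forall>km\<in>F. fst km \<noteq> 0) \<Longrightarrow>
      e / (8 * pi) * (\<Sum>km\<in>F. f e (of_int (fst km)) (freq e (\<lambda>k. - of_int k * T) km)) \<le> B + C * e"
    for B :: real and f :: "real \<Rightarrow> real \<Rightarrow> real \<Rightarrow> real"
  proof (rule L2norm_le_synthesis[OF u, where C = "c * C + c' * Q" and \<tau> = "\<lambda>k. - of_int k * T"])
    show "0 \<le> c * B" "0 \<le> c * C + c' * Q" using B c C(1) Q(1) by auto
    show "hat 0 e 0 q \<theta> u = 0" if "e > 0" for e q \<theta> by (rule z[OF that])
    fix e :: real and F :: "(int \<times> int) set" assume h: "0 < e" "e \<le> 1" "finite F" "\<And>km. km \<in> F \<Longrightarrow> fst km \<noteq> 0"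
    define q where "q km = freq e (\<lambda>k. - of_int k * T) km" for km
    define k :: "int \<times> int \<Rightarrow> real" where "k km = of_int (fst km)" for km
    have "e / (8 * pi) * (\<Sum>km\<in>F. hat2 0 e (k km) (q km) u)
        \<le> e / (8 * pi) * (\<Sum>km\<in>F. c * f e (k km) (q km) + c' * e * commutators2 e (k km) (q km) T)"
      using h by (intro mult_left_mono sum_mono f) (auto simp: k_def)
    also have "\<dots> = c * (e / (8 * pi) * (\<Sum>km\<in>F. f e (k km) (q km))) + c' * e * (e / (8 * pi) * (\<Sum>km\<in>F. commutators2 e (k km) (q km) T))"
      unfolding sum.distrib sum_distrib_left[symmetric] distrib_left by (simp add: mult_ac)
    also have "\<dots> \<le> c * (B + C * e) + c' * e * Q"
      unfolding k_def q_def using h c T by (intro add_mono mult_left_mono fs Q(2)) auto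
    finally show "e / (8 * pi) * (\<Sum>km\<in>F. hat2 0 e (of_int (fst km)) (freq e (\<lambda>k. - of_int k * T) km) u) \<le> c * B + (c * C + c' * Q) * e"
      unfolding k_def q_def by (simp add: algebra_simps)
  qed
  have d3: "0 \<le> growth_const * ((1 + T)^3 * decay T) * (2 * (1 + M\<^sup>2) * D2)" "0 \<le> growth_const * ((1 + T) * decay T) * (2 * (1 + M\<^sup>2) * D2)"
    using growth_const_pos decay_pos[of T] T D20 by auto
  show "(L2norm u)\<^sup>2 \<le> c * (growth_const * ((1 + T)^3 * decay T) * (2 * (1 + M\<^sup>2) * D2))"
    if "\<forall>e k q. 0 < e \<longrightarrow> e \<le> 1 \<longrightarrow> k \<in> \<int> \<longrightarrow> k \<noteq> 0 \<longrightarrow> hat2 0 e k q u \<le> c * F2 e k q T + c' * e * commutators2 e k q T"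
    by (rule gen[OF d3(1), of "\<lambda>e k q. F2 e k q T"]) (use that C(2) in blast)+
  show "(L2norm u)\<^sup>2 \<le> c * (growth_const * ((1 + T) * decay T) * (2 * (1 + M\<^sup>2) * D2))"
    if "\<forall>e k q. 0 < e \<longrightarrow> e \<le> 1 \<longrightarrow> k \<in> \<int> \<longrightarrow> k \<noteq> 0 \<longrightarrow> hat2 0 e k q u \<le> c * (F2 e k q T / (k\<^sup>2 + q\<^sup>2)) + c' * e * commutators2 e k q T"
    by (rule gen[OF d3(2), of "\<lambda>e k q. F2 e k q T / (k\<^sup>2 + q\<^sup>2)"]) (use that C(2) in blast)+
qed

end

text \<open>Part of the rate 1/12 is traded for the polynomial factor, leaving 1/32 = 2/64 for the
  square. The surplus 1/12 - 1/32 is 15/288, hence 5/288 for each of three factors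
  \<open>1 + T\<close>; 58 is the first integer with \<open>58 * 5 / 288 >= 1\<close>. Each factor
  costs \<open>1 / \<mu>\<close>.\<close>

lemma algebraic_growth_le:
  fixes \<mu> T :: real
  assumes mu: "0 < \<mu>" "\<mu> \<le> 1" and T: "T \<ge> 0"
  shows "(1 + T) * exp (- (\<mu> * T / 12)) \<le> 58 / \<mu> * (exp (- (\<mu> / 64) * T))\<^sup>2"
    "(1 + T)^3 * exp (- (\<mu> * T / 12)) \<le> 58^3 / \<mu>^3 * (exp (- (\<mu> / 64) * T))\<^sup>2"
proof -
  define x where "x = \<mu> * T"
  have x: "x \<ge> 0" using mu T by (simp add: x_def)
  have e: "(exp (- (\<mu> / 64) * T))\<^sup>2 = exp (- (x / 32))" by (simp add: x_def power2_eq_square flip: exp_add)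
  have a: "1 + T \<le> 58 / \<mu> * exp (5 * x / 288)"
  proof -
    have "1 + x \<le> 58 * (1 + 5 * x / 288)" using x by simp
    also have "\<dots> \<le> 58 * exp (5 * x / 288)" by (intro mult_left_mono exp_ge_add_one_self) simp
    finally have "(1 + x) / \<mu> \<le> 58 * exp (5 * x / 288) / \<mu>" using mu by (intro divide_right_mono) auto
    moreover have "1 + T \<le> (1 + x) / \<mu>" using mu by (simp add: x_def field_simps)
    ultimately show ?thesis by simp
  qed
  have "(1 + T) * exp (- (x / 12)) \<le> 58 / \<mu> * exp (5 * x / 288) * exp (- (x / 12))" by (intro mult_right_mono a) simp
  also have "\<dots> = 58 / \<mu> * exp (5 * x / 288 + - (x / 12))" by (simp only: exp_add mult.assoc)
  also have "\<dots> \<le> 58 / \<mu> * exp (- (x / 32))" using mu x by (intro mult_left_mono) auto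
  finally show "(1 + T) * exp (- (\<mu> * T / 12)) \<le> 58 / \<mu> * (exp (- (\<mu> / 64) * T))\<^sup>2" unfolding e by (simp add: x_def)
  have "(1 + T)^3 * exp (- (x / 12)) \<le> (58 / \<mu> * exp (5 * x / 288))^3 * exp (- (x / 12))"
    using T by (intro mult_right_mono power_mono a) auto
  also have "(58 / \<mu> * exp (5 * x / 288))^3 = 58^3 / \<mu>^3 * exp (3 * (5 * x / 288))"
    using exp_of_nat_mult[of 3 "5 * x / 288"] unfolding power_mult_distrib power_divide by simp
  also have "58^3 / \<mu>^3 * exp (3 * (5 * x / 288)) * exp (- (x / 12)) = 58^3 / \<mu>^3 * exp (3 * (5 * x / 288) + - (x / 12))"
    unfolding exp_add by (rule mult.assoc)
  also have "3 * (5 * x / 288) + - (x / 12) = - (x / 32)" by simp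
  finally show "(1 + T)^3 * exp (- (\<mu> * T / 12)) \<le> 58^3 / \<mu>^3 * (exp (- (\<mu> / 64) * T))\<^sup>2" unfolding e by (simp add: x_def)
qed

lemma L2norm2_le:
  assumes "L2 f" "L2 g" "(L2norm f)\<^sup>2 \<le> a * G\<^sup>2" "(L2norm g)\<^sup>2 \<le> b * G\<^sup>2" "a + b \<le> c\<^sup>2" "0 \<le> c" "0 \<le> G"
  shows "L2norm2 f g \<le> c * G"
proof (rule power2_le_imp_le)
  have "(L2norm2 f g)\<^sup>2 \<le> (a + b) * G\<^sup>2" unfolding L2norm2_sq[OF assms(1,2)] distrib_right using assms(3,4) by (rule add_mono)
  also have "\<dots> \<le> c\<^sup>2 * G\<^sup>2" using assms(5) by (rule mult_right_mono) simp
  finally show "(L2norm2 f g)\<^sup>2 \<le> (c * G)\<^sup>2" by (simp add: power_mult_distrib)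
qed (use assms in simp)

section \<open>Decay of the individual fields and the constants\<close>

context couette
begin

text \<open>The potentials are orthogonal to functions of \<open>y\<close>. Hence the frequencies
  with \<open>k = 0\<close>, for which there is no energy estimate, do not occur in the
  reconstruction of the velocity.\<close>

lemma hat_psi_zero:
  assumes "t \<ge> 0" "e > 0" shows "hat j e 0 q \<theta> (\<psi>\<alpha> t) = 0" "hat j e 0 q \<theta> (\<psi>\<omega> t) = 0"
proof -
  have "test_function (mode (chi j e) 0 q \<theta>)" by (rule test_function_mode_chi[OF assms(2)]) simp
  note i = inv_laplacian_fluct(5)[OF _ this]
  have "xavg (mode (chi j e) 0 q \<theta>) = mode (chi j e) 0 q \<theta>" by (rule xavg_indep) (simp add: mode_def)
  then show "hat j e 0 q \<theta> (\<psi>\<alpha> t) = 0" "hat j e 0 q \<theta> (\<psi>\<omega> t) = 0"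
    using i[OF L2_sol(2)[OF assms(1)]] i[OF L2_sol(3)[OF assms(1)]] unfolding hat_def \<psi>\<alpha>_def \<psi>\<omega>_def by simp_all
qed

lemma L2_v: assumes "t \<ge> 0" shows "L2 (vx_fluct (\<alpha> t) (\<omega> t))" "L2 (vy_fluct (\<alpha> t) (\<omega> t))"
  unfolding vx_fluct_def vy_fluct_def \<psi>\<alpha>_def[symmetric] \<psi>\<omega>_def[symmetric] by (intro L2_diff L2_add psi assms)+

lemma F2_ge:
  shows "hat2 0 e k q (\<alpha> t) \<le> F2 e k q t" "hat2 0 e k q (\<omega> t) \<le> F2 e k q t"
    "(k\<^sup>2 + q\<^sup>2) * hat2 0 e k q (\<rho> t) \<le> M\<^sup>2 * F2 e k q t" "hat2 0 e k q (\<alpha> t) + hat2 0 e k q (\<omega> t) \<le> F2 e k q t"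
proof -
  note n = hat2_nonneg[of 0 e k q]
  have r: "0 \<le> (k\<^sup>2 + q\<^sup>2) / M\<^sup>2 * hat2 0 e k q (\<rho> t)" using n by simp
  show "hat2 0 e k q (\<alpha> t) \<le> F2 e k q t" "hat2 0 e k q (\<omega> t) \<le> F2 e k q t"
    "hat2 0 e k q (\<alpha> t) + hat2 0 e k q (\<omega> t) \<le> F2 e k q t"
    unfolding F2_def using r n[of "\<alpha> t"] n[of "\<omega> t"] by linarith+
  have "M\<^sup>2 * ((k\<^sup>2 + q\<^sup>2) / M\<^sup>2 * hat2 0 e k q (\<rho> t)) \<le> M\<^sup>2 * F2 e k q t"
    unfolding F2_def using n[of "\<alpha> t"] n[of "\<omega> t"] by (intro mult_left_mono) auto
  then show "(k\<^sup>2 + q\<^sup>2) * hat2 0 e k q (\<rho> t) \<le> M\<^sup>2 * F2 e k q t" using M by simp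
qed

lemma commutators2_ge:
  assumes "u \<in> {\<psi>\<alpha> t, \<psi>\<omega> t, \<rho> t, \<alpha> t, \<omega> t}" shows "hat2 1 e k q u + hat2 2 e k q u \<le> commutators2 e k q t"
proof -
  have "0 \<le> hat2 1 e k q u + hat2 2 e k q u" for u by (intro add_nonneg_nonneg hat2_nonneg)
  note n = this[of "\<psi>\<alpha> t"] this[of "\<psi>\<omega> t"] this[of "\<rho> t"] this[of "\<alpha> t"] this[of "\<omega> t"]
  have "commutators2 e k q t = (hat2 1 e k q (\<psi>\<alpha> t) + hat2 2 e k q (\<psi>\<alpha> t)) + (hat2 1 e k q (\<psi>\<omega> t) + hat2 2 e k q (\<psi>\<omega> t))
     + (hat2 1 e k q (\<rho> t) + hat2 2 e k q (\<rho> t)) + (hat2 1 e k q (\<alpha> t) + hat2 2 e k q (\<alpha> t)) + (hat2 1 e k q (\<omega> t) + hat2 2 e k q (\<omega> t))"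
    by (simp add: commutators2_def)
  with n show ?thesis using assms by (elim insertE emptyE; simp only:; linarith)
qed

text \<open>The square of the gradient of the potential is \<open>k\<^sup>2 + q\<^sup>2\<close>
  times its own square, and inverting the Laplacian divides the source by
  \<open>k\<^sup>2 + q\<^sup>2\<close>. The net gain is one factor \<open>1 / P\<^sup>2\<close> in
  the squared velocity.\<close>

lemma psi_velocity_sq:
  fixes \<psi>
  assumes e: "0 < e" "e \<le> 1" and k: "k \<in> \<int>" "k \<noteq> 0" and h: "\<And>\<theta>. hat 0 e k q \<theta> \<psi> = (comm e k q \<theta> \<psi> - hat 0 e k q \<theta> u) / (k\<^sup>2 + q\<^sup>2)"
  shows "(k\<^sup>2 + q\<^sup>2) * hat2 0 e k q \<psi> \<le> 2 * (hat2 0 e k q u / (k\<^sup>2 + q\<^sup>2)) + 16 * e\<^sup>2 * (hat2 1 e k q \<psi> + hat2 2 e k q \<psi>)"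
proof -
  define p where "p = k\<^sup>2 + q\<^sup>2"
  have p: "p > 0" unfolding p_def using k by (simp add: add_pos_nonneg)
  have one: "p * (hat 0 e k q \<theta> \<psi>)\<^sup>2 \<le> 2 * ((hat 0 e k q \<theta> u)\<^sup>2 / p) + 16 * e\<^sup>2 * ((hat 1 e k q (\<theta> + pi / 2) \<psi>)\<^sup>2 + (hat 2 e k q \<theta> \<psi>)\<^sup>2)" for \<theta>
  proof -
    have "p * (hat 0 e k q \<theta> \<psi>)\<^sup>2 = (comm e k q \<theta> \<psi> - hat 0 e k q \<theta> u)\<^sup>2 / p"
      unfolding h p_def[symmetric] using p by (simp add: power_divide power2_eq_square[of p])
    also have "\<dots> \<le> (2 * (comm e k q \<theta> \<psi>)\<^sup>2 + 2 * (hat 0 e k q \<theta> u)\<^sup>2) / p"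
      using sq_sum_le[of "comm e k q \<theta> \<psi>" "- hat 0 e k q \<theta> u"] p by (intro divide_right_mono) auto
    also have "\<dots> \<le> (2 * (8 * e\<^sup>2 * p * ((hat 1 e k q (\<theta> + pi / 2) \<psi>)\<^sup>2 + (hat 2 e k q \<theta> \<psi>)\<^sup>2)) + 2 * (hat 0 e k q \<theta> u)\<^sup>2) / p"
      using comm_sq[OF e k] p unfolding p_def by (intro divide_right_mono add_right_mono mult_left_mono) auto
    also have "\<dots> = 2 * ((hat 0 e k q \<theta> u)\<^sup>2 / p) + 16 * e\<^sup>2 * ((hat 1 e k q (\<theta> + pi / 2) \<psi>)\<^sup>2 + (hat 2 e k q \<theta> \<psi>)\<^sup>2)"
      using p by (simp add: add_divide_distrib)
    finally show ?thesis .
  qed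
  show ?thesis using one[of 0] one[of "pi / 2"] unfolding hat2_def p_def[symmetric]
    by (simp add: hat_shift_pi add_divide_distrib distrib_left)
qed

text \<open>Each velocity component has three summands: two gradients of potentials and one cutoff
  term. The square of a sum of three gives the factor 3, so 6 = 3 * 2, and 102 leaves some room
  above 3 * 32 + 3.\<close>

lemma velocity_sq:
  assumes t: "t \<ge> 0" and e: "0 < e" "e \<le> 1" and k: "k \<in> \<int>" "k \<noteq> 0"
  shows "hat2 0 e k q (vx_fluct (\<alpha> t) (\<omega> t)) \<le> 6 * (F2 e k q t / (k\<^sup>2 + q\<^sup>2)) + 102 * e * commutators2 e k q t"
    "hat2 0 e k q (vy_fluct (\<alpha> t) (\<omega> t)) \<le> 6 * (F2 e k q t / (k\<^sup>2 + q\<^sup>2)) + 102 * e * commutators2 e k q t"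
proof -
  define p where "p = k\<^sup>2 + q\<^sup>2"
  have p: "p > 0" "k\<^sup>2 \<le> p" "q\<^sup>2 \<le> p" unfolding p_def using k by (auto simp: add_pos_nonneg)
  have ee: "e\<^sup>2 \<le> e" using e by (simp add: power2_eq_square mult_left_le)
  define \<Psi> where "\<Psi> = p * hat2 0 e k q (\<psi>\<alpha> t) + p * hat2 0 e k q (\<psi>\<omega> t)"
  have s3: "(a + b + c)\<^sup>2 \<le> 3 * a\<^sup>2 + 3 * b\<^sup>2 + 3 * c\<^sup>2" for a b c :: real
  proof -
    have "0 \<le> (a - b)\<^sup>2 + (a - c)\<^sup>2 + (b - c)\<^sup>2" by simp
    also have "\<dots> = 3 * a\<^sup>2 + 3 * b\<^sup>2 + 3 * c\<^sup>2 - (a + b + c)\<^sup>2" by algebra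
    finally show ?thesis by simp
  qed
  define N where "N = commutators2 e k q t"
  have N: "hat2 1 e k q (\<psi>\<alpha> t) + hat2 2 e k q (\<psi>\<alpha> t) \<le> N" "hat2 1 e k q (\<psi>\<omega> t) + hat2 2 e k q (\<psi>\<omega> t) \<le> N"
    unfolding N_def by (intro commutators2_ge; simp)+
  have N1: "hat2 1 e k q (\<psi>\<alpha> t) \<le> N" "hat2 1 e k q (\<psi>\<omega> t) \<le> N"
    using N hat2_nonneg[of 2 e k q "\<psi>\<alpha> t"] hat2_nonneg[of 2 e k q "\<psi>\<omega> t"] by linarith+
  have eN: "e\<^sup>2 * x \<le> e * N" if "x \<le> N" for x
  proof -
    have "e\<^sup>2 * x \<le> e\<^sup>2 * N" using that by (intro mult_left_mono) auto
    also have "\<dots> \<le> e * N" using ee commutators2_nonneg[of e k q t] by (intro mult_right_mono) (auto simp: N_def)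
    finally show ?thesis .
  qed
  have Psi: "\<Psi> \<le> 2 * (F2 e k q t / p) + 32 * (e * N)"
  proof -
    have "p * hat2 0 e k q (\<psi>\<alpha> t) \<le> 2 * (hat2 0 e k q (\<alpha> t) / p) + 16 * e\<^sup>2 * (hat2 1 e k q (\<psi>\<alpha> t) + hat2 2 e k q (\<psi>\<alpha> t))"
      unfolding p_def by (rule psi_velocity_sq[OF e k hat_psi(1)[OF t e(1) k]])
    moreover have "p * hat2 0 e k q (\<psi>\<omega> t) \<le> 2 * (hat2 0 e k q (\<omega> t) / p) + 16 * e\<^sup>2 * (hat2 1 e k q (\<psi>\<omega> t) + hat2 2 e k q (\<psi>\<omega> t))"
      unfolding p_def by (rule psi_velocity_sq[OF e k hat_psi(2)[OF t e(1) k]])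
    moreover have "(hat2 0 e k q (\<alpha> t) + hat2 0 e k q (\<omega> t)) / p \<le> F2 e k q t / p"
      using p F2_ge(4) by (intro divide_right_mono) auto
    ultimately show ?thesis unfolding \<Psi>_def add_divide_distrib mult.assoc using eN[OF N(1)] eN[OF N(2)] by linarith
  qed
  have kq: "k\<^sup>2 * hat2 0 e k q w \<le> p * hat2 0 e k q w" "q\<^sup>2 * hat2 0 e k q w \<le> p * hat2 0 e k q w" for w
    using p hat2_nonneg by (auto intro: mult_right_mono)
  have vx: "hat 0 e k q 0 (vx_fluct (\<alpha> t) (\<omega> t)) = - k * hat 0 e k q (pi / 2) (\<psi>\<alpha> t) + q * hat 0 e k q (pi / 2) (\<psi>\<omega> t) + e * hat 1 e k q 0 (\<psi>\<omega> t)"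
    "hat 0 e k q (pi / 2) (vx_fluct (\<alpha> t) (\<omega> t)) = k * hat 0 e k q 0 (\<psi>\<alpha> t) + - q * hat 0 e k q 0 (\<psi>\<omega> t) + e * hat 1 e k q (pi / 2) (\<psi>\<omega> t)"
    using hat_vx[OF t e(1) k(1), of q 0] hat_vx[OF t e(1) k(1), of q "pi / 2"] by (simp_all add: hat_shift_pi)
  have "hat2 0 e k q (vx_fluct (\<alpha> t) (\<omega> t)) \<le> 3 * (k\<^sup>2 * hat2 0 e k q (\<psi>\<alpha> t)) + 3 * (q\<^sup>2 * hat2 0 e k q (\<psi>\<omega> t)) + 3 * (e\<^sup>2 * hat2 1 e k q (\<psi>\<omega> t))"
    unfolding hat2_def[of 0 e k q "vx_fluct (\<alpha> t) (\<omega> t)"] vx by (rule order_trans[OF add_mono[OF s3 s3]])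
     (simp add: hat2_def power_mult_distrib distrib_left)
  also have "\<dots> \<le> 3 * \<Psi> + 3 * (e * N)" unfolding \<Psi>_def distrib_left using kq(1)[of "\<psi>\<alpha> t"] kq(2)[of "\<psi>\<omega> t"] eN[OF N1(2)] by linarith
  also have "\<dots> \<le> 6 * (F2 e k q t / p) + 102 * (e * N)"
    using Psi mult_nonneg_nonneg[OF less_imp_le[OF e(1)] commutators2_nonneg[of e k q t, folded N_def]] by linarith
  finally show "hat2 0 e k q (vx_fluct (\<alpha> t) (\<omega> t)) \<le> 6 * (F2 e k q t / (k\<^sup>2 + q\<^sup>2)) + 102 * e * commutators2 e k q t"
    unfolding p_def N_def mult.assoc .
  have vy: "hat 0 e k q 0 (vy_fluct (\<alpha> t) (\<omega> t)) = - q * hat 0 e k q (pi / 2) (\<psi>\<alpha> t) + - k * hat 0 e k q (pi / 2) (\<psi>\<omega> t) + - e * hat 1 e k q 0 (\<psi>\<alpha> t)"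
    "hat 0 e k q (pi / 2) (vy_fluct (\<alpha> t) (\<omega> t)) = q * hat 0 e k q 0 (\<psi>\<alpha> t) + k * hat 0 e k q 0 (\<psi>\<omega> t) + - e * hat 1 e k q (pi / 2) (\<psi>\<alpha> t)"
    using hat_vy[OF t e(1) k(1), of q 0] hat_vy[OF t e(1) k(1), of q "pi / 2"] by (simp_all add: hat_shift_pi)
  have "hat2 0 e k q (vy_fluct (\<alpha> t) (\<omega> t)) \<le> 3 * (q\<^sup>2 * hat2 0 e k q (\<psi>\<alpha> t)) + 3 * (k\<^sup>2 * hat2 0 e k q (\<psi>\<omega> t)) + 3 * (e\<^sup>2 * hat2 1 e k q (\<psi>\<alpha> t))"
    unfolding hat2_def[of 0 e k q "vy_fluct (\<alpha> t) (\<omega> t)"] vy by (rule order_trans[OF add_mono[OF s3 s3]])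
     (simp add: hat2_def power_mult_distrib distrib_left)
  also have "\<dots> \<le> 3 * \<Psi> + 3 * (e * N)" unfolding \<Psi>_def distrib_left using kq(2)[of "\<psi>\<alpha> t"] kq(1)[of "\<psi>\<omega> t"] eN[OF N1(1)] by linarith
  also have "\<dots> \<le> 6 * (F2 e k q t / p) + 102 * (e * N)"
    using Psi mult_nonneg_nonneg[OF less_imp_le[OF e(1)] commutators2_nonneg[of e k q t, folded N_def]] by linarith
  finally show "hat2 0 e k q (vy_fluct (\<alpha> t) (\<omega> t)) \<le> 6 * (F2 e k q t / (k\<^sup>2 + q\<^sup>2)) + 102 * e * commutators2 e k q t"
    unfolding p_def N_def mult.assoc .
qed

lemma D2_le: "D2 \<le> (dev_norm M \<rho>in \<alpha>in \<omega>in)\<^sup>2"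
proof -
  have w: "L2 (wdx (fluct \<rho>in))" "L2 (wdy (fluct \<rho>in))"
    using H1_fluct_weak[OF in_reg(1)] by (auto simp: is_weak_dx_def is_weak_dy_def)
  have "a\<^sup>2 + b\<^sup>2 + c\<^sup>2 \<le> (a + b + c)\<^sup>2" if "0 \<le> a" "0 \<le> b" "0 \<le> c" for a b c :: real
  proof -
    have "(a + b + c)\<^sup>2 = a\<^sup>2 + b\<^sup>2 + c\<^sup>2 + 2 * (a * b) + 2 * (a * c) + 2 * (b * c)" by algebra
    moreover have "0 \<le> a * b" "0 \<le> a * c" "0 \<le> b * c" using that by simp_all
    ultimately show ?thesis by linarith
  qed
  from this[of "L2norm (fluct \<alpha>in)" "1 / M * L2norm2 (wdx (fluct \<rho>in)) (wdy (fluct \<rho>in))" "L2norm (fluct \<omega>in)"]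
  show ?thesis using M unfolding D2_def dev_norm_def
    by (simp add: power_mult_distrib power_divide L2norm2_sq[OF w])
qed

text \<open>Brought into the form of a square, since it will be compared with squared norms. The
  polynomial factors are absorbed by \<open>1 + M\<^sup>2 <= exp (M\<^sup>2)\<close>, and
  \<open>(1 + M)\<^sup>2 <= 2 + 2 M\<^sup>2\<close> removes the linear term in the exponent.\<close>

lemma growth_const_le: "growth_const * (2 * (1 + M\<^sup>2)) \<le> (16 * exp (513 * (1 + M\<^sup>2)))\<^sup>2"
proof -
  have m: "1 + M\<^sup>2 \<le> exp (M\<^sup>2)" by (rule exp_ge_add_one_self)
  have "512 * (1 + M)\<^sup>2 + 1 \<le> 1025 + 1024 * M\<^sup>2"
    using zero_le_power2[of "1 - M"] unfolding power2_sum power2_diff by simp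
  then have x: "exp (512 * (1 + M)\<^sup>2 + 1) \<le> exp (1025 + 1024 * M\<^sup>2)" by simp
  have "growth_const * (2 * (1 + M\<^sup>2)) = 256 * ((1 + M\<^sup>2) * (1 + M\<^sup>2) * exp (512 * (1 + M)\<^sup>2 + 1))"
    by (simp add: growth_const_def algebra_simps)
  also have "\<dots> \<le> 256 * (exp (M\<^sup>2) * exp (M\<^sup>2) * exp (1025 + 1024 * M\<^sup>2))"
    by (intro mult_left_mono mult_mono m x) auto
  also have "\<dots> = 256 * exp (1025 + 1026 * M\<^sup>2)" by (simp flip: exp_add)
  also have "\<dots> \<le> 256 * exp (1026 * (1 + M\<^sup>2))" by simp
  also have "\<dots> = (16 * exp (513 * (1 + M\<^sup>2)))\<^sup>2"
    by (simp add: power2_eq_square flip: exp_add)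
  finally show ?thesis .
qed

text \<open>The factor \<open>58\<^sup>2\<close> rounds up the root of \<open>58^3\<close>, so that
  both estimates share one constant.\<close>

definition "main_const = 16 * 58\<^sup>2 * exp (513 * (1 + M\<^sup>2))"

lemma square_bounds:
  assumes T: "T \<ge> 0"
  defines "E \<equiv> exp (- (\<nu> powr (1/3) / 64) * T) * dev_norm M \<rho>in \<alpha>in \<omega>in"
  shows "growth_const * ((1 + T)^3 * decay T) * (2 * (1 + M\<^sup>2) * D2) \<le> (main_const * \<nu> powr (- 1 / 2) * E)\<^sup>2"
    "growth_const * ((1 + T) * decay T) * (2 * (1 + M\<^sup>2) * D2) \<le> (main_const * \<nu> powr (- 1 / 6) * E)\<^sup>2"
proof -
  define \<mu> where "\<mu> = \<nu> powr (1/3)"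
  have mu: "0 < \<mu>" "\<mu> \<le> 1" using nu nul l by (auto simp: \<mu>_def powr_le1)
  have v1: "(\<nu> powr (- 1 / 6))\<^sup>2 = 1 / \<mu>" using nu by (simp add: \<mu>_def power2_eq_square powr_add[symmetric] powr_minus_divide)
  have "\<mu>^3 = \<nu>" using nu by (simp add: \<mu>_def power3_eq_cube powr_add[symmetric])
  then have v3: "(\<nu> powr (- 1 / 2))\<^sup>2 = 1 / \<mu>^3" using nu by (simp add: power2_eq_square powr_add[symmetric] powr_minus_divide)
  have D: "0 \<le> D2" by (simp add: D2_def)
  have gen: "growth_const * g * (2 * (1 + M\<^sup>2) * D2) \<le> (main_const * v * E)\<^sup>2"
    if g: "g \<le> c * v\<^sup>2 * (exp (- (\<mu> / 64) * T))\<^sup>2" "0 \<le> g" "c \<le> (58\<^sup>2)\<^sup>2" for g c v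
  proof -
    have "growth_const * g * (2 * (1 + M\<^sup>2) * D2) = (growth_const * (2 * (1 + M\<^sup>2))) * g * D2" by (simp only: mult_ac)
    also have "\<dots> \<le> (16 * exp (513 * (1 + M\<^sup>2)))\<^sup>2 * ((58\<^sup>2)\<^sup>2 * v\<^sup>2 * (exp (- (\<mu> / 64) * T))\<^sup>2) * (dev_norm M \<rho>in \<alpha>in \<omega>in)\<^sup>2"
    proof (intro mult_mono growth_const_le D2_le)
      show "g \<le> (58\<^sup>2)\<^sup>2 * v\<^sup>2 * (exp (- (\<mu> / 64) * T))\<^sup>2"
        by (rule order_trans[OF g(1)]) (intro mult_right_mono g(3); simp)
    qed (use g D in auto)
    also have "\<dots> = (main_const * v * E)\<^sup>2"
    proof -
      have "(16 * x)\<^sup>2 * ((58\<^sup>2)\<^sup>2 * v\<^sup>2 * y\<^sup>2) * z\<^sup>2 = (16 * 58\<^sup>2 * x * v * (y * z))\<^sup>2" for x y z :: real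
        unfolding power_mult_distrib by (simp only: mult_ac)
      then show ?thesis unfolding main_const_def E_def \<mu>_def[symmetric] .
    qed
    finally show ?thesis .
  qed
  show "growth_const * ((1 + T)^3 * decay T) * (2 * (1 + M\<^sup>2) * D2) \<le> (main_const * \<nu> powr (- 1 / 2) * E)\<^sup>2"
  proof (rule gen[of _ "58^3"])
    show "(1 + T)^3 * decay T \<le> 58^3 * (\<nu> powr (- 1 / 2))\<^sup>2 * (exp (- (\<mu> / 64) * T))\<^sup>2"
      using algebraic_growth_le(2)[OF mu T] unfolding v3 decay_def \<mu>_def[symmetric] by simp
    show "0 \<le> (1 + T)^3 * decay T" using decay_pos[of T] T by simp
  qed simp
  show "growth_const * ((1 + T) * decay T) * (2 * (1 + M\<^sup>2) * D2) \<le> (main_const * \<nu> powr (- 1 / 6) * E)\<^sup>2"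
  proof (rule gen[of _ 58])
    show "(1 + T) * decay T \<le> 58 * (\<nu> powr (- 1 / 6))\<^sup>2 * (exp (- (\<mu> / 64) * T))\<^sup>2"
      using algebraic_growth_le(1)[OF mu T] unfolding v1 decay_def \<mu>_def[symmetric] by simp
    show "0 \<le> (1 + T) * decay T" using decay_pos[of T] T by simp
  qed simp
qed

text \<open>The factor 5 covers both sums: 1 + 2 + 1 for \<alpha>, the gradient of the density and
  \<omega>, and 4 + 1 for velocity and density, where 4 exceeds the root of 6 + 6.\<close>

lemma decay_estimates:
  assumes T: "T \<ge> 0"
  defines "E \<equiv> exp (- (\<nu> powr (1/3) / 64) * T) * dev_norm M \<rho>in \<alpha>in \<omega>in"
  shows "dev_norm M (\<rho> T) (\<alpha> T) (\<omega> T) \<le> 5 * (main_const * \<nu> powr (- 1 / 2) * E)"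
    "L2norm2 (vx_fluct (\<alpha> T) (\<omega> T)) (vy_fluct (\<alpha> T) (\<omega> T)) + 1 / M * L2norm (fluct (\<rho> T)) \<le> 5 * (main_const * \<nu> powr (- 1 / 6) * E)"
proof -
  have E0: "E \<ge> 0" unfolding E_def dev_norm_def using M by simp
  define G3 where "G3 = main_const * \<nu> powr (- 1 / 2) * E"
  define G1 where "G1 = main_const * \<nu> powr (- 1 / 6) * E"
  have G0: "G3 \<ge> 0" "G1 \<ge> 0" unfolding G3_def G1_def main_const_def using E0 by simp_all
  note L = L2_sol[OF T]
  note out = output_bounds[OF T]
  have b3: "x \<le> c * (growth_const * ((1 + T)^3 * decay T) * (2 * (1 + M\<^sup>2) * D2)) \<Longrightarrow> c \<ge> 0 \<Longrightarrow> x \<le> c * G3\<^sup>2" for c x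
    unfolding G3_def E_def by (erule order_trans) (rule mult_left_mono[OF square_bounds(1)[OF T]])
  have b1: "x \<le> c * (growth_const * ((1 + T) * decay T) * (2 * (1 + M\<^sup>2) * D2)) \<Longrightarrow> c \<ge> 0 \<Longrightarrow> x \<le> c * G1\<^sup>2" for c x
    unfolding G1_def E_def by (erule order_trans) (rule mult_left_mono[OF square_bounds(2)[OF T]])
  have a: "(L2norm (fluct (\<alpha> T)))\<^sup>2 \<le> 1 * G3\<^sup>2" "(L2norm (fluct (\<omega> T)))\<^sup>2 \<le> 1 * G3\<^sup>2"
  proof -
    show "(L2norm (fluct (\<alpha> T)))\<^sup>2 \<le> 1 * G3\<^sup>2"
      by (rule b3[OF out(1)[OF fluct_L2[OF L(2)], where c' = 0]]) (simp_all add: hat_fluct_0[OF L(2)] hat2_fluct[OF L(2)] F2_ge)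
    show "(L2norm (fluct (\<omega> T)))\<^sup>2 \<le> 1 * G3\<^sup>2"
      by (rule b3[OF out(1)[OF fluct_L2[OF L(3)], where c' = 0]]) (simp_all add: hat_fluct_0[OF L(3)] hat2_fluct[OF L(3)] F2_ge)
  qed
  note wx = H1_fluct_weak(1)[OF C0(4)[OF T]] and wy = H1_fluct_weak(2)[OF C0(4)[OF T]]
  have w: "L2 (wdx (fluct (\<rho> T)))" "L2 (wdy (fluct (\<rho> T)))" using wx wy by (auto simp: is_weak_dx_def is_weak_dy_def)
  have kq: "k\<^sup>2 * hat2 0 e k q (\<rho> T) \<le> M\<^sup>2 * F2 e k q T" "q\<^sup>2 * hat2 0 e k q (\<rho> T) \<le> M\<^sup>2 * F2 e k q T" for e k q
  proof -
    have "0 \<le> k\<^sup>2 * hat2 0 e k q (\<rho> T)" "0 \<le> q\<^sup>2 * hat2 0 e k q (\<rho> T)" using hat2_nonneg by simp_all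
    then show "k\<^sup>2 * hat2 0 e k q (\<rho> T) \<le> M\<^sup>2 * F2 e k q T" "q\<^sup>2 * hat2 0 e k q (\<rho> T) \<le> M\<^sup>2 * F2 e k q T"
      using F2_ge(3)[of k q e T] unfolding distrib_right by linarith+
  qed
  have rx: "(L2norm (wdx (fluct (\<rho> T))))\<^sup>2 \<le> M\<^sup>2 * G3\<^sup>2"
  proof (rule b3[OF out(1)[OF w(1), where c' = 0]])
    show "hat 0 e 0 q \<theta> (wdx (fluct (\<rho> T))) = 0" if "e > 0" for e q \<theta> using hat_weak_dx[OF wx that, of 0] by simp
    show "\<forall>e k q. 0 < e \<longrightarrow> e \<le> 1 \<longrightarrow> k \<in> \<int> \<longrightarrow> k \<noteq> 0 \<longrightarrow> hat2 0 e k q (wdx (fluct (\<rho> T))) \<le> M\<^sup>2 * F2 e k q T + 0 * e * commutators2 e k q T"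
      by (simp add: hat2_weak_dx[OF wx] hat2_fluct[OF L(1)] kq)
  qed simp_all
  \<comment> \<open>Here, in contrast to the x-derivative, the cutoff is differentiated, which costs
    a factor 2 and a commutator term; \<open>c' = 2\<close> admits it.\<close>
  have ry: "(L2norm (wdy (fluct (\<rho> T))))\<^sup>2 \<le> 2 * M\<^sup>2 * G3\<^sup>2"
  proof (rule b3[OF out(1)[OF w(2), where c' = 2]])
    show "hat 0 e 0 q \<theta> (wdy (fluct (\<rho> T))) = 0" if "e > 0" for e q \<theta>
      using hat_weak_dy[OF fluct_L2[OF L(1)] wy that, of 0] by (simp add: hat_fluct_0[OF L(1) that])
    show "\<forall>e k q. 0 < e \<longrightarrow> e \<le> 1 \<longrightarrow> k \<in> \<int> \<longrightarrow> k \<noteq> 0 \<longrightarrow> hat2 0 e k q (wdy (fluct (\<rho> T))) \<le> 2 * M\<^sup>2 * F2 e k q T + 2 * e * commutators2 e k q T"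
    proof (intro allI impI)
      fix e k q :: real assume h: "0 < e" "e \<le> 1" "k \<in> \<int>" "k \<noteq> 0"
      have "hat2 1 e k q (\<rho> T) \<le> commutators2 e k q T"
        using commutators2_ge[of "\<rho> T" T e k q] hat2_nonneg[of 2 e k q "\<rho> T"] by simp
      moreover have "e\<^sup>2 \<le> e" using h by (simp add: power2_eq_square mult_left_le)
      ultimately have "e\<^sup>2 * hat2 1 e k q (\<rho> T) \<le> e * commutators2 e k q T" using h hat2_nonneg by (intro mult_mono) auto
      then show "hat2 0 e k q (wdy (fluct (\<rho> T))) \<le> 2 * M\<^sup>2 * F2 e k q T + 2 * e * commutators2 e k q T"
        using hat2_weak_dy(1)[OF fluct_L2[OF L(1)] wy h(1,3), of q] kq(2)[of q e k]
        unfolding hat2_fluct[OF L(1) h(1,3,4)] mult.assoc by linarith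
    qed
  qed simp_all
  have "L2norm2 (wdx (fluct (\<rho> T))) (wdy (fluct (\<rho> T))) \<le> 2 * (M * G3)"
    using L2norm2_le[OF w, of 1 "M * G3" 2 2] rx ry M G0 by (simp add: power_mult_distrib)
  then have "1 / M * L2norm2 (wdx (fluct (\<rho> T))) (wdy (fluct (\<rho> T))) \<le> 2 * G3" using M by (simp add: field_simps)
  moreover have "L2norm (fluct (\<alpha> T)) \<le> G3" "L2norm (fluct (\<omega> T)) \<le> G3"
    using power2_le_imp_le[OF _ G0(1)] a by auto
  ultimately show "dev_norm M (\<rho> T) (\<alpha> T) (\<omega> T) \<le> 5 * (main_const * \<nu> powr (- 1 / 2) * E)"
    unfolding dev_norm_def G3_def[symmetric] using G0 by linarith
  have v: "(L2norm (vx_fluct (\<alpha> T) (\<omega> T)))\<^sup>2 \<le> 6 * G1\<^sup>2" "(L2norm (vy_fluct (\<alpha> T) (\<omega> T)))\<^sup>2 \<le> 6 * G1\<^sup>2"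
  proof -
    show "(L2norm (vx_fluct (\<alpha> T) (\<omega> T)))\<^sup>2 \<le> 6 * G1\<^sup>2"
      by (rule b1[OF out(2)[OF L2_v(1)[OF T], where c' = 102]]) (use velocity_sq(1)[OF T] in \<open>simp_all only: hat_vx[OF T] hat_psi_zero[OF T] Ints_0, simp_all\<close>)
    show "(L2norm (vy_fluct (\<alpha> T) (\<omega> T)))\<^sup>2 \<le> 6 * G1\<^sup>2"
      by (rule b1[OF out(2)[OF L2_v(2)[OF T], where c' = 102]]) (use velocity_sq(2)[OF T] in \<open>simp_all only: hat_vy[OF T] hat_psi_zero[OF T] Ints_0, simp_all\<close>)
  qed
  have vb: "L2norm2 (vx_fluct (\<alpha> T) (\<omega> T)) (vy_fluct (\<alpha> T) (\<omega> T)) \<le> 4 * G1"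
    using L2norm2_le[OF L2_v[OF T] v, of 4] G0 by simp
  have "(L2norm (fluct (\<rho> T)))\<^sup>2 \<le> M\<^sup>2 * G1\<^sup>2"
  proof (rule b1[OF out(2)[OF fluct_L2[OF L(1)], where c' = 0]])
    show "\<forall>e k q. 0 < e \<longrightarrow> e \<le> 1 \<longrightarrow> k \<in> \<int> \<longrightarrow> k \<noteq> 0 \<longrightarrow> hat2 0 e k q (fluct (\<rho> T)) \<le> M\<^sup>2 * (F2 e k q T / (k\<^sup>2 + q\<^sup>2)) + 0 * e * commutators2 e k q T"
    proof (intro allI impI)
      fix e k q :: real assume h: "0 < e" "e \<le> 1" "k \<in> \<int>" "k \<noteq> 0"
      have p: "k\<^sup>2 + q\<^sup>2 > 0" using h by (simp add: add_pos_nonneg)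
      have "(k\<^sup>2 + q\<^sup>2) * hat2 0 e k q (\<rho> T) / (k\<^sup>2 + q\<^sup>2) \<le> M\<^sup>2 * F2 e k q T / (k\<^sup>2 + q\<^sup>2)"
        using p by (intro divide_right_mono F2_ge) simp
      then show "hat2 0 e k q (fluct (\<rho> T)) \<le> M\<^sup>2 * (F2 e k q T / (k\<^sup>2 + q\<^sup>2)) + 0 * e * commutators2 e k q T"
        unfolding hat2_fluct[OF L(1) h(1,3,4)] nonzero_mult_div_cancel_left[OF less_imp_neq[OF p, symmetric]] by simp
    qed
  qed (simp_all add: hat_fluct_0[OF L(1)])
  then have "(L2norm (fluct (\<rho> T)))\<^sup>2 \<le> (M * G1)\<^sup>2" unfolding power_mult_distrib .
  moreover have "0 \<le> M * G1" using M G0(2) by simp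
  ultimately have "L2norm (fluct (\<rho> T)) \<le> M * G1" by (rule power2_le_imp_le)
  from mult_left_mono[OF this, of "1 / M"] have "1 / M * L2norm (fluct (\<rho> T)) \<le> G1" using M by simp
  with vb show "L2norm2 (vx_fluct (\<alpha> T) (\<omega> T)) (vy_fluct (\<alpha> T) (\<omega> T)) + 1 / M * L2norm (fluct (\<rho> T)) \<le> 5 * (main_const * \<nu> powr (- 1 / 6) * E)"
    unfolding G1_def[symmetric] by linarith
qed

text \<open>The required form \<open>exp (M^\<beta>)\<close> has no coefficient in front of the
  power. Raising the power from 2 to 3 absorbs the coefficient 513: for \<open>M >= 513\<close> by
  \<open>513 M\<^sup>2 <= M^3\<close>, and otherwise by the constant \<open>513^3\<close>.\<close>

lemma main_const_le: "5 * main_const \<le> 80 * 58\<^sup>2 * (exp (513 + 513^3) * exp (M powr 3))"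
proof -
  have "513 * M\<^sup>2 \<le> 513^3 + M^3"
  proof (cases "M \<le> 513")
    case True
    then have "513 * M\<^sup>2 \<le> 513 * 513\<^sup>2" using M by (intro mult_left_mono power_mono) auto
    moreover have "0 \<le> M^3" using M by simp
    moreover have "(513::real) * 513\<^sup>2 = 513^3" by simp
    ultimately show ?thesis by argo
  next
    case False
    then have "513 * M\<^sup>2 \<le> M * M\<^sup>2" by (intro mult_right_mono) auto
    then show ?thesis by (simp add: power3_eq_cube power2_eq_square)
  qed
  moreover have "M powr 3 = M^3" using M by simp
  ultimately have "513 * (1 + M\<^sup>2) \<le> (513 + 513^3) + M powr 3" unfolding distrib_left by argo
  then have "exp (513 * (1 + M\<^sup>2)) \<le> exp (513 + 513^3) * exp (M powr 3)" unfolding exp_add[symmetric] exp_le_cancel_iff .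
  then have "(80 * 58\<^sup>2) * exp (513 * (1 + M\<^sup>2)) \<le> 80 * 58\<^sup>2 * (exp (513 + 513^3) * exp (M powr 3))" by (rule mult_left_mono) simp
  then show ?thesis unfolding main_const_def by linarith
qed

end

theorem theorem1p6:
  shows "\<exists>K \<beta> :: real. K > 0 \<and> \<beta> \<ge> 1 \<and>
    (\<forall>(\<nu> :: real) (l :: real) (M :: real)
       (\<rho>in :: real \<times> real \<Rightarrow> real) (\<alpha>in :: real \<times> real \<Rightarrow> real) (\<omega>in :: real \<times> real \<Rightarrow> real)
       (\<rho> :: real \<Rightarrow> real \<times> real \<Rightarrow> real) (\<alpha> :: real \<Rightarrow> real \<times> real \<Rightarrow> real)
       (\<omega> :: real \<Rightarrow> real \<times> real \<Rightarrow> real).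
       \<nu> > 0 \<longrightarrow> l \<ge> 0 \<longrightarrow> M > 0 \<longrightarrow> \<nu> + l \<le> 1 / 2 \<longrightarrow>
       M \<le> min ((\<nu> + l) powr (- 1 / 2)) (\<nu> powr (- 1 / 3)) \<longrightarrow>
       H1 \<rho>in \<longrightarrow> L2 \<alpha>in \<longrightarrow> L2 \<omega>in \<longrightarrow>
       couette_solution \<nu> l M \<rho>in \<alpha>in \<omega>in \<rho> \<alpha> \<omega> \<longrightarrow>
       (\<forall>t\<ge>0.
          dev_norm M (\<rho> t) (\<alpha> t) (\<omega> t)
            \<le> K * exp (M powr \<beta>) * \<nu> powr (- 1 / 2) * exp (- (\<nu> powr (1 / 3) / 64) * t)
               * dev_norm M \<rho>in \<alpha>in \<omega>in \<and>
          L2norm2 (vx_fluct (\<alpha> t) (\<omega> t)) (vy_fluct (\<alpha> t) (\<omega> t)) + 1 / M * L2norm (fluct (\<rho> t))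
            \<le> K * exp (M powr \<beta>) * \<nu> powr (- 1 / 6) * exp (- (\<nu> powr (1 / 3) / 64) * t)
               * dev_norm M \<rho>in \<alpha>in \<omega>in))"
proof -
  \<comment> \<open>80 is the factor 5 of \<open>decay_estimates\<close> times the 16 in
    \<open>main_const\<close>; the exponential is the part of \<open>main_const_le\<close> that does
    not depend on \<open>M\<close>.\<close>
  define K :: real where "K = 80 * 58\<^sup>2 * exp (513 + 513^3)"
  show ?thesis
  proof (rule exI[of _ K], rule exI[of _ 3], intro conjI allI impI)
    show "K > 0" unfolding K_def by (intro mult_pos_pos exp_gt_zero) simp_all
    show "(3::real) \<ge> 1" by simp
    fix \<nu> l M :: real and \<rho>in \<alpha>in \<omega>in :: "real \<times> real \<Rightarrow> real" and \<rho> \<alpha> \<omega> :: "real \<Rightarrow> real \<times> real \<Rightarrow> real" and t :: real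
    assume h: "\<nu> > 0" "l \<ge> 0" "M > 0" "\<nu> + l \<le> 1 / 2" "M \<le> min ((\<nu> + l) powr (- 1 / 2)) (\<nu> powr (- 1 / 3))"
      "H1 \<rho>in" "L2 \<alpha>in" "L2 \<omega>in" "couette_solution \<nu> l M \<rho>in \<alpha>in \<omega>in \<rho> \<alpha> \<omega>" and t: "t \<ge> 0"
    have d: "\<nu> + l > 0" using h by simp
    have "M\<^sup>2 \<le> ((\<nu> + l) powr (- 1 / 2))\<^sup>2" using h by (intro power_mono) auto
    also have "\<dots> = 1 / (\<nu> + l)" using d by (simp add: power2_eq_square powr_add[symmetric] powr_minus_divide)
    finally have "(\<nu> + l) * M\<^sup>2 \<le> 1" using d by (simp add: field_simps)
    then interpret couette \<nu> l M \<rho>in \<alpha>in \<omega>in \<rho> \<alpha> \<omega> using h by unfold_locales auto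
    define E where "E = exp (- (\<nu> powr (1 / 3) / 64) * t) * dev_norm M \<rho>in \<alpha>in \<omega>in"
    have E0: "E \<ge> 0" unfolding E_def dev_norm_def using M by simp
    have fin: "5 * (main_const * v * E) \<le> K * exp (M powr 3) * v * exp (- (\<nu> powr (1 / 3) / 64) * t) * dev_norm M \<rho>in \<alpha>in \<omega>in" if "v \<ge> 0" for v
    proof -
      have "5 * main_const * (v * E) \<le> K * exp (M powr 3) * (v * E)"
        unfolding K_def mult.assoc[of _ "exp _"] by (rule mult_right_mono[OF main_const_le]) (rule mult_nonneg_nonneg[OF that E0])
      then show ?thesis unfolding E_def by (simp only: mult.assoc)
    qed
    show "dev_norm M (\<rho> t) (\<alpha> t) (\<omega> t) \<le> K * exp (M powr 3) * \<nu> powr (- 1 / 2) * exp (- (\<nu> powr (1 / 3) / 64) * t) * dev_norm M \<rho>in \<alpha>in \<omega>in"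
      using decay_estimates(1)[OF t] unfolding E_def[symmetric] by (rule order_trans[OF _ fin]) simp
    show "L2norm2 (vx_fluct (\<alpha> t) (\<omega> t)) (vy_fluct (\<alpha> t) (\<omega> t)) + 1 / M * L2norm (fluct (\<rho> t))
       \<le> K * exp (M powr 3) * \<nu> powr (- 1 / 6) * exp (- (\<nu> powr (1 / 3) / 64) * t) * dev_norm M \<rho>in \<alpha>in \<omega>in"
      using decay_estimates(2)[OF t] unfolding E_def[symmetric] by (rule order_trans[OF _ fin]) simp
  qed
qed

end
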